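(* Let $k$ be an algebraically closed field of characteristic zero, let $(F,\Gamma)$ be a matched pair of finite groups and $G=F\bowtie\Gamma$ the associated factorizable group. Let $A$ be a Hopf algebra which fits into an abelian exact sequence $$k\to k^\Gamma\to A\to kF\to k$$ affording the actions of the matched pair. Then $\exp A$ divides $\exp\operatorname{Opext}(k^\Gamma,kF)\cdot\exp G$.
   Context: A matched pair of finite groups $(F,\Gamma)$ consists of actions by permutations $\triangleright:\Gamma\times F\to F$ (left) and $\triangleleft:\Gamma\times F\to\Gamma$ (right) with $s\triangleright(xy)=(s\triangleright x)((s\triangleleft x)\triangleright y)$ and $(st)\triangleleft x=(s\triangleleft(t\triangleright x))(t\triangleleft x)$ for $s,t\in\Gamma$, $x,y\in F$. The group $G=F\bowtie\Gamma$ is the set $F\times\Gamma$ with product $(x,s)(y,t)=(x(s\triangleright y),(s\triangleleft y)t)$; it has an exact factorization $G=F\Gamma$, $F\cap\Gamma=1$. Hopf algebra extensions $k\to k^\Gamma\to A\to kF\to k$ (exact sequences of finite-dimensional Hopf algebras) affording these actions are, up to equivalence, exactly the bicrossed products $A=k^\Gamma\,{}^{\tau}\#_\sigma kF$: here $\sigma:F\times F\to(k^\Gamma)^\times$ and $\tau:\Gamma\times\Gamma\to(k^F)^\times$ are normalized 2-cocycles, written $\sigma_s(x,y)$, $\tau_x(s,t)$, subject to the compatibility conditions making $k^\Gamma\otimes kF$, with basis $e_s\#x$, a Hopf algebra under $$(e_s\#x)(e_t\#y)=\delta_{s\triangleleft x,t}\,\sigma_s(x,y)\,e_s\#xy,\qquad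 \Delta(e_s\#x)=\sum_{tu=s}\tau_x(t,u)\,(e_t\#(u\triangleright x))\otimes(e_u\#x).$$ The equivalence classes of such extensions, for the fixed actions, form a finite abelian group $\operatorname{Opext}(k^\Gamma,kF)$, with product induced by pointwise multiplication of the pairs $(\sigma,\tau)$. The exponent of a finite group is the least common multiple of the orders of its elements. The exponent $\exp A$ of a finite-dimensional semisimple Hopf algebra $A$ is the exponent of the fusion category $\operatorname{Rep}A$, where the exponent of a fusion category $\mathcal C$ is the smallest integer $N\ge1$ with $(\beta_{V,U}\beta_{U,V})^N=\operatorname{id}$ for all objects $U,V$ of the Drinfeld center $\mathcal Z(\mathcal C)$, $\beta$ being its canonical braiding. *)

theory Defs
  imports "HOL-Computational_Algebra.Polynomial" "HOL-Algebra.Multiplicative_Group" "Jordan_Normal_Form.Matrix"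
begin

section \<open>Matched pairs of finite groups\<close>

locale matched_pair = F: group F + \<Gamma>: group \<Gamma>
  for F :: "('f, 'm) monoid_scheme" and \<Gamma> :: "('g, 'n) monoid_scheme" +
  fixes lact :: "'g \<Rightarrow> 'f \<Rightarrow> 'f" (infixr "\<triangleright>" 75)
    and ract :: "'g \<Rightarrow> 'f \<Rightarrow> 'g" (infixl "\<triangleleft>" 75)
  assumes finite_F: "finite (carrier F)"
    and finite_\<Gamma>: "finite (carrier \<Gamma>)"
    and lact_closed: "\<lbrakk>s \<in> carrier \<Gamma>; x \<in> carrier F\<rbrakk> \<Longrightarrow> s \<triangleright> x \<in> carrier F"
    and lact_one: "x \<in> carrier F \<Longrightarrow> \<one>\<^bsub>\<Gamma>\<^esub> \<triangleright> x = x"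
    and lact_mult: "\<lbrakk>s \<in> carrier \<Gamma>; t \<in> carrier \<Gamma>; x \<in> carrier F\<rbrakk>
                    \<Longrightarrow> (s \<otimes>\<^bsub>\<Gamma>\<^esub> t) \<triangleright> x = s \<triangleright> (t \<triangleright> x)"
    and ract_closed: "\<lbrakk>s \<in> carrier \<Gamma>; x \<in> carrier F\<rbrakk> \<Longrightarrow> s \<triangleleft> x \<in> carrier \<Gamma>"
    and ract_one: "s \<in> carrier \<Gamma> \<Longrightarrow> s \<triangleleft> \<one>\<^bsub>F\<^esub> = s"
    and ract_mult: "\<lbrakk>s \<in> carrier \<Gamma>; x \<in> carrier F; y \<in> carrier F\<rbrakk>
                    \<Longrightarrow> s \<triangleleft> (x \<otimes>\<^bsub>F\<^esub> y) = (s \<triangleleft> x) \<triangleleft> y"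
    and lact_matched: "\<lbrakk>s \<in> carrier \<Gamma>; x \<in> carrier F; y \<in> carrier F\<rbrakk>
                    \<Longrightarrow> s \<triangleright> (x \<otimes>\<^bsub>F\<^esub> y) = (s \<triangleright> x) \<otimes>\<^bsub>F\<^esub> ((s \<triangleleft> x) \<triangleright> y)"
    and ract_matched: "\<lbrakk>s \<in> carrier \<Gamma>; t \<in> carrier \<Gamma>; x \<in> carrier F\<rbrakk>
                    \<Longrightarrow> (s \<otimes>\<^bsub>\<Gamma>\<^esub> t) \<triangleleft> x = (s \<triangleleft> (t \<triangleright> x)) \<otimes>\<^bsub>\<Gamma>\<^esub> (t \<triangleleft> x)"

definition bowtie ::
  "('f, 'm) monoid_scheme \<Rightarrow> ('g, 'n) monoid_scheme \<Rightarrow> ('g \<Rightarrow> 'f \<Rightarrow> 'f) \<Rightarrow> ('g \<Rightarrow> 'f \<Rightarrow> 'g)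
    \<Rightarrow> ('f \<times> 'g) monoid" where
  "bowtie F \<Gamma> lact ract =
    \<lparr> carrier = carrier F \<times> carrier \<Gamma>,
      monoid.mult = (\<lambda>(x, s) (y, t). (x \<otimes>\<^bsub>F\<^esub> lact s y, ract s y \<otimes>\<^bsub>\<Gamma>\<^esub> t)),
      one = (\<one>\<^bsub>F\<^esub>, \<one>\<^bsub>\<Gamma>\<^esub>) \<rparr>"

definition group_exponent :: "('a, 'm) monoid_scheme \<Rightarrow> nat" where
  "group_exponent G = Lcm (group.ord G ` carrier G)"


section \<open>Finite-dimensional spaces with a basis\<close>

text \<open>
  A finite-dimensional space is given with a finite set \<open>I\<close> indexing a basis, so it is \<open>k\<^sup>I\<close>, and
  \<open>k\<^sup>I \<otimes> k\<^sup>J\<close> is \<open>k\<^bsup>I \<times> J\<^esup>\<close>. A linear map from \<open>k\<^sup>I\<close> to \<open>k\<^sup>J\<close> is given by its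
  coefficients: \<open>f i j\<close> is the coefficient of the basis vector \<open>j\<close> in the image of the basis
  vector \<open>i\<close>. Coefficients with indices outside \<open>I\<close> and \<open>J\<close> are irrelevant.
\<close>

definition vecs :: "'i set \<Rightarrow> ('i \<Rightarrow> 'k) set" where
  "vecs I = (I \<rightarrow>\<^sub>E UNIV)"

definition lmap :: "'i set \<Rightarrow> 'j set \<Rightarrow> ('i \<Rightarrow> 'j \<Rightarrow> 'k::field) \<Rightarrow> ('i \<Rightarrow> 'k) \<Rightarrow> 'j \<Rightarrow> 'k" where
  "lmap I J f v = (\<lambda>j\<in>J. \<Sum>i\<in>I. v i * f i j)"

definition vzero :: "'i set \<Rightarrow> 'i \<Rightarrow> 'k::field" where
  "vzero I = (\<lambda>i\<in>I. 0)"

definition bvec :: "'i set \<Rightarrow> 'i \<Rightarrow> 'i \<Rightarrow> 'k::field" where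
  "bvec I i = (\<lambda>j\<in>I. of_bool (j = i))"

definition vtensor :: "'i set \<Rightarrow> 'j set \<Rightarrow> ('i \<Rightarrow> 'k::field) \<Rightarrow> ('j \<Rightarrow> 'k) \<Rightarrow> 'i \<times> 'j \<Rightarrow> 'k" where
  "vtensor I J v w = (\<lambda>(i, j)\<in>I \<times> J. v i * w j)"

definition lid :: "'i \<Rightarrow> 'i \<Rightarrow> 'k::field" where
  "lid i j = of_bool (i = j)"

definition ltensor ::
  "('i \<Rightarrow> 'p \<Rightarrow> 'k::field) \<Rightarrow> ('j \<Rightarrow> 'q \<Rightarrow> 'k) \<Rightarrow> 'i \<times> 'j \<Rightarrow> 'p \<times> 'q \<Rightarrow> 'k" where
  "ltensor f g = (\<lambda>(i, j) (p, q). f i p * g j q)"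


section \<open>Hopf algebras\<close>

text \<open>
  Structure constants with respect to the basis \<open>b\<close>:
  \<open>b\<^sub>i b\<^sub>j = \<Sum>\<^sub>l mlt i j l b\<^sub>l\<close>, \<open>1 = \<Sum>\<^sub>i unt i b\<^sub>i\<close>,
  \<open>\<Delta> b\<^sub>i = \<Sum>\<^sub>j\<^sub>l cml i j l b\<^sub>j \<otimes> b\<^sub>l\<close>, \<open>\<epsilon> b\<^sub>i = cou i\<close>.
\<close>

record ('i, 'k) bialg =
  basis :: "'i set"
  mlt :: "'i \<Rightarrow> 'i \<Rightarrow> 'i \<Rightarrow> 'k"
  unt :: "'i \<Rightarrow> 'k"
  cml :: "'i \<Rightarrow> 'i \<Rightarrow> 'i \<Rightarrow> 'k"
  cou :: "'i \<Rightarrow> 'k"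

locale bialgebra =
  fixes A :: "('i, 'k::field) bialg"
  assumes finite_basis: "finite (basis A)"
    and assoc: "\<lbrakk>i \<in> basis A; j \<in> basis A; l \<in> basis A; n \<in> basis A\<rbrakk> \<Longrightarrow>
      (\<Sum>p\<in>basis A. mlt A i j p * mlt A p l n) = (\<Sum>p\<in>basis A. mlt A j l p * mlt A i p n)"
    and unit_left: "\<lbrakk>i \<in> basis A; j \<in> basis A\<rbrakk> \<Longrightarrow>
      (\<Sum>p\<in>basis A. unt A p * mlt A p i j) = of_bool (i = j)"
    and unit_right: "\<lbrakk>i \<in> basis A; j \<in> basis A\<rbrakk> \<Longrightarrow>
      (\<Sum>p\<in>basis A. unt A p * mlt A i p j) = of_bool (i = j)"
    and coassoc: "\<lbrakk>i \<in> basis A; j \<in> basis A; l \<in> basis A; n \<in> basis A\<rbrakk> \<Longrightarrow>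
      (\<Sum>p\<in>basis A. cml A i p n * cml A p j l) = (\<Sum>p\<in>basis A. cml A i j p * cml A p l n)"
    and counit_left: "\<lbrakk>i \<in> basis A; j \<in> basis A\<rbrakk> \<Longrightarrow>
      (\<Sum>p\<in>basis A. cml A i p j * cou A p) = of_bool (i = j)"
    and counit_right: "\<lbrakk>i \<in> basis A; j \<in> basis A\<rbrakk> \<Longrightarrow>
      (\<Sum>p\<in>basis A. cml A i j p * cou A p) = of_bool (i = j)"
    and comult_mult: "\<lbrakk>i \<in> basis A; j \<in> basis A; p \<in> basis A; q \<in> basis A\<rbrakk> \<Longrightarrow>
      (\<Sum>l\<in>basis A. mlt A i j l * cml A l p q) =
      (\<Sum>a\<in>basis A. \<Sum>b\<in>basis A. \<Sum>c\<in>basis A. \<Sum>d\<in>basis A.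
        cml A i a b * cml A j c d * mlt A a c p * mlt A b d q)"
    and comult_unit: "\<lbrakk>p \<in> basis A; q \<in> basis A\<rbrakk> \<Longrightarrow>
      (\<Sum>i\<in>basis A. unt A i * cml A i p q) = unt A p * unt A q"
    and counit_mult: "\<lbrakk>i \<in> basis A; j \<in> basis A\<rbrakk> \<Longrightarrow>
      (\<Sum>l\<in>basis A. mlt A i j l * cou A l) = cou A i * cou A j"
    and counit_unit: "(\<Sum>i\<in>basis A. unt A i * cou A i) = 1"

locale hopf_algebra = bialgebra +
  assumes antipode: "\<exists>S. \<forall>i\<in>basis A. \<forall>n\<in>basis A.
      (\<Sum>j\<in>basis A. \<Sum>l\<in>basis A. \<Sum>p\<in>basis A. cml A i j l * S j p * mlt A p l n) = cou A i * unt A n \<and>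
      (\<Sum>j\<in>basis A. \<Sum>l\<in>basis A. \<Sum>p\<in>basis A. cml A i j l * S l p * mlt A j p n) = cou A i * unt A n"

definition vmult :: "('i, 'k::field) bialg \<Rightarrow> ('i \<Rightarrow> 'k) \<Rightarrow> ('i \<Rightarrow> 'k) \<Rightarrow> 'i \<Rightarrow> 'k" where
  "vmult A v w = (\<lambda>l\<in>basis A. \<Sum>i\<in>basis A. \<Sum>j\<in>basis A. v i * w j * mlt A i j l)"

definition vunit :: "('i, 'k::field) bialg \<Rightarrow> 'i \<Rightarrow> 'k" where
  "vunit A = (\<lambda>i\<in>basis A. unt A i)"

definition vcomult :: "('i, 'k::field) bialg \<Rightarrow> ('i \<Rightarrow> 'k) \<Rightarrow> 'i \<times> 'i \<Rightarrow> 'k" where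
  "vcomult A v = (\<lambda>(j, l)\<in>basis A \<times> basis A. \<Sum>i\<in>basis A. v i * cml A i j l)"

definition vcounit :: "('i, 'k::field) bialg \<Rightarrow> ('i \<Rightarrow> 'k) \<Rightarrow> 'k" where
  "vcounit A v = (\<Sum>i\<in>basis A. v i * cou A i)"

text \<open>A bialgebra map between Hopf algebras commutes with the antipodes automatically.\<close>

definition hopf_hom ::
  "('i, 'k::field) bialg \<Rightarrow> ('j, 'k) bialg \<Rightarrow> ('i \<Rightarrow> 'j \<Rightarrow> 'k) \<Rightarrow> bool" where
  "hopf_hom A B f \<longleftrightarrow>
    (let f' = lmap (basis A) (basis B) f in
      (\<forall>v\<in>vecs (basis A). \<forall>w\<in>vecs (basis A). f' (vmult A v w) = vmult B (f' v) (f' w)) \<and>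
      f' (vunit A) = vunit B \<and>
      (\<forall>v\<in>vecs (basis A).
        lmap (basis A \<times> basis A) (basis B \<times> basis B) (ltensor f f) (vcomult A v)
          = vcomult B (f' v)) \<and>
      (\<forall>v\<in>vecs (basis A). vcounit B (f' v) = vcounit A v))"

text \<open>The function algebra \<open>k\<^sup>\<Gamma>\<close>, with the basis \<open>e\<^sub>s\<close>, and the group algebra \<open>k F\<close>.\<close>

definition fun_hopf :: "('g, 'n) monoid_scheme \<Rightarrow> ('g, 'k::field) bialg" where
  "fun_hopf \<Gamma> =
    \<lparr> basis = carrier \<Gamma>,
      mlt = (\<lambda>s t u. of_bool (s = t \<and> u = s)),
      unt = (\<lambda>s. 1),
      cml = (\<lambda>s t u. of_bool (t \<otimes>\<^bsub>\<Gamma>\<^esub> u = s)),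
      cou = (\<lambda>s. of_bool (s = \<one>\<^bsub>\<Gamma>\<^esub>)) \<rparr>"

definition grp_hopf :: "('f, 'm) monoid_scheme \<Rightarrow> ('f, 'k::field) bialg" where
  "grp_hopf F =
    \<lparr> basis = carrier F,
      mlt = (\<lambda>x y z. of_bool (z = x \<otimes>\<^bsub>F\<^esub> y)),
      unt = (\<lambda>x. of_bool (x = \<one>\<^bsub>F\<^esub>)),
      cml = (\<lambda>x y z. of_bool (y = x \<and> z = x)),
      cou = (\<lambda>x. 1) \<rparr>"


section \<open>Extensions of Hopf algebras\<close>

text \<open>The left ideal \<open>A \<iota>(K)\<^sup>+\<close>, with \<open>K\<^sup>+\<close> the kernel of the counit.\<close>

definition augmentation_ideal ::
  "('h, 'k::field) bialg \<Rightarrow> ('i, 'k) bialg \<Rightarrow> ('h \<Rightarrow> 'i \<Rightarrow> 'k) \<Rightarrow> ('i \<Rightarrow> 'k) set" where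
  "augmentation_ideal K A \<iota> =
    {(\<lambda>i\<in>basis A. \<Sum>n<N. vmult A (a n) (lmap (basis K) (basis A) \<iota> (f n)) i) | (N::nat) a f.
      \<forall>n<N. a n \<in> vecs (basis A) \<and> f n \<in> vecs (basis K) \<and> vcounit K (f n) = 0}"

text \<open>Right and left coinvariance of degree \<open>w\<close>: \<open>(id \<otimes> \<pi>) \<Delta>(a) = a \<otimes> w\<close> and \<open>(\<pi> \<otimes> id) \<Delta>(a) = w \<otimes> a\<close>.\<close>

definition right_degree ::
  "('i, 'k::field) bialg \<Rightarrow> ('j, 'k) bialg \<Rightarrow> ('i \<Rightarrow> 'j \<Rightarrow> 'k) \<Rightarrow> ('j \<Rightarrow> 'k) \<Rightarrow> ('i \<Rightarrow> 'k) set" where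
  "right_degree A H \<pi> w = {a \<in> vecs (basis A).
    lmap (basis A \<times> basis A) (basis A \<times> basis H) (ltensor lid \<pi>) (vcomult A a)
      = vtensor (basis A) (basis H) a w}"

definition left_degree ::
  "('i, 'k::field) bialg \<Rightarrow> ('j, 'k) bialg \<Rightarrow> ('i \<Rightarrow> 'j \<Rightarrow> 'k) \<Rightarrow> ('j \<Rightarrow> 'k) \<Rightarrow> ('i \<Rightarrow> 'k) set" where
  "left_degree A H \<pi> w = {a \<in> vecs (basis A).
    lmap (basis A \<times> basis A) (basis H \<times> basis A) (ltensor \<pi> lid) (vcomult A a)
      = vtensor (basis H) (basis A) w a}"

text \<open>Exactness of \<open>k \<rightarrow> K \<rightarrow> A \<rightarrow> H \<rightarrow> k\<close>.\<close>

definition exact_sequence ::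
  "('h, 'k::field) bialg \<Rightarrow> ('i, 'k) bialg \<Rightarrow> ('j, 'k) bialg
    \<Rightarrow> ('h \<Rightarrow> 'i \<Rightarrow> 'k) \<Rightarrow> ('i \<Rightarrow> 'j \<Rightarrow> 'k) \<Rightarrow> bool" where
  "exact_sequence K A H \<iota> \<pi> \<longleftrightarrow>
    hopf_hom K A \<iota> \<and> hopf_hom A H \<pi> \<and>
    inj_on (lmap (basis K) (basis A) \<iota>) (vecs (basis K)) \<and>
    lmap (basis A) (basis H) \<pi> ` vecs (basis A) = vecs (basis H) \<and>
    {a \<in> vecs (basis A). lmap (basis A) (basis H) \<pi> a = vzero (basis H)}
      = augmentation_ideal K A \<iota> \<and>
    lmap (basis K) (basis A) \<iota> ` vecs (basis K) = right_degree A H \<pi> (vunit H)"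

text \<open>
  Let \<open>A\<^sub>x\<close> be the right degree \<open>x\<close> part of an extension \<open>A\<close> of \<open>k F\<close> by \<open>k\<^sup>\<Gamma>\<close>. A cleaving map
  sends \<open>x\<close> to some \<open>\<chi>(x)\<close> with \<open>A\<^sub>x = k\<^sup>\<Gamma> \<chi>(x)\<close>. The weak action of \<open>k F\<close> on \<open>k\<^sup>\<Gamma>\<close> is conjugation
  by \<open>\<chi>(x)\<close>, so it comes from \<open>\<triangleleft>\<close> when \<open>e\<^sub>s a = a e\<^bsub>s \<triangleleft> x\<^esub>\<close> for all \<open>a\<close> in \<open>A\<^sub>x\<close>. Dually, the weak coaction
  of \<open>k\<^sup>\<Gamma>\<close> on \<open>k F\<close> comes from \<open>\<triangleright>\<close> when \<open>e\<^sub>s A\<^sub>x\<close> has left degree \<open>s \<triangleright> x\<close>. Neither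
  condition depends on the cleaving map.
\<close>

definition affords_actions ::
  "('f, 'm) monoid_scheme \<Rightarrow> ('g, 'n) monoid_scheme \<Rightarrow> ('g \<Rightarrow> 'f \<Rightarrow> 'f) \<Rightarrow> ('g \<Rightarrow> 'f \<Rightarrow> 'g)
    \<Rightarrow> ('i, 'k::field) bialg \<Rightarrow> ('g \<Rightarrow> 'i \<Rightarrow> 'k) \<Rightarrow> ('i \<Rightarrow> 'f \<Rightarrow> 'k) \<Rightarrow> bool" where
  "affords_actions F \<Gamma> lact ract A \<iota> \<pi> \<longleftrightarrow>
    (let e = (\<lambda>s. lmap (carrier \<Gamma>) (basis A) \<iota> (bvec (carrier \<Gamma>) s)) in
      \<forall>x\<in>carrier F. \<forall>a\<in>right_degree A (grp_hopf F) \<pi> (bvec (carrier F) x). \<forall>s\<in>carrier \<Gamma>.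
        vmult A (e s) a = vmult A a (e (ract s x)) \<and>
        vmult A (e s) a \<in> left_degree A (grp_hopf F) \<pi> (bvec (carrier F) (lact s x)))"

definition equivalent_extensions ::
  "('h, 'k::field) bialg \<Rightarrow> ('j, 'k) bialg
    \<Rightarrow> ('i, 'k) bialg \<Rightarrow> ('h \<Rightarrow> 'i \<Rightarrow> 'k) \<Rightarrow> ('i \<Rightarrow> 'j \<Rightarrow> 'k)
    \<Rightarrow> ('i2, 'k) bialg \<Rightarrow> ('h \<Rightarrow> 'i2 \<Rightarrow> 'k) \<Rightarrow> ('i2 \<Rightarrow> 'j \<Rightarrow> 'k) \<Rightarrow> bool" where
  "equivalent_extensions K H A \<iota> \<pi> A' \<iota>' \<pi>' \<longleftrightarrow>
    (\<exists>\<phi>. hopf_hom A A' \<phi> \<and>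
      bij_betw (lmap (basis A) (basis A') \<phi>) (vecs (basis A)) (vecs (basis A')) \<and>
      (\<forall>v\<in>vecs (basis K). lmap (basis A) (basis A') \<phi> (lmap (basis K) (basis A) \<iota> v)
        = lmap (basis K) (basis A') \<iota>' v) \<and>
      (\<forall>v\<in>vecs (basis A). lmap (basis A') (basis H) \<pi>' (lmap (basis A) (basis A') \<phi> v)
        = lmap (basis A) (basis H) \<pi> v))"


section \<open>Bicrossed products and the group Opext\<close>

text \<open>The basis element \<open>e\<^sub>s # x\<close> is the pair \<open>(s, x)\<close>; \<open>\<sigma> s x y\<close> is \<open>\<sigma>\<^sub>s(x, y)\<close> and \<open>\<tau> x s t\<close> is \<open>\<tau>\<^sub>x(s, t)\<close>.\<close>

definition bicrossed ::
  "('f, 'm) monoid_scheme \<Rightarrow> ('g, 'n) monoid_scheme \<Rightarrow> ('g \<Rightarrow> 'f \<Rightarrow> 'f) \<Rightarrow> ('g \<Rightarrow> 'f \<Rightarrow> 'g)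
    \<Rightarrow> ('g \<Rightarrow> 'f \<Rightarrow> 'f \<Rightarrow> 'k::field) \<times> ('f \<Rightarrow> 'g \<Rightarrow> 'g \<Rightarrow> 'k) \<Rightarrow> ('g \<times> 'f, 'k) bialg" where
  "bicrossed F \<Gamma> lact ract = (\<lambda>(\<sigma>, \<tau>).
    \<lparr> basis = carrier \<Gamma> \<times> carrier F,
      mlt = (\<lambda>(s, x) (t, y) (u, z).
        of_bool (ract s x = t \<and> u = s \<and> z = x \<otimes>\<^bsub>F\<^esub> y) * \<sigma> s x y),
      unt = (\<lambda>(s, x). of_bool (x = \<one>\<^bsub>F\<^esub>)),
      cml = (\<lambda>(s, x) (t, y) (u, z).
        of_bool (t \<otimes>\<^bsub>\<Gamma>\<^esub> u = s \<and> y = lact u x \<and> z = x) * \<tau> x t u),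
      cou = (\<lambda>(s, x). of_bool (s = \<one>\<^bsub>\<Gamma>\<^esub>)) \<rparr>)"

definition bicrossed_incl :: "('f, 'm) monoid_scheme \<Rightarrow> 'g \<Rightarrow> 'g \<times> 'f \<Rightarrow> 'k::field" where
  "bicrossed_incl F = (\<lambda>s (t, x). of_bool (t = s \<and> x = \<one>\<^bsub>F\<^esub>))"

definition bicrossed_proj :: "('g, 'n) monoid_scheme \<Rightarrow> 'g \<times> 'f \<Rightarrow> 'f \<Rightarrow> 'k::field" where
  "bicrossed_proj \<Gamma> = (\<lambda>(s, x) y. of_bool (s = \<one>\<^bsub>\<Gamma>\<^esub> \<and> y = x))"

text \<open>
  The 2-cocycle identities are those for the \<open>F\<close>-module \<open>(k\<^sup>\<Gamma>)\<^sup>\<times>\<close> with \<open>(x \<cdot> f)(s) = f(s \<triangleleft> x)\<close> and for the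
  right \<open>\<Gamma>\<close>-module \<open>(k\<^sup>F)\<^sup>\<times>\<close> with \<open>(f \<cdot> u)(x) = f(u \<triangleright> x)\<close>.
\<close>

definition cocycle_pairs ::
  "('f, 'm) monoid_scheme \<Rightarrow> ('g, 'n) monoid_scheme \<Rightarrow> ('g \<Rightarrow> 'f \<Rightarrow> 'f) \<Rightarrow> ('g \<Rightarrow> 'f \<Rightarrow> 'g)
    \<Rightarrow> (('g \<Rightarrow> 'f \<Rightarrow> 'f \<Rightarrow> 'k::field) \<times> ('f \<Rightarrow> 'g \<Rightarrow> 'g \<Rightarrow> 'k)) set" where
  "cocycle_pairs F \<Gamma> lact ract = {(\<sigma>, \<tau>).
    (\<forall>s\<in>carrier \<Gamma>. \<forall>x\<in>carrier F. \<forall>y\<in>carrier F. \<sigma> s x y \<noteq> 0) \<and>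
    (\<forall>s\<in>carrier \<Gamma>. \<forall>x\<in>carrier F. \<sigma> s x \<one>\<^bsub>F\<^esub> = 1 \<and> \<sigma> s \<one>\<^bsub>F\<^esub> x = 1) \<and>
    (\<forall>s\<in>carrier \<Gamma>. \<forall>x\<in>carrier F. \<forall>y\<in>carrier F. \<forall>z\<in>carrier F.
      \<sigma> (ract s x) y z * \<sigma> s x (y \<otimes>\<^bsub>F\<^esub> z) = \<sigma> s x y * \<sigma> s (x \<otimes>\<^bsub>F\<^esub> y) z) \<and>
    (\<forall>x\<in>carrier F. \<forall>s\<in>carrier \<Gamma>. \<forall>t\<in>carrier \<Gamma>. \<tau> x s t \<noteq> 0) \<and>
    (\<forall>x\<in>carrier F. \<forall>s\<in>carrier \<Gamma>. \<tau> x s \<one>\<^bsub>\<Gamma>\<^esub> = 1 \<and> \<tau> x \<one>\<^bsub>\<Gamma>\<^esub> s = 1) \<and>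
    (\<forall>x\<in>carrier F. \<forall>s\<in>carrier \<Gamma>. \<forall>t\<in>carrier \<Gamma>. \<forall>u\<in>carrier \<Gamma>.
      \<tau> (lact u x) s t * \<tau> x (s \<otimes>\<^bsub>\<Gamma>\<^esub> t) u = \<tau> x t u * \<tau> x s (t \<otimes>\<^bsub>\<Gamma>\<^esub> u)) \<and>
    hopf_algebra (bicrossed F \<Gamma> lact ract (\<sigma>, \<tau>))}"

definition pair_mult ::
  "('g \<Rightarrow> 'f \<Rightarrow> 'f \<Rightarrow> 'k::field) \<times> ('f \<Rightarrow> 'g \<Rightarrow> 'g \<Rightarrow> 'k)
    \<Rightarrow> ('g \<Rightarrow> 'f \<Rightarrow> 'f \<Rightarrow> 'k) \<times> ('f \<Rightarrow> 'g \<Rightarrow> 'g \<Rightarrow> 'k)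
    \<Rightarrow> ('g \<Rightarrow> 'f \<Rightarrow> 'f \<Rightarrow> 'k) \<times> ('f \<Rightarrow> 'g \<Rightarrow> 'g \<Rightarrow> 'k)" where
  "pair_mult = (\<lambda>(\<sigma>, \<tau>) (\<sigma>', \<tau>').
    (\<lambda>s x y. \<sigma> s x y * \<sigma>' s x y, \<lambda>x s t. \<tau> x s t * \<tau>' x s t))"

definition opext_rel ::
  "('f, 'm) monoid_scheme \<Rightarrow> ('g, 'n) monoid_scheme \<Rightarrow> ('g \<Rightarrow> 'f \<Rightarrow> 'f) \<Rightarrow> ('g \<Rightarrow> 'f \<Rightarrow> 'g)
    \<Rightarrow> (('g \<Rightarrow> 'f \<Rightarrow> 'f \<Rightarrow> 'k::field) \<times> ('f \<Rightarrow> 'g \<Rightarrow> 'g \<Rightarrow> 'k)) rel" where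
  "opext_rel F \<Gamma> lact ract =
    {(c, d) \<in> cocycle_pairs F \<Gamma> lact ract \<times> cocycle_pairs F \<Gamma> lact ract.
      equivalent_extensions (fun_hopf \<Gamma>) (grp_hopf F)
        (bicrossed F \<Gamma> lact ract c) (bicrossed_incl F) (bicrossed_proj \<Gamma>)
        (bicrossed F \<Gamma> lact ract d) (bicrossed_incl F) (bicrossed_proj \<Gamma>)}"

definition Opext ::
  "('f, 'm) monoid_scheme \<Rightarrow> ('g, 'n) monoid_scheme \<Rightarrow> ('g \<Rightarrow> 'f \<Rightarrow> 'f) \<Rightarrow> ('g \<Rightarrow> 'f \<Rightarrow> 'g)
    \<Rightarrow> (('g \<Rightarrow> 'f \<Rightarrow> 'f \<Rightarrow> 'k::field) \<times> ('f \<Rightarrow> 'g \<Rightarrow> 'g \<Rightarrow> 'k)) set monoid" where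
  "Opext F \<Gamma> lact ract =
    \<lparr> carrier = cocycle_pairs F \<Gamma> lact ract // opext_rel F \<Gamma> lact ract,
      monoid.mult = (\<lambda>C D. opext_rel F \<Gamma> lact ract `` {pair_mult c d | c d. c \<in> C \<and> d \<in> D}),
      one = opext_rel F \<Gamma> lact ract `` {(\<lambda>s x y. 1, \<lambda>x s t. 1)} \<rparr>"


section \<open>Drinfeld center and exponent of a monoidal category\<close>

text \<open>
  Strict monoidal categories suffice, since representations on the spaces \<open>k\<^sup>d\<close>, with the Kronecker
  product as tensor product, form one.
\<close>

record ('o, 'm) monoidal_cat =
  Obj :: "'o set"
  Hom :: "'o \<Rightarrow> 'o \<Rightarrow> 'm set"
  Comp :: "'m \<Rightarrow> 'm \<Rightarrow> 'm"
  Ident :: "'o \<Rightarrow> 'm"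
  TensO :: "'o \<Rightarrow> 'o \<Rightarrow> 'o"
  TensM :: "'m \<Rightarrow> 'm \<Rightarrow> 'm"
  UnitO :: "'o"

definition iso_in :: "('o, 'm) monoidal_cat \<Rightarrow> 'o \<Rightarrow> 'o \<Rightarrow> 'm \<Rightarrow> bool" where
  "iso_in \<C> X Y f \<longleftrightarrow> f \<in> Hom \<C> X Y \<and>
    (\<exists>g\<in>Hom \<C> Y X. Comp \<C> g f = Ident \<C> X \<and> Comp \<C> f g = Ident \<C> Y)"

text \<open>A half-braiding on \<open>Z\<close> is a natural family of isomorphisms \<open>c X : Z \<otimes> X \<rightarrow> X \<otimes> Z\<close>.\<close>

definition half_braiding :: "('o, 'm) monoidal_cat \<Rightarrow> 'o \<Rightarrow> ('o \<Rightarrow> 'm) \<Rightarrow> bool" where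
  "half_braiding \<C> Z c \<longleftrightarrow>
    (\<forall>X\<in>Obj \<C>. iso_in \<C> (TensO \<C> Z X) (TensO \<C> X Z) (c X)) \<and>
    (\<forall>X\<in>Obj \<C>. \<forall>Y\<in>Obj \<C>. \<forall>f\<in>Hom \<C> X Y.
      Comp \<C> (c Y) (TensM \<C> (Ident \<C> Z) f) = Comp \<C> (TensM \<C> f (Ident \<C> Z)) (c X)) \<and>
    (\<forall>X\<in>Obj \<C>. \<forall>Y\<in>Obj \<C>.
      c (TensO \<C> X Y) = Comp \<C> (TensM \<C> (Ident \<C> X) (c Y)) (TensM \<C> (c X) (Ident \<C> Y))) \<and>
    c (UnitO \<C>) = Ident \<C> Z"

definition center_objects :: "('o, 'm) monoidal_cat \<Rightarrow> ('o \<times> ('o \<Rightarrow> 'm)) set" where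
  "center_objects \<C> = {(Z, c). Z \<in> Obj \<C> \<and> half_braiding \<C> Z c}"

text \<open>The canonical braiding \<open>(U, c) \<otimes> (V, d) \<rightarrow> (V, d) \<otimes> (U, c)\<close> of the Drinfeld center.\<close>

definition center_braiding :: "'o \<times> ('o \<Rightarrow> 'm) \<Rightarrow> 'o \<times> ('o \<Rightarrow> 'm) \<Rightarrow> 'm" where
  "center_braiding U V = snd U (fst V)"

definition cat_exponent :: "('o, 'm) monoidal_cat \<Rightarrow> nat" where
  "cat_exponent \<C> = (LEAST N. 1 \<le> N \<and>
    (\<forall>U\<in>center_objects \<C>. \<forall>V\<in>center_objects \<C>.
      (Comp \<C> (Comp \<C> (center_braiding V U) (center_braiding U V)) ^^ N)
        (Ident \<C> (TensO \<C> (fst U) (fst V))) = Ident \<C> (TensO \<C> (fst U) (fst V))))"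


section \<open>The category of representations\<close>

definition kron :: "'k::field mat \<Rightarrow> 'k mat \<Rightarrow> 'k mat" where
  "kron M N = mat (dim_row M * dim_row N) (dim_col M * dim_col N)
    (\<lambda>(i, j). M $$ (i div dim_row N, j div dim_col N) * N $$ (i mod dim_row N, j mod dim_col N))"

definition mat_sum :: "nat \<Rightarrow> 'a set \<Rightarrow> ('a \<Rightarrow> 'k::field) \<Rightarrow> ('a \<Rightarrow> 'k mat) \<Rightarrow> 'k mat" where
  "mat_sum d I a M = mat d d (\<lambda>rc. \<Sum>i\<in>I. a i * M i $$ rc)"

text \<open>An object \<open>(d, \<rho>)\<close> is the module \<open>k\<^sup>d\<close> on which the basis element \<open>i\<close> acts by \<open>\<rho> i\<close>.\<close>

definition rep_objects :: "('i, 'k::field) bialg \<Rightarrow> (nat \<times> ('i \<Rightarrow> 'k mat)) set" where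
  "rep_objects A = {(d, \<rho>).
    \<rho> \<in> basis A \<rightarrow>\<^sub>E carrier_mat d d \<and>
    (\<forall>i\<in>basis A. \<forall>j\<in>basis A. \<rho> i * \<rho> j = mat_sum d (basis A) (mlt A i j) \<rho>) \<and>
    mat_sum d (basis A) (unt A) \<rho> = 1\<^sub>m d}"

definition Rep :: "('i, 'k::field) bialg \<Rightarrow> (nat \<times> ('i \<Rightarrow> 'k mat), 'k mat) monoidal_cat" where
  "Rep A =
    \<lparr> Obj = rep_objects A,
      Hom = (\<lambda>(d, \<rho>) (d', \<rho>'). {T \<in> carrier_mat d' d. \<forall>i\<in>basis A. T * \<rho> i = \<rho>' i * T}),
      Comp = (*),
      Ident = (\<lambda>(d, \<rho>). 1\<^sub>m d),
      TensO = (\<lambda>(d, \<rho>) (d', \<rho>'). (d * d',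
        \<lambda>i\<in>basis A. mat_sum (d * d') (basis A \<times> basis A)
          (\<lambda>(p, q). cml A i p q) (\<lambda>(p, q). kron (\<rho> p) (\<rho>' q)))),
      TensM = kron,
      UnitO = (1, \<lambda>i\<in>basis A. mat 1 1 (\<lambda>_. cou A i)) \<rparr>"

definition hopf_exponent :: "('i, 'k::field) bialg \<Rightarrow> nat" where
  "hopf_exponent A = cat_exponent (Rep A)"

end

theory Submission imports Defs
begin

text \<open>
  A half-braiding on a module \<open>Z\<close> is determined by its component at the regular module. It has the form
  \<open>c\<^sub>X = \<Sum>\<^sub>i b\<^sub>i|\<^sub>X \<otimes> T\<^sub>i\<close>, up to the exchange of the factors, where \<open>b\<close> is the basis of \<open>A\<close> and the operators
  \<open>T\<^sub>i\<close> turn \<open>Z\<close> into a Yetter-Drinfeld module (\<open>half_braiding_data\<close>). With \<open>R\<^sub>i\<close> the action of \<open>b\<^sub>i\<close> and primes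
  for a second object, the double braiding is \<open>(\<Sum>\<^sub>i R\<^sub>i T'\<^sub>i) (\<Sum>\<^sub>j R'\<^sub>j T\<^sub>j)\<close>.

  The powers of a double braiding are hard to see directly, so they are compared with those of the twist
  \<open>\<phi> = \<Sum>\<^sub>i R\<^sub>i T\<^sub>i\<close> of a single object. The twist commutes with the actions of \<open>R\<close> and \<open>T\<close>, and the twist of a tensor
  product is \<open>\<phi> \<phi>'\<close> times the double braiding, where all three factors commute (\<open>twist_tensor\<close>). If the
  \<open>N\<close>-th power of each twist is 1, then the same holds for the double braidings.

  Let \<open>A\<close> be an extension that affords the matched pair. It is strongly graded by \<open>F\<close>: applying the antipode to
  one factor of the coproduct of an element of degree \<open>x\<close> with counit 1 writes 1 as an element of
  \<open>A\<^bsub>inverse x\<^esub> A\<^sub>x\<close>. This makes each \<open>e\<^sub>s A\<^sub>x\<close> a line, and generators of these lines form a basis on which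
  \<open>A\<close> is the bicrossed product for a pair of cocycles \<open>(\<sigma>, \<tau>)\<close> (\<open>component_generator\<close>, \<open>bicrossed_datum_of_basis\<close>).
  In this basis \<open>\<phi> = \<Sum> P(s, x) T(s, x)\<close>, the sum being over \<open>\<Gamma> \<times> F\<close>. Since \<open>P(s, x) P(t, y)\<close> vanishes unless
  \<open>t = s \<triangleleft> x\<close>, and \<open>T(t, y) T(s, x)\<close> unless \<open>x = t \<triangleright> y\<close>, the power \<open>\<phi>\<^sup>n\<close> only involves the products
  that follow an orbit of the map sending \<open>(s, x)\<close> to \<open>(t, inverse t \<triangleright> x)\<close> with \<open>t = s \<triangleleft> x\<close>:
  \<open>\<phi>\<^sup>n\<close> is the sum of the terms \<open>C\<^sub>n(s, x) P(s, X\<^sub>n) T(S\<^sub>n, L\<^sub>n)\<close>, where \<open>C\<^sub>n(s, x)\<close> is a product of values of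
  \<open>\<sigma>\<close> and \<open>\<tau>\<close> along the orbit (\<open>twist_power_expansion\<close>).

  Both exponents now enter. The words \<open>X\<^sub>n\<close> and \<open>S\<^sub>n\<close> can be read off from the \<open>n\<close>-th power of one element of
  \<open>G = F \<bowtie> \<Gamma>\<close>, so for \<open>m = exp G\<close> they are trivial and \<open>\<phi>\<^sup>m\<close> is the sum of the terms
  \<open>C\<^sub>m(s, x) P(s, 1) T(1, s \<triangleright> x)\<close> (\<open>orb_exponent\<close>). Its powers have the powers of \<open>C\<^sub>m(s, x)\<close> as coefficients. The number \<open>C\<^sub>m(s, x)\<close> is multiplicative in \<open>(\<sigma>, \<tau>)\<close> and equals 1 when the extension given by
  \<open>(\<sigma>, \<tau>)\<close> is trivial in \<open>Opext\<close>, because the rescaling that trivializes the cocycles telescopes along the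
  orbit (\<open>orb_coeff_coboundary\<close>). Hence \<open>C\<^sub>m(s, x)\<^sup>e = 1\<close> for \<open>e = exp Opext\<close>, and \<open>\<phi>\<close> to the power \<open>e m\<close> is 1.
\<close>

section \<open>Matched pairs and their factorizable group\<close>

context matched_pair
begin

lemmas act_closed [simp, intro] = lact_closed ract_closed

lemma lact_unit [simp]: "s \<in> carrier \<Gamma> \<Longrightarrow> s \<triangleright> \<one>\<^bsub>F\<^esub> = \<one>\<^bsub>F\<^esub>"
  using lact_matched[of s "\<one>\<^bsub>F\<^esub>" "\<one>\<^bsub>F\<^esub>"] by (simp add: ract_one)

lemma ract_unit [simp]: "x \<in> carrier F \<Longrightarrow> \<one>\<^bsub>\<Gamma>\<^esub> \<triangleleft> x = \<one>\<^bsub>\<Gamma>\<^esub>"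
  using ract_matched[of "\<one>\<^bsub>\<Gamma>\<^esub>" "\<one>\<^bsub>\<Gamma>\<^esub>" x] by (simp add: lact_one)

lemmas act_one [simp] = lact_one ract_one

lemma lact_inv_lact [simp]:
  "s \<in> carrier \<Gamma> \<Longrightarrow> x \<in> carrier F \<Longrightarrow> inv\<^bsub>\<Gamma>\<^esub> s \<triangleright> (s \<triangleright> x) = x"
  by (simp flip: lact_mult)

lemma lact_lact_inv [simp]:
  "s \<in> carrier \<Gamma> \<Longrightarrow> x \<in> carrier F \<Longrightarrow> s \<triangleright> (inv\<^bsub>\<Gamma>\<^esub> s \<triangleright> x) = x"
  by (simp flip: lact_mult)

lemma ract_ract_inv [simp]:
  "s \<in> carrier \<Gamma> \<Longrightarrow> x \<in> carrier F \<Longrightarrow> s \<triangleleft> x \<triangleleft> inv\<^bsub>F\<^esub> x = s"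
  by (simp flip: ract_mult)

lemma ract_inv_ract [simp]:
  "s \<in> carrier \<Gamma> \<Longrightarrow> x \<in> carrier F \<Longrightarrow> s \<triangleleft> inv\<^bsub>F\<^esub> x \<triangleleft> x = s"
  by (simp flip: ract_mult)

lemma lact_eq_iff:
  "\<lbrakk>s \<in> carrier \<Gamma>; x \<in> carrier F; y \<in> carrier F\<rbrakk> \<Longrightarrow> s \<triangleright> x = y \<longleftrightarrow> x = inv\<^bsub>\<Gamma>\<^esub> s \<triangleright> y"
  by auto

lemma ract_eq_iff:
  "\<lbrakk>s \<in> carrier \<Gamma>; t \<in> carrier \<Gamma>; x \<in> carrier F\<rbrakk> \<Longrightarrow> s \<triangleleft> x = t \<longleftrightarrow> s = t \<triangleleft> inv\<^bsub>F\<^esub> x"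
  by auto

lemma lact_inv:
  "s \<in> carrier \<Gamma> \<Longrightarrow> x \<in> carrier F \<Longrightarrow> (s \<triangleleft> x) \<triangleright> inv\<^bsub>F\<^esub> x = inv\<^bsub>F\<^esub> (s \<triangleright> x)"
  using lact_matched[of s x "inv\<^bsub>F\<^esub> x"]
  by (metis F.inv_closed F.inv_equality F.inv_inv F.r_inv lact_closed lact_unit ract_closed)

lemma ract_inv:
  "s \<in> carrier \<Gamma> \<Longrightarrow> x \<in> carrier F \<Longrightarrow> inv\<^bsub>\<Gamma>\<^esub> s \<triangleleft> (s \<triangleright> x) = inv\<^bsub>\<Gamma>\<^esub> (s \<triangleleft> x)"
  using ract_matched[of "inv\<^bsub>\<Gamma>\<^esub> s" s x]
  by (metis \<Gamma>.inv_closed \<Gamma>.inv_equality \<Gamma>.l_inv lact_closed ract_closed ract_unit)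

lemma bowtie_simps [simp]:
  "carrier (bowtie F \<Gamma> (\<triangleright>) (\<triangleleft>)) = carrier F \<times> carrier \<Gamma>"
  "\<one>\<^bsub>bowtie F \<Gamma> (\<triangleright>) (\<triangleleft>)\<^esub> = (\<one>\<^bsub>F\<^esub>, \<one>\<^bsub>\<Gamma>\<^esub>)"
  "(x, s) \<otimes>\<^bsub>bowtie F \<Gamma> (\<triangleright>) (\<triangleleft>)\<^esub> (y, t) = (x \<otimes>\<^bsub>F\<^esub> (s \<triangleright> y), (s \<triangleleft> y) \<otimes>\<^bsub>\<Gamma>\<^esub> t)"
  by (simp_all add: bowtie_def)

lemma group_bowtie: "group (bowtie F \<Gamma> (\<triangleright>) (\<triangleleft>))"
proof (rule groupI)
  fix a b c
  assume "a \<in> carrier (bowtie F \<Gamma> (\<triangleright>) (\<triangleleft>))" "b \<in> carrier (bowtie F \<Gamma> (\<triangleright>) (\<triangleleft>))"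
    "c \<in> carrier (bowtie F \<Gamma> (\<triangleright>) (\<triangleleft>))"
  then show "a \<otimes>\<^bsub>bowtie F \<Gamma> (\<triangleright>) (\<triangleleft>)\<^esub> b \<otimes>\<^bsub>bowtie F \<Gamma> (\<triangleright>) (\<triangleleft>)\<^esub> c =
    a \<otimes>\<^bsub>bowtie F \<Gamma> (\<triangleright>) (\<triangleleft>)\<^esub> (b \<otimes>\<^bsub>bowtie F \<Gamma> (\<triangleright>) (\<triangleleft>)\<^esub> c)"
    by (cases a; cases b; cases c)
      (simp add: F.m_assoc \<Gamma>.m_assoc lact_matched ract_matched lact_mult ract_mult)
next
  fix a assume "a \<in> carrier (bowtie F \<Gamma> (\<triangleright>) (\<triangleleft>))"
  then obtain x s where a: "a = (x, s)" "x \<in> carrier F" "s \<in> carrier \<Gamma>"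
    by (cases a) simp
  define b where "b = (inv\<^bsub>\<Gamma>\<^esub> s \<triangleright> inv\<^bsub>F\<^esub> x, inv\<^bsub>\<Gamma>\<^esub> s \<triangleleft> inv\<^bsub>F\<^esub> x)"
  have "b \<in> carrier (bowtie F \<Gamma> (\<triangleright>) (\<triangleleft>))" "b \<otimes>\<^bsub>bowtie F \<Gamma> (\<triangleright>) (\<triangleleft>)\<^esub> a = \<one>\<^bsub>bowtie F \<Gamma> (\<triangleright>) (\<triangleleft>)\<^esub>"
    using a by (simp_all add: b_def flip: lact_matched)
  then show "\<exists>b\<in>carrier (bowtie F \<Gamma> (\<triangleright>) (\<triangleleft>)). b \<otimes>\<^bsub>bowtie F \<Gamma> (\<triangleright>) (\<triangleleft>)\<^esub> a = \<one>\<^bsub>bowtie F \<Gamma> (\<triangleright>) (\<triangleleft>)\<^esub>"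
    by blast
qed auto

lemma bowtie_pow_exponent:
  assumes "g \<in> carrier (bowtie F \<Gamma> (\<triangleright>) (\<triangleleft>))"
  shows "g [^]\<^bsub>bowtie F \<Gamma> (\<triangleright>) (\<triangleleft>)\<^esub> group_exponent (bowtie F \<Gamma> (\<triangleright>) (\<triangleleft>)) = (\<one>\<^bsub>F\<^esub>, \<one>\<^bsub>\<Gamma>\<^esub>)"
proof -
  interpret B: group "bowtie F \<Gamma> (\<triangleright>) (\<triangleleft>)" by (rule group_bowtie)
  have "B.ord g dvd group_exponent (bowtie F \<Gamma> (\<triangleright>) (\<triangleleft>))"
    unfolding group_exponent_def by (rule dvd_Lcm) (use assms in blast)
  then show ?thesis using B.pow_eq_id[OF assms] by simp
qed

section \<open>Orbits in a matched pair\<close>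

text \<open>
  The pairs \<open>(s\<^sub>1, x\<^sub>1) = (s, x)\<close> and \<open>(s\<^sub>i\<^sub>+\<^sub>1, x\<^sub>i\<^sub>+\<^sub>1)\<close> with \<open>s\<^sub>i\<^sub>+\<^sub>1 = s\<^sub>i \<triangleleft> x\<^sub>i\<close> and \<open>s\<^sub>i\<^sub>+\<^sub>1 \<triangleright> x\<^sub>i\<^sub>+\<^sub>1 = x\<^sub>i\<close>
  are exactly the composable ones: \<open>e\<^sub>s # x\<close> can be multiplied by its successor on the right, and dually for
  the coproduct. The following functions give the product \<open>x\<^sub>1 \<dots> x\<^sub>n\<close>, the product \<open>s\<^sub>1 \<dots> s\<^sub>n\<close> and the element
  \<open>x\<^sub>n\<close>. For \<open>n = 0\<close> the last one has to be \<open>s \<triangleright> x\<close>, the predecessor of \<open>x\<close>, to fit the recursion.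
\<close>

primrec orbF :: "nat \<Rightarrow> 'g \<Rightarrow> 'f \<Rightarrow> 'f" where
  "orbF 0 s x = \<one>\<^bsub>F\<^esub>"
| "orbF (Suc n) s x = x \<otimes>\<^bsub>F\<^esub> orbF n (s \<triangleleft> x) (inv\<^bsub>\<Gamma>\<^esub> (s \<triangleleft> x) \<triangleright> x)"

primrec orb\<Gamma> :: "nat \<Rightarrow> 'g \<Rightarrow> 'f \<Rightarrow> 'g" where
  "orb\<Gamma> 0 s x = \<one>\<^bsub>\<Gamma>\<^esub>"
| "orb\<Gamma> (Suc n) s x = s \<otimes>\<^bsub>\<Gamma>\<^esub> orb\<Gamma> n (s \<triangleleft> x) (inv\<^bsub>\<Gamma>\<^esub> (s \<triangleleft> x) \<triangleright> x)"

primrec orb_last :: "nat \<Rightarrow> 'g \<Rightarrow> 'f \<Rightarrow> 'f" where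
  "orb_last 0 s x = s \<triangleright> x"
| "orb_last (Suc n) s x = orb_last n (s \<triangleleft> x) (inv\<^bsub>\<Gamma>\<^esub> (s \<triangleleft> x) \<triangleright> x)"

text \<open>
  The scalar that remains when the elements \<open>e # x\<close> for the pairs of the orbit are multiplied in the bicrossed product
  (which gives values of \<open>\<sigma>\<close>) and the dual elements are multiplied in the dual algebra (values of \<open>\<tau>\<close>).
\<close>

primrec orb_coeff :: "('g \<Rightarrow> 'f \<Rightarrow> 'f \<Rightarrow> 'k) \<Rightarrow> ('f \<Rightarrow> 'g \<Rightarrow> 'g \<Rightarrow> 'k) \<Rightarrow> nat \<Rightarrow> 'g \<Rightarrow> 'f \<Rightarrow> 'k::field" where
  "orb_coeff \<sigma> \<tau> 0 s x = 1"
| "orb_coeff \<sigma> \<tau> (Suc n) s x =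
    \<sigma> s x (orbF n (s \<triangleleft> x) (inv\<^bsub>\<Gamma>\<^esub> (s \<triangleleft> x) \<triangleright> x))
    * \<tau> (orb_last n (s \<triangleleft> x) (inv\<^bsub>\<Gamma>\<^esub> (s \<triangleleft> x) \<triangleright> x)) s (orb\<Gamma> n (s \<triangleleft> x) (inv\<^bsub>\<Gamma>\<^esub> (s \<triangleleft> x) \<triangleright> x))
    * orb_coeff \<sigma> \<tau> n (s \<triangleleft> x) (inv\<^bsub>\<Gamma>\<^esub> (s \<triangleleft> x) \<triangleright> x)"

lemma orb_closed [simp]:
  assumes "s \<in> carrier \<Gamma>" "x \<in> carrier F"
  shows "orbF n s x \<in> carrier F" "orb\<Gamma> n s x \<in> carrier \<Gamma>" "orb_last n s x \<in> carrier F"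
  using assms by (induction n arbitrary: s x) auto

lemma orb\<Gamma>_lact_last:
  "s \<in> carrier \<Gamma> \<Longrightarrow> x \<in> carrier F \<Longrightarrow> orb\<Gamma> n s x \<triangleright> orb_last n s x = s \<triangleright> x"
  by (induction n arbitrary: s x) (auto simp: lact_mult)

text \<open>
  In \<open>F \<bowtie> \<Gamma>\<close> put \<open>h = inverse (s \<triangleright> x) s\<close>. Conjugation by \<open>x\<close> turns the corresponding element \<open>h'\<close> of the next
  pair of the orbit into \<open>h\<close>: this is the identity \<open>x h' = h x\<close>, a form of \<open>s x = (s \<triangleright> x) (s \<triangleleft> x)\<close>. So all
  steps of the orbit contribute the same element and the product along the orbit becomes a power of \<open>h\<close>.
\<close>

lemma orb_factorization:
  assumes "s \<in> carrier \<Gamma>" "x \<in> carrier F"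
  shows "(\<one>\<^bsub>F\<^esub>, orb\<Gamma> n s x) \<otimes>\<^bsub>bowtie F \<Gamma> (\<triangleright>) (\<triangleleft>)\<^esub> (orb_last n s x, \<one>\<^bsub>\<Gamma>\<^esub>)
    = (s \<triangleright> x, \<one>\<^bsub>\<Gamma>\<^esub>) \<otimes>\<^bsub>bowtie F \<Gamma> (\<triangleright>) (\<triangleleft>)\<^esub>
      ((inv\<^bsub>F\<^esub> (s \<triangleright> x), s) [^]\<^bsub>bowtie F \<Gamma> (\<triangleright>) (\<triangleleft>)\<^esub> n \<otimes>\<^bsub>bowtie F \<Gamma> (\<triangleright>) (\<triangleleft>)\<^esub> (orbF n s x, \<one>\<^bsub>\<Gamma>\<^esub>))"
  using assms
proof (induction n arbitrary: s x)
  case 0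
  interpret B: group "bowtie F \<Gamma> (\<triangleright>) (\<triangleleft>)" by (rule group_bowtie)
  show ?case using 0 by simp
next
  case (Suc n)
  interpret B: group "bowtie F \<Gamma> (\<triangleright>) (\<triangleleft>)" by (rule group_bowtie)
  let ?G = "bowtie F \<Gamma> (\<triangleright>) (\<triangleleft>)"
  define s' where "s' = s \<triangleleft> x"
  define x' where "x' = inv\<^bsub>\<Gamma>\<^esub> s' \<triangleright> x"
  have [simp]: "s \<in> carrier \<Gamma>" "x \<in> carrier F" "s' \<in> carrier \<Gamma>" "x' \<in> carrier F" "s' \<triangleright> x' = x"
    using Suc by (auto simp: s'_def x'_def)
  define h where "h = (inv\<^bsub>F\<^esub> (s \<triangleright> x), s)"
  define h' where "h' = (inv\<^bsub>F\<^esub> x, s')"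
  have hG: "h \<in> carrier ?G" "h' \<in> carrier ?G" by (auto simp: h_def h'_def)
  note [simp] = hG[simplified] B.nat_pow_closed[OF hG(1), simplified] B.nat_pow_closed[OF hG(2), simplified]
  have [simp]: "(y, t) \<in> carrier ?G \<longleftrightarrow> y \<in> carrier F \<and> t \<in> carrier \<Gamma>" for y t by simp
  note assoc = B.m_assoc[simplified]
  have conj: "(x, \<one>\<^bsub>\<Gamma>\<^esub>) \<otimes>\<^bsub>?G\<^esub> h' = h \<otimes>\<^bsub>?G\<^esub> (x, \<one>\<^bsub>\<Gamma>\<^esub>)"
    by (simp add: h_def h'_def s'_def)
  have pow: "(x, \<one>\<^bsub>\<Gamma>\<^esub>) \<otimes>\<^bsub>?G\<^esub> h' [^]\<^bsub>?G\<^esub> k = h [^]\<^bsub>?G\<^esub> k \<otimes>\<^bsub>?G\<^esub> (x, \<one>\<^bsub>\<Gamma>\<^esub>)" for k :: nat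
  proof (induction k)
    case (Suc k)
    have "(x, \<one>\<^bsub>\<Gamma>\<^esub>) \<otimes>\<^bsub>?G\<^esub> h' [^]\<^bsub>?G\<^esub> Suc k = ((x, \<one>\<^bsub>\<Gamma>\<^esub>) \<otimes>\<^bsub>?G\<^esub> h' [^]\<^bsub>?G\<^esub> k) \<otimes>\<^bsub>?G\<^esub> h'"
      by (simp add: assoc del: bowtie_simps(3))
    also have "\<dots> = h [^]\<^bsub>?G\<^esub> k \<otimes>\<^bsub>?G\<^esub> ((x, \<one>\<^bsub>\<Gamma>\<^esub>) \<otimes>\<^bsub>?G\<^esub> h')"
      unfolding Suc by (simp add: assoc del: bowtie_simps(3))
    also have "\<dots> = h [^]\<^bsub>?G\<^esub> Suc k \<otimes>\<^bsub>?G\<^esub> (x, \<one>\<^bsub>\<Gamma>\<^esub>)"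
      unfolding conj by (simp add: assoc del: bowtie_simps(3))
    finally show ?case .
  qed auto
  have s: "(\<one>\<^bsub>F\<^esub>, s) = (s \<triangleright> x, \<one>\<^bsub>\<Gamma>\<^esub>) \<otimes>\<^bsub>?G\<^esub> h"
    by (simp add: h_def)
  have "(\<one>\<^bsub>F\<^esub>, orb\<Gamma> (Suc n) s x) \<otimes>\<^bsub>?G\<^esub> (orb_last (Suc n) s x, \<one>\<^bsub>\<Gamma>\<^esub>)
    = (\<one>\<^bsub>F\<^esub>, s) \<otimes>\<^bsub>?G\<^esub> ((\<one>\<^bsub>F\<^esub>, orb\<Gamma> n s' x') \<otimes>\<^bsub>?G\<^esub> (orb_last n s' x', \<one>\<^bsub>\<Gamma>\<^esub>))"
    by (subst B.m_assoc[symmetric]) (auto simp: s'_def x'_def)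
  also have "\<dots> = (\<one>\<^bsub>F\<^esub>, s) \<otimes>\<^bsub>?G\<^esub> ((x, \<one>\<^bsub>\<Gamma>\<^esub>) \<otimes>\<^bsub>?G\<^esub> (h' [^]\<^bsub>?G\<^esub> n \<otimes>\<^bsub>?G\<^esub> (orbF n s' x', \<one>\<^bsub>\<Gamma>\<^esub>)))"
    using Suc.IH[of s' x'] by (simp add: h'_def)
  also have "\<dots> = (\<one>\<^bsub>F\<^esub>, s) \<otimes>\<^bsub>?G\<^esub> ((h [^]\<^bsub>?G\<^esub> n \<otimes>\<^bsub>?G\<^esub> (x, \<one>\<^bsub>\<Gamma>\<^esub>)) \<otimes>\<^bsub>?G\<^esub> (orbF n s' x', \<one>\<^bsub>\<Gamma>\<^esub>))"
    unfolding pow[symmetric] by (simp add: assoc del: bowtie_simps(3))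
  also have "\<dots> = (s \<triangleright> x, \<one>\<^bsub>\<Gamma>\<^esub>) \<otimes>\<^bsub>?G\<^esub> (h [^]\<^bsub>?G\<^esub> Suc n \<otimes>\<^bsub>?G\<^esub> ((x, \<one>\<^bsub>\<Gamma>\<^esub>) \<otimes>\<^bsub>?G\<^esub> (orbF n s' x', \<one>\<^bsub>\<Gamma>\<^esub>)))"
    unfolding s B.nat_pow_Suc2[OF hG(1)]
    by (simp add: B.m_assoc hG[simplified] hG del: bowtie_simps(1,3) B.nat_pow_Suc)
  also have "(x, \<one>\<^bsub>\<Gamma>\<^esub>) \<otimes>\<^bsub>?G\<^esub> (orbF n s' x', \<one>\<^bsub>\<Gamma>\<^esub>) = (orbF (Suc n) s x, \<one>\<^bsub>\<Gamma>\<^esub>)"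
    by (simp add: s'_def x'_def)
  finally show ?case by (simp only: h_def)
qed

text \<open>
  For this length the power of \<open>h\<close> in \<open>orb_factorization\<close> is 1, and the factorization of elements of
  \<open>F \<bowtie> \<Gamma>\<close> into an element of \<open>F\<close> and one of \<open>\<Gamma>\<close> is unique.
\<close>

lemma orb_exponent:
  assumes "s \<in> carrier \<Gamma>" "x \<in> carrier F"
  defines "m \<equiv> group_exponent (bowtie F \<Gamma> (\<triangleright>) (\<triangleleft>))"
  shows "orbF m s x = \<one>\<^bsub>F\<^esub>" "orb\<Gamma> m s x = \<one>\<^bsub>\<Gamma>\<^esub>" "orb_last m s x = s \<triangleright> x"
proof -
  have "(\<one>\<^bsub>F\<^esub>, orb\<Gamma> m s x) \<otimes>\<^bsub>bowtie F \<Gamma> (\<triangleright>) (\<triangleleft>)\<^esub> (orb_last m s x, \<one>\<^bsub>\<Gamma>\<^esub>)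
    = (s \<triangleright> x, \<one>\<^bsub>\<Gamma>\<^esub>) \<otimes>\<^bsub>bowtie F \<Gamma> (\<triangleright>) (\<triangleleft>)\<^esub> (orbF m s x, \<one>\<^bsub>\<Gamma>\<^esub>)"
    unfolding orb_factorization[OF assms(1,2)] m_def
    using assms by (subst bowtie_pow_exponent) auto
  then have e: "(s \<triangleright> x) \<otimes>\<^bsub>F\<^esub> orbF m s x = s \<triangleright> x" "orb\<Gamma> m s x \<triangleleft> orb_last m s x = \<one>\<^bsub>\<Gamma>\<^esub>"
    using assms by (auto simp: orb\<Gamma>_lact_last)
  show "orbF m s x = \<one>\<^bsub>F\<^esub>" using e(1) assms by simp
  show g: "orb\<Gamma> m s x = \<one>\<^bsub>\<Gamma>\<^esub>" using e(2) assms by (subst (asm) ract_eq_iff) auto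
  show "orb_last m s x = s \<triangleright> x" using orb\<Gamma>_lact_last[OF assms(1,2), of m] g assms by simp
qed

text \<open>
  Each recursion step replaces a value of \<open>\<sigma>\<close> and a value of \<open>\<tau>\<close> by quotients of values of \<open>f\<close>, and these
  cancel along the orbit.
\<close>

lemma orb_coeff_coboundary:
  fixes f :: "'g \<Rightarrow> 'f \<Rightarrow> 'k::field"
  assumes \<sigma>: "\<And>s x y. \<lbrakk>s \<in> carrier \<Gamma>; x \<in> carrier F; y \<in> carrier F\<rbrakk>
      \<Longrightarrow> \<sigma> s x y * f s (x \<otimes>\<^bsub>F\<^esub> y) = f s x * f (s \<triangleleft> x) y"
    and \<tau>: "\<And>x t u. \<lbrakk>x \<in> carrier F; t \<in> carrier \<Gamma>; u \<in> carrier \<Gamma>\<rbrakk>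
      \<Longrightarrow> \<tau> x t u * (f t (u \<triangleright> x) * f u x) = f (t \<otimes>\<^bsub>\<Gamma>\<^esub> u) x"
    and f1: "\<And>s. s \<in> carrier \<Gamma> \<Longrightarrow> f s \<one>\<^bsub>F\<^esub> = 1" "\<And>x. x \<in> carrier F \<Longrightarrow> f \<one>\<^bsub>\<Gamma>\<^esub> x = 1"
    and "s \<in> carrier \<Gamma>" "x \<in> carrier F"
  shows "orb_coeff \<sigma> \<tau> n s x * f s (orbF n s x) = f (orb\<Gamma> n s x) (orb_last n s x)"
  using assms(5,6)
proof (induction n arbitrary: s x)
  case 0
  then show ?case by (simp add: f1)
next
  case (Suc n)
  define s' where "s' = s \<triangleleft> x"
  define x' where "x' = inv\<^bsub>\<Gamma>\<^esub> s' \<triangleright> x"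
  have [simp]: "s \<in> carrier \<Gamma>" "x \<in> carrier F" "s' \<in> carrier \<Gamma>" "x' \<in> carrier F" "s' \<triangleright> x' = x"
    using Suc by (auto simp: s'_def x'_def)
  let ?X = "orbF n s' x'" and ?S = "orb\<Gamma> n s' x'" and ?L = "orb_last n s' x'"
  have "orb_coeff \<sigma> \<tau> (Suc n) s x * f s (orbF (Suc n) s x)
      = \<tau> ?L s ?S * orb_coeff \<sigma> \<tau> n s' x' * (\<sigma> s x ?X * f s (x \<otimes>\<^bsub>F\<^esub> ?X))"
    by (simp add: s'_def x'_def)
  also have "\<dots> = \<tau> ?L s ?S * f s x * (orb_coeff \<sigma> \<tau> n s' x' * f s' ?X)"
    by (subst \<sigma>) (auto simp flip: s'_def)
  also have "\<dots> = \<tau> ?L s ?S * (f s (?S \<triangleright> ?L) * f ?S ?L)"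
    by (subst Suc.IH) (simp_all add: orb\<Gamma>_lact_last)
  also have "\<dots> = f (s \<otimes>\<^bsub>\<Gamma>\<^esub> ?S) ?L"
    by (rule \<tau>) auto
  finally show ?case by (simp add: s'_def x'_def)
qed

lemma orb_coeff_power:
  "orb_coeff (\<lambda>s x y. \<sigma> s x y ^ e) (\<lambda>x s t. \<tau> x s t ^ e) n s x = orb_coeff \<sigma> \<tau> n s x ^ e"
  by (induction n arbitrary: s x) (auto simp: power_mult_distrib)

end

section \<open>Modules and comodules of a bicrossed product in an algebra\<close>

text \<open>
  The identities that make \<open>k\<^sup>\<Gamma> \<otimes> k F\<close> a Hopf algebra. Besides the two cocycle conditions these are the
  compatibility with the unit and the counit (\<open>\<tau>_unit\<close>, \<open>\<sigma>_unit\<close>) and the multiplicativity of the coproduct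
  (\<open>compat\<close>); see \<open>cocycle_pairs_iff\<close>.
\<close>

locale bicrossed_datum = matched_pair F \<Gamma> lact ract
  for F :: "('f, 'm) monoid_scheme" and \<Gamma> :: "('g, 'n) monoid_scheme"
    and lact :: "'g \<Rightarrow> 'f \<Rightarrow> 'f" (infixr "\<triangleright>" 75)
    and ract :: "'g \<Rightarrow> 'f \<Rightarrow> 'g" (infixl "\<triangleleft>" 75) +
  fixes \<sigma> :: "'g \<Rightarrow> 'f \<Rightarrow> 'f \<Rightarrow> 'k::field" and \<tau> :: "'f \<Rightarrow> 'g \<Rightarrow> 'g \<Rightarrow> 'k"
  assumes \<sigma>_nonzero: "\<lbrakk>s \<in> carrier \<Gamma>; x \<in> carrier F; y \<in> carrier F\<rbrakk> \<Longrightarrow> \<sigma> s x y \<noteq> 0"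
    and \<sigma>_one_right: "\<lbrakk>s \<in> carrier \<Gamma>; x \<in> carrier F\<rbrakk> \<Longrightarrow> \<sigma> s x \<one>\<^bsub>F\<^esub> = 1"
    and \<sigma>_one_left: "\<lbrakk>s \<in> carrier \<Gamma>; x \<in> carrier F\<rbrakk> \<Longrightarrow> \<sigma> s \<one>\<^bsub>F\<^esub> x = 1"
    and \<sigma>_cocycle: "\<lbrakk>s \<in> carrier \<Gamma>; x \<in> carrier F; y \<in> carrier F; z \<in> carrier F\<rbrakk>
      \<Longrightarrow> \<sigma> (s \<triangleleft> x) y z * \<sigma> s x (y \<otimes>\<^bsub>F\<^esub> z) = \<sigma> s x y * \<sigma> s (x \<otimes>\<^bsub>F\<^esub> y) z"
    and \<tau>_nonzero: "\<lbrakk>x \<in> carrier F; s \<in> carrier \<Gamma>; t \<in> carrier \<Gamma>\<rbrakk> \<Longrightarrow> \<tau> x s t \<noteq> 0"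
    and \<tau>_one_right: "\<lbrakk>x \<in> carrier F; s \<in> carrier \<Gamma>\<rbrakk> \<Longrightarrow> \<tau> x s \<one>\<^bsub>\<Gamma>\<^esub> = 1"
    and \<tau>_one_left: "\<lbrakk>x \<in> carrier F; s \<in> carrier \<Gamma>\<rbrakk> \<Longrightarrow> \<tau> x \<one>\<^bsub>\<Gamma>\<^esub> s = 1"
    and \<tau>_cocycle: "\<lbrakk>x \<in> carrier F; s \<in> carrier \<Gamma>; t \<in> carrier \<Gamma>; u \<in> carrier \<Gamma>\<rbrakk>
      \<Longrightarrow> \<tau> (u \<triangleright> x) s t * \<tau> x (s \<otimes>\<^bsub>\<Gamma>\<^esub> t) u = \<tau> x t u * \<tau> x s (t \<otimes>\<^bsub>\<Gamma>\<^esub> u)"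
    and \<sigma>_unit: "\<lbrakk>x \<in> carrier F; y \<in> carrier F\<rbrakk> \<Longrightarrow> \<sigma> \<one>\<^bsub>\<Gamma>\<^esub> x y = 1"
    and \<tau>_unit: "\<lbrakk>s \<in> carrier \<Gamma>; t \<in> carrier \<Gamma>\<rbrakk> \<Longrightarrow> \<tau> \<one>\<^bsub>F\<^esub> s t = 1"
    and compat: "\<lbrakk>t \<in> carrier \<Gamma>; u \<in> carrier \<Gamma>; x \<in> carrier F; y \<in> carrier F\<rbrakk>
      \<Longrightarrow> \<sigma> (t \<otimes>\<^bsub>\<Gamma>\<^esub> u) x y * \<tau> (x \<otimes>\<^bsub>F\<^esub> y) t u
        = \<tau> x t u * \<tau> y (t \<triangleleft> (u \<triangleright> x)) (u \<triangleleft> x)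
          * \<sigma> t (u \<triangleright> x) ((u \<triangleleft> x) \<triangleright> y) * \<sigma> u x y"

text \<open>
  Modules are treated inside an arbitrary ring with central scalars, in which the actions and coactions of two
  modules become commuting families of elements. So the two factors of a tensor product live in the same ring and
  need no separate notation.
\<close>

locale scalar_algebra =
  fixes scale :: "'k::field \<Rightarrow> 'e::ring_1 \<Rightarrow> 'e" (infixr "\<cdot>" 75)
  assumes scale_add_left: "(a + b) \<cdot> x = a \<cdot> x + b \<cdot> x"
    and scale_add_right: "a \<cdot> (x + y) = a \<cdot> x + a \<cdot> y"
    and scale_scale [simp]: "a \<cdot> b \<cdot> x = (a * b) \<cdot> x"
    and scale_one [simp]: "1 \<cdot> x = x"
    and scale_mult_left [simp]: "(a \<cdot> x) * y = a \<cdot> (x * y)"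
    and scale_mult_right [simp]: "x * (a \<cdot> y) = a \<cdot> (x * y)"
begin

lemma scale_zero_left [simp]: "0 \<cdot> x = 0"
  using scale_add_left[of 0 0 x] by simp

lemma scale_zero_right [simp]: "a \<cdot> 0 = 0"
  using scale_add_right[of a 0 0] by simp

lemma scale_sum_left: "sum f I \<cdot> x = (\<Sum>i\<in>I. f i \<cdot> x)"
  by (induction I rule: infinite_finite_induct) (simp_all add: scale_add_left)

lemma scale_sum_right: "a \<cdot> sum f I = (\<Sum>i\<in>I. a \<cdot> f i)"
  by (induction I rule: infinite_finite_induct) (simp_all add: scale_add_right)

lemma scale_cancel: "c \<noteq> 0 \<Longrightarrow> c \<cdot> x = c \<cdot> y \<longleftrightarrow> x = y"
  by (metis left_inverse scale_one scale_scale)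

lemma scale_mult_cancel: "c \<noteq> 0 \<Longrightarrow> (c * a) \<cdot> x = (c * b) \<cdot> y \<longleftrightarrow> a \<cdot> x = b \<cdot> y"
  by (metis scale_cancel scale_scale)

end

lemma commute_power:
  fixes x y :: "'e::monoid_mult"
  assumes "x * y = y * x"
  shows "x ^ n * y = y * x ^ n"
  using assms by (rule power_commuting_commutes)

locale bicrossed_modules = bicrossed_datum F \<Gamma> lact ract \<sigma> \<tau> + scalar_algebra scale
  for F :: "('f, 'm) monoid_scheme" and \<Gamma> :: "('g, 'n) monoid_scheme"
    and lact :: "'g \<Rightarrow> 'f \<Rightarrow> 'f" (infixr "\<triangleright>" 75)
    and ract :: "'g \<Rightarrow> 'f \<Rightarrow> 'g" (infixl "\<triangleleft>" 75)
    and \<sigma> :: "'g \<Rightarrow> 'f \<Rightarrow> 'f \<Rightarrow> 'k::field" and \<tau> :: "'f \<Rightarrow> 'g \<Rightarrow> 'g \<Rightarrow> 'k"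
    and scale :: "'k \<Rightarrow> 'e::ring_1 \<Rightarrow> 'e" (infixr "\<cdot>" 75)
begin

text \<open>
  \<open>P s x\<close> is the action of \<open>e\<^sub>s # x\<close>, so this is a unital representation of the bicrossed product.
\<close>

definition alg_rep :: "('g \<Rightarrow> 'f \<Rightarrow> 'e) \<Rightarrow> bool" where
  "alg_rep P \<longleftrightarrow>
    (\<forall>s\<in>carrier \<Gamma>. \<forall>x\<in>carrier F. \<forall>t\<in>carrier \<Gamma>. \<forall>y\<in>carrier F.
      P s x * P t y = (if s \<triangleleft> x = t then (\<sigma> s x y) \<cdot> P s (x \<otimes>\<^bsub>F\<^esub> y) else 0)) \<and>
    (\<Sum>s\<in>carrier \<Gamma>. P s \<one>\<^bsub>F\<^esub>) = 1"

text \<open>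
  \<open>T s x\<close> is the operator that belongs to the dual basis of \<open>e\<^sub>s # x\<close>. The order of the two factors is
  that of the opposite of the dual algebra, as it comes out of a half-braiding.
\<close>

definition coalg_rep :: "('g \<Rightarrow> 'f \<Rightarrow> 'e) \<Rightarrow> bool" where
  "coalg_rep T \<longleftrightarrow>
    (\<forall>u\<in>carrier \<Gamma>. \<forall>x\<in>carrier F. \<forall>t\<in>carrier \<Gamma>. \<forall>y\<in>carrier F.
      T u x * T t y = (if y = u \<triangleright> x then (\<tau> x t u) \<cdot> T (t \<otimes>\<^bsub>\<Gamma>\<^esub> u) x else 0)) \<and>
    (\<Sum>x\<in>carrier F. T \<one>\<^bsub>\<Gamma>\<^esub> x) = 1"

text \<open>
  The Yetter-Drinfeld condition is an identity of sums over the basis. In the bicrossed basis each side reduces to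
  one term: \<open>u\<close> is determined by \<open>v\<close> and \<open>y\<close>, while \<open>r\<close> and \<open>z\<close> solve the two equations in \<open>\<Gamma>\<close> and in
  \<open>F\<close> that come from comparing the indices.
\<close>

definition yd :: "('g \<Rightarrow> 'f \<Rightarrow> 'e) \<Rightarrow> ('g \<Rightarrow> 'f \<Rightarrow> 'e) \<Rightarrow> bool" where
  "yd P T \<longleftrightarrow> alg_rep P \<and> coalg_rep T \<and>
    (\<forall>v\<in>carrier \<Gamma>. \<forall>t\<in>carrier \<Gamma>. \<forall>u\<in>carrier \<Gamma>. \<forall>r\<in>carrier \<Gamma>.
     \<forall>x\<in>carrier F. \<forall>y\<in>carrier F. \<forall>z\<in>carrier F.
      u = v \<triangleleft> y \<longrightarrow> v \<otimes>\<^bsub>\<Gamma>\<^esub> r = t \<otimes>\<^bsub>\<Gamma>\<^esub> u \<longrightarrow> (r \<triangleright> x) \<otimes>\<^bsub>F\<^esub> z = y \<otimes>\<^bsub>F\<^esub> x \<longrightarrow>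
      (\<tau> x t u * \<sigma> v y x) \<cdot> (T v y * P t (u \<triangleright> x))
        = (\<tau> x v r * \<sigma> v (r \<triangleright> x) z) \<cdot> (P r x * T (v \<triangleleft> (r \<triangleright> x)) z))"

text \<open>
  The coaction followed by the action. It behaves like the twist of a ribbon category, see \<open>twist_tensor\<close>.
\<close>

definition twist :: "('g \<Rightarrow> 'f \<Rightarrow> 'e) \<Rightarrow> ('g \<Rightarrow> 'f \<Rightarrow> 'e) \<Rightarrow> 'e" where
  "twist P T = (\<Sum>(s, x)\<in>carrier \<Gamma> \<times> carrier F. P s x * T s x)"

lemma alg_repD:
  assumes "alg_rep P"
  shows "\<lbrakk>s \<in> carrier \<Gamma>; x \<in> carrier F; t \<in> carrier \<Gamma>; y \<in> carrier F\<rbrakk>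
      \<Longrightarrow> P s x * P t y = (if s \<triangleleft> x = t then (\<sigma> s x y) \<cdot> P s (x \<otimes>\<^bsub>F\<^esub> y) else 0)"
    and "(\<Sum>s\<in>carrier \<Gamma>. P s \<one>\<^bsub>F\<^esub>) = 1"
  using assms by (auto simp: alg_rep_def)

lemma coalg_repD:
  assumes "coalg_rep T"
  shows "\<lbrakk>u \<in> carrier \<Gamma>; x \<in> carrier F; t \<in> carrier \<Gamma>; y \<in> carrier F\<rbrakk>
      \<Longrightarrow> T u x * T t y = (if y = u \<triangleright> x then (\<tau> x t u) \<cdot> T (t \<otimes>\<^bsub>\<Gamma>\<^esub> u) x else 0)"
    and "(\<Sum>x\<in>carrier F. T \<one>\<^bsub>\<Gamma>\<^esub> x) = 1"
  using assms by (auto simp: coalg_rep_def)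

lemma ydD:
  assumes "yd P T"
  shows "alg_rep P" "coalg_rep T"
    and "\<lbrakk>v \<in> carrier \<Gamma>; t \<in> carrier \<Gamma>; u \<in> carrier \<Gamma>; r \<in> carrier \<Gamma>; x \<in> carrier F; y \<in> carrier F;
          z \<in> carrier F; u = v \<triangleleft> y; v \<otimes>\<^bsub>\<Gamma>\<^esub> r = t \<otimes>\<^bsub>\<Gamma>\<^esub> u; (r \<triangleright> x) \<otimes>\<^bsub>F\<^esub> z = y \<otimes>\<^bsub>F\<^esub> x\<rbrakk> \<Longrightarrow>
      (\<tau> x t u * \<sigma> v y x) \<cdot> (T v y * P t (u \<triangleright> x))
        = (\<tau> x v r * \<sigma> v (r \<triangleright> x) z) \<cdot> (P r x * T (v \<triangleleft> (r \<triangleright> x)) z)"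
  using assms unfolding yd_def by blast+

lemma twist_eq: "twist P T = (\<Sum>s\<in>carrier \<Gamma>. \<Sum>x\<in>carrier F. P s x * T s x)"
  by (simp add: twist_def sum.cartesian_product)

lemma yd_idem_right:
  assumes "yd P T" "v \<in> carrier \<Gamma>" "t \<in> carrier \<Gamma>" "y \<in> carrier F" "r \<in> carrier \<Gamma>"
    and "v \<otimes>\<^bsub>\<Gamma>\<^esub> r = t \<otimes>\<^bsub>\<Gamma>\<^esub> (v \<triangleleft> y)"
  shows "T v y * P t \<one>\<^bsub>F\<^esub> = P r \<one>\<^bsub>F\<^esub> * T v y"
  using ydD(3)[OF assms(1), of v t "v \<triangleleft> y" r "\<one>\<^bsub>F\<^esub>" y y] assms
  by (simp add: \<tau>_unit \<sigma>_one_right \<sigma>_one_left)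

lemma yd_idem_left:
  assumes "yd P T" "t \<in> carrier \<Gamma>" "x \<in> carrier F" "y \<in> carrier F" "z \<in> carrier F"
    and "(t \<triangleright> x) \<otimes>\<^bsub>F\<^esub> z = y \<otimes>\<^bsub>F\<^esub> x"
  shows "T \<one>\<^bsub>\<Gamma>\<^esub> y * P t x = P t x * T \<one>\<^bsub>\<Gamma>\<^esub> z"
  using ydD(3)[OF assms(1), of "\<one>\<^bsub>\<Gamma>\<^esub>" t "\<one>\<^bsub>\<Gamma>\<^esub>" t x y z] assms
  by (simp add: \<tau>_one_right \<tau>_one_left \<sigma>_unit)

lemma alg_rep_idem:
  assumes "alg_rep P" "s \<in> carrier \<Gamma>" "x \<in> carrier F" "t \<in> carrier \<Gamma>"
  shows "P t \<one>\<^bsub>F\<^esub> * P s x = (if t = s then P s x else 0)"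
    and "P s x * P t \<one>\<^bsub>F\<^esub> = (if s \<triangleleft> x = t then P s x else 0)"
  using assms by (simp_all add: alg_repD \<sigma>_one_left \<sigma>_one_right)

lemma coalg_rep_idem:
  assumes "coalg_rep T" "u \<in> carrier \<Gamma>" "x \<in> carrier F" "y \<in> carrier F"
  shows "T \<one>\<^bsub>\<Gamma>\<^esub> y * T u x = (if y = x then T u x else 0)"
    and "T u x * T \<one>\<^bsub>\<Gamma>\<^esub> y = (if y = u \<triangleright> x then T u x else 0)"
  using assms by (auto simp add: coalg_repD \<tau>_one_left \<tau>_one_right)

text \<open>
  The Yetter-Drinfeld condition with \<open>P t 1\<close> shows that only the terms with first index \<open>t\<close> survive in
  \<open>twist P T * P t z\<close>. For these the condition moves \<open>P\<close> to the left term by term, up to a bijection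
  \<open>\<eta>\<close> of the index set.
\<close>

lemma twist_commutes_module:
  assumes yd: "yd P T" and t: "t \<in> carrier \<Gamma>" and z: "z \<in> carrier F"
  shows "twist P T * P t z = P t z * twist P T"
proof -
  note P = ydD(1)[OF yd] and T = ydD(2)[OF yd]
  have zero: "P s x * T s x * P t z = 0" if "s \<in> carrier \<Gamma>" "x \<in> carrier F" "s \<noteq> t" for s x
  proof -
    define r where "r = inv\<^bsub>\<Gamma>\<^esub> s \<otimes>\<^bsub>\<Gamma>\<^esub> (t \<otimes>\<^bsub>\<Gamma>\<^esub> (s \<triangleleft> x))"
    have r: "r \<in> carrier \<Gamma>" "s \<otimes>\<^bsub>\<Gamma>\<^esub> r = t \<otimes>\<^bsub>\<Gamma>\<^esub> (s \<triangleleft> x)"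
      using that t by (auto simp: r_def simp flip: \<Gamma>.m_assoc)
    have "r \<noteq> s \<triangleleft> x" using r that t by auto
    have "P s x * T s x * P t z = P s x * (T s x * P t \<one>\<^bsub>F\<^esub>) * P t z"
      using alg_rep_idem(1)[OF P t z t] by (simp add: mult.assoc)
    also have "\<dots> = (P s x * P r \<one>\<^bsub>F\<^esub>) * (T s x * P t z)"
      using yd_idem_right[OF yd _ t _ r] that by (simp add: mult.assoc)
    also have "\<dots> = 0"
      using \<open>r \<noteq> s \<triangleleft> x\<close> that r by (simp add: alg_rep_idem[OF P])
    finally show ?thesis .
  qed
  \<comment> \<open>The index with \<open>(t \<triangleleft> x) \<triangleright> \<xi> x = z\<close>; \<open>\<eta> x\<close> then solves \<open>z \<otimes> \<eta> x = x \<otimes> \<xi> x\<close>.\<close>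
  define \<xi> where "\<xi> x = inv\<^bsub>\<Gamma>\<^esub> (t \<triangleleft> x) \<triangleright> z" for x
  define \<eta> where "\<eta> x = inv\<^bsub>F\<^esub> z \<otimes>\<^bsub>F\<^esub> (x \<otimes>\<^bsub>F\<^esub> \<xi> x)" for x
  have \<xi>: "\<xi> x \<in> carrier F" "(t \<triangleleft> x) \<triangleright> \<xi> x = z" if "x \<in> carrier F" for x
    using that t z by (auto simp: \<xi>_def)
  have \<eta>: "\<eta> x \<in> carrier F" "z \<otimes>\<^bsub>F\<^esub> \<eta> x = x \<otimes>\<^bsub>F\<^esub> \<xi> x" if "x \<in> carrier F" for x
    using that t z \<xi>(1)[OF that] by (auto simp: \<eta>_def simp flip: F.m_assoc)
  have main: "P t x * T t x * P t z = P t z * (P (t \<triangleleft> z) (\<eta> x) * T (t \<triangleleft> z) (\<eta> x))"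
    if x: "x \<in> carrier F" for x
  proof -
    let ?u = "t \<triangleleft> x"
    have "(\<tau> (\<xi> x) t ?u) \<cdot> ((\<sigma> t x (\<xi> x)) \<cdot> (T t x * P t z))
        = (\<tau> (\<xi> x) t ?u) \<cdot> ((\<sigma> t z (\<eta> x)) \<cdot> (P ?u (\<xi> x) * T (t \<triangleleft> z) (\<eta> x)))"
      using ydD(3)[OF yd, of t t ?u ?u "\<xi> x" x "\<eta> x"] x t z \<xi>[OF x] \<eta>[OF x] by simp
    then have TP: "(\<sigma> t x (\<xi> x)) \<cdot> (T t x * P t z) = (\<sigma> t z (\<eta> x)) \<cdot> (P ?u (\<xi> x) * T (t \<triangleleft> z) (\<eta> x))"
      using x t \<xi>[OF x] by (simp add: scale_mult_cancel \<tau>_nonzero)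
    have "(\<sigma> t x (\<xi> x)) \<cdot> (P t x * T t x * P t z) = P t x * ((\<sigma> t x (\<xi> x)) \<cdot> (T t x * P t z))"
      by (simp add: mult.assoc)
    also have "\<dots> = (\<sigma> t z (\<eta> x)) \<cdot> ((P t x * P ?u (\<xi> x)) * T (t \<triangleleft> z) (\<eta> x))"
      unfolding TP by (simp add: mult.assoc)
    also have "\<dots> = (\<sigma> t x (\<xi> x)) \<cdot> ((\<sigma> t z (\<eta> x)) \<cdot> P t (z \<otimes>\<^bsub>F\<^esub> \<eta> x) * T (t \<triangleleft> z) (\<eta> x))"
      using x t z \<xi>[OF x] \<eta>[OF x] by (simp add: alg_repD[OF P] mult.assoc mult.commute[of "\<sigma> t z (\<eta> x)"])
    also have "(\<sigma> t z (\<eta> x)) \<cdot> P t (z \<otimes>\<^bsub>F\<^esub> \<eta> x) = P t z * P (t \<triangleleft> z) (\<eta> x)"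
      using t z \<eta>[OF x] by (simp add: alg_repD[OF P])
    finally show ?thesis
      using x t \<xi>[OF x] by (simp add: scale_cancel \<sigma>_nonzero mult.assoc)
  qed
  have "twist P T * P t z = (\<Sum>s\<in>carrier \<Gamma>. \<Sum>x\<in>carrier F. P s x * T s x * P t z)"
    by (simp add: twist_eq sum_distrib_right)
  also have "\<dots> = (\<Sum>s\<in>carrier \<Gamma>. if s = t then \<Sum>x\<in>carrier F. P t x * T t x * P t z else 0)"
    by (rule sum.cong) (auto simp: zero intro!: sum.neutral)
  also have "\<dots> = (\<Sum>x\<in>carrier F. P t z * (P (t \<triangleleft> z) (\<eta> x) * T (t \<triangleleft> z) (\<eta> x)))"
    using t main by (simp add: finite_\<Gamma>)
  also have "\<dots> = (\<Sum>y\<in>carrier F. P t z * (P (t \<triangleleft> z) y * T (t \<triangleleft> z) y))"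
  proof -
    have \<xi>': "t \<triangleright> (x \<otimes>\<^bsub>F\<^esub> \<xi> x) = (t \<triangleright> x) \<otimes>\<^bsub>F\<^esub> z" if "x \<in> carrier F" for x
      using that t \<xi>[OF that] by (simp add: lact_matched)
    define i where "i y = inv\<^bsub>\<Gamma>\<^esub> t \<triangleright> ((t \<triangleright> (z \<otimes>\<^bsub>F\<^esub> y)) \<otimes>\<^bsub>F\<^esub> inv\<^bsub>F\<^esub> z)" for y
    have i: "i y \<in> carrier F" "(t \<triangleright> i y) \<otimes>\<^bsub>F\<^esub> z = t \<triangleright> (z \<otimes>\<^bsub>F\<^esub> y)" if "y \<in> carrier F" for y
      using that t z by (auto simp: i_def F.m_assoc)
    have "i (\<eta> x) = x" if "x \<in> carrier F" for x
      using that t z \<xi>'[OF that] \<eta>[OF that] by (simp add: i_def F.m_assoc)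
    moreover have "\<eta> (i y) = y" if "y \<in> carrier F" for y
    proof -
      have "t \<triangleright> (i y \<otimes>\<^bsub>F\<^esub> \<xi> (i y)) = t \<triangleright> (z \<otimes>\<^bsub>F\<^esub> y)"
        using \<xi>'[OF i(1)[OF that]] i(2)[OF that] by simp
      then have "i y \<otimes>\<^bsub>F\<^esub> \<xi> (i y) = z \<otimes>\<^bsub>F\<^esub> y"
        using t z that i(1)[OF that] \<xi>(1)[OF i(1)[OF that]] by (subst (asm) lact_eq_iff) auto
      then show ?thesis using z that by (simp add: \<eta>_def flip: F.m_assoc)
    qed
    ultimately show ?thesis
      using \<eta> i by (intro sum.reindex_bij_witness[where i = i and j = \<eta>]) auto
  qed
  also have "\<dots> = P t z * twist P T"
  proof -
    have "P t z * twist P T = (\<Sum>s\<in>carrier \<Gamma>. \<Sum>x\<in>carrier F. P t z * P s x * T s x)"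
      by (simp add: twist_eq sum_distrib_left mult.assoc)
    also have "\<dots> = (\<Sum>s\<in>carrier \<Gamma>. if s = t \<triangleleft> z then \<Sum>x\<in>carrier F. P t z * P s x * T s x else 0)"
      using t z by (intro sum.cong) (auto simp: alg_repD[OF P] intro!: sum.neutral)
    finally show ?thesis using t z by (simp add: finite_\<Gamma> mult.assoc)
  qed
  finally show ?thesis .
qed

text \<open>
  This is dual to \<open>twist_commutes_module\<close>: now \<open>T 1 (v \<triangleright> w)\<close> selects the terms with \<open>s \<triangleright> x = v \<triangleright> w\<close>.
\<close>

lemma twist_commutes_comodule:
  assumes yd: "yd P T" and v: "v \<in> carrier \<Gamma>" and w: "w \<in> carrier F"
  shows "T v w * twist P T = twist P T * T v w"
proof -
  note P = ydD(1)[OF yd] and T = ydD(2)[OF yd]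
  have zero: "T v w * (P s x * T s x) = 0" if "s \<in> carrier \<Gamma>" "x \<in> carrier F" "s \<triangleright> x \<noteq> v \<triangleright> w" for s x
  proof -
    define z where "z = inv\<^bsub>F\<^esub> (s \<triangleright> x) \<otimes>\<^bsub>F\<^esub> ((v \<triangleright> w) \<otimes>\<^bsub>F\<^esub> x)"
    have z: "z \<in> carrier F" "(s \<triangleright> x) \<otimes>\<^bsub>F\<^esub> z = (v \<triangleright> w) \<otimes>\<^bsub>F\<^esub> x"
      using that v w by (auto simp: z_def simp flip: F.m_assoc)
    have "z \<noteq> x"
    proof
      assume "z = x"
      then have "(s \<triangleright> x) \<otimes>\<^bsub>F\<^esub> x = (v \<triangleright> w) \<otimes>\<^bsub>F\<^esub> x" using z(2) by simp
      then show False using that v w by (simp only: F.right_cancel lact_closed)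
    qed
    have "T v w * (P s x * T s x) = T v w * (T \<one>\<^bsub>\<Gamma>\<^esub> (v \<triangleright> w) * P s x) * T s x"
      using coalg_rep_idem(2)[OF T v w, of "v \<triangleright> w"] v w by (simp flip: mult.assoc)
    also have "\<dots> = T v w * (P s x * (T \<one>\<^bsub>\<Gamma>\<^esub> z * T s x))"
      using yd_idem_left[OF yd that(1,2) _ z] v w by (simp add: mult.assoc)
    also have "\<dots> = 0"
      using \<open>z \<noteq> x\<close> that z by (simp add: coalg_rep_idem[OF T])
    finally show ?thesis .
  qed
  define u where "u = v \<triangleleft> w"
  have u: "u \<in> carrier \<Gamma>" using v w by (simp add: u_def)
  define \<rho> where "\<rho> s = inv\<^bsub>\<Gamma>\<^esub> v \<otimes>\<^bsub>\<Gamma>\<^esub> (s \<otimes>\<^bsub>\<Gamma>\<^esub> u)" for s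
  have main: "T v w * (P s x * T s x) = P (\<rho> s) (inv\<^bsub>\<Gamma>\<^esub> u \<triangleright> x) * T (\<rho> s) (inv\<^bsub>\<Gamma>\<^esub> u \<triangleright> x) * T v w"
    and main': "\<rho> s \<triangleright> (inv\<^bsub>\<Gamma>\<^esub> u \<triangleright> x) = w"
    if sx: "s \<in> carrier \<Gamma>" "x \<in> carrier F" "s \<triangleright> x = v \<triangleright> w" for s x
  proof -
    define \<xi> where "\<xi> = inv\<^bsub>\<Gamma>\<^esub> u \<triangleright> x"
    have \<xi>: "\<xi> \<in> carrier F" "u \<triangleright> \<xi> = x" using sx u by (auto simp: \<xi>_def)
    have r: "\<rho> s \<in> carrier \<Gamma>" "v \<otimes>\<^bsub>\<Gamma>\<^esub> \<rho> s = s \<otimes>\<^bsub>\<Gamma>\<^esub> u"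
      using sx u v by (auto simp: \<rho>_def simp flip: \<Gamma>.m_assoc)
    have rw: "\<rho> s \<triangleright> \<xi> = w"
      using sx u v w \<xi> by (simp add: \<rho>_def lact_mult)
    then show "\<rho> s \<triangleright> (inv\<^bsub>\<Gamma>\<^esub> u \<triangleright> x) = w" by (simp add: \<xi>_def)
    have "(\<sigma> v w \<xi>) \<cdot> ((\<tau> \<xi> s u) \<cdot> (T v w * P s x))
        = (\<sigma> v w \<xi>) \<cdot> ((\<tau> \<xi> v (\<rho> s)) \<cdot> (P (\<rho> s) \<xi> * T u \<xi>))"
      using ydD(3)[OF yd, of v s u "\<rho> s" \<xi> w \<xi>] sx u v w \<xi> r rw
      by (simp add: u_def mult.commute)
    then have TP: "(\<tau> \<xi> s u) \<cdot> (T v w * P s x) = (\<tau> \<xi> v (\<rho> s)) \<cdot> (P (\<rho> s) \<xi> * T u \<xi>)"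
      using v w \<xi> by (simp add: scale_mult_cancel \<sigma>_nonzero)
    have "(\<tau> \<xi> s u) \<cdot> (T v w * (P s x * T s x)) = ((\<tau> \<xi> s u) \<cdot> (T v w * P s x)) * T s x"
      by (simp add: mult.assoc)
    also have "\<dots> = (\<tau> \<xi> v (\<rho> s)) \<cdot> (P (\<rho> s) \<xi> * (T u \<xi> * T s x))"
      unfolding TP by (simp add: mult.assoc)
    also have "\<dots> = (\<tau> \<xi> s u) \<cdot> (P (\<rho> s) \<xi> * ((\<tau> \<xi> v (\<rho> s)) \<cdot> T (v \<otimes>\<^bsub>\<Gamma>\<^esub> \<rho> s) \<xi>))"
    proof -
      have "T u \<xi> * T s x = (\<tau> \<xi> s u) \<cdot> T (s \<otimes>\<^bsub>\<Gamma>\<^esub> u) \<xi>"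
        using coalg_repD(1)[OF T, of u \<xi> s x] sx u \<xi> by simp
      then show ?thesis
        unfolding r(2) by (simp add: mult.commute)
    qed
    also have "(\<tau> \<xi> v (\<rho> s)) \<cdot> T (v \<otimes>\<^bsub>\<Gamma>\<^esub> \<rho> s) \<xi> = T (\<rho> s) \<xi> * T v w"
      using v w r rw \<xi> by (simp add: coalg_repD[OF T])
    finally have "T v w * (P s x * T s x) = P (\<rho> s) \<xi> * (T (\<rho> s) \<xi> * T v w)"
      using sx u \<xi> by (simp add: scale_cancel \<tau>_nonzero)
    then show "T v w * (P s x * T s x) = P (\<rho> s) (inv\<^bsub>\<Gamma>\<^esub> u \<triangleright> x) * T (\<rho> s) (inv\<^bsub>\<Gamma>\<^esub> u \<triangleright> x) * T v w"
      by (simp add: \<xi>_def mult.assoc)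
  qed
  let ?I = "{(s, x) \<in> carrier \<Gamma> \<times> carrier F. s \<triangleright> x = v \<triangleright> w}"
  let ?J = "{(s, x) \<in> carrier \<Gamma> \<times> carrier F. s \<triangleright> x = w}"
  have fin: "finite (carrier \<Gamma> \<times> carrier F)" using finite_F finite_\<Gamma> by simp
  have "T v w * twist P T = (\<Sum>(s, x)\<in>carrier \<Gamma> \<times> carrier F. T v w * (P s x * T s x))"
    by (simp add: twist_def sum_distrib_left case_prod_unfold)
  also have "\<dots> = (\<Sum>(s, x)\<in>?I. T v w * (P s x * T s x))"
    using zero by (intro sum.mono_neutral_right[OF fin]) auto
  also have "\<dots> = (\<Sum>(s, x)\<in>?J. P s x * T s x * T v w)"
  proof (rule sum.reindex_bij_witness[where
        j = "\<lambda>(s, x). (\<rho> s, inv\<^bsub>\<Gamma>\<^esub> u \<triangleright> x)" and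
        i = "\<lambda>(s, x). (v \<otimes>\<^bsub>\<Gamma>\<^esub> s \<otimes>\<^bsub>\<Gamma>\<^esub> inv\<^bsub>\<Gamma>\<^esub> u, u \<triangleright> x)"])
    fix p assume p: "p \<in> ?I"
    then obtain s x where sx: "p = (s, x)" "s \<in> carrier \<Gamma>" "x \<in> carrier F" "s \<triangleright> x = v \<triangleright> w" by auto
    show "(case case p of (s, x) \<Rightarrow> (\<rho> s, inv\<^bsub>\<Gamma>\<^esub> u \<triangleright> x) of
         (s, x) \<Rightarrow> (v \<otimes>\<^bsub>\<Gamma>\<^esub> s \<otimes>\<^bsub>\<Gamma>\<^esub> inv\<^bsub>\<Gamma>\<^esub> u, u \<triangleright> x)) = p"
    proof -
      have "v \<otimes>\<^bsub>\<Gamma>\<^esub> \<rho> s \<otimes>\<^bsub>\<Gamma>\<^esub> inv\<^bsub>\<Gamma>\<^esub> u = (v \<otimes>\<^bsub>\<Gamma>\<^esub> inv\<^bsub>\<Gamma>\<^esub> v) \<otimes>\<^bsub>\<Gamma>\<^esub> s \<otimes>\<^bsub>\<Gamma>\<^esub> (u \<otimes>\<^bsub>\<Gamma>\<^esub> inv\<^bsub>\<Gamma>\<^esub> u)"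
        using sx u v unfolding \<rho>_def by (simp only: \<Gamma>.m_assoc \<Gamma>.m_closed \<Gamma>.inv_closed)
      then show ?thesis using sx u v by simp
    qed
    show "(case p of (s, x) \<Rightarrow> (\<rho> s, inv\<^bsub>\<Gamma>\<^esub> u \<triangleright> x)) \<in> ?J"
      using sx u v main'[OF sx(2-4)] by (simp add: \<rho>_def)
    show "(case case p of (s, x) \<Rightarrow> (\<rho> s, inv\<^bsub>\<Gamma>\<^esub> u \<triangleright> x) of (s, x) \<Rightarrow> P s x * T s x * T v w)
        = (case p of (s, x) \<Rightarrow> T v w * (P s x * T s x))"
      using main[OF sx(2-4)] sx by simp
  next
    fix p assume "p \<in> ?J"
    then obtain s x where sx: "p = (s, x)" "s \<in> carrier \<Gamma>" "x \<in> carrier F" "s \<triangleright> x = w" by auto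
    have "inv\<^bsub>\<Gamma>\<^esub> v \<otimes>\<^bsub>\<Gamma>\<^esub> (v \<otimes>\<^bsub>\<Gamma>\<^esub> s \<otimes>\<^bsub>\<Gamma>\<^esub> inv\<^bsub>\<Gamma>\<^esub> u \<otimes>\<^bsub>\<Gamma>\<^esub> u) = (inv\<^bsub>\<Gamma>\<^esub> v \<otimes>\<^bsub>\<Gamma>\<^esub> v) \<otimes>\<^bsub>\<Gamma>\<^esub> s \<otimes>\<^bsub>\<Gamma>\<^esub> (inv\<^bsub>\<Gamma>\<^esub> u \<otimes>\<^bsub>\<Gamma>\<^esub> u)"
      using sx u v by (simp only: \<Gamma>.m_assoc \<Gamma>.m_closed \<Gamma>.inv_closed)
    then show "(case case p of (s, x) \<Rightarrow> (v \<otimes>\<^bsub>\<Gamma>\<^esub> s \<otimes>\<^bsub>\<Gamma>\<^esub> inv\<^bsub>\<Gamma>\<^esub> u, u \<triangleright> x) of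
         (s, x) \<Rightarrow> (\<rho> s, inv\<^bsub>\<Gamma>\<^esub> u \<triangleright> x)) = p"
      using sx u v by (simp add: \<rho>_def)
    show "(case p of (s, x) \<Rightarrow> (v \<otimes>\<^bsub>\<Gamma>\<^esub> s \<otimes>\<^bsub>\<Gamma>\<^esub> inv\<^bsub>\<Gamma>\<^esub> u, u \<triangleright> x)) \<in> ?I"
      using sx u v by (simp add: lact_mult)
  qed
  also have "\<dots> = (\<Sum>(s, x)\<in>carrier \<Gamma> \<times> carrier F. P s x * T s x * T v w)"
    using v w by (intro sum.mono_neutral_left[OF fin]) (auto simp: mult.assoc coalg_repD[OF T] split: if_splits)
  also have "\<dots> = twist P T * T v w"
    by (simp add: twist_def sum_distrib_right case_prod_unfold)
  finally show ?thesis .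
qed

text \<open>
  Since the twist commutes with \<open>P s x\<close>, the next factor \<open>P s x * T s x\<close> can be wrapped around
  \<open>twist P T ^ n\<close>. In \<open>P s x * twist P T ^ n * T s x\<close> the product rules of \<open>P\<close> and \<open>T\<close> leave only the term of
  the successor of \<open>(s, x)\<close> in the orbit.
\<close>

lemma twist_power_expansion:
  assumes P: "alg_rep P" and T: "coalg_rep T"
    and comm: "\<And>s x. \<lbrakk>s \<in> carrier \<Gamma>; x \<in> carrier F\<rbrakk> \<Longrightarrow> twist P T * P s x = P s x * twist P T"
  shows "twist P T ^ n = (\<Sum>(s, x)\<in>carrier \<Gamma> \<times> carrier F.
    (orb_coeff \<sigma> \<tau> n s x) \<cdot> (P s (orbF n s x) * T (orb\<Gamma> n s x) (orb_last n s x)))"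
proof (induction n)
  case 0
  have "1 = (\<Sum>s\<in>carrier \<Gamma>. P s \<one>\<^bsub>F\<^esub>) * (\<Sum>x\<in>carrier F. T \<one>\<^bsub>\<Gamma>\<^esub> x)"
    by (simp add: alg_repD[OF P] coalg_repD[OF T])
  also have "\<dots> = (\<Sum>s\<in>carrier \<Gamma>. \<Sum>x\<in>carrier F. P s \<one>\<^bsub>F\<^esub> * T \<one>\<^bsub>\<Gamma>\<^esub> x)"
    by (simp add: sum_product)
  also have "\<dots> = (\<Sum>s\<in>carrier \<Gamma>. \<Sum>x\<in>carrier F. P s \<one>\<^bsub>F\<^esub> * T \<one>\<^bsub>\<Gamma>\<^esub> (s \<triangleright> x))"
  proof (rule sum.cong[OF refl])
    fix s assume "s \<in> carrier \<Gamma>"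
    then show "(\<Sum>x\<in>carrier F. P s \<one>\<^bsub>F\<^esub> * T \<one>\<^bsub>\<Gamma>\<^esub> x) = (\<Sum>x\<in>carrier F. P s \<one>\<^bsub>F\<^esub> * T \<one>\<^bsub>\<Gamma>\<^esub> (s \<triangleright> x))"
      by (intro sum.reindex_bij_witness[where i = "\<lambda>x. s \<triangleright> x" and j = "\<lambda>x. inv\<^bsub>\<Gamma>\<^esub> s \<triangleright> x"]) auto
  qed
  finally show ?case by (simp add: sum.cartesian_product case_prod_unfold)
next
  case (Suc n)
  let ?B = "carrier \<Gamma> \<times> carrier F"
  have comm': "twist P T ^ n * P s x = P s x * twist P T ^ n" if "s \<in> carrier \<Gamma>" "x \<in> carrier F" for s x
    by (rule commute_power) (rule comm[OF that])
  have step: "P s x * twist P T ^ n * T s x = (orb_coeff \<sigma> \<tau> (Suc n) s x)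
      \<cdot> (P s (orbF (Suc n) s x) * T (orb\<Gamma> (Suc n) s x) (orb_last (Suc n) s x))"
    if sx: "s \<in> carrier \<Gamma>" "x \<in> carrier F" for s x
  proof -
    define G where "G q = (orb_coeff \<sigma> \<tau> n (fst q) (snd q)) \<cdot> (P s x * P (fst q) (orbF n (fst q) (snd q))
        * (T (orb\<Gamma> n (fst q) (snd q)) (orb_last n (fst q) (snd q)) * T s x))" for q
    let ?q = "(s \<triangleleft> x, inv\<^bsub>\<Gamma>\<^esub> (s \<triangleleft> x) \<triangleright> x)"
    have "P s x * twist P T ^ n * T s x = (\<Sum>q\<in>?B. G q)"
      unfolding Suc by (simp add: sum_distrib_left sum_distrib_right case_prod_unfold G_def  mult.assoc)
    also have "\<dots> = (\<Sum>q\<in>?B. if q = ?q then G q else 0)"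
    proof (rule sum.cong[OF refl])
      fix q assume "q \<in> ?B"
      then obtain s' x' where q: "q = (s', x')" "s' \<in> carrier \<Gamma>" "x' \<in> carrier F" by auto
      show "G q = (if q = ?q then G q else 0)"
      proof (cases "s \<triangleleft> x = s' \<and> x = s' \<triangleright> x'")
        case True then show ?thesis using q by auto
      next
        case False
        then have "G q = 0" "q \<noteq> ?q"
          using q sx by (auto simp: G_def alg_repD[OF P] coalg_repD[OF T] orb\<Gamma>_lact_last)
        then show ?thesis by simp
      qed
    qed
    also have "\<dots> = G ?q"
      using sx finite_F finite_\<Gamma> by (simp add: sum.delta')
    also have "\<dots> = (orb_coeff \<sigma> \<tau> (Suc n) s x)
      \<cdot> (P s (orbF (Suc n) s x) * T (orb\<Gamma> (Suc n) s x) (orb_last (Suc n) s x))"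
      using sx by (simp add: G_def alg_repD[OF P] coalg_repD[OF T] orb\<Gamma>_lact_last  mult.assoc) (simp add: ac_simps)
    finally show ?thesis .
  qed
  have "twist P T ^ Suc n = (\<Sum>(s, x)\<in>?B. twist P T ^ n * P s x * T s x)"
    unfolding power_Suc2 by (subst (2) twist_def) (simp add: sum_distrib_left case_prod_unfold mult.assoc)
  also have "\<dots> = (\<Sum>(s, x)\<in>?B. P s x * twist P T ^ n * T s x)"
    by (rule sum.cong) (auto simp: comm')
  also have "\<dots> = (\<Sum>(s, x)\<in>?B. (orb_coeff \<sigma> \<tau> (Suc n) s x)
      \<cdot> (P s (orbF (Suc n) s x) * T (orb\<Gamma> (Suc n) s x) (orb_last (Suc n) s x)))"
    by (rule sum.cong) (auto simp del: orbF.simps orb\<Gamma>.simps orb_last.simps orb_coeff.simps simp: step)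
  finally show ?case .
qed

text \<open>
  For the exponent \<open>m\<close> of the group, the terms of the expansion are multiples of the products
  \<open>P s 1 * T 1 y\<close>. The families \<open>P s 1\<close> and \<open>T 1 y\<close> are orthogonal idempotents with sum 1, and the \<open>m\<close>-th power of the
  twist commutes with those of the first family. Between \<open>P s 1\<close> and \<open>T 1 y\<close> it is therefore a scalar, and its powers
  are given by the powers of the scalars.
\<close>

lemma twist_exponent:
  assumes P: "alg_rep P" and T: "coalg_rep T"
    and comm: "\<And>s x. \<lbrakk>s \<in> carrier \<Gamma>; x \<in> carrier F\<rbrakk> \<Longrightarrow> twist P T * P s x = P s x * twist P T"
    and e: "\<And>s x. \<lbrakk>s \<in> carrier \<Gamma>; x \<in> carrier F\<rbrakk>
      \<Longrightarrow> orb_coeff \<sigma> \<tau> (group_exponent (bowtie F \<Gamma> (\<triangleright>) (\<triangleleft>))) s x ^ e = 1"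
  shows "twist P T ^ (e * group_exponent (bowtie F \<Gamma> (\<triangleright>) (\<triangleleft>))) = 1"
proof -
  define m where "m = group_exponent (bowtie F \<Gamma> (\<triangleright>) (\<triangleleft>))"
  \<comment> \<open>Indexed by \<open>y = s \<triangleright> x\<close>, since \<open>T\<close> has the second index \<open>s \<triangleright> x\<close> after \<open>m\<close> steps.\<close>
  define c where "c s y = orb_coeff \<sigma> \<tau> m s (inv\<^bsub>\<Gamma>\<^esub> s \<triangleright> y)" for s y
  define \<phi> where "\<phi> = twist P T ^ m"
  have shift: "(\<Sum>(s, x)\<in>carrier \<Gamma> \<times> carrier F. h s (s \<triangleright> x)) = (\<Sum>s\<in>carrier \<Gamma>. \<Sum>y\<in>carrier F. h s y)"
    for h :: "'g \<Rightarrow> 'f \<Rightarrow> 'e"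
    unfolding sum.cartesian_product
    by (rule sum.reindex_bij_witness[where j = "\<lambda>(s, x). (s, s \<triangleright> x)" and i = "\<lambda>(s, y). (s, inv\<^bsub>\<Gamma>\<^esub> s \<triangleright> y)"]) auto
  have \<phi>: "\<phi> = (\<Sum>s\<in>carrier \<Gamma>. \<Sum>y\<in>carrier F. (c s y) \<cdot> (P s \<one>\<^bsub>F\<^esub> * T \<one>\<^bsub>\<Gamma>\<^esub> y))"
  proof -
    have "\<phi> = (\<Sum>(s, x)\<in>carrier \<Gamma> \<times> carrier F. c s (s \<triangleright> x) \<cdot> (P s \<one>\<^bsub>F\<^esub> * T \<one>\<^bsub>\<Gamma>\<^esub> (s \<triangleright> x)))"
      unfolding \<phi>_def
      by (subst twist_power_expansion[OF P T]) (auto simp: comm m_def orb_exponent c_def intro!: sum.cong)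
    then show ?thesis by (simp only: shift[of "\<lambda>s y. c s y \<cdot> (P s \<one>\<^bsub>F\<^esub> * T \<one>\<^bsub>\<Gamma>\<^esub> y)"])
  qed
  have \<phi>_comm: "P s \<one>\<^bsub>F\<^esub> * \<phi> = \<phi> * P s \<one>\<^bsub>F\<^esub>" if "s \<in> carrier \<Gamma>" for s
    unfolding \<phi>_def using commute_power[OF comm[OF that F.one_closed]] by simp
  have sandwich: "P s \<one>\<^bsub>F\<^esub> * \<phi> * T \<one>\<^bsub>\<Gamma>\<^esub> y = (c s y) \<cdot> (P s \<one>\<^bsub>F\<^esub> * T \<one>\<^bsub>\<Gamma>\<^esub> y)"
    if "s \<in> carrier \<Gamma>" "y \<in> carrier F" for s y
  proof -
    have "P s \<one>\<^bsub>F\<^esub> * \<phi> * T \<one>\<^bsub>\<Gamma>\<^esub> y = (\<Sum>s'\<in>carrier \<Gamma>. \<Sum>y'\<in>carrier F.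
        (c s' y') \<cdot> ((P s \<one>\<^bsub>F\<^esub> * P s' \<one>\<^bsub>F\<^esub>) * (T \<one>\<^bsub>\<Gamma>\<^esub> y' * T \<one>\<^bsub>\<Gamma>\<^esub> y)))"
      unfolding \<phi> by (simp add: sum_distrib_left sum_distrib_right  mult.assoc)
    also have "\<dots> = (\<Sum>s'\<in>carrier \<Gamma>. if s = s' then \<Sum>y'\<in>carrier F.
        (if y' = y then (c s' y') \<cdot> (P s \<one>\<^bsub>F\<^esub> * T \<one>\<^bsub>\<Gamma>\<^esub> y) else 0) else 0)"
    proof (rule sum.cong[OF refl])
      fix s' assume s': "s' \<in> carrier \<Gamma>"
      have "(c s' y') \<cdot> (P s \<one>\<^bsub>F\<^esub> * P s' \<one>\<^bsub>F\<^esub> * (T \<one>\<^bsub>\<Gamma>\<^esub> y' * T \<one>\<^bsub>\<Gamma>\<^esub> y))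
          = (if s = s' then if y' = y then (c s' y') \<cdot> (P s \<one>\<^bsub>F\<^esub> * T \<one>\<^bsub>\<Gamma>\<^esub> y) else 0 else 0)"
        if "y' \<in> carrier F" for y'
        using that s' \<open>s \<in> carrier \<Gamma>\<close> \<open>y \<in> carrier F\<close>
        by (simp add: alg_rep_idem(1)[OF P] coalg_rep_idem(1)[OF T])
      then show "(\<Sum>y'\<in>carrier F. (c s' y') \<cdot> (P s \<one>\<^bsub>F\<^esub> * P s' \<one>\<^bsub>F\<^esub> * (T \<one>\<^bsub>\<Gamma>\<^esub> y' * T \<one>\<^bsub>\<Gamma>\<^esub> y)))
          = (if s = s' then \<Sum>y'\<in>carrier F. (if y' = y then (c s' y') \<cdot> (P s \<one>\<^bsub>F\<^esub> * T \<one>\<^bsub>\<Gamma>\<^esub> y) else 0) else 0)"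
        by simp
    qed
    also have "\<dots> = (c s y) \<cdot> (P s \<one>\<^bsub>F\<^esub> * T \<one>\<^bsub>\<Gamma>\<^esub> y)"
      using that finite_F finite_\<Gamma> by simp
    finally show ?thesis .
  qed
  have one: "(\<Sum>s\<in>carrier \<Gamma>. \<Sum>y\<in>carrier F. P s \<one>\<^bsub>F\<^esub> * T \<one>\<^bsub>\<Gamma>\<^esub> y) = 1"
    by (simp add: alg_repD[OF P] coalg_repD[OF T] flip: sum_product)
  have pow: "\<phi> ^ n = (\<Sum>s\<in>carrier \<Gamma>. \<Sum>y\<in>carrier F. (c s y ^ n) \<cdot> (P s \<one>\<^bsub>F\<^esub> * T \<one>\<^bsub>\<Gamma>\<^esub> y))" for n
  proof (induction n)
    case 0 then show ?case by (simp add: one)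
  next
    case (Suc n)
    have "\<phi> ^ Suc n = (\<Sum>s\<in>carrier \<Gamma>. \<Sum>y\<in>carrier F. (c s y ^ n) \<cdot> ((\<phi> * P s \<one>\<^bsub>F\<^esub>) * T \<one>\<^bsub>\<Gamma>\<^esub> y))"
      by (simp add: Suc sum_distrib_left  mult.assoc)
    also have "\<dots> = (\<Sum>s\<in>carrier \<Gamma>. \<Sum>y\<in>carrier F. (c s y ^ Suc n) \<cdot> (P s \<one>\<^bsub>F\<^esub> * T \<one>\<^bsub>\<Gamma>\<^esub> y))"
      by (intro sum.cong refl) (simp add: sandwich mult.commute flip: \<phi>_comm)
    finally show ?case .
  qed
  have "twist P T ^ (e * m) = \<phi> ^ e"
    by (simp add: \<phi>_def mult.commute flip: power_mult)
  also have "\<dots> = 1"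
    unfolding pow one[symmetric] using e by (intro sum.cong refl) (simp add: c_def m_def)
  finally show ?thesis by (simp add: m_def)
qed

end

section \<open>The twist of a tensor product\<close>

lemma power_mult_commuting:
  fixes x y :: "'e::monoid_mult"
  assumes "x * y = y * x"
  shows "(x * y) ^ n = x ^ n * y ^ n"
proof (induction n)
  case (Suc n)
  have "(x * y) ^ Suc n = x * (y * x ^ n) * y ^ n" by (simp add: Suc mult.assoc)
  also have "y * x ^ n = x ^ n * y" using commute_power[OF assms] by simp
  finally show ?case by (simp add: mult.assoc)
qed simp

context bicrossed_modules
begin

text \<open>
  The action of the coproduct of \<open>e\<^sub>s # x\<close> on a tensor product, when \<open>P\<close> and \<open>P'\<close> act on its two factors;
  \<open>tensT\<close> is the dual formula.
\<close>

definition tensP :: "('g \<Rightarrow> 'f \<Rightarrow> 'e) \<Rightarrow> ('g \<Rightarrow> 'f \<Rightarrow> 'e) \<Rightarrow> 'g \<Rightarrow> 'f \<Rightarrow> 'e" where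
  "tensP P P' s x = (\<Sum>u\<in>carrier \<Gamma>. \<tau> x (s \<otimes>\<^bsub>\<Gamma>\<^esub> inv\<^bsub>\<Gamma>\<^esub> u) u \<cdot> (P (s \<otimes>\<^bsub>\<Gamma>\<^esub> inv\<^bsub>\<Gamma>\<^esub> u) (u \<triangleright> x) * P' u x))"

definition tensT :: "('g \<Rightarrow> 'f \<Rightarrow> 'e) \<Rightarrow> ('g \<Rightarrow> 'f \<Rightarrow> 'e) \<Rightarrow> 'g \<Rightarrow> 'f \<Rightarrow> 'e" where
  "tensT T T' s x = (\<Sum>y\<in>carrier F. \<sigma> s y (inv\<^bsub>F\<^esub> y \<otimes>\<^bsub>F\<^esub> x) \<cdot> (T s y * T' (s \<triangleleft> y) (inv\<^bsub>F\<^esub> y \<otimes>\<^bsub>F\<^esub> x)))"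

definition commuting :: "('g \<Rightarrow> 'f \<Rightarrow> 'e) \<Rightarrow> ('g \<Rightarrow> 'f \<Rightarrow> 'e) \<Rightarrow> bool" where
  "commuting P Q \<longleftrightarrow> (\<forall>s\<in>carrier \<Gamma>. \<forall>x\<in>carrier F. \<forall>t\<in>carrier \<Gamma>. \<forall>y\<in>carrier F. P s x * Q t y = Q t y * P s x)"

lemma commutingD:
  "\<lbrakk>commuting P Q; s \<in> carrier \<Gamma>; x \<in> carrier F; t \<in> carrier \<Gamma>; y \<in> carrier F\<rbrakk>
    \<Longrightarrow> P s x * Q t y = Q t y * P s x"
  by (auto simp: commuting_def)

lemma commuting_sym: "commuting P Q \<Longrightarrow> commuting Q P"
  by (auto simp: commuting_def)

lemma sum_rdiv: "s \<in> carrier \<Gamma> \<Longrightarrow> (\<Sum>u\<in>carrier \<Gamma>. h (s \<otimes>\<^bsub>\<Gamma>\<^esub> inv\<^bsub>\<Gamma>\<^esub> u) u) = (\<Sum>t\<in>carrier \<Gamma>. h t (inv\<^bsub>\<Gamma>\<^esub> t \<otimes>\<^bsub>\<Gamma>\<^esub> s))"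
  by (rule sum.reindex_bij_witness[where i = "\<lambda>t. inv\<^bsub>\<Gamma>\<^esub> t \<otimes>\<^bsub>\<Gamma>\<^esub> s" and j = "\<lambda>u. s \<otimes>\<^bsub>\<Gamma>\<^esub> inv\<^bsub>\<Gamma>\<^esub> u"])
    (auto simp: \<Gamma>.inv_mult_group \<Gamma>.m_assoc, simp flip: \<Gamma>.m_assoc)

lemma sum_translate\<Gamma>: "u \<in> carrier \<Gamma> \<Longrightarrow> (\<Sum>s\<in>carrier \<Gamma>. h (s \<otimes>\<^bsub>\<Gamma>\<^esub> inv\<^bsub>\<Gamma>\<^esub> u) s) = (\<Sum>t\<in>carrier \<Gamma>. h t (t \<otimes>\<^bsub>\<Gamma>\<^esub> u))"
  by (rule sum.reindex_bij_witness[where i = "\<lambda>t. t \<otimes>\<^bsub>\<Gamma>\<^esub> u" and j = "\<lambda>s. s \<otimes>\<^bsub>\<Gamma>\<^esub> inv\<^bsub>\<Gamma>\<^esub> u"])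
    (auto simp: \<Gamma>.m_assoc)

lemma sum_translateF: "y \<in> carrier F \<Longrightarrow> (\<Sum>x\<in>carrier F. h (inv\<^bsub>F\<^esub> y \<otimes>\<^bsub>F\<^esub> x) x) = (\<Sum>z\<in>carrier F. h z (y \<otimes>\<^bsub>F\<^esub> z))"
  by (rule sum.reindex_bij_witness[where i = "\<lambda>z. y \<otimes>\<^bsub>F\<^esub> z" and j = "\<lambda>x. inv\<^bsub>F\<^esub> y \<otimes>\<^bsub>F\<^esub> x"])
    (auto simp flip: F.m_assoc)

lemma ract_quotient:
  assumes "s \<in> carrier \<Gamma>" "u \<in> carrier \<Gamma>" "x \<in> carrier F"
  shows "((s \<otimes>\<^bsub>\<Gamma>\<^esub> inv\<^bsub>\<Gamma>\<^esub> u) \<triangleleft> (u \<triangleright> x)) \<otimes>\<^bsub>\<Gamma>\<^esub> (u \<triangleleft> x) = s \<triangleleft> x"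
  using assms ract_matched[of "s \<otimes>\<^bsub>\<Gamma>\<^esub> inv\<^bsub>\<Gamma>\<^esub> u" u x] by (simp add: \<Gamma>.m_assoc)

text \<open>
  Here the compatibility of \<open>\<sigma>\<close> and \<open>\<tau>\<close> enters: it says that the coproduct is multiplicative.
\<close>

lemma alg_rep_tensP:
  assumes P: "alg_rep P" and P': "alg_rep P'" and comm: "commuting P P'"
  shows "alg_rep (tensP P P')"
  unfolding alg_rep_def
proof (intro conjI ballI)
  fix s x s' y
  assume sx: "s \<in> carrier \<Gamma>" "x \<in> carrier F" and sy: "s' \<in> carrier \<Gamma>" "y \<in> carrier F"
  let ?q = "\<lambda>s u. s \<otimes>\<^bsub>\<Gamma>\<^esub> inv\<^bsub>\<Gamma>\<^esub> u"
  have inner: "(\<tau> x (?q s u) u * \<tau> y (?q s' u') u') \<cdot> (P (?q s u) (u \<triangleright> x) * P (?q s' u') (u' \<triangleright> y) * (P' u x * P' u' y))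
      = (if u' = u \<triangleleft> x then if s \<triangleleft> x = s' then (\<sigma> s x y * \<tau> (x \<otimes>\<^bsub>F\<^esub> y) (?q s u) u) \<cdot>
          (P (?q s u) (u \<triangleright> (x \<otimes>\<^bsub>F\<^esub> y)) * P' u (x \<otimes>\<^bsub>F\<^esub> y)) else 0 else 0)"
    if u: "u \<in> carrier \<Gamma>" "u' \<in> carrier \<Gamma>" for u u'
  proof (cases "u' = u \<triangleleft> x")
    case False
    then show ?thesis using u sx sy by (simp add: alg_repD[OF P'])
  next
    case u': True
    let ?t = "?q s u" and ?t' = "?q s u \<triangleleft> (u \<triangleright> x)"
    have q: "?t' \<otimes>\<^bsub>\<Gamma>\<^esub> u' = s \<triangleleft> x" using ract_quotient[of s u x] u sx u' by simp
    have cl: "?t \<in> carrier \<Gamma>" "?t' \<in> carrier \<Gamma>" using u sx by auto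
    have iff: "?t' = ?q s' u' \<longleftrightarrow> s \<triangleleft> x = s'"
    proof
      assume "?t' = ?q s' u'"
      then show "s \<triangleleft> x = s'" using q u sy by (simp add: \<Gamma>.m_assoc)
    next
      assume "s \<triangleleft> x = s'"
      then have "?t' \<otimes>\<^bsub>\<Gamma>\<^esub> u' = s'" using q by simp
      then show "?t' = ?q s' u'" using u cl by (auto simp: \<Gamma>.m_assoc)
    qed
    show ?thesis
    proof (cases "s \<triangleleft> x = s'")
      case False
      then have "P ?t (u \<triangleright> x) * P (?q s' u') (u' \<triangleright> y) = 0"
        using iff u sx sy by (simp add: alg_repD[OF P])
      then show ?thesis using False by simp
    next
      case True
      then have t': "?q s' u' = ?t'" using iff by simp
      have "(\<tau> x ?t u * \<tau> y ?t' u') \<cdot> (P ?t (u \<triangleright> x) * P ?t' (u' \<triangleright> y) * (P' u x * P' u' y))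
        = (\<tau> x ?t u * \<tau> y ?t' u' * \<sigma> ?t (u \<triangleright> x) (u' \<triangleright> y) * \<sigma> u x y) \<cdot>
          (P ?t ((u \<triangleright> x) \<otimes>\<^bsub>F\<^esub> (u' \<triangleright> y)) * P' u (x \<otimes>\<^bsub>F\<^esub> y))"
        using u u' sx sy cl by (simp add: alg_repD[OF P] alg_repD[OF P'] ac_simps)
      also have "\<tau> x ?t u * \<tau> y ?t' u' * \<sigma> ?t (u \<triangleright> x) (u' \<triangleright> y) * \<sigma> u x y = \<sigma> s x y * \<tau> (x \<otimes>\<^bsub>F\<^esub> y) ?t u"
        using compat[of ?t u x y] u u' sx sy by (simp add: \<Gamma>.m_assoc)
      also have "(u \<triangleright> x) \<otimes>\<^bsub>F\<^esub> (u' \<triangleright> y) = u \<triangleright> (x \<otimes>\<^bsub>F\<^esub> y)"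
        using lact_matched u u' sx sy by simp
      finally show ?thesis using True u' t' by simp
    qed
  qed
  have "tensP P P' s x * tensP P P' s' y = (\<Sum>u\<in>carrier \<Gamma>. \<Sum>u'\<in>carrier \<Gamma>.
      (\<tau> x (?q s u) u * \<tau> y (?q s' u') u') \<cdot> (P (?q s u) (u \<triangleright> x) * (P' u x * P (?q s' u') (u' \<triangleright> y)) * P' u' y))"
    unfolding tensP_def sum_product by (simp add: mult.assoc mult.commute)
  also have "\<dots> = (\<Sum>u\<in>carrier \<Gamma>. \<Sum>u'\<in>carrier \<Gamma>.
      (\<tau> x (?q s u) u * \<tau> y (?q s' u') u') \<cdot> (P (?q s u) (u \<triangleright> x) * P (?q s' u') (u' \<triangleright> y) * (P' u x * P' u' y)))"
    by (intro sum.cong refl, subst commutingD[OF commuting_sym[OF comm]])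
      (use sx sy in \<open>simp_all add: mult.assoc\<close>)
  also have "\<dots> = (\<Sum>u\<in>carrier \<Gamma>. if s \<triangleleft> x = s' then (\<sigma> s x y * \<tau> (x \<otimes>\<^bsub>F\<^esub> y) (?q s u) u) \<cdot>
          (P (?q s u) (u \<triangleright> (x \<otimes>\<^bsub>F\<^esub> y)) * P' u (x \<otimes>\<^bsub>F\<^esub> y)) else 0)"
    using sx finite_\<Gamma> by (intro sum.cong refl) (simp add: inner sum.delta)
  also have "\<dots> = (if s \<triangleleft> x = s' then \<sigma> s x y \<cdot> tensP P P' s (x \<otimes>\<^bsub>F\<^esub> y) else 0)"
    by (simp add: tensP_def scale_sum_right)
  finally show "tensP P P' s x * tensP P P' s' y = (if s \<triangleleft> x = s' then \<sigma> s x y \<cdot> tensP P P' s (x \<otimes>\<^bsub>F\<^esub> y) else 0)" .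
next
  have "(\<Sum>s\<in>carrier \<Gamma>. tensP P P' s \<one>\<^bsub>F\<^esub>)
      = (\<Sum>u\<in>carrier \<Gamma>. \<Sum>s\<in>carrier \<Gamma>. P (s \<otimes>\<^bsub>\<Gamma>\<^esub> inv\<^bsub>\<Gamma>\<^esub> u) \<one>\<^bsub>F\<^esub> * P' u \<one>\<^bsub>F\<^esub>)"
    unfolding tensP_def by (subst sum.swap) (simp add: \<tau>_unit)
  also have "\<dots> = (\<Sum>u\<in>carrier \<Gamma>. \<Sum>t\<in>carrier \<Gamma>. P t \<one>\<^bsub>F\<^esub> * P' u \<one>\<^bsub>F\<^esub>)"
    by (rule sum.cong[OF refl], rule sum_translate\<Gamma>)
  also have "\<dots> = 1"
    by (simp add: alg_repD[OF P] alg_repD[OF P'] flip: sum_distrib_left sum_distrib_right)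
  finally show "(\<Sum>s\<in>carrier \<Gamma>. tensP P P' s \<one>\<^bsub>F\<^esub>) = 1" .
qed

lemma coalg_rep_tensT:
  assumes T: "coalg_rep T" and T': "coalg_rep T'" and comm: "commuting T T'"
  shows "coalg_rep (tensT T T')"
  unfolding coalg_rep_def
proof (intro conjI ballI)
  fix u x t w
  assume ux: "u \<in> carrier \<Gamma>" "x \<in> carrier F" and tw: "t \<in> carrier \<Gamma>" "w \<in> carrier F"
  let ?q = "\<lambda>y x. inv\<^bsub>F\<^esub> y \<otimes>\<^bsub>F\<^esub> x"
  have inner: "(\<sigma> u y (?q y x) * \<sigma> t y' (?q y' w)) \<cdot> (T u y * T t y' * (T' (u \<triangleleft> y) (?q y x) * T' (t \<triangleleft> y') (?q y' w)))
      = (if y' = u \<triangleright> y then if w = u \<triangleright> x then (\<tau> x t u * \<sigma> (t \<otimes>\<^bsub>\<Gamma>\<^esub> u) y (?q y x)) \<cdot>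
          (T (t \<otimes>\<^bsub>\<Gamma>\<^esub> u) y * T' ((t \<otimes>\<^bsub>\<Gamma>\<^esub> u) \<triangleleft> y) (?q y x)) else 0 else 0)"
    if y: "y \<in> carrier F" "y' \<in> carrier F" for y y'
  proof (cases "y' = u \<triangleright> y")
    case False
    then show ?thesis using y ux tw by (simp add: coalg_repD[OF T])
  next
    case y': True
    let ?z = "?q y x" and ?z' = "(u \<triangleleft> y) \<triangleright> ?q y x"
    have z: "?z \<in> carrier F" "y \<otimes>\<^bsub>F\<^esub> ?z = x" using y ux by (auto simp flip: F.m_assoc)
    have q: "y' \<otimes>\<^bsub>F\<^esub> ?z' = u \<triangleright> x" using lact_matched[of u y ?z] y ux z y' by simp
    have iff: "?q y' w = ?z' \<longleftrightarrow> w = u \<triangleright> x"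
    proof
      assume "?q y' w = ?z'"
      then have "y' \<otimes>\<^bsub>F\<^esub> ?q y' w = u \<triangleright> x" using q by simp
      then show "w = u \<triangleright> x" using y tw by (simp flip: F.m_assoc)
    next
      assume "w = u \<triangleright> x"
      then have "w = y' \<otimes>\<^bsub>F\<^esub> ?z'" using q by simp
      then show "?q y' w = ?z'" using y ux z by (simp flip: F.m_assoc)
    qed
    show ?thesis
    proof (cases "w = u \<triangleright> x")
      case False
      then have "T' (u \<triangleleft> y) ?z * T' (t \<triangleleft> y') (?q y' w) = 0"
        using iff y ux tw by (simp add: coalg_repD[OF T'])
      then show ?thesis using False by simp
    next
      case True
      then have t': "?q y' w = ?z'" using iff by simp
      have "(\<sigma> u y ?z * \<sigma> t y' ?z') \<cdot> (T u y * T t y' * (T' (u \<triangleleft> y) ?z * T' (t \<triangleleft> y') ?z'))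
        = (\<tau> y t u * \<tau> ?z (t \<triangleleft> y') (u \<triangleleft> y) * \<sigma> t y' ?z' * \<sigma> u y ?z) \<cdot>
          (T (t \<otimes>\<^bsub>\<Gamma>\<^esub> u) y * T' ((t \<triangleleft> y') \<otimes>\<^bsub>\<Gamma>\<^esub> (u \<triangleleft> y)) ?z)"
        using y y' ux tw z(1) by (simp add: coalg_repD[OF T] coalg_repD[OF T'] ac_simps)
      also have "\<tau> y t u * \<tau> ?z (t \<triangleleft> y') (u \<triangleleft> y) * \<sigma> t y' ?z' * \<sigma> u y ?z = \<tau> x t u * \<sigma> (t \<otimes>\<^bsub>\<Gamma>\<^esub> u) y ?z"
        using compat[of t u y ?z] y y' ux tw z by (simp add: mult.commute)
      also have "(t \<triangleleft> y') \<otimes>\<^bsub>\<Gamma>\<^esub> (u \<triangleleft> y) = (t \<otimes>\<^bsub>\<Gamma>\<^esub> u) \<triangleleft> y"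
        using ract_matched y y' ux tw by simp
      finally show ?thesis using True y' t' by simp
    qed
  qed
  have "tensT T T' u x * tensT T T' t w = (\<Sum>y\<in>carrier F. \<Sum>y'\<in>carrier F.
      (\<sigma> u y (?q y x) * \<sigma> t y' (?q y' w)) \<cdot> (T u y * (T' (u \<triangleleft> y) (?q y x) * T t y') * T' (t \<triangleleft> y') (?q y' w)))"
    unfolding tensT_def sum_product by (simp add: mult.assoc mult.commute)
  also have "\<dots> = (\<Sum>y\<in>carrier F. \<Sum>y'\<in>carrier F.
      (\<sigma> u y (?q y x) * \<sigma> t y' (?q y' w)) \<cdot> (T u y * T t y' * (T' (u \<triangleleft> y) (?q y x) * T' (t \<triangleleft> y') (?q y' w))))"
    by (intro sum.cong refl, subst commutingD[OF commuting_sym[OF comm]])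
      (use ux tw in \<open>simp_all add: mult.assoc\<close>)
  also have "\<dots> = (\<Sum>y\<in>carrier F. if w = u \<triangleright> x then (\<tau> x t u * \<sigma> (t \<otimes>\<^bsub>\<Gamma>\<^esub> u) y (?q y x)) \<cdot>
          (T (t \<otimes>\<^bsub>\<Gamma>\<^esub> u) y * T' ((t \<otimes>\<^bsub>\<Gamma>\<^esub> u) \<triangleleft> y) (?q y x)) else 0)"
    using ux finite_F by (intro sum.cong refl) (simp add: inner sum.delta)
  also have "\<dots> = (if w = u \<triangleright> x then \<tau> x t u \<cdot> tensT T T' (t \<otimes>\<^bsub>\<Gamma>\<^esub> u) x else 0)"
    by (simp add: tensT_def scale_sum_right)
  finally show "tensT T T' u x * tensT T T' t w = (if w = u \<triangleright> x then \<tau> x t u \<cdot> tensT T T' (t \<otimes>\<^bsub>\<Gamma>\<^esub> u) x else 0)" .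
next
  have "(\<Sum>x\<in>carrier F. tensT T T' \<one>\<^bsub>\<Gamma>\<^esub> x)
      = (\<Sum>y\<in>carrier F. \<Sum>x\<in>carrier F. T \<one>\<^bsub>\<Gamma>\<^esub> y * T' \<one>\<^bsub>\<Gamma>\<^esub> (inv\<^bsub>F\<^esub> y \<otimes>\<^bsub>F\<^esub> x))"
    unfolding tensT_def by (subst sum.swap) (simp add: \<sigma>_unit)
  also have "\<dots> = (\<Sum>y\<in>carrier F. \<Sum>z\<in>carrier F. T \<one>\<^bsub>\<Gamma>\<^esub> y * T' \<one>\<^bsub>\<Gamma>\<^esub> z)"
    by (rule sum.cong[OF refl], rule sum_translateF)
  also have "\<dots> = 1"
    by (simp add: coalg_repD[OF T] coalg_repD[OF T'] flip: sum_distrib_left sum_distrib_right)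
  finally show "(\<Sum>x\<in>carrier F. tensT T T' \<one>\<^bsub>\<Gamma>\<^esub> x) = 1" .
qed

lemma commuting_twist:
  assumes "\<And>s x. \<lbrakk>s \<in> carrier \<Gamma>; x \<in> carrier F\<rbrakk> \<Longrightarrow> a * P s x = P s x * a"
    and "\<And>s x. \<lbrakk>s \<in> carrier \<Gamma>; x \<in> carrier F\<rbrakk> \<Longrightarrow> a * T s x = T s x * a"
  shows "a * twist P T = twist P T * a"
proof -
  have "a * (P s x * T s x) = P s x * T s x * a" if "s \<in> carrier \<Gamma>" "x \<in> carrier F" for s x
    using assms[OF that] by (metis mult.assoc)
  then show ?thesis
    by (simp add: twist_eq sum_distrib_left sum_distrib_right)
qed

lemma twist_commutes_family:
  assumes "commuting A P" "commuting A T" "s \<in> carrier \<Gamma>" "x \<in> carrier F"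
  shows "twist P T * A s x = A s x * twist P T"
proof (rule commuting_twist[symmetric])
  fix t y assume "t \<in> carrier \<Gamma>" "y \<in> carrier F"
  then show "A s x * P t y = P t y * A s x" "A s x * T t y = T t y * A s x"
    using assms unfolding commuting_def by blast+
qed

text \<open>
  Half of a double braiding intertwines the tensor product of two modules with the one in the other order: it is the
  value at \<open>L\<close> of the half-braiding of the Yetter-Drinfeld module given by \<open>P\<close> and \<open>T\<close>.
\<close>

lemma tensP_twist_exchange:
  assumes L: "alg_rep L" and yd: "yd P T" and LP: "commuting L P" and LT: "commuting L T"
    and s: "s \<in> carrier \<Gamma>" and x: "x \<in> carrier F"
  shows "tensP L P s x * twist L T = twist L T * tensP P L s x"
proof -
  let ?q = "\<lambda>u. s \<otimes>\<^bsub>\<Gamma>\<^esub> inv\<^bsub>\<Gamma>\<^esub> u"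
  have "tensP L P s x * twist L T = (\<Sum>u\<in>carrier \<Gamma>. \<Sum>v\<in>carrier \<Gamma>. \<Sum>z\<in>carrier F.
      \<tau> x (?q u) u \<cdot> (L (?q u) (u \<triangleright> x) * (P u x * L v z) * T v z))"
    unfolding tensP_def twist_eq sum_distrib_right by (simp add: sum_distrib_left mult.assoc)
  also have "\<dots> = (\<Sum>u\<in>carrier \<Gamma>. \<Sum>v\<in>carrier \<Gamma>. if v = ?q u \<triangleleft> (u \<triangleright> x) then \<Sum>z\<in>carrier F.
      (\<tau> x (?q u) u * \<sigma> (?q u) (u \<triangleright> x) z) \<cdot> (L (?q u) ((u \<triangleright> x) \<otimes>\<^bsub>F\<^esub> z) * (P u x * T (?q u \<triangleleft> (u \<triangleright> x)) z)) else 0)"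
  proof (intro sum.cong refl)
    fix u v assume u: "u \<in> carrier \<Gamma>" and v: "v \<in> carrier \<Gamma>"
    have "L (?q u) (u \<triangleright> x) * (P u x * L v z) * T v z = (if v = ?q u \<triangleleft> (u \<triangleright> x)
        then \<sigma> (?q u) (u \<triangleright> x) z \<cdot> (L (?q u) ((u \<triangleright> x) \<otimes>\<^bsub>F\<^esub> z) * (P u x * T v z)) else 0)" if "z \<in> carrier F" for z
    proof -
      have "L (?q u) (u \<triangleright> x) * (P u x * L v z) * T v z = (L (?q u) (u \<triangleright> x) * L v z) * (P u x * T v z)"
        using u v x that by (simp add: mult.assoc flip: commutingD[OF LP])
      then show ?thesis using u v s x that by (auto simp: alg_repD[OF L])
    qed
    then show "(\<Sum>z\<in>carrier F. \<tau> x (?q u) u \<cdot> (L (?q u) (u \<triangleright> x) * (P u x * L v z) * T v z))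
        = (if v = ?q u \<triangleleft> (u \<triangleright> x) then \<Sum>z\<in>carrier F. (\<tau> x (?q u) u * \<sigma> (?q u) (u \<triangleright> x) z) \<cdot>
            (L (?q u) ((u \<triangleright> x) \<otimes>\<^bsub>F\<^esub> z) * (P u x * T (?q u \<triangleleft> (u \<triangleright> x)) z)) else 0)"
      by simp
  qed
  also have "\<dots> = (\<Sum>u\<in>carrier \<Gamma>. \<Sum>z\<in>carrier F. (\<tau> x (?q u) u * \<sigma> (?q u) (u \<triangleright> x) z) \<cdot>
      (L (?q u) ((u \<triangleright> x) \<otimes>\<^bsub>F\<^esub> z) * (P u x * T (?q u \<triangleleft> (u \<triangleright> x)) z)))"
    using s x finite_\<Gamma> by (intro sum.cong refl) simp
  also have "\<dots> = (\<Sum>v\<in>carrier \<Gamma>. \<Sum>z\<in>carrier F. (\<tau> x v (inv\<^bsub>\<Gamma>\<^esub> v \<otimes>\<^bsub>\<Gamma>\<^esub> s) * \<sigma> v ((inv\<^bsub>\<Gamma>\<^esub> v \<otimes>\<^bsub>\<Gamma>\<^esub> s) \<triangleright> x) z) \<cdot>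
      (L v (((inv\<^bsub>\<Gamma>\<^esub> v \<otimes>\<^bsub>\<Gamma>\<^esub> s) \<triangleright> x) \<otimes>\<^bsub>F\<^esub> z) * (P (inv\<^bsub>\<Gamma>\<^esub> v \<otimes>\<^bsub>\<Gamma>\<^esub> s) x * T (v \<triangleleft> ((inv\<^bsub>\<Gamma>\<^esub> v \<otimes>\<^bsub>\<Gamma>\<^esub> s) \<triangleright> x)) z)))"
    by (rule sum_rdiv[OF s])
  also have "\<dots> = (\<Sum>v\<in>carrier \<Gamma>. \<Sum>y\<in>carrier F. (\<tau> x (?q (v \<triangleleft> y)) (v \<triangleleft> y) * \<sigma> v y x) \<cdot>
      (L v (y \<otimes>\<^bsub>F\<^esub> x) * (T v y * P (?q (v \<triangleleft> y)) ((v \<triangleleft> y) \<triangleright> x))))"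
  proof (rule sum.cong[OF refl])
    fix v assume v: "v \<in> carrier \<Gamma>"
    define r where "r = inv\<^bsub>\<Gamma>\<^esub> v \<otimes>\<^bsub>\<Gamma>\<^esub> s"
    have r: "r \<in> carrier \<Gamma>" "v \<otimes>\<^bsub>\<Gamma>\<^esub> r = s" using v s by (auto simp: r_def simp flip: \<Gamma>.m_assoc)
    have "(\<Sum>z\<in>carrier F. (\<tau> x v r * \<sigma> v (r \<triangleright> x) z) \<cdot> (L v ((r \<triangleright> x) \<otimes>\<^bsub>F\<^esub> z) * (P r x * T (v \<triangleleft> (r \<triangleright> x)) z)))
      = (\<Sum>y\<in>carrier F. (\<tau> x (?q (v \<triangleleft> y)) (v \<triangleleft> y) * \<sigma> v y x) \<cdot>
      (L v (y \<otimes>\<^bsub>F\<^esub> x) * (T v y * P (?q (v \<triangleleft> y)) ((v \<triangleleft> y) \<triangleright> x))))"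
    proof (rule sum.reindex_bij_witness[where j = "\<lambda>z. (r \<triangleright> x) \<otimes>\<^bsub>F\<^esub> z \<otimes>\<^bsub>F\<^esub> inv\<^bsub>F\<^esub> x"
          and i = "\<lambda>y. inv\<^bsub>F\<^esub> (r \<triangleright> x) \<otimes>\<^bsub>F\<^esub> (y \<otimes>\<^bsub>F\<^esub> x)"])
      fix z assume z: "z \<in> carrier F"
      let ?y = "(r \<triangleright> x) \<otimes>\<^bsub>F\<^esub> z \<otimes>\<^bsub>F\<^esub> inv\<^bsub>F\<^esub> x"
      have y: "?y \<in> carrier F" "?y \<otimes>\<^bsub>F\<^esub> x = (r \<triangleright> x) \<otimes>\<^bsub>F\<^esub> z" using r x z by (auto simp: F.m_assoc)
      show "?y \<in> carrier F" by (rule y)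
      show "inv\<^bsub>F\<^esub> (r \<triangleright> x) \<otimes>\<^bsub>F\<^esub> (?y \<otimes>\<^bsub>F\<^esub> x) = z" unfolding y(2) using r x z by (simp flip: F.m_assoc)
      have "(\<tau> x (?q (v \<triangleleft> ?y)) (v \<triangleleft> ?y) * \<sigma> v ?y x) \<cdot> (T v ?y * P (?q (v \<triangleleft> ?y)) ((v \<triangleleft> ?y) \<triangleright> x))
          = (\<tau> x v r * \<sigma> v (r \<triangleright> x) z) \<cdot> (P r x * T (v \<triangleleft> (r \<triangleright> x)) z)"
        using v r x z s y by (intro ydD(3)[OF yd]) (auto simp: \<Gamma>.m_assoc)
      then show "(\<tau> x (?q (v \<triangleleft> ?y)) (v \<triangleleft> ?y) * \<sigma> v ?y x) \<cdot> (L v (?y \<otimes>\<^bsub>F\<^esub> x) * (T v ?y * P (?q (v \<triangleleft> ?y)) ((v \<triangleleft> ?y) \<triangleright> x)))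
        = (\<tau> x v r * \<sigma> v (r \<triangleright> x) z) \<cdot> (L v ((r \<triangleright> x) \<otimes>\<^bsub>F\<^esub> z) * (P r x * T (v \<triangleleft> (r \<triangleright> x)) z))"
        unfolding y(2) by (simp flip: scale_mult_right)
    next
      fix y assume y: "y \<in> carrier F"
      have "(r \<triangleright> x) \<otimes>\<^bsub>F\<^esub> (inv\<^bsub>F\<^esub> (r \<triangleright> x) \<otimes>\<^bsub>F\<^esub> (y \<otimes>\<^bsub>F\<^esub> x)) = y \<otimes>\<^bsub>F\<^esub> x"
        using r x y by (simp flip: F.m_assoc)
      then show "(r \<triangleright> x) \<otimes>\<^bsub>F\<^esub> (inv\<^bsub>F\<^esub> (r \<triangleright> x) \<otimes>\<^bsub>F\<^esub> (y \<otimes>\<^bsub>F\<^esub> x)) \<otimes>\<^bsub>F\<^esub> inv\<^bsub>F\<^esub> x = y"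
        using r x y by (simp add: F.m_assoc)
    qed (use r x in auto)
    then show "(\<Sum>z\<in>carrier F. (\<tau> x v (inv\<^bsub>\<Gamma>\<^esub> v \<otimes>\<^bsub>\<Gamma>\<^esub> s) * \<sigma> v ((inv\<^bsub>\<Gamma>\<^esub> v \<otimes>\<^bsub>\<Gamma>\<^esub> s) \<triangleright> x) z) \<cdot>
      (L v (((inv\<^bsub>\<Gamma>\<^esub> v \<otimes>\<^bsub>\<Gamma>\<^esub> s) \<triangleright> x) \<otimes>\<^bsub>F\<^esub> z) * (P (inv\<^bsub>\<Gamma>\<^esub> v \<otimes>\<^bsub>\<Gamma>\<^esub> s) x * T (v \<triangleleft> ((inv\<^bsub>\<Gamma>\<^esub> v \<otimes>\<^bsub>\<Gamma>\<^esub> s) \<triangleright> x)) z)))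
      = (\<Sum>y\<in>carrier F. (\<tau> x (?q (v \<triangleleft> y)) (v \<triangleleft> y) * \<sigma> v y x) \<cdot>
      (L v (y \<otimes>\<^bsub>F\<^esub> x) * (T v y * P (?q (v \<triangleleft> y)) ((v \<triangleleft> y) \<triangleright> x))))"
      unfolding r_def .
  qed
  also have "\<dots> = (\<Sum>v\<in>carrier \<Gamma>. \<Sum>y\<in>carrier F. \<Sum>u\<in>carrier \<Gamma>.
      \<tau> x (?q u) u \<cdot> (L v y * L u x * (T v y * P (?q u) (u \<triangleright> x))))"
  proof (intro sum.cong refl)
    fix v y assume vy: "v \<in> carrier \<Gamma>" "y \<in> carrier F"
    have "(\<Sum>u\<in>carrier \<Gamma>. \<tau> x (?q u) u \<cdot> (L v y * L u x * (T v y * P (?q u) (u \<triangleright> x))))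
      = (\<Sum>u\<in>carrier \<Gamma>. if u = v \<triangleleft> y then (\<tau> x (?q u) u * \<sigma> v y x) \<cdot> (L v (y \<otimes>\<^bsub>F\<^esub> x) * (T v y * P (?q u) (u \<triangleright> x))) else 0)"
      using vy x by (intro sum.cong refl) (simp add: alg_repD[OF L])
    then show "(\<tau> x (?q (v \<triangleleft> y)) (v \<triangleleft> y) * \<sigma> v y x) \<cdot> (L v (y \<otimes>\<^bsub>F\<^esub> x) * (T v y * P (?q (v \<triangleleft> y)) ((v \<triangleleft> y) \<triangleright> x)))
      = (\<Sum>u\<in>carrier \<Gamma>. \<tau> x (?q u) u \<cdot> (L v y * L u x * (T v y * P (?q u) (u \<triangleright> x))))"
      using vy finite_\<Gamma> by simp
  qed
  also have "\<dots> = (\<Sum>v\<in>carrier \<Gamma>. \<Sum>y\<in>carrier F. \<Sum>u\<in>carrier \<Gamma>.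
      L v y * T v y * (\<tau> x (?q u) u \<cdot> (P (?q u) (u \<triangleright> x) * L u x)))"
  proof (intro sum.cong refl)
    fix v y u assume v: "v \<in> carrier \<Gamma>" "y \<in> carrier F" "u \<in> carrier \<Gamma>"
    have "L u x * (T v y * P (?q u) (u \<triangleright> x)) = T v y * (L u x * P (?q u) (u \<triangleright> x))"
      using commutingD[OF LT, of u x v y] v x by (metis mult.assoc)
    also have "L u x * P (?q u) (u \<triangleright> x) = P (?q u) (u \<triangleright> x) * L u x"
      using v s x by (intro commutingD[OF LP]) auto
    finally show "\<tau> x (?q u) u \<cdot> (L v y * L u x * (T v y * P (?q u) (u \<triangleright> x)))
      = L v y * T v y * (\<tau> x (?q u) u \<cdot> (P (?q u) (u \<triangleright> x) * L u x))"
      by (simp add: mult.assoc)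
  qed
  also have "\<dots> = twist L T * tensP P L s x"
    unfolding tensP_def twist_eq sum_distrib_right by (simp only: sum_distrib_left)
  finally show ?thesis .
qed

text \<open>
  The coproduct in \<open>tensP\<close> is traded for the product of two elements of the family \<open>T\<close>, so that one of its two
  legs forms half of a braiding. The element \<open>M\<close> in the middle keeps the place for the operators in between.
\<close>

lemma sum_tensP_middle:
  assumes T: "coalg_rep T"
    and M: "\<And>u x. \<lbrakk>u \<in> carrier \<Gamma>; x \<in> carrier F\<rbrakk> \<Longrightarrow> M * B u x = B u x * M"
  shows "(\<Sum>s\<in>carrier \<Gamma>. \<Sum>x\<in>carrier F. tensP A B s x * (M * T s x))
    = (\<Sum>s\<in>carrier \<Gamma>. \<Sum>x\<in>carrier F. A s x * (M * (twist B T * T s x)))"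
proof -
  let ?q = "\<lambda>s u. s \<otimes>\<^bsub>\<Gamma>\<^esub> inv\<^bsub>\<Gamma>\<^esub> u"
  have "(\<Sum>s\<in>carrier \<Gamma>. \<Sum>x\<in>carrier F. tensP A B s x * (M * T s x))
    = (\<Sum>s\<in>carrier \<Gamma>. \<Sum>x\<in>carrier F. \<Sum>u\<in>carrier \<Gamma>.
        A (?q s u) (u \<triangleright> x) * (M * (B u x * (T u x * T (?q s u) (u \<triangleright> x)))))"
  proof (intro sum.cong refl)
    fix s x assume sx: "s \<in> carrier \<Gamma>" "x \<in> carrier F"
    have "\<tau> x (?q s u) u \<cdot> (A (?q s u) (u \<triangleright> x) * B u x * (M * T s x))
        = A (?q s u) (u \<triangleright> x) * (M * (B u x * (T u x * T (?q s u) (u \<triangleright> x))))" if u: "u \<in> carrier \<Gamma>" for u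
    proof -
      have "B u x * (M * T s x) = M * (B u x * T s x)"
        using M[OF u sx(2)] by (metis mult.assoc)
      moreover have "T u x * T (?q s u) (u \<triangleright> x) = \<tau> x (?q s u) u \<cdot> T s x"
        using u sx by (simp add: coalg_repD[OF T] \<Gamma>.m_assoc)
      ultimately show ?thesis by (simp add: mult.assoc)
    qed
    then show "tensP A B s x * (M * T s x) = (\<Sum>u\<in>carrier \<Gamma>.
        A (?q s u) (u \<triangleright> x) * (M * (B u x * (T u x * T (?q s u) (u \<triangleright> x)))))"
      by (simp add: tensP_def sum_distrib_right)
  qed
  also have "\<dots> = (\<Sum>s\<in>carrier \<Gamma>. \<Sum>u\<in>carrier \<Gamma>. \<Sum>x\<in>carrier F.
        A (?q s u) (u \<triangleright> x) * (M * (B u x * (T u x * T (?q s u) (u \<triangleright> x)))))"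
    by (rule sum.cong[OF refl], rule sum.swap)
  also have "\<dots> = (\<Sum>u\<in>carrier \<Gamma>. \<Sum>s\<in>carrier \<Gamma>. \<Sum>x\<in>carrier F.
        A (?q s u) (u \<triangleright> x) * (M * (B u x * (T u x * T (?q s u) (u \<triangleright> x)))))"
    by (rule sum.swap)
  also have "\<dots> = (\<Sum>u\<in>carrier \<Gamma>. \<Sum>t\<in>carrier \<Gamma>. \<Sum>x\<in>carrier F.
        A t (u \<triangleright> x) * (M * (B u x * (T u x * T t (u \<triangleright> x)))))"
    by (rule sum.cong[OF refl], rule sum_translate\<Gamma>)
  also have "\<dots> = (\<Sum>u\<in>carrier \<Gamma>. \<Sum>t\<in>carrier \<Gamma>. \<Sum>x\<in>carrier F. \<Sum>y\<in>carrier F.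
        A t y * (M * (B u x * (T u x * T t y))))"
  proof (intro sum.cong refl)
    fix u t x assume *: "u \<in> carrier \<Gamma>" "t \<in> carrier \<Gamma>" "x \<in> carrier F"
    have "(\<Sum>y\<in>carrier F. A t y * (M * (B u x * (T u x * T t y))))
        = (\<Sum>y\<in>carrier F. if y = u \<triangleright> x then A t y * (M * (B u x * (T u x * T t y))) else 0)"
      using * by (intro sum.cong refl) (auto simp: coalg_repD[OF T])
    then show "A t (u \<triangleright> x) * (M * (B u x * (T u x * T t (u \<triangleright> x))))
        = (\<Sum>y\<in>carrier F. A t y * (M * (B u x * (T u x * T t y))))"
      using * finite_F by simp
  qed
  also have "\<dots> = (\<Sum>t\<in>carrier \<Gamma>. \<Sum>u\<in>carrier \<Gamma>. \<Sum>x\<in>carrier F. \<Sum>y\<in>carrier F.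
        A t y * (M * (B u x * (T u x * T t y))))"
    by (rule sum.swap)
  also have "\<dots> = (\<Sum>t\<in>carrier \<Gamma>. \<Sum>u\<in>carrier \<Gamma>. \<Sum>y\<in>carrier F. \<Sum>x\<in>carrier F.
        A t y * (M * (B u x * (T u x * T t y))))"
    by (rule sum.cong[OF refl], rule sum.cong[OF refl], rule sum.swap)
  also have "\<dots> = (\<Sum>t\<in>carrier \<Gamma>. \<Sum>y\<in>carrier F. \<Sum>u\<in>carrier \<Gamma>. \<Sum>x\<in>carrier F.
        A t y * (M * (B u x * (T u x * T t y))))"
    by (rule sum.cong[OF refl], rule sum.swap)
  also have "\<dots> = (\<Sum>s\<in>carrier \<Gamma>. \<Sum>x\<in>carrier F. A s x * (M * (twist B T * T s x)))"
    by (simp add: twist_eq sum_distrib_left sum_distrib_right mult.assoc)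
  finally show ?thesis .
qed

text \<open>
  Expand the twist of the tensor product, collect the second legs into \<open>twist P' T'\<close> and \<open>twist P T'\<close> by
  \<open>sum_tensP_middle\<close>, move the latter to the left by \<open>tensP_twist_exchange\<close> and repeat for the remaining sum.
\<close>

lemma twist_tensor:
  assumes yd: "yd P T" and yd': "yd P' T'"
    and comm: "commuting P P'" "commuting P T'" "commuting T P'" "commuting T T'"
  shows "twist (tensP P P') (tensT T T') = twist P T * twist P' T' * (twist P T' * twist P' T)"
proof -
  note P = ydD(1)[OF yd] and T = ydD(2)[OF yd] and P' = ydD(1)[OF yd'] and T' = ydD(2)[OF yd']
  let ?D = "tensP P P'"
  note D = alg_rep_tensP[OF P P' comm(1)]
  have \<phi>'P: "twist P' T' * P s x = P s x * twist P' T'" if "s \<in> carrier \<Gamma>" "x \<in> carrier F" for s x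
    by (rule twist_commutes_family[OF comm(1) comm(2) that])
  have \<phi>'T: "twist P' T' * T s x = T s x * twist P' T'" if "s \<in> carrier \<Gamma>" "x \<in> carrier F" for s x
    by (rule twist_commutes_family[OF comm(3) comm(4) that])
  have \<phi>P': "twist P T * P' s x = P' s x * twist P T" if "s \<in> carrier \<Gamma>" "x \<in> carrier F" for s x
    by (rule twist_commutes_family[OF comm(1)[THEN commuting_sym] comm(3)[THEN commuting_sym] that])
  have \<phi>T': "twist P T * T' s x = T' s x * twist P T" if "s \<in> carrier \<Gamma>" "x \<in> carrier F" for s x
    by (rule twist_commutes_family[OF comm(2)[THEN commuting_sym] comm(4)[THEN commuting_sym] that])
  have \<phi>'D: "?D s x * twist P' T' = twist P' T' * ?D s x" if "s \<in> carrier \<Gamma>" "x \<in> carrier F" for s x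
  proof -
    have "P (s \<otimes>\<^bsub>\<Gamma>\<^esub> inv\<^bsub>\<Gamma>\<^esub> u) (u \<triangleright> x) * P' u x * twist P' T'
        = twist P' T' * (P (s \<otimes>\<^bsub>\<Gamma>\<^esub> inv\<^bsub>\<Gamma>\<^esub> u) (u \<triangleright> x) * P' u x)" if "u \<in> carrier \<Gamma>" for u
      using that \<open>s \<in> carrier \<Gamma>\<close> \<open>x \<in> carrier F\<close> \<phi>'P[of "s \<otimes>\<^bsub>\<Gamma>\<^esub> inv\<^bsub>\<Gamma>\<^esub> u" "u \<triangleright> x"]
        twist_commutes_module[OF yd', of u x] by (simp flip: mult.assoc) (simp add: mult.assoc)
    then show ?thesis by (simp add: tensP_def sum_distrib_left sum_distrib_right)
  qed
  have expand: "twist ?D (tensT T T') = (\<Sum>s\<in>carrier \<Gamma>. \<Sum>y\<in>carrier F. \<Sum>t\<in>carrier \<Gamma>. \<Sum>z\<in>carrier F.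
      ?D s y * ?D t z * (T s y * T' t z))"
  proof -
    have "(\<Sum>s\<in>carrier \<Gamma>. \<Sum>y\<in>carrier F. \<Sum>t\<in>carrier \<Gamma>. \<Sum>z\<in>carrier F. ?D s y * ?D t z * (T s y * T' t z))
      = (\<Sum>s\<in>carrier \<Gamma>. \<Sum>y\<in>carrier F. \<Sum>t\<in>carrier \<Gamma>. if t = s \<triangleleft> y then
          \<Sum>z\<in>carrier F. \<sigma> s y z \<cdot> (?D s (y \<otimes>\<^bsub>F\<^esub> z) * (T s y * T' (s \<triangleleft> y) z)) else 0)"
      by (intro sum.cong refl) (auto simp: alg_repD[OF D])
    also have "\<dots> = (\<Sum>s\<in>carrier \<Gamma>. \<Sum>y\<in>carrier F. \<Sum>z\<in>carrier F.
          \<sigma> s y z \<cdot> (?D s (y \<otimes>\<^bsub>F\<^esub> z) * (T s y * T' (s \<triangleleft> y) z)))"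
      using finite_\<Gamma> by (intro sum.cong refl) simp
    also have "\<dots> = (\<Sum>s\<in>carrier \<Gamma>. \<Sum>y\<in>carrier F. \<Sum>x\<in>carrier F.
          \<sigma> s y (inv\<^bsub>F\<^esub> y \<otimes>\<^bsub>F\<^esub> x) \<cdot> (?D s x * (T s y * T' (s \<triangleleft> y) (inv\<^bsub>F\<^esub> y \<otimes>\<^bsub>F\<^esub> x))))"
      by (rule sum.cong[OF refl], rule sum.cong[OF refl], rule sum_translateF[symmetric])
    also have "\<dots> = (\<Sum>s\<in>carrier \<Gamma>. \<Sum>x\<in>carrier F. \<Sum>y\<in>carrier F.
          \<sigma> s y (inv\<^bsub>F\<^esub> y \<otimes>\<^bsub>F\<^esub> x) \<cdot> (?D s x * (T s y * T' (s \<triangleleft> y) (inv\<^bsub>F\<^esub> y \<otimes>\<^bsub>F\<^esub> x))))"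
      by (rule sum.cong[OF refl], rule sum.swap)
    also have "\<dots> = twist ?D (tensT T T')"
      by (simp add: twist_eq tensT_def sum_distrib_left)
    finally show ?thesis ..
  qed
  also have "\<dots> = (\<Sum>s\<in>carrier \<Gamma>. \<Sum>y\<in>carrier F. ?D s y *
      (\<Sum>t\<in>carrier \<Gamma>. \<Sum>z\<in>carrier F. ?D t z * (T s y * T' t z)))"
    by (simp add: sum_distrib_left mult.assoc)
  also have "\<dots> = (\<Sum>s\<in>carrier \<Gamma>. \<Sum>y\<in>carrier F. ?D s y *
      (\<Sum>t\<in>carrier \<Gamma>. \<Sum>z\<in>carrier F. P t z * (T s y * (twist P' T' * T' t z))))"
  proof (rule sum.cong[OF refl], rule sum.cong[OF refl])
    fix s y assume "s \<in> carrier \<Gamma>" "y \<in> carrier F"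
    then have "T s y * P' u x = P' u x * T s y" if "u \<in> carrier \<Gamma>" "x \<in> carrier F" for u x
      using that commutingD[OF comm(3)] by blast
    from sum_tensP_middle[OF T' this]
    show "?D s y * (\<Sum>t\<in>carrier \<Gamma>. \<Sum>z\<in>carrier F. ?D t z * (T s y * T' t z))
      = ?D s y * (\<Sum>t\<in>carrier \<Gamma>. \<Sum>z\<in>carrier F. P t z * (T s y * (twist P' T' * T' t z)))"
      by simp
  qed
  also have "\<dots> = (\<Sum>s\<in>carrier \<Gamma>. \<Sum>y\<in>carrier F. twist P' T' * (?D s y * twist P T' * T s y))"
  proof (intro sum.cong refl)
    fix s y assume sy: "s \<in> carrier \<Gamma>" "y \<in> carrier F"
    have "P t z * (T s y * (twist P' T' * T' t z)) = twist P' T' * (P t z * T' t z * T s y)"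
      if "t \<in> carrier \<Gamma>" "z \<in> carrier F" for t z
    proof -
      have "P t z * (T s y * (twist P' T' * T' t z)) = twist P' T' * (P t z * (T s y * T' t z))"
        using \<phi>'T[OF sy] \<phi>'P[OF that] by (metis mult.assoc)
      also have "T s y * T' t z = T' t z * T s y"
        using that sy by (intro commutingD[OF comm(4)])
      finally show ?thesis by (simp add: mult.assoc)
    qed
    then have "(\<Sum>t\<in>carrier \<Gamma>. \<Sum>z\<in>carrier F. P t z * (T s y * (twist P' T' * T' t z)))
        = twist P' T' * (twist P T' * T s y)"
      by (simp add: twist_eq[of P T'] sum_distrib_left sum_distrib_right)
    then show "?D s y * (\<Sum>t\<in>carrier \<Gamma>. \<Sum>z\<in>carrier F. P t z * (T s y * (twist P' T' * T' t z)))
        = twist P' T' * (?D s y * twist P T' * T s y)"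
      by (simp only: \<phi>'D[OF sy] flip: mult.assoc)
  qed
  also have "\<dots> = twist P' T' * (\<Sum>s\<in>carrier \<Gamma>. \<Sum>y\<in>carrier F. ?D s y * twist P T' * T s y)"
    by (simp add: sum_distrib_left)
  also have "(\<Sum>s\<in>carrier \<Gamma>. \<Sum>y\<in>carrier F. ?D s y * twist P T' * T s y)
      = (\<Sum>s\<in>carrier \<Gamma>. \<Sum>y\<in>carrier F. twist P T' * (tensP P' P s y * (1 * T s y)))"
    by (intro sum.cong refl)
      (simp add: tensP_twist_exchange[OF P yd' comm(1,2)] mult.assoc)
  also have "\<dots> = twist P T' * (\<Sum>s\<in>carrier \<Gamma>. \<Sum>y\<in>carrier F. tensP P' P s y * (1 * T s y))"
    by (simp only: sum_distrib_left)
  also have "(\<Sum>s\<in>carrier \<Gamma>. \<Sum>y\<in>carrier F. tensP P' P s y * (1 * T s y))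
      = (\<Sum>s\<in>carrier \<Gamma>. \<Sum>y\<in>carrier F. P' s y * (1 * (twist P T * T s y)))"
    by (rule sum_tensP_middle[OF T]) simp
  also have "\<dots> = (\<Sum>s\<in>carrier \<Gamma>. \<Sum>y\<in>carrier F. twist P T * (P' s y * T s y))"
    by (intro sum.cong refl) (simp add: \<phi>P' flip: mult.assoc)
  also have "\<dots> = twist P T * twist P' T"
    by (simp add: twist_eq[of P' T] sum_distrib_left)
  also have "twist P T' * (twist P T * twist P' T) = twist P T * (twist P T' * twist P' T)"
    using commuting_twist[OF twist_commutes_module[OF yd] \<phi>T'] by (simp flip: mult.assoc)
  also have "twist P' T' * (twist P T * (twist P T' * twist P' T))
      = twist P T * twist P' T' * (twist P T' * twist P' T)"
    using commuting_twist[OF \<phi>P' \<phi>T'] by (simp flip: mult.assoc)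
  finally show ?thesis .
qed

text \<open>
  This power of the twists of the two modules and of their tensor product is 1, and the double braiding is a
  quotient of these twists. The tensor product enters only through \<open>tensP\<close> and \<open>tensT\<close> and through the fact that its twist
  commutes with \<open>tensP\<close>. This fact can be read off from
  the formula for the twist.
\<close>

lemma double_braiding_exponent:
  assumes yd: "yd P T" and yd': "yd P' T'"
    and comm: "commuting P P'" "commuting P T'" "commuting T P'" "commuting T T'"
    and e: "\<And>s x. \<lbrakk>s \<in> carrier \<Gamma>; x \<in> carrier F\<rbrakk>
      \<Longrightarrow> orb_coeff \<sigma> \<tau> (group_exponent (bowtie F \<Gamma> (\<triangleright>) (\<triangleleft>))) s x ^ e = 1"
  shows "(twist P T' * twist P' T) ^ (e * group_exponent (bowtie F \<Gamma> (\<triangleright>) (\<triangleleft>))) = 1"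
proof -
  define N where "N = e * group_exponent (bowtie F \<Gamma> (\<triangleright>) (\<triangleleft>))"
  note P = ydD(1)[OF yd] and T = ydD(2)[OF yd] and P' = ydD(1)[OF yd'] and T' = ydD(2)[OF yd']
  note comm' = comm[THEN commuting_sym]
  let ?\<phi> = "twist P T" and ?\<phi>' = "twist P' T'" and ?B = "twist P T' * twist P' T"
  let ?D = "tensP P P'"
  have \<phi>: "?\<phi> * P s x = P s x * ?\<phi>" "?\<phi> * T s x = T s x * ?\<phi>"
      "?\<phi> * P' s x = P' s x * ?\<phi>" "?\<phi> * T' s x = T' s x * ?\<phi>"
    and \<phi>': "?\<phi>' * P s x = P s x * ?\<phi>'" "?\<phi>' * T s x = T s x * ?\<phi>'"
      "?\<phi>' * P' s x = P' s x * ?\<phi>'" "?\<phi>' * T' s x = T' s x * ?\<phi>'"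
    if sx: "s \<in> carrier \<Gamma>" "x \<in> carrier F" for s x
  proof -
    show "?\<phi> * P s x = P s x * ?\<phi>" "?\<phi>' * P' s x = P' s x * ?\<phi>'"
      by (rule twist_commutes_module[OF yd sx] twist_commutes_module[OF yd' sx])+
    show "?\<phi> * T s x = T s x * ?\<phi>" "?\<phi>' * T' s x = T' s x * ?\<phi>'"
      by (rule twist_commutes_comodule[OF yd sx, symmetric] twist_commutes_comodule[OF yd' sx, symmetric])+
    show "?\<phi> * P' s x = P' s x * ?\<phi>" "?\<phi> * T' s x = T' s x * ?\<phi>"
      "?\<phi>' * P s x = P s x * ?\<phi>'" "?\<phi>' * T s x = T s x * ?\<phi>'"
      by (intro twist_commutes_family comm comm' sx)+
  qed
  have \<phi>\<phi>': "?\<phi> * ?\<phi>' = ?\<phi>' * ?\<phi>" by (rule commuting_twist) (simp_all add: \<phi>)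
  have comm_prod: "a * (b * c) = b * c * a" if "a * b = b * a" "a * c = c * a" for a b c :: 'e
    using that by (metis mult.assoc)
  have \<phi>B: "?\<phi> * ?B = ?B * ?\<phi>"
    by (rule comm_prod[OF commuting_twist[OF \<phi>(1,4)] commuting_twist[OF \<phi>(3,2)]])
  have \<phi>'B: "?\<phi>' * ?B = ?B * ?\<phi>'"
    by (rule comm_prod[OF commuting_twist[OF \<phi>'(1,4)] commuting_twist[OF \<phi>'(3,2)]])
  have D_comm: "a * ?D s x = ?D s x * a"
    if sx: "s \<in> carrier \<Gamma>" "x \<in> carrier F"
      and a: "\<And>s x. \<lbrakk>s \<in> carrier \<Gamma>; x \<in> carrier F\<rbrakk> \<Longrightarrow> a * P s x = P s x * a"
        "\<And>s x. \<lbrakk>s \<in> carrier \<Gamma>; x \<in> carrier F\<rbrakk> \<Longrightarrow> a * P' s x = P' s x * a" for a s x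
  proof -
    have "a * (P (s \<otimes>\<^bsub>\<Gamma>\<^esub> inv\<^bsub>\<Gamma>\<^esub> u) (u \<triangleright> x) * P' u x) = P (s \<otimes>\<^bsub>\<Gamma>\<^esub> inv\<^bsub>\<Gamma>\<^esub> u) (u \<triangleright> x) * P' u x * a"
      if u: "u \<in> carrier \<Gamma>" for u
      using u sx by (intro comm_prod a) auto
    then show ?thesis by (simp add: tensP_def sum_distrib_left sum_distrib_right)
  qed
  have B_D: "?B * ?D s x = ?D s x * ?B" if sx: "s \<in> carrier \<Gamma>" "x \<in> carrier F" for s x
  proof -
    have "twist P' T * ?D s x = tensP P' P s x * twist P' T"
      by (rule tensP_twist_exchange[OF P' yd comm'(1,3) sx, symmetric])
    moreover have "?D s x * twist P T' = twist P T' * tensP P' P s x"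
      by (rule tensP_twist_exchange[OF P yd' comm(1,2) sx])
    ultimately show ?thesis by (simp add: mult.assoc) (simp flip: mult.assoc)
  qed
  have tens: "twist ?D (tensT T T') = ?\<phi> * ?\<phi>' * ?B"
    by (rule twist_tensor[OF yd yd' comm])
  have "(?\<phi> * ?\<phi>' * ?B) ^ N = 1"
    unfolding N_def tens[symmetric]
  proof (rule twist_exponent[OF alg_rep_tensP[OF P P' comm(1)] coalg_rep_tensT[OF T T' comm(4)] _ e])
    fix s x assume sx: "s \<in> carrier \<Gamma>" "x \<in> carrier F"
    have "?\<phi> * ?D s x = ?D s x * ?\<phi>" "?\<phi>' * ?D s x = ?D s x * ?\<phi>'"
      by (rule D_comm[OF sx \<phi>(1,3)] D_comm[OF sx \<phi>'(1,3)]; assumption)+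
    then show "twist ?D (tensT T T') * ?D s x = ?D s x * twist ?D (tensT T T')"
      unfolding tens using B_D[OF sx] comm_prod[of "?D s x" "?\<phi> * ?\<phi>'" ?B] comm_prod[of "?D s x" ?\<phi> ?\<phi>']
      by simp
  qed
  moreover have "(?\<phi> * ?\<phi>' * ?B) ^ N = ?\<phi> ^ N * ?\<phi>' ^ N * ?B ^ N"
  proof -
    have "?\<phi> * ?\<phi>' * ?B = ?B * (?\<phi> * ?\<phi>')"
      using comm_prod[of ?B ?\<phi> ?\<phi>'] \<phi>B \<phi>'B by simp
    then have "(?\<phi> * ?\<phi>' * ?B) ^ N = (?\<phi> * ?\<phi>') ^ N * ?B ^ N"
      by (rule power_mult_commuting)
    then show ?thesis unfolding power_mult_commuting[OF \<phi>\<phi>'] .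
  qed
  moreover have "?\<phi> ^ N = 1" "?\<phi>' ^ N = 1"
    unfolding N_def
    by (rule twist_exponent[OF P T \<phi>(1) e] twist_exponent[OF P' T' \<phi>'(3) e]; assumption)+
  ultimately show ?thesis by (simp add: N_def)
qed

end

section \<open>Bialgebra maps in coordinates\<close>

lemma sum_of_bool_eq:
  fixes g :: "'i \<Rightarrow> 'k::semiring_1"
  assumes "finite I"
  shows "(\<Sum>i\<in>I. of_bool (i = a) * g i) = (if a \<in> I then g a else 0)"
    and "(\<Sum>i\<in>I. of_bool (a = i) * g i) = (if a \<in> I then g a else 0)"
    and "(\<Sum>i\<in>I. g i * of_bool (i = a)) = (if a \<in> I then g a else 0)"
    and "(\<Sum>i\<in>I. g i * of_bool (a = i)) = (if a \<in> I then g a else 0)"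
proof -
  have "(\<Sum>i\<in>I. of_bool (i = a) * g i) = (\<Sum>i\<in>I. if i = a then g i else 0)"
    "(\<Sum>i\<in>I. of_bool (a = i) * g i) = (\<Sum>i\<in>I. if i = a then g i else 0)"
    "(\<Sum>i\<in>I. g i * of_bool (i = a)) = (\<Sum>i\<in>I. if i = a then g i else 0)"
    "(\<Sum>i\<in>I. g i * of_bool (a = i)) = (\<Sum>i\<in>I. if i = a then g i else 0)"
    by (rule sum.cong; force)+
  then show "(\<Sum>i\<in>I. of_bool (i = a) * g i) = (if a \<in> I then g a else 0)"
    "(\<Sum>i\<in>I. of_bool (a = i) * g i) = (if a \<in> I then g a else 0)"
    "(\<Sum>i\<in>I. g i * of_bool (i = a)) = (if a \<in> I then g a else 0)"
    "(\<Sum>i\<in>I. g i * of_bool (a = i)) = (if a \<in> I then g a else 0)"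
    using assms by simp_all
qed

lemma bvec_in_vecs [simp]: "bvec I i \<in> vecs I"
  by (simp add: bvec_def vecs_def)

lemma lmap_bvec:
  assumes "finite I" "i \<in> I"
  shows "lmap I J f (bvec I i) = (\<lambda>j\<in>J. f i j)"
proof -
  have "(\<Sum>i'\<in>I. bvec I i i' * f i' j) = f i j" for j
  proof -
    have "(\<Sum>i'\<in>I. bvec I i i' * f i' j) = (\<Sum>i'\<in>I. of_bool (i' = i) * f i' j)"
      by (rule sum.cong) (auto simp: bvec_def)
    then show ?thesis using assms by (simp add: sum_of_bool_eq)
  qed
  then show ?thesis by (simp add: lmap_def)
qed

lemma vmult_bvec:
  assumes "finite (basis A)" "i \<in> basis A" "j \<in> basis A"
  shows "vmult A (bvec (basis A) i) (bvec (basis A) j) = (\<lambda>l\<in>basis A. mlt A i j l)"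
proof -
  have "(\<Sum>i'\<in>basis A. \<Sum>j'\<in>basis A. bvec (basis A) i i' * bvec (basis A) j j' * mlt A i' j' l) = mlt A i j l" for l
  proof -
    have "(\<Sum>i'\<in>basis A. \<Sum>j'\<in>basis A. bvec (basis A) i i' * bvec (basis A) j j' * mlt A i' j' l)
      = (\<Sum>i'\<in>basis A. of_bool (i' = i) * (\<Sum>j'\<in>basis A. of_bool (j' = j) * mlt A i' j' l))"
      unfolding sum_distrib_left by (intro sum.cong refl) (auto simp: bvec_def)
    then show ?thesis using assms by (simp add: sum_of_bool_eq)
  qed
  then show ?thesis by (simp add: vmult_def)
qed

lemma vcomult_bvec:
  assumes "finite (basis A)" "i \<in> basis A"
  shows "vcomult A (bvec (basis A) i) = (\<lambda>(j, l)\<in>basis A \<times> basis A. cml A i j l)"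
proof -
  have "(\<Sum>i'\<in>basis A. bvec (basis A) i i' * cml A i' j l) = cml A i j l" for j l
  proof -
    have "(\<Sum>i'\<in>basis A. bvec (basis A) i i' * cml A i' j l) = (\<Sum>i'\<in>basis A. of_bool (i' = i) * cml A i' j l)"
      by (rule sum.cong) (auto simp: bvec_def)
    then show ?thesis using assms by (simp add: sum_of_bool_eq)
  qed
  then show ?thesis by (simp add: vcomult_def)
qed

lemma vcounit_bvec:
  assumes "finite (basis A)" "i \<in> basis A"
  shows "vcounit A (bvec (basis A) i) = cou A i"
proof -
  have "(\<Sum>i'\<in>basis A. bvec (basis A) i i' * cou A i') = (\<Sum>i'\<in>basis A. of_bool (i' = i) * cou A i')"
    by (rule sum.cong) (auto simp: bvec_def)
  then show ?thesis using assms by (simp add: vcounit_def sum_of_bool_eq)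
qed

lemma restrict_eq_iff: "restrict f I = restrict g I \<longleftrightarrow> (\<forall>i\<in>I. f i = g i)"
  by (metis restrict_apply' restrict_ext)

text \<open>
  By linearity the conditions on a bialgebra map need to be tested on basis vectors only.
\<close>

definition hopf_hom_coords :: "('i, 'k::field) bialg \<Rightarrow> ('j, 'k) bialg \<Rightarrow> ('i \<Rightarrow> 'j \<Rightarrow> 'k) \<Rightarrow> bool" where
  "hopf_hom_coords A B f \<longleftrightarrow>
    (\<forall>i\<in>basis A. \<forall>j\<in>basis A. \<forall>l\<in>basis B.
      (\<Sum>p\<in>basis A. mlt A i j p * f p l) = (\<Sum>a\<in>basis B. \<Sum>b\<in>basis B. f i a * f j b * mlt B a b l)) \<and>
    (\<forall>l\<in>basis B. (\<Sum>i\<in>basis A. unt A i * f i l) = unt B l) \<and>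
    (\<forall>i\<in>basis A. \<forall>q\<in>basis B. \<forall>r\<in>basis B.
      (\<Sum>j\<in>basis A. \<Sum>l\<in>basis A. cml A i j l * (f j q * f l r)) = (\<Sum>p\<in>basis B. f i p * cml B p q r)) \<and>
    (\<forall>i\<in>basis A. (\<Sum>p\<in>basis B. f i p * cou B p) = cou A i)"

lemma hopf_hom_coordsI:
  assumes fin: "finite (basis A)" "finite (basis B)" and h: "hopf_hom A B f"
  shows "hopf_hom_coords A B f"
  unfolding hopf_hom_coords_def
proof (intro conjI ballI)
  let ?I = "basis A" and ?J = "basis B"
  let ?f = "lmap ?I ?J f"
  note H = h[unfolded hopf_hom_def Let_def]
  fix i j l assume ij: "i \<in> ?I" "j \<in> ?I" and l: "l \<in> ?J"
  have "?f (vmult A (bvec ?I i) (bvec ?I j)) l = vmult B (?f (bvec ?I i)) (?f (bvec ?I j)) l"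
    using H by simp
  then show "(\<Sum>p\<in>?I. mlt A i j p * f p l) = (\<Sum>a\<in>?J. \<Sum>b\<in>?J. f i a * f j b * mlt B a b l)"
    using ij l fin by (simp add: vmult_bvec lmap_bvec) (simp add: lmap_def vmult_def)
next
  let ?I = "basis A" and ?J = "basis B"
  fix l assume l: "l \<in> ?J"
  have "lmap ?I ?J f (vunit A) l = vunit B l" using h by (simp add: hopf_hom_def Let_def)
  then show "(\<Sum>i\<in>?I. unt A i * f i l) = unt B l" using l by (simp add: lmap_def vunit_def)
next
  let ?I = "basis A" and ?J = "basis B"
  fix i q r assume i: "i \<in> ?I" and q: "q \<in> ?J" "r \<in> ?J"
  have "lmap (?I \<times> ?I) (?J \<times> ?J) (ltensor f f) (vcomult A (bvec ?I i)) (q, r) = vcomult B (lmap ?I ?J f (bvec ?I i)) (q, r)"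
    using h by (simp add: hopf_hom_def Let_def)
  then show "(\<Sum>j\<in>?I. \<Sum>l\<in>?I. cml A i j l * (f j q * f l r)) = (\<Sum>p\<in>?J. f i p * cml B p q r)"
    using i q fin by (simp add: vcomult_bvec lmap_bvec)
      (simp add: lmap_def vcomult_def ltensor_def sum.cartesian_product case_prod_unfold)
next
  let ?I = "basis A" and ?J = "basis B"
  fix i assume i: "i \<in> ?I"
  have "vcounit B (lmap ?I ?J f (bvec ?I i)) = vcounit A (bvec ?I i)"
    using h by (simp add: hopf_hom_def Let_def)
  then show "(\<Sum>p\<in>?J. f i p * cou B p) = cou A i"
    using i fin by (simp add: vcounit_bvec lmap_bvec) (simp add: vcounit_def)
qed

lemma hopf_hom_coordsD:
  fixes A :: "('i, 'k::field) bialg" and B :: "('j, 'k) bialg"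
  assumes fin: "finite (basis A)" "finite (basis B)" and h: "hopf_hom_coords A B f"
  shows "hopf_hom A B f"
  unfolding hopf_hom_def Let_def
proof (intro conjI ballI)
  let ?I = "basis A" and ?J = "basis B"
  let ?f = "lmap ?I ?J f"
  note H = h[unfolded hopf_hom_coords_def]
  fix v w :: "'i \<Rightarrow> 'k" assume "v \<in> vecs ?I" "w \<in> vecs ?I"
  have "?f (vmult A v w) l = vmult B (?f v) (?f w) l" if l: "l \<in> ?J" for l
  proof -
    have "?f (vmult A v w) l = (\<Sum>p\<in>?I. \<Sum>i\<in>?I. \<Sum>j\<in>?I. v i * w j * (mlt A i j p * f p l))"
      using l by (simp add: lmap_def vmult_def sum_distrib_right mult.assoc)
    also have "\<dots> = (\<Sum>i\<in>?I. \<Sum>p\<in>?I. \<Sum>j\<in>?I. v i * w j * (mlt A i j p * f p l))"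
      by (rule sum.swap)
    also have "\<dots> = (\<Sum>i\<in>?I. \<Sum>j\<in>?I. \<Sum>p\<in>?I. v i * w j * (mlt A i j p * f p l))"
      by (rule sum.cong[OF refl], rule sum.swap)
    also have "\<dots> = (\<Sum>i\<in>?I. \<Sum>j\<in>?I. v i * w j * (\<Sum>a\<in>?J. \<Sum>b\<in>?J. f i a * f j b * mlt B a b l))"
      using H l by (intro sum.cong refl) (simp flip: sum_distrib_left)
    also have "\<dots> = (\<Sum>i\<in>?I. \<Sum>j\<in>?I. \<Sum>a\<in>?J. \<Sum>b\<in>?J. v i * f i a * (w j * f j b) * mlt B a b l)"
      by (simp add: sum_distrib_left ac_simps)
    also have "\<dots> = (\<Sum>i\<in>?I. \<Sum>a\<in>?J. \<Sum>j\<in>?I. \<Sum>b\<in>?J. v i * f i a * (w j * f j b) * mlt B a b l)"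
      by (rule sum.cong[OF refl], rule sum.swap)
    also have "\<dots> = (\<Sum>a\<in>?J. \<Sum>i\<in>?I. \<Sum>j\<in>?I. \<Sum>b\<in>?J. v i * f i a * (w j * f j b) * mlt B a b l)"
      by (rule sum.swap)
    also have "\<dots> = (\<Sum>a\<in>?J. \<Sum>i\<in>?I. \<Sum>b\<in>?J. \<Sum>j\<in>?I. v i * f i a * (w j * f j b) * mlt B a b l)"
      by (rule sum.cong[OF refl], rule sum.cong[OF refl], rule sum.swap)
    also have "\<dots> = (\<Sum>a\<in>?J. \<Sum>b\<in>?J. \<Sum>i\<in>?I. \<Sum>j\<in>?I. v i * f i a * (w j * f j b) * mlt B a b l)"
      by (rule sum.cong[OF refl], rule sum.swap)
    also have "\<dots> = (\<Sum>a\<in>?J. \<Sum>b\<in>?J. (\<Sum>i\<in>?I. v i * f i a) * (\<Sum>j\<in>?I. w j * f j b) * mlt B a b l)"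
      by (intro sum.cong refl) (simp add: sum_distrib_left sum_distrib_right mult.assoc, rule sum.swap)
    also have "\<dots> = vmult B (?f v) (?f w) l"
      using l by (simp add: lmap_def vmult_def)
    finally show ?thesis .
  qed
  then show "?f (vmult A v w) = vmult B (?f v) (?f w)"
    by (intro extensionalityI[of _ ?J]) (auto simp: lmap_def vmult_def)
next
  show "lmap (basis A) (basis B) f (vunit A) = vunit B"
    using h by (auto simp: hopf_hom_coords_def lmap_def vunit_def restrict_eq_iff)
next
  let ?I = "basis A" and ?J = "basis B"
  let ?f = "lmap ?I ?J f"
  note H = h[unfolded hopf_hom_coords_def]
  fix v :: "'i \<Rightarrow> 'k" assume "v \<in> vecs ?I"
  have "lmap (?I \<times> ?I) (?J \<times> ?J) (ltensor f f) (vcomult A v) (q, r) = vcomult B (?f v) (q, r)"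
    if q: "q \<in> ?J" "r \<in> ?J" for q r
  proof -
    have "lmap (?I \<times> ?I) (?J \<times> ?J) (ltensor f f) (vcomult A v) (q, r)
      = (\<Sum>j\<in>?I. \<Sum>l\<in>?I. \<Sum>i\<in>?I. v i * (cml A i j l * (f j q * f l r)))"
      using q by (simp add: lmap_def vcomult_def ltensor_def sum.cartesian_product' sum_distrib_right mult.assoc)
    also have "\<dots> = (\<Sum>j\<in>?I. \<Sum>i\<in>?I. \<Sum>l\<in>?I. v i * (cml A i j l * (f j q * f l r)))"
      by (rule sum.cong[OF refl], rule sum.swap)
    also have "\<dots> = (\<Sum>i\<in>?I. \<Sum>j\<in>?I. \<Sum>l\<in>?I. v i * (cml A i j l * (f j q * f l r)))"
      by (rule sum.swap)
    also have "\<dots> = (\<Sum>i\<in>?I. v i * (\<Sum>p\<in>?J. f i p * cml B p q r))"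
      using H q by (intro sum.cong refl) (simp flip: sum_distrib_left)
    also have "\<dots> = (\<Sum>p\<in>?J. \<Sum>i\<in>?I. v i * f i p * cml B p q r)"
      unfolding sum_distrib_left by (subst sum.swap) (simp add: mult.assoc)
    also have "\<dots> = vcomult B (?f v) (q, r)"
      using q by (simp add: lmap_def vcomult_def sum_distrib_right)
    finally show ?thesis .
  qed
  then show "lmap (?I \<times> ?I) (?J \<times> ?J) (ltensor f f) (vcomult A v) = vcomult B (?f v)"
    by (intro extensionalityI[of _ "?J \<times> ?J"]) (auto simp: lmap_def vcomult_def)
next
  let ?I = "basis A" and ?J = "basis B"
  fix v :: "'i \<Rightarrow> 'k" assume "v \<in> vecs ?I"
  have "vcounit B (lmap ?I ?J f v) = (\<Sum>p\<in>?J. \<Sum>i\<in>?I. v i * (f i p * cou B p))"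
    by (simp add: vcounit_def lmap_def sum_distrib_right mult.assoc)
  also have "\<dots> = (\<Sum>i\<in>?I. v i * (\<Sum>p\<in>?J. f i p * cou B p))"
    unfolding sum_distrib_left by (rule sum.swap)
  also have "\<dots> = vcounit A v"
    using h by (simp add: vcounit_def hopf_hom_coords_def)
  finally show "vcounit B (lmap ?I ?J f v) = vcounit A v" .
qed

section \<open>Bicrossed products and the group of extensions\<close>

context matched_pair
begin

abbreviation "BP c \<equiv> bicrossed F \<Gamma> (\<triangleright>) (\<triangleleft>) c"

lemma bicrossed_simps:
  "basis (BP (\<sigma>, \<tau>)) = carrier \<Gamma> \<times> carrier F"
  "mlt (BP (\<sigma>, \<tau>)) (s, x) (t, y) (u, z) = of_bool (s \<triangleleft> x = t \<and> u = s \<and> z = x \<otimes>\<^bsub>F\<^esub> y) * \<sigma> s x y"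
  "unt (BP (\<sigma>, \<tau>)) (s, x) = of_bool (x = \<one>\<^bsub>F\<^esub>)"
  "cml (BP (\<sigma>, \<tau>)) (s, x) (t, y) (u, z) = of_bool (t \<otimes>\<^bsub>\<Gamma>\<^esub> u = s \<and> y = u \<triangleright> x \<and> z = x) * \<tau> x t u"
  "cou (BP (\<sigma>, \<tau>)) (s, x) = of_bool (s = \<one>\<^bsub>\<Gamma>\<^esub>)"
  by (simp_all add: bicrossed_def)

lemma finite_index: "finite (carrier \<Gamma> \<times> carrier F)"
  using finite_F finite_\<Gamma> by simp

lemma sum_mlt:
  assumes "s \<in> carrier \<Gamma>" "x \<in> carrier F" "y \<in> carrier F"
  shows "(\<Sum>p\<in>carrier \<Gamma> \<times> carrier F. mlt (BP (\<sigma>, \<tau>)) (s, x) (t, y) p * g p)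
    = of_bool (s \<triangleleft> x = t) * (\<sigma> s x y * g (s, x \<otimes>\<^bsub>F\<^esub> y))"
proof -
  have "(\<Sum>p\<in>carrier \<Gamma> \<times> carrier F. mlt (BP (\<sigma>, \<tau>)) (s, x) (t, y) p * g p)
    = (\<Sum>p\<in>carrier \<Gamma> \<times> carrier F. of_bool (p = (s, x \<otimes>\<^bsub>F\<^esub> y)) * (of_bool (s \<triangleleft> x = t) * (\<sigma> s x y * g p)))"
    by (intro sum.cong refl) (auto simp: bicrossed_simps)
  then show ?thesis using assms finite_index by (simp add: sum_of_bool_eq)
qed

lemma sum_cml_left:
  assumes "s \<in> carrier \<Gamma>" "x \<in> carrier F" "u \<in> carrier \<Gamma>"
  shows "(\<Sum>p\<in>carrier \<Gamma> \<times> carrier F. cml (BP (\<sigma>, \<tau>)) (s, x) p (u, z) * g p)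
    = of_bool (z = x) * (\<tau> x (s \<otimes>\<^bsub>\<Gamma>\<^esub> inv\<^bsub>\<Gamma>\<^esub> u) u * g (s \<otimes>\<^bsub>\<Gamma>\<^esub> inv\<^bsub>\<Gamma>\<^esub> u, u \<triangleright> x))"
proof -
  have eq: "t \<otimes>\<^bsub>\<Gamma>\<^esub> u = s \<longleftrightarrow> t = s \<otimes>\<^bsub>\<Gamma>\<^esub> inv\<^bsub>\<Gamma>\<^esub> u" if "t \<in> carrier \<Gamma>" for t
    using that assms by (auto simp: \<Gamma>.m_assoc)
  have "(\<Sum>p\<in>carrier \<Gamma> \<times> carrier F. cml (BP (\<sigma>, \<tau>)) (s, x) p (u, z) * g p)
    = (\<Sum>p\<in>carrier \<Gamma> \<times> carrier F. of_bool (p = (s \<otimes>\<^bsub>\<Gamma>\<^esub> inv\<^bsub>\<Gamma>\<^esub> u, u \<triangleright> x)) * (of_bool (z = x) * (\<tau> x (s \<otimes>\<^bsub>\<Gamma>\<^esub> inv\<^bsub>\<Gamma>\<^esub> u) u * g p)))"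
    by (intro sum.cong refl) (auto simp: bicrossed_simps eq)
  then show ?thesis using assms finite_index by (simp add: sum_of_bool_eq)
qed

lemma sum_cml_right:
  assumes "s \<in> carrier \<Gamma>" "x \<in> carrier F" "t \<in> carrier \<Gamma>"
  shows "(\<Sum>p\<in>carrier \<Gamma> \<times> carrier F. cml (BP (\<sigma>, \<tau>)) (s, x) (t, y) p * g p)
    = of_bool (y = (inv\<^bsub>\<Gamma>\<^esub> t \<otimes>\<^bsub>\<Gamma>\<^esub> s) \<triangleright> x) * (\<tau> x t (inv\<^bsub>\<Gamma>\<^esub> t \<otimes>\<^bsub>\<Gamma>\<^esub> s) * g (inv\<^bsub>\<Gamma>\<^esub> t \<otimes>\<^bsub>\<Gamma>\<^esub> s, x))"
proof -
  have eq: "t \<otimes>\<^bsub>\<Gamma>\<^esub> u = s \<longleftrightarrow> u = inv\<^bsub>\<Gamma>\<^esub> t \<otimes>\<^bsub>\<Gamma>\<^esub> s" if "u \<in> carrier \<Gamma>" for u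
    using that assms by (auto simp flip: \<Gamma>.m_assoc)
  have "(\<Sum>p\<in>carrier \<Gamma> \<times> carrier F. cml (BP (\<sigma>, \<tau>)) (s, x) (t, y) p * g p)
    = (\<Sum>p\<in>carrier \<Gamma> \<times> carrier F. of_bool (p = (inv\<^bsub>\<Gamma>\<^esub> t \<otimes>\<^bsub>\<Gamma>\<^esub> s, x)) *
        (of_bool (y = (inv\<^bsub>\<Gamma>\<^esub> t \<otimes>\<^bsub>\<Gamma>\<^esub> s) \<triangleright> x) * (\<tau> x t (inv\<^bsub>\<Gamma>\<^esub> t \<otimes>\<^bsub>\<Gamma>\<^esub> s) * g p)))"
  proof (rule sum.cong[OF refl], clarify)
    fix u z assume uz: "u \<in> carrier \<Gamma>" "z \<in> carrier F"
    show "cml (BP (\<sigma>, \<tau>)) (s, x) (t, y) (u, z) * g (u, z) = of_bool ((u, z) = (inv\<^bsub>\<Gamma>\<^esub> t \<otimes>\<^bsub>\<Gamma>\<^esub> s, x)) *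
        (of_bool (y = (inv\<^bsub>\<Gamma>\<^esub> t \<otimes>\<^bsub>\<Gamma>\<^esub> s) \<triangleright> x) * (\<tau> x t (inv\<^bsub>\<Gamma>\<^esub> t \<otimes>\<^bsub>\<Gamma>\<^esub> s) * g (u, z)))"
    proof (cases "u = inv\<^bsub>\<Gamma>\<^esub> t \<otimes>\<^bsub>\<Gamma>\<^esub> s")
      case True
      then have "t \<otimes>\<^bsub>\<Gamma>\<^esub> u = s" using eq uz by blast
      then show ?thesis by (auto simp: bicrossed_simps True[symmetric])
    qed (use eq[OF uz(1)] in \<open>simp add: bicrossed_simps\<close>)
  qed
  then show ?thesis using assms finite_index by (simp add: sum_of_bool_eq)
qed

lemma sum_cml:
  fixes g :: "'g \<times> 'f \<Rightarrow> 'g \<times> 'f \<Rightarrow> 'k::field"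
  assumes "s \<in> carrier \<Gamma>" "x \<in> carrier F"
  shows "(\<Sum>p\<in>carrier \<Gamma> \<times> carrier F. \<Sum>q\<in>carrier \<Gamma> \<times> carrier F. cml (BP (\<sigma>, \<tau>)) (s, x) p q * g p q)
    = (\<Sum>u\<in>carrier \<Gamma>. \<tau> x (s \<otimes>\<^bsub>\<Gamma>\<^esub> inv\<^bsub>\<Gamma>\<^esub> u) u * g (s \<otimes>\<^bsub>\<Gamma>\<^esub> inv\<^bsub>\<Gamma>\<^esub> u, u \<triangleright> x) (u, x))"
proof -
  have "(\<Sum>p\<in>carrier \<Gamma> \<times> carrier F. \<Sum>q\<in>carrier \<Gamma> \<times> carrier F. cml (BP (\<sigma>, \<tau>)) (s, x) p q * g p q)
    = (\<Sum>q\<in>carrier \<Gamma> \<times> carrier F. \<Sum>p\<in>carrier \<Gamma> \<times> carrier F. cml (BP (\<sigma>, \<tau>)) (s, x) p q * g p q)"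
    by (rule sum.swap)
  also have "\<dots> = (\<Sum>(u, z)\<in>carrier \<Gamma> \<times> carrier F. of_bool (z = x) *
      (\<tau> x (s \<otimes>\<^bsub>\<Gamma>\<^esub> inv\<^bsub>\<Gamma>\<^esub> u) u * g (s \<otimes>\<^bsub>\<Gamma>\<^esub> inv\<^bsub>\<Gamma>\<^esub> u, u \<triangleright> x) (u, z)))"
    using assms by (intro sum.cong refl) (clarsimp simp only: sum_cml_left mem_Times_iff fst_conv snd_conv split: prod.split)
  also have "\<dots> = (\<Sum>u\<in>carrier \<Gamma>. \<Sum>z\<in>carrier F. of_bool (z = x) *
      (\<tau> x (s \<otimes>\<^bsub>\<Gamma>\<^esub> inv\<^bsub>\<Gamma>\<^esub> u) u * g (s \<otimes>\<^bsub>\<Gamma>\<^esub> inv\<^bsub>\<Gamma>\<^esub> u, u \<triangleright> x) (u, z)))"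
    by (rule sum.cartesian_product[symmetric])
  finally show ?thesis using assms finite_F by (simp add: sum_of_bool_eq)
qed

end

context bicrossed_datum
begin

lemma \<sigma>_inv_right:
  assumes "s \<in> carrier \<Gamma>" "x \<in> carrier F"
  shows "\<sigma> (s \<triangleleft> x) (inv\<^bsub>F\<^esub> x) x = \<sigma> s x (inv\<^bsub>F\<^esub> x)"
  using \<sigma>_cocycle[of s x "inv\<^bsub>F\<^esub> x" x] assms by (simp add: \<sigma>_one_left \<sigma>_one_right)

lemma \<tau>_inv_left:
  assumes "s \<in> carrier \<Gamma>" "x \<in> carrier F"
  shows "\<tau> (s \<triangleright> x) s (inv\<^bsub>\<Gamma>\<^esub> s) = \<tau> x (inv\<^bsub>\<Gamma>\<^esub> s) s"
  using \<tau>_cocycle[of x s "inv\<^bsub>\<Gamma>\<^esub> s" s] assms by (simp add: \<tau>_one_left \<tau>_one_right)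

text \<open>
  The sums over the basis collapse by \<open>sum_mlt\<close>, \<open>sum_cml\<close> and their variants, and what remains of each axiom is one
  of the identities of the locale.
\<close>

lemma bialgebra_bicrossed: "bialgebra (BP (\<sigma>, \<tau>))"
proof
  let ?A = "BP (\<sigma>, \<tau>)" and ?q = "\<lambda>s u. s \<otimes>\<^bsub>\<Gamma>\<^esub> inv\<^bsub>\<Gamma>\<^esub> u"
  note [simp] = bicrossed_simps sum_mlt sum_cml_left sum_cml_right
  show "finite (basis ?A)" using finite_index by simp
  {
    fix i j l n assume "i \<in> basis ?A" "j \<in> basis ?A" "l \<in> basis ?A" "n \<in> basis ?A"
    then obtain s x t y u z v w where *: "i = (s, x)" "j = (t, y)" "l = (u, z)" "n = (v, w)"
      "s \<in> carrier \<Gamma>" "t \<in> carrier \<Gamma>" "u \<in> carrier \<Gamma>" "v \<in> carrier \<Gamma>"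
      "x \<in> carrier F" "y \<in> carrier F" "z \<in> carrier F" "w \<in> carrier F" by auto
    show "(\<Sum>p\<in>basis ?A. mlt ?A i j p * mlt ?A p l n) = (\<Sum>p\<in>basis ?A. mlt ?A j l p * mlt ?A i p n)"
      using * \<sigma>_cocycle[of s x y z] by (auto simp: ract_mult F.m_assoc) (simp_all add: ac_simps)?
    have q: "?q (?q s v) u = ?q s (u \<otimes>\<^bsub>\<Gamma>\<^esub> v)" if "u \<in> carrier \<Gamma>" "v \<in> carrier \<Gamma>" for u v
      using * that by (simp add: \<Gamma>.m_assoc \<Gamma>.inv_mult_group)
    have eqs: "t \<otimes>\<^bsub>\<Gamma>\<^esub> u = ?q s v \<longleftrightarrow> u \<otimes>\<^bsub>\<Gamma>\<^esub> v = inv\<^bsub>\<Gamma>\<^esub> t \<otimes>\<^bsub>\<Gamma>\<^esub> s"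
    proof
      assume "t \<otimes>\<^bsub>\<Gamma>\<^esub> u = ?q s v"
      then have "t \<otimes>\<^bsub>\<Gamma>\<^esub> u \<otimes>\<^bsub>\<Gamma>\<^esub> v = ?q s v \<otimes>\<^bsub>\<Gamma>\<^esub> v" by simp
      then have "t \<otimes>\<^bsub>\<Gamma>\<^esub> (u \<otimes>\<^bsub>\<Gamma>\<^esub> v) = s" using * by (simp add: \<Gamma>.m_assoc)
      then show "u \<otimes>\<^bsub>\<Gamma>\<^esub> v = inv\<^bsub>\<Gamma>\<^esub> t \<otimes>\<^bsub>\<Gamma>\<^esub> s"
        using *(5-8) by (metis \<Gamma>.inv_solve_left \<Gamma>.m_closed)
    next
      assume "u \<otimes>\<^bsub>\<Gamma>\<^esub> v = inv\<^bsub>\<Gamma>\<^esub> t \<otimes>\<^bsub>\<Gamma>\<^esub> s"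
      then have "t \<otimes>\<^bsub>\<Gamma>\<^esub> (u \<otimes>\<^bsub>\<Gamma>\<^esub> v) \<otimes>\<^bsub>\<Gamma>\<^esub> inv\<^bsub>\<Gamma>\<^esub> v = t \<otimes>\<^bsub>\<Gamma>\<^esub> (inv\<^bsub>\<Gamma>\<^esub> t \<otimes>\<^bsub>\<Gamma>\<^esub> s) \<otimes>\<^bsub>\<Gamma>\<^esub> inv\<^bsub>\<Gamma>\<^esub> v" by simp
      moreover have "t \<otimes>\<^bsub>\<Gamma>\<^esub> (inv\<^bsub>\<Gamma>\<^esub> t \<otimes>\<^bsub>\<Gamma>\<^esub> s) = s" using * by (simp flip: \<Gamma>.m_assoc)
      ultimately show "t \<otimes>\<^bsub>\<Gamma>\<^esub> u = ?q s v" using * by (simp add: \<Gamma>.m_assoc)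
    qed
    show "(\<Sum>p\<in>basis ?A. cml ?A i p n * cml ?A p j l) = (\<Sum>p\<in>basis ?A. cml ?A i j p * cml ?A p l n)"
    proof (cases "t \<otimes>\<^bsub>\<Gamma>\<^esub> u = ?q s v \<and> w = x \<and> z = v \<triangleright> x \<and> y = u \<triangleright> (v \<triangleright> x)")
      case True
      then have 1: "?q s v = t \<otimes>\<^bsub>\<Gamma>\<^esub> u" "inv\<^bsub>\<Gamma>\<^esub> t \<otimes>\<^bsub>\<Gamma>\<^esub> s = u \<otimes>\<^bsub>\<Gamma>\<^esub> v" using eqs by auto
      show ?thesis using True * \<tau>_cocycle[of x t u v] by (simp add: 1 lact_mult) (simp add: mult.commute)
    next
      case False
      have "of_bool (w = x) * of_bool (t \<otimes>\<^bsub>\<Gamma>\<^esub> u = ?q s v \<and> y = u \<triangleright> v \<triangleright> x \<and> z = v \<triangleright> x) = (0::'k)"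
        using False by auto
      moreover have "of_bool (y = (inv\<^bsub>\<Gamma>\<^esub> t \<otimes>\<^bsub>\<Gamma>\<^esub> s) \<triangleright> x) * of_bool (u \<otimes>\<^bsub>\<Gamma>\<^esub> v = inv\<^bsub>\<Gamma>\<^esub> t \<otimes>\<^bsub>\<Gamma>\<^esub> s \<and> z = v \<triangleright> x \<and> w = x) = (0::'k)"
      proof (cases "u \<otimes>\<^bsub>\<Gamma>\<^esub> v = inv\<^bsub>\<Gamma>\<^esub> t \<otimes>\<^bsub>\<Gamma>\<^esub> s")
        case True
        then show ?thesis using False eqs * by (auto simp: lact_mult simp flip: True)
      qed simp
      ultimately show ?thesis using * by auto
    qed
  }
  {
    fix i j assume "i \<in> basis ?A" "j \<in> basis ?A"
    then obtain s x t y where *: "i = (s, x)" "j = (t, y)"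
      "s \<in> carrier \<Gamma>" "t \<in> carrier \<Gamma>" "x \<in> carrier F" "y \<in> carrier F" by auto
    have "(\<Sum>p\<in>basis ?A. unt ?A p * mlt ?A p i j)
      = (\<Sum>p\<in>carrier \<Gamma> \<times> carrier F. of_bool (p = (s, \<one>\<^bsub>F\<^esub>)) * of_bool (i = j))"
      using * by (intro sum.cong) (auto simp: \<sigma>_one_left)
    then show "(\<Sum>p\<in>basis ?A. unt ?A p * mlt ?A p i j) = of_bool (i = j)"
      using * finite_index by (simp add: sum_of_bool_eq)
    have "(\<Sum>p\<in>basis ?A. unt ?A p * mlt ?A i p j)
      = (\<Sum>p\<in>carrier \<Gamma> \<times> carrier F. of_bool (p = (s \<triangleleft> x, \<one>\<^bsub>F\<^esub>)) * of_bool (i = j))"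
      using * by (intro sum.cong) (auto simp: \<sigma>_one_right)
    then show "(\<Sum>p\<in>basis ?A. unt ?A p * mlt ?A i p j) = of_bool (i = j)"
      using * finite_index by (simp add: sum_of_bool_eq)
    have "(\<Sum>p\<in>basis ?A. cml ?A i p j * cou ?A p) = of_bool (y = x) * (\<tau> x (?q s t) t * of_bool (?q s t = \<one>\<^bsub>\<Gamma>\<^esub>))"
      using * by simp
    also have "?q s t = \<one>\<^bsub>\<Gamma>\<^esub> \<longleftrightarrow> s = t"
      using * \<Gamma>.inv_equality by fastforce
    finally show "(\<Sum>p\<in>basis ?A. cml ?A i p j * cou ?A p) = of_bool (i = j)"
      using * by (auto simp: \<tau>_one_left)
    have "(\<Sum>p\<in>basis ?A. cml ?A i j p * cou ?A p)
        = of_bool (y = (inv\<^bsub>\<Gamma>\<^esub> t \<otimes>\<^bsub>\<Gamma>\<^esub> s) \<triangleright> x) * (\<tau> x t (inv\<^bsub>\<Gamma>\<^esub> t \<otimes>\<^bsub>\<Gamma>\<^esub> s) * of_bool (inv\<^bsub>\<Gamma>\<^esub> t \<otimes>\<^bsub>\<Gamma>\<^esub> s = \<one>\<^bsub>\<Gamma>\<^esub>))"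
      using * by simp
    also have "inv\<^bsub>\<Gamma>\<^esub> t \<otimes>\<^bsub>\<Gamma>\<^esub> s = \<one>\<^bsub>\<Gamma>\<^esub> \<longleftrightarrow> s = t"
      using * \<Gamma>.inv_equality by fastforce
    finally show "(\<Sum>p\<in>basis ?A. cml ?A i j p * cou ?A p) = of_bool (i = j)"
      using * by (auto simp: \<tau>_one_right)
    show "(\<Sum>l\<in>basis ?A. mlt ?A i j l * cou ?A l) = cou ?A i * cou ?A j"
      using * by (cases "s = \<one>\<^bsub>\<Gamma>\<^esub>") (auto simp: \<sigma>_unit)
  }
  {
    fix i j p q assume "i \<in> basis ?A" "j \<in> basis ?A" "p \<in> basis ?A" "q \<in> basis ?A"
    then obtain s x t y a b v z where *: "i = (s, x)" "j = (t, y)" "p = (a, b)" "q = (v, z)"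
      "s \<in> carrier \<Gamma>" "t \<in> carrier \<Gamma>" "a \<in> carrier \<Gamma>" "v \<in> carrier \<Gamma>"
      "x \<in> carrier F" "y \<in> carrier F" "b \<in> carrier F" "z \<in> carrier F" by auto
    let ?B = "carrier \<Gamma> \<times> carrier F"
    have "(\<Sum>a\<in>?B. \<Sum>b\<in>?B. \<Sum>c\<in>?B. \<Sum>d\<in>?B.
        cml ?A i a b * cml ?A j c d * mlt ?A a c p * mlt ?A b d q)
      = (\<Sum>a\<in>?B. \<Sum>b\<in>?B. cml ?A i a b * (\<Sum>c\<in>?B. \<Sum>d\<in>?B. cml ?A j c d * (mlt ?A a c p * mlt ?A b d q)))"
      by (simp only: sum_distrib_left mult.assoc)
    also have "\<dots> = (\<Sum>u\<in>carrier \<Gamma>. \<tau> x (?q s u) u * (\<Sum>u'\<in>carrier \<Gamma>. \<tau> y (?q t u') u' *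
        (mlt ?A (?q s u, u \<triangleright> x) (?q t u', u' \<triangleright> y) p * mlt ?A (u, x) (u', y) q)))"
      unfolding *(1,2) by (simp only: sum_cml *)
    also have "\<dots> = (\<Sum>u\<in>carrier \<Gamma>. \<tau> x (?q s u) u * (\<Sum>u'\<in>carrier \<Gamma>. of_bool (u' = u \<triangleleft> x) * (\<tau> y (?q t u') u' *
        (mlt ?A (?q s u, u \<triangleright> x) (?q t u', u' \<triangleright> y) p * (of_bool (v = u \<and> z = x \<otimes>\<^bsub>F\<^esub> y) * \<sigma> u x y)))))"
      by (rule sum.cong[OF refl], rule arg_cong2[where f = "(*)"], rule refl, rule sum.cong[OF refl]) (auto simp: *)
    also have "\<dots> = (\<Sum>u\<in>carrier \<Gamma>. of_bool (u = v) * (\<tau> x (?q s u) u * \<tau> y (?q t (u \<triangleleft> x)) (u \<triangleleft> x) *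
        (mlt ?A (?q s u, u \<triangleright> x) (?q t (u \<triangleleft> x), (u \<triangleleft> x) \<triangleright> y) p * (of_bool (z = x \<otimes>\<^bsub>F\<^esub> y) * \<sigma> u x y))))"
      using * finite_\<Gamma> by (intro sum.cong refl) (auto simp: sum_of_bool_eq simp del: bicrossed_simps(2))
    also have "\<dots> = \<tau> x (?q s v) v * \<tau> y (?q t (v \<triangleleft> x)) (v \<triangleleft> x) *
        (mlt ?A (?q s v, v \<triangleright> x) (?q t (v \<triangleleft> x), (v \<triangleleft> x) \<triangleright> y) p * (of_bool (z = x \<otimes>\<^bsub>F\<^esub> y) * \<sigma> v x y))"
      using * finite_\<Gamma> by (simp add: sum_of_bool_eq del: bicrossed_simps(2))
    also have "\<dots> = of_bool (s \<triangleleft> x = t) * (\<sigma> s x y * cml ?A (s, x \<otimes>\<^bsub>F\<^esub> y) p q)"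
    proof -
      have iff1: "?q s v \<triangleleft> (v \<triangleright> x) = ?q t (v \<triangleleft> x) \<longleftrightarrow> s \<triangleleft> x = t"
      proof
        assume "?q s v \<triangleleft> (v \<triangleright> x) = ?q t (v \<triangleleft> x)"
        then show "s \<triangleleft> x = t" using ract_matched[of "?q s v" v x] * by (simp add: \<Gamma>.m_assoc)
      next
        assume "s \<triangleleft> x = t"
        then show "?q s v \<triangleleft> (v \<triangleright> x) = ?q t (v \<triangleleft> x)"
          using ract_matched[of "?q s v" v x] * by (auto simp: \<Gamma>.m_assoc)
      qed
      have iff2: "a \<otimes>\<^bsub>\<Gamma>\<^esub> v = s \<longleftrightarrow> a = ?q s v" using * by (auto simp: \<Gamma>.m_assoc)
      have F: "(v \<triangleright> x) \<otimes>\<^bsub>F\<^esub> ((v \<triangleleft> x) \<triangleright> y) = v \<triangleright> (x \<otimes>\<^bsub>F\<^esub> y)" using lact_matched[of v x y] * by simp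
      show ?thesis
      proof (cases "s \<triangleleft> x = t \<and> a = ?q s v \<and> b = v \<triangleright> (x \<otimes>\<^bsub>F\<^esub> y) \<and> z = x \<otimes>\<^bsub>F\<^esub> y")
        case True
        then have t: "?q t (v \<triangleleft> x) = ?q s v \<triangleleft> (v \<triangleright> x)" using iff1 by simp
        show ?thesis
          using True * compat[of "?q s v" v x y] by (simp add: t iff2 F \<Gamma>.m_assoc ac_simps)
      next
        case False
        then show ?thesis using * by (auto simp: iff1 iff2 F)
      qed
    qed
    also have "\<dots> = (\<Sum>l\<in>?B. mlt ?A i j l * cml ?A l p q)"
      using * by (simp del: bicrossed_simps)
    finally show "(\<Sum>l\<in>basis ?A. mlt ?A i j l * cml ?A l p q) =
      (\<Sum>a\<in>basis ?A. \<Sum>b\<in>basis ?A. \<Sum>c\<in>basis ?A. \<Sum>d\<in>basis ?A.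
        cml ?A i a b * cml ?A j c d * mlt ?A a c p * mlt ?A b d q)"
      by (simp only: bicrossed_simps(1))
  }
  {
    fix p q assume "p \<in> basis ?A" "q \<in> basis ?A"
    then obtain s x t y where *: "p = (s, x)" "q = (t, y)"
      "s \<in> carrier \<Gamma>" "t \<in> carrier \<Gamma>" "x \<in> carrier F" "y \<in> carrier F" by auto
    have "(\<Sum>i\<in>basis ?A. unt ?A i * cml ?A i p q)
      = (\<Sum>i\<in>carrier \<Gamma> \<times> carrier F. of_bool (i = (s \<otimes>\<^bsub>\<Gamma>\<^esub> t, \<one>\<^bsub>F\<^esub>)) * of_bool (x = \<one>\<^bsub>F\<^esub> \<and> y = \<one>\<^bsub>F\<^esub>))"
      using * by (intro sum.cong) (auto simp: \<tau>_unit)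
    then show "(\<Sum>i\<in>basis ?A. unt ?A i * cml ?A i p q) = unt ?A p * unt ?A q"
      using * finite_index by (simp add: sum_of_bool_eq)
  }
  have "(\<Sum>i\<in>basis ?A. unt ?A i * cou ?A i) = (\<Sum>i\<in>carrier \<Gamma> \<times> carrier F. of_bool (i = (\<one>\<^bsub>\<Gamma>\<^esub>, \<one>\<^bsub>F\<^esub>)) * 1)"
    by (intro sum.cong) auto
  then show "(\<Sum>i\<in>basis ?A. unt ?A i * cou ?A i) = 1"
    using finite_index by (simp only: sum_of_bool_eq) simp
qed

text \<open>
  The antipode sends \<open>e\<^sub>s # x\<close> to a multiple of the basis vector with the indices inverse to \<open>s \<triangleleft> x\<close> and
  \<open>s \<triangleright> x\<close>. The scalar \<open>c s x\<close> compensates the values of \<open>\<tau>\<close> and \<open>\<sigma>\<close> that arise from the coproduct and the product.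
\<close>

lemma hopf_algebra_bicrossed: "hopf_algebra (BP (\<sigma>, \<tau>))"
proof -
  interpret bialgebra "BP (\<sigma>, \<tau>)" by (rule bialgebra_bicrossed)
  let ?A = "BP (\<sigma>, \<tau>)" and ?B = "carrier \<Gamma> \<times> carrier F"
  let ?q = "\<lambda>s u. s \<otimes>\<^bsub>\<Gamma>\<^esub> inv\<^bsub>\<Gamma>\<^esub> u"
  define c where "c s x = inverse (\<tau> x (inv\<^bsub>\<Gamma>\<^esub> s) s * \<sigma> (inv\<^bsub>\<Gamma>\<^esub> s) (s \<triangleright> x) (inv\<^bsub>F\<^esub> (s \<triangleright> x)))" for s x
  define S where "S = (\<lambda>(s, x) p. of_bool (p = (inv\<^bsub>\<Gamma>\<^esub> (s \<triangleleft> x), inv\<^bsub>F\<^esub> (s \<triangleright> x))) * c s x)"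
  have S: "(\<Sum>p\<in>?B. S (s, x) p * g p) = c s x * g (inv\<^bsub>\<Gamma>\<^esub> (s \<triangleleft> x), inv\<^bsub>F\<^esub> (s \<triangleright> x))"
    if "s \<in> carrier \<Gamma>" "x \<in> carrier F" for s x g
    using that finite_index by (simp add: S_def mult.assoc sum_of_bool_eq)
  have inv_act: "inv\<^bsub>\<Gamma>\<^esub> (t \<triangleleft> y) \<triangleleft> inv\<^bsub>F\<^esub> (t \<triangleright> y) = inv\<^bsub>\<Gamma>\<^esub> t" if "t \<in> carrier \<Gamma>" "y \<in> carrier F" for t y
    using that by (simp flip: ract_inv)
  have div_iff: "?q s u = inv\<^bsub>\<Gamma>\<^esub> u \<longleftrightarrow> s = \<one>\<^bsub>\<Gamma>\<^esub>" if "s \<in> carrier \<Gamma>" "u \<in> carrier \<Gamma>" for s u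
    using that by simp
  have inv_iff: "inv\<^bsub>\<Gamma>\<^esub> ?q s u = u \<longleftrightarrow> s = \<one>\<^bsub>\<Gamma>\<^esub>" if "s \<in> carrier \<Gamma>" "u \<in> carrier \<Gamma>" for s u
    using div_iff[OF that] that by (metis \<Gamma>.inv_closed \<Gamma>.inv_inv \<Gamma>.m_closed)
  have left: "(\<Sum>j\<in>?B. \<Sum>l\<in>?B. \<Sum>p\<in>?B. cml ?A (s, x) j l * S j p * mlt ?A p l (w, z))
      = of_bool (s = \<one>\<^bsub>\<Gamma>\<^esub>) * of_bool (z = \<one>\<^bsub>F\<^esub>)"
    if sx: "s \<in> carrier \<Gamma>" "x \<in> carrier F" and wz: "w \<in> carrier \<Gamma>" "z \<in> carrier F" for s x w z
  proof -
    have "(\<Sum>j\<in>?B. \<Sum>l\<in>?B. \<Sum>p\<in>?B. cml ?A (s, x) j l * S j p * mlt ?A p l (w, z))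
      = (\<Sum>j\<in>?B. \<Sum>l\<in>?B. cml ?A (s, x) j l * (\<Sum>p\<in>?B. S j p * mlt ?A p l (w, z)))"
      by (simp only: sum_distrib_left mult.assoc)
    also have "\<dots> = (\<Sum>u\<in>carrier \<Gamma>. \<tau> x (?q s u) u * (c (?q s u) (u \<triangleright> x) *
        mlt ?A (inv\<^bsub>\<Gamma>\<^esub> (?q s u \<triangleleft> (u \<triangleright> x)), inv\<^bsub>F\<^esub> (?q s u \<triangleright> (u \<triangleright> x))) (u, x) (w, z)))"
      unfolding sum_cml[OF sx] using sx by (intro sum.cong refl) (simp add: S)
    also have "\<dots> = (\<Sum>u\<in>carrier \<Gamma>. of_bool (u = w \<triangleleft> inv\<^bsub>F\<^esub> x) * (of_bool (s = \<one>\<^bsub>\<Gamma>\<^esub>) * of_bool (z = \<one>\<^bsub>F\<^esub>)))"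
    proof (rule sum.cong[OF refl])
      fix u assume u: "u \<in> carrier \<Gamma>"
      show "\<tau> x (?q s u) u * (c (?q s u) (u \<triangleright> x) *
        mlt ?A (inv\<^bsub>\<Gamma>\<^esub> (?q s u \<triangleleft> (u \<triangleright> x)), inv\<^bsub>F\<^esub> (?q s u \<triangleright> (u \<triangleright> x))) (u, x) (w, z))
        = of_bool (u = w \<triangleleft> inv\<^bsub>F\<^esub> x) * (of_bool (s = \<one>\<^bsub>\<Gamma>\<^esub>) * of_bool (z = \<one>\<^bsub>F\<^esub>))"
      proof (cases "s = \<one>\<^bsub>\<Gamma>\<^esub>")
        case False
        then show ?thesis using sx u by (simp add: bicrossed_simps inv_act inv_iff)
      next
        case True
        have q: "?q s u = inv\<^bsub>\<Gamma>\<^esub> u" using True u by simp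
        have "u \<triangleleft> x = inv\<^bsub>\<Gamma>\<^esub> (inv\<^bsub>\<Gamma>\<^esub> u \<triangleleft> (u \<triangleright> x))" using u sx by (simp add: ract_inv)
        then have 1: "inv\<^bsub>\<Gamma>\<^esub> (inv\<^bsub>\<Gamma>\<^esub> u \<triangleleft> (u \<triangleright> x)) = u \<triangleleft> x" ..
        have iff: "w = u \<triangleleft> x \<longleftrightarrow> u = w \<triangleleft> inv\<^bsub>F\<^esub> x" using wz u sx by auto
        have K: "\<tau> x (inv\<^bsub>\<Gamma>\<^esub> u) u * c (inv\<^bsub>\<Gamma>\<^esub> u) (u \<triangleright> x) * \<sigma> (u \<triangleleft> x) (inv\<^bsub>F\<^esub> x) x = 1"
          using u sx \<sigma>_nonzero[of u x "inv\<^bsub>F\<^esub> x"] \<tau>_nonzero[of x "inv\<^bsub>\<Gamma>\<^esub> u" u]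
          by (simp add: c_def \<tau>_inv_left \<sigma>_inv_right field_simps)
        have "\<tau> x (?q s u) u * (c (?q s u) (u \<triangleright> x) *
          mlt ?A (inv\<^bsub>\<Gamma>\<^esub> (?q s u \<triangleleft> (u \<triangleright> x)), inv\<^bsub>F\<^esub> (?q s u \<triangleright> (u \<triangleright> x))) (u, x) (w, z))
          = of_bool (w = u \<triangleleft> x) * of_bool (z = \<one>\<^bsub>F\<^esub>) *
            (\<tau> x (inv\<^bsub>\<Gamma>\<^esub> u) u * c (inv\<^bsub>\<Gamma>\<^esub> u) (u \<triangleright> x) * \<sigma> (u \<triangleleft> x) (inv\<^bsub>F\<^esub> x) x)"
          unfolding q 1 using u sx by (simp add: bicrossed_simps)
        then show ?thesis unfolding K iff using True by simp
      qed
    qed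
    finally show ?thesis using finite_\<Gamma> sx wz by (simp add: sum_of_bool_eq)
  qed
  have right: "(\<Sum>j\<in>?B. \<Sum>l\<in>?B. \<Sum>p\<in>?B. cml ?A (s, x) j l * S l p * mlt ?A j p (w, z))
      = of_bool (s = \<one>\<^bsub>\<Gamma>\<^esub>) * of_bool (z = \<one>\<^bsub>F\<^esub>)"
    if sx: "s \<in> carrier \<Gamma>" "x \<in> carrier F" and wz: "w \<in> carrier \<Gamma>" "z \<in> carrier F" for s x w z
  proof -
    have "(\<Sum>j\<in>?B. \<Sum>l\<in>?B. \<Sum>p\<in>?B. cml ?A (s, x) j l * S l p * mlt ?A j p (w, z))
      = (\<Sum>j\<in>?B. \<Sum>l\<in>?B. cml ?A (s, x) j l * (\<Sum>p\<in>?B. S l p * mlt ?A j p (w, z)))"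
      by (simp only: sum_distrib_left mult.assoc)
    also have "\<dots> = (\<Sum>u\<in>carrier \<Gamma>. \<tau> x (?q s u) u * (c u x *
        mlt ?A (?q s u, u \<triangleright> x) (inv\<^bsub>\<Gamma>\<^esub> (u \<triangleleft> x), inv\<^bsub>F\<^esub> (u \<triangleright> x)) (w, z)))"
      unfolding sum_cml[OF sx] using sx by (intro sum.cong refl) (simp add: S)
    also have "\<dots> = (\<Sum>u\<in>carrier \<Gamma>. of_bool (u = inv\<^bsub>\<Gamma>\<^esub> w) * (of_bool (s = \<one>\<^bsub>\<Gamma>\<^esub>) * of_bool (z = \<one>\<^bsub>F\<^esub>)))"
    proof (rule sum.cong[OF refl])
      fix u assume u: "u \<in> carrier \<Gamma>"
      have iff: "?q s u \<triangleleft> (u \<triangleright> x) = inv\<^bsub>\<Gamma>\<^esub> (u \<triangleleft> x) \<longleftrightarrow> s = \<one>\<^bsub>\<Gamma>\<^esub>"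
        using u sx div_iff[of s u] by (simp add: ract_inv[symmetric] ract_eq_iff)
      have iff2: "w = inv\<^bsub>\<Gamma>\<^esub> u \<longleftrightarrow> u = inv\<^bsub>\<Gamma>\<^esub> w" using u wz by auto
      have K: "\<tau> x (inv\<^bsub>\<Gamma>\<^esub> u) u * c u x * \<sigma> (inv\<^bsub>\<Gamma>\<^esub> u) (u \<triangleright> x) (inv\<^bsub>F\<^esub> (u \<triangleright> x)) = 1"
        using u sx \<sigma>_nonzero[of "inv\<^bsub>\<Gamma>\<^esub> u" "u \<triangleright> x" "inv\<^bsub>F\<^esub> (u \<triangleright> x)"] \<tau>_nonzero[of x "inv\<^bsub>\<Gamma>\<^esub> u" u]
        by (simp add: c_def field_simps)
      show "\<tau> x (?q s u) u * (c u x * mlt ?A (?q s u, u \<triangleright> x) (inv\<^bsub>\<Gamma>\<^esub> (u \<triangleleft> x), inv\<^bsub>F\<^esub> (u \<triangleright> x)) (w, z))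
        = of_bool (u = inv\<^bsub>\<Gamma>\<^esub> w) * (of_bool (s = \<one>\<^bsub>\<Gamma>\<^esub>) * of_bool (z = \<one>\<^bsub>F\<^esub>))"
      proof (cases "s = \<one>\<^bsub>\<Gamma>\<^esub>")
        case True
        then have q: "?q s u = inv\<^bsub>\<Gamma>\<^esub> u" using u by simp
        have "\<tau> x (?q s u) u * (c u x * mlt ?A (?q s u, u \<triangleright> x) (inv\<^bsub>\<Gamma>\<^esub> (u \<triangleleft> x), inv\<^bsub>F\<^esub> (u \<triangleright> x)) (w, z))
          = of_bool (w = inv\<^bsub>\<Gamma>\<^esub> u) * of_bool (z = \<one>\<^bsub>F\<^esub>) *
            (\<tau> x (inv\<^bsub>\<Gamma>\<^esub> u) u * c u x * \<sigma> (inv\<^bsub>\<Gamma>\<^esub> u) (u \<triangleright> x) (inv\<^bsub>F\<^esub> (u \<triangleright> x)))"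
          using iff[unfolded q] True u sx unfolding q by (simp add: bicrossed_simps)
        then show ?thesis unfolding K iff2 using True by simp
      qed (simp add: bicrossed_simps iff)
    qed
    finally show ?thesis using finite_\<Gamma> sx wz by (simp add: sum_of_bool_eq)
  qed
  show ?thesis
  proof
    show "\<exists>S. \<forall>i\<in>basis ?A. \<forall>n\<in>basis ?A.
      (\<Sum>j\<in>basis ?A. \<Sum>l\<in>basis ?A. \<Sum>p\<in>basis ?A. cml ?A i j l * S j p * mlt ?A p l n) = cou ?A i * unt ?A n \<and>
      (\<Sum>j\<in>basis ?A. \<Sum>l\<in>basis ?A. \<Sum>p\<in>basis ?A. cml ?A i j l * S l p * mlt ?A j p n) = cou ?A i * unt ?A n"
    proof (rule exI[of _ S], unfold bicrossed_simps(1), intro ballI)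
      fix i n assume "i \<in> ?B" "n \<in> ?B"
      then obtain s x w z where "i = (s, x)" "n = (w, z)" "s \<in> carrier \<Gamma>" "x \<in> carrier F" "w \<in> carrier \<Gamma>" "z \<in> carrier F"
        by auto
      then show "(\<Sum>j\<in>?B. \<Sum>l\<in>?B. \<Sum>p\<in>?B. cml ?A i j l * S j p * mlt ?A p l n) = cou ?A i * unt ?A n \<and>
        (\<Sum>j\<in>?B. \<Sum>l\<in>?B. \<Sum>p\<in>?B. cml ?A i j l * S l p * mlt ?A j p n) = cou ?A i * unt ?A n"
        using left right by (simp add: bicrossed_simps(3,5))
    qed
  qed
qed

end

context matched_pair
begin

text \<open>
  For the converse direction, the counit is multiplicative on \<open>e\<^sub>1 # x\<close>, which gives \<open>\<sigma>_unit\<close>; the coproduct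
  preserves the unit, which gives \<open>\<tau>_unit\<close>; and \<open>compat\<close> is one coefficient of the multiplicativity of the coproduct.
\<close>

lemma cocycle_pairs_iff:
  "(\<sigma>, \<tau>) \<in> cocycle_pairs F \<Gamma> (\<triangleright>) (\<triangleleft>) \<longleftrightarrow> bicrossed_datum F \<Gamma> (\<triangleright>) (\<triangleleft>) \<sigma> \<tau>"
proof
  assume "bicrossed_datum F \<Gamma> (\<triangleright>) (\<triangleleft>) \<sigma> \<tau>"
  then interpret bicrossed_datum F \<Gamma> "(\<triangleright>)" "(\<triangleleft>)" \<sigma> \<tau> .
  show "(\<sigma>, \<tau>) \<in> cocycle_pairs F \<Gamma> (\<triangleright>) (\<triangleleft>)"
    using hopf_algebra_bicrossed
    by (auto simp: cocycle_pairs_def \<sigma>_nonzero \<sigma>_one_left \<sigma>_one_right \<sigma>_cocycle \<tau>_nonzero \<tau>_one_left \<tau>_one_right \<tau>_cocycle)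
next
  assume *: "(\<sigma>, \<tau>) \<in> cocycle_pairs F \<Gamma> (\<triangleright>) (\<triangleleft>)"
  let ?A = "BP (\<sigma>, \<tau>)" and ?B = "carrier \<Gamma> \<times> carrier F"
  interpret hopf_algebra ?A using * by (simp add: cocycle_pairs_def)
  have \<sigma>1: "\<sigma> \<one>\<^bsub>\<Gamma>\<^esub> x y = 1" if "x \<in> carrier F" "y \<in> carrier F" for x y
    using counit_mult[of "(\<one>\<^bsub>\<Gamma>\<^esub>, x)" "(\<one>\<^bsub>\<Gamma>\<^esub>, y)"] that by (simp add: bicrossed_simps(1,5) sum_mlt)
  have \<tau>1: "\<tau> \<one>\<^bsub>F\<^esub> s t = 1" if "s \<in> carrier \<Gamma>" "t \<in> carrier \<Gamma>" for s t
  proof -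
    have "(\<Sum>i\<in>?B. unt ?A i * cml ?A i (s, \<one>\<^bsub>F\<^esub>) (t, \<one>\<^bsub>F\<^esub>))
      = (\<Sum>i\<in>?B. of_bool (i = (s \<otimes>\<^bsub>\<Gamma>\<^esub> t, \<one>\<^bsub>F\<^esub>)) * \<tau> \<one>\<^bsub>F\<^esub> s t)"
      using that by (intro sum.cong) (auto simp: bicrossed_simps)
    also have "\<dots> = \<tau> \<one>\<^bsub>F\<^esub> s t" using that finite_index by (simp add: sum_of_bool_eq)
    finally show ?thesis
      using comult_unit[of "(s, \<one>\<^bsub>F\<^esub>)" "(t, \<one>\<^bsub>F\<^esub>)"] that by (simp add: bicrossed_simps(1,3))
  qed
  have compat: "\<sigma> (t \<otimes>\<^bsub>\<Gamma>\<^esub> v) x y * \<tau> (x \<otimes>\<^bsub>F\<^esub> y) t v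
      = \<tau> x t v * \<tau> y (t \<triangleleft> (v \<triangleright> x)) (v \<triangleleft> x) * \<sigma> t (v \<triangleright> x) ((v \<triangleleft> x) \<triangleright> y) * \<sigma> v x y"
    if c: "t \<in> carrier \<Gamma>" "v \<in> carrier \<Gamma>" "x \<in> carrier F" "y \<in> carrier F" for t v x y
  proof -
    define s where "s = t \<otimes>\<^bsub>\<Gamma>\<^esub> v"
    let ?q = "\<lambda>s u. s \<otimes>\<^bsub>\<Gamma>\<^esub> inv\<^bsub>\<Gamma>\<^esub> u"
    define i j p q where "i = (s, x)" and "j = (s \<triangleleft> x, y)" and "p = (t, v \<triangleright> (x \<otimes>\<^bsub>F\<^esub> y))" and "q = (v, x \<otimes>\<^bsub>F\<^esub> y)"
    note d = i_def j_def p_def q_def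
    have s: "s \<in> carrier \<Gamma>" "?q s v = t" using c by (auto simp: s_def \<Gamma>.m_assoc)
    have "(\<Sum>a\<in>?B. \<Sum>b\<in>?B. \<Sum>c\<in>?B. \<Sum>d\<in>?B.
        cml ?A i a b * cml ?A j c d * mlt ?A a c p * mlt ?A b d q)
      = (\<Sum>a\<in>?B. \<Sum>b\<in>?B. cml ?A i a b * (\<Sum>c\<in>?B. \<Sum>d\<in>?B. cml ?A j c d * (mlt ?A a c p * mlt ?A b d q)))"
      by (simp only: sum_distrib_left mult.assoc)
    also have "\<dots> = (\<Sum>u\<in>carrier \<Gamma>. \<tau> x (?q s u) u * (\<Sum>u'\<in>carrier \<Gamma>. \<tau> y (?q (s \<triangleleft> x) u') u' *
        (mlt ?A (?q s u, u \<triangleright> x) (?q (s \<triangleleft> x) u', u' \<triangleright> y) p * mlt ?A (u, x) (u', y) q)))"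
      unfolding i_def j_def using c s by (simp only: sum_cml ract_closed)
    also have "\<dots> = (\<Sum>u\<in>carrier \<Gamma>. \<tau> x (?q s u) u * (\<Sum>u'\<in>carrier \<Gamma>. of_bool (u' = u \<triangleleft> x) * (\<tau> y (?q (s \<triangleleft> x) u') u' *
        (mlt ?A (?q s u, u \<triangleright> x) (?q (s \<triangleleft> x) u', u' \<triangleright> y) p * (of_bool (v = u) * \<sigma> u x y)))))"
      by (rule sum.cong[OF refl], rule arg_cong2[where f = "(*)"], rule refl, rule sum.cong[OF refl])
        (auto simp: d bicrossed_simps)
    also have "\<dots> = (\<Sum>u\<in>carrier \<Gamma>. of_bool (u = v) * (\<tau> x (?q s u) u * \<tau> y (?q (s \<triangleleft> x) (u \<triangleleft> x)) (u \<triangleleft> x) *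
        (mlt ?A (?q s u, u \<triangleright> x) (?q (s \<triangleleft> x) (u \<triangleleft> x), (u \<triangleleft> x) \<triangleright> y) p * \<sigma> u x y)))"
      using c finite_\<Gamma> by (intro sum.cong refl) (auto simp: sum_of_bool_eq)
    also have "\<dots> = \<tau> x t v * \<tau> y (?q (s \<triangleleft> x) (v \<triangleleft> x)) (v \<triangleleft> x) *
        (mlt ?A (t, v \<triangleright> x) (?q (s \<triangleleft> x) (v \<triangleleft> x), (v \<triangleleft> x) \<triangleright> y) p * \<sigma> v x y)"
      using c s finite_\<Gamma> by (simp add: sum_of_bool_eq)
    also have "?q (s \<triangleleft> x) (v \<triangleleft> x) = t \<triangleleft> (v \<triangleright> x)"
      using ract_matched[of t v x] c by (simp add: s_def \<Gamma>.m_assoc)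
    also have "mlt ?A (t, v \<triangleright> x) (t \<triangleleft> (v \<triangleright> x), (v \<triangleleft> x) \<triangleright> y) p = \<sigma> t (v \<triangleright> x) ((v \<triangleleft> x) \<triangleright> y)"
      using c lact_matched[of v x y] by (simp add: bicrossed_simps p_def)
    finally have "(\<Sum>l\<in>?B. mlt ?A i j l * cml ?A l p q) = \<tau> x t v * \<tau> y (t \<triangleleft> (v \<triangleright> x)) (v \<triangleleft> x) *
        (\<sigma> t (v \<triangleright> x) ((v \<triangleleft> x) \<triangleright> y) * \<sigma> v x y)"
      using comult_mult[of i j p q] c s by (simp add: bicrossed_simps(1) d)
    moreover have "(\<Sum>l\<in>?B. mlt ?A i j l * cml ?A l p q) = \<sigma> s x y * \<tau> (x \<otimes>\<^bsub>F\<^esub> y) t v"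
      unfolding i_def j_def using c s by (simp add: sum_mlt) (simp add: d bicrossed_simps s_def)
    ultimately show ?thesis by (simp add: s_def mult.assoc)
  qed
  show "bicrossed_datum F \<Gamma> (\<triangleright>) (\<triangleleft>) \<sigma> \<tau>"
    by unfold_locales (use * \<sigma>1 \<tau>1 compat in \<open>simp_all add: cocycle_pairs_def\<close>)
qed

text \<open>
  The relation between the structure constants for the basis \<open>e\<^sub>s # x\<close> and those for the basis in which each
  \<open>e\<^sub>s # x\<close> is multiplied by a scalar. Between \<open>c\<close> and the trivial pair this is the hypothesis of
  \<open>orb_coeff_coboundary\<close>.
\<close>

definition rescaling ::
  "('g \<Rightarrow> 'f \<Rightarrow> 'k::field) \<Rightarrow> ('g \<Rightarrow> 'f \<Rightarrow> 'f \<Rightarrow> 'k) \<times> ('f \<Rightarrow> 'g \<Rightarrow> 'g \<Rightarrow> 'k)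
    \<Rightarrow> ('g \<Rightarrow> 'f \<Rightarrow> 'f \<Rightarrow> 'k) \<times> ('f \<Rightarrow> 'g \<Rightarrow> 'g \<Rightarrow> 'k) \<Rightarrow> bool" where
  "rescaling f c d \<longleftrightarrow>
    (\<forall>s\<in>carrier \<Gamma>. \<forall>x\<in>carrier F. f s x \<noteq> 0) \<and>
    (\<forall>s\<in>carrier \<Gamma>. f s \<one>\<^bsub>F\<^esub> = 1) \<and> (\<forall>x\<in>carrier F. f \<one>\<^bsub>\<Gamma>\<^esub> x = 1) \<and>
    (\<forall>s\<in>carrier \<Gamma>. \<forall>x\<in>carrier F. \<forall>y\<in>carrier F.
      fst c s x y * f s (x \<otimes>\<^bsub>F\<^esub> y) = f s x * f (s \<triangleleft> x) y * fst d s x y) \<and>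
    (\<forall>x\<in>carrier F. \<forall>t\<in>carrier \<Gamma>. \<forall>u\<in>carrier \<Gamma>.
      snd c x t u * (f t (u \<triangleright> x) * f u x) = f (t \<otimes>\<^bsub>\<Gamma>\<^esub> u) x * snd d x t u)"

lemma lmap_incl:
  "v \<in> vecs (carrier \<Gamma>) \<Longrightarrow> lmap (carrier \<Gamma>) (carrier \<Gamma> \<times> carrier F) (bicrossed_incl F) v
    = (\<lambda>(t, x)\<in>carrier \<Gamma> \<times> carrier F. of_bool (x = \<one>\<^bsub>F\<^esub>) * v t)"
proof -
  have "(\<Sum>s\<in>carrier \<Gamma>. v s * bicrossed_incl F s (t, x)) = of_bool (x = \<one>\<^bsub>F\<^esub>) * v t" if "t \<in> carrier \<Gamma>" for t x
  proof -
    have "(\<Sum>s\<in>carrier \<Gamma>. v s * bicrossed_incl F s (t, x)) = (\<Sum>s\<in>carrier \<Gamma>. of_bool (s = t) * (of_bool (x = \<one>\<^bsub>F\<^esub>) * v s))"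
      by (rule sum.cong) (auto simp: bicrossed_incl_def)
    then show ?thesis using that finite_\<Gamma> by (simp add: sum_of_bool_eq)
  qed
  then show ?thesis by (auto simp: lmap_def restrict_eq_iff)
qed

lemma lmap_proj:
  "lmap (carrier \<Gamma> \<times> carrier F) (carrier F) (bicrossed_proj \<Gamma>) v = (\<lambda>x\<in>carrier F. v (\<one>\<^bsub>\<Gamma>\<^esub>, x))"
proof -
  have "(\<Sum>i\<in>carrier \<Gamma> \<times> carrier F. v i * bicrossed_proj \<Gamma> i x) = v (\<one>\<^bsub>\<Gamma>\<^esub>, x)" if "x \<in> carrier F" for x
  proof -
    have "(\<Sum>i\<in>carrier \<Gamma> \<times> carrier F. v i * bicrossed_proj \<Gamma> i x) = (\<Sum>i\<in>carrier \<Gamma> \<times> carrier F. of_bool (i = (\<one>\<^bsub>\<Gamma>\<^esub>, x)) * v i)"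
      by (rule sum.cong) (auto simp: bicrossed_proj_def)
    then show ?thesis using that finite_index by (simp add: sum_of_bool_eq)
  qed
  then show ?thesis by (auto simp: lmap_def restrict_eq_iff)
qed

lemma equivalent_if_rescaling:
  fixes \<sigma> :: "'g \<Rightarrow> 'f \<Rightarrow> 'f \<Rightarrow> 'k::field"
  assumes "rescaling f (\<sigma>, \<tau>) (\<sigma>', \<tau>')"
  shows "equivalent_extensions (fun_hopf \<Gamma>) (grp_hopf F) (BP (\<sigma>, \<tau>)) (bicrossed_incl F) (bicrossed_proj \<Gamma>)
    (BP (\<sigma>', \<tau>')) (bicrossed_incl F) (bicrossed_proj \<Gamma>)"
proof -
  let ?B = "carrier \<Gamma> \<times> carrier F"
  define \<phi> :: "'g \<times> 'f \<Rightarrow> 'g \<times> 'f \<Rightarrow> 'k" where "\<phi> = (\<lambda>a b. of_bool (a = b) * f (fst a) (snd a))"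
  have f: "\<And>s x. s \<in> carrier \<Gamma> \<Longrightarrow> x \<in> carrier F \<Longrightarrow> f s x \<noteq> 0"
    "\<And>s. s \<in> carrier \<Gamma> \<Longrightarrow> f s \<one>\<^bsub>F\<^esub> = 1" "\<And>x. x \<in> carrier F \<Longrightarrow> f \<one>\<^bsub>\<Gamma>\<^esub> x = 1"
    "\<And>s x y. s \<in> carrier \<Gamma> \<Longrightarrow> x \<in> carrier F \<Longrightarrow> y \<in> carrier F \<Longrightarrow> \<sigma> s x y * f s (x \<otimes>\<^bsub>F\<^esub> y) = f s x * f (s \<triangleleft> x) y * \<sigma>' s x y"
    "\<And>x t u. x \<in> carrier F \<Longrightarrow> t \<in> carrier \<Gamma> \<Longrightarrow> u \<in> carrier \<Gamma> \<Longrightarrow> \<tau> x t u * (f t (u \<triangleright> x) * f u x) = f (t \<otimes>\<^bsub>\<Gamma>\<^esub> u) x * \<tau>' x t u"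
    using assms by (auto simp: rescaling_def)
  have \<phi>1: "(\<Sum>a\<in>?B. g a * \<phi> a b) = g b * f (fst b) (snd b)" if "b \<in> ?B" for g b
  proof -
    have "(\<Sum>a\<in>?B. g a * \<phi> a b) = (\<Sum>a\<in>?B. of_bool (a = b) * (g a * f (fst a) (snd a)))"
      by (rule sum.cong) (auto simp: \<phi>_def)
    then show ?thesis using that finite_index by (simp add: sum_of_bool_eq)
  qed
  have \<phi>2: "(\<Sum>b\<in>?B. \<phi> a b * g b) = f (fst a) (snd a) * g a" if "a \<in> ?B" for g a
  proof -
    have "(\<Sum>b\<in>?B. \<phi> a b * g b) = (\<Sum>b\<in>?B. of_bool (b = a) * (f (fst a) (snd a) * g b))"
      by (rule sum.cong) (auto simp: \<phi>_def)
    then show ?thesis using that finite_index by (simp add: sum_of_bool_eq)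
  qed
  have L: "lmap ?B ?B \<phi> v = (\<lambda>b\<in>?B. v b * f (fst b) (snd b))" for v
    by (auto simp: lmap_def \<phi>1 restrict_eq_iff)
  have "hopf_hom_coords (BP (\<sigma>, \<tau>)) (BP (\<sigma>', \<tau>')) \<phi>"
    unfolding hopf_hom_coords_def bicrossed_simps(1)
  proof (intro conjI ballI)
    fix i j l assume "i \<in> ?B" "j \<in> ?B" "l \<in> ?B"
    then obtain s x t y u z where *: "i = (s, x)" "j = (t, y)" "l = (u, z)" "s \<in> carrier \<Gamma>" "t \<in> carrier \<Gamma>" "u \<in> carrier \<Gamma>"
      "x \<in> carrier F" "y \<in> carrier F" "z \<in> carrier F" by auto
    have "(\<Sum>a\<in>?B. \<Sum>b\<in>?B. \<phi> i a * \<phi> j b * mlt (BP (\<sigma>', \<tau>')) a b l)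
      = (\<Sum>a\<in>?B. \<phi> i a * (\<Sum>b\<in>?B. \<phi> j b * mlt (BP (\<sigma>', \<tau>')) a b l))"
      by (simp only: sum_distrib_left mult.assoc)
    also have "\<dots> = f s x * (f t y * mlt (BP (\<sigma>', \<tau>')) i j l)"
      using * by (simp add: \<phi>2)
    also have "\<dots> = mlt (BP (\<sigma>, \<tau>)) i j l * f u z"
      using * f(4)[of s x y] by (auto simp: bicrossed_simps mult.assoc)
    also have "\<dots> = (\<Sum>p\<in>?B. mlt (BP (\<sigma>, \<tau>)) i j p * \<phi> p l)"
      using * by (simp add: \<phi>1)
    finally show "(\<Sum>p\<in>?B. mlt (BP (\<sigma>, \<tau>)) i j p * \<phi> p l)
      = (\<Sum>a\<in>?B. \<Sum>b\<in>?B. \<phi> i a * \<phi> j b * mlt (BP (\<sigma>', \<tau>')) a b l)" ..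
  next
    fix l assume "l \<in> ?B"
    then show "(\<Sum>i\<in>?B. unt (BP (\<sigma>, \<tau>)) i * \<phi> i l) = unt (BP (\<sigma>', \<tau>')) l"
      by (auto simp: \<phi>1 bicrossed_simps f)
  next
    fix i q r assume "i \<in> ?B" "q \<in> ?B" "r \<in> ?B"
    then obtain s x t y u z where *: "i = (s, x)" "q = (t, y)" "r = (u, z)" "s \<in> carrier \<Gamma>" "t \<in> carrier \<Gamma>" "u \<in> carrier \<Gamma>"
      "x \<in> carrier F" "y \<in> carrier F" "z \<in> carrier F" by auto
    have "(\<Sum>j\<in>?B. \<Sum>l\<in>?B. cml (BP (\<sigma>, \<tau>)) i j l * (\<phi> j q * \<phi> l r))
      = (\<Sum>j\<in>?B. (\<Sum>l\<in>?B. cml (BP (\<sigma>, \<tau>)) i j l * \<phi> l r) * \<phi> j q)"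
      by (simp add: sum_distrib_left sum_distrib_right ac_simps)
    also have "\<dots> = cml (BP (\<sigma>, \<tau>)) i q r * f u z * f t y"
      using * by (simp add: \<phi>1)
    also have "\<dots> = f s x * cml (BP (\<sigma>', \<tau>')) i q r"
      using * f(5)[of x t u] by (auto simp: bicrossed_simps ac_simps)
    also have "\<dots> = (\<Sum>p\<in>?B. \<phi> i p * cml (BP (\<sigma>', \<tau>')) p q r)"
      using * by (simp add: \<phi>2)
    finally show "(\<Sum>j\<in>?B. \<Sum>l\<in>?B. cml (BP (\<sigma>, \<tau>)) i j l * (\<phi> j q * \<phi> l r))
      = (\<Sum>p\<in>?B. \<phi> i p * cml (BP (\<sigma>', \<tau>')) p q r)" .
  next
    fix i assume "i \<in> ?B"
    then show "(\<Sum>p\<in>?B. \<phi> i p * cou (BP (\<sigma>', \<tau>')) p) = cou (BP (\<sigma>, \<tau>)) i"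
      by (auto simp: \<phi>2 bicrossed_simps f)
  qed
  then have "hopf_hom (BP (\<sigma>, \<tau>)) (BP (\<sigma>', \<tau>')) \<phi>"
    by (intro hopf_hom_coordsD) (simp_all add: bicrossed_simps finite_index)
  moreover have "bij_betw (lmap ?B ?B \<phi>) (vecs ?B) (vecs ?B)"
  proof (rule bij_betw_byWitness[where f' = "\<lambda>v. \<lambda>b\<in>?B. v b / f (fst b) (snd b)"])
    have f': "f (fst b) (snd b) \<noteq> 0" if "b \<in> ?B" for b using that f(1) by auto
    have arb: "v b = undefined" if "v \<in> vecs ?B" "b \<notin> ?B" for v :: "'g \<times> 'f \<Rightarrow> 'k" and b
      using that unfolding vecs_def by (rule PiE_arb)
    show "\<forall>v\<in>vecs ?B. (\<lambda>b\<in>?B. lmap ?B ?B \<phi> v b / f (fst b) (snd b)) = v"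
      by (intro ballI ext) (simp add: L f' arb restrict_def)
    show "\<forall>v\<in>vecs ?B. lmap ?B ?B \<phi> (\<lambda>b\<in>?B. v b / f (fst b) (snd b)) = v"
      by (intro ballI ext) (simp add: L f' arb restrict_def)
  qed (auto simp: L vecs_def)
  moreover have "lmap ?B ?B \<phi> (lmap (carrier \<Gamma>) ?B (bicrossed_incl F) v) = lmap (carrier \<Gamma>) ?B (bicrossed_incl F) v"
    if "v \<in> vecs (carrier \<Gamma>)" for v
    using that by (auto simp: L lmap_incl restrict_eq_iff f)
  moreover have "lmap ?B (carrier F) (bicrossed_proj \<Gamma>) (lmap ?B ?B \<phi> v) = lmap ?B (carrier F) (bicrossed_proj \<Gamma>) v" for v
    by (auto simp: L lmap_proj restrict_eq_iff f)
  ultimately show ?thesis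
    unfolding equivalent_extensions_def
    by (intro exI[of _ \<phi>]) (auto simp: bicrossed_simps fun_hopf_def grp_hopf_def)
qed

text \<open>
  An equivalence is the identity on \<open>k\<^sup>\<Gamma>\<close> and over \<open>k F\<close>, so it preserves both the left multiplication by
  \<open>e\<^sub>s\<close> and the degree in \<open>F\<close>. Hence it maps the line spanned by \<open>e\<^sub>s # x\<close> to itself.
\<close>

lemma rescaling_if_equivalent:
  fixes \<sigma> :: "'g \<Rightarrow> 'f \<Rightarrow> 'f \<Rightarrow> 'k::field"
  assumes c: "bicrossed_datum F \<Gamma> (\<triangleright>) (\<triangleleft>) \<sigma> \<tau>" and d: "bicrossed_datum F \<Gamma> (\<triangleright>) (\<triangleleft>) \<sigma>' \<tau>'"
    and eq: "equivalent_extensions (fun_hopf \<Gamma>) (grp_hopf F) (BP (\<sigma>, \<tau>)) (bicrossed_incl F) (bicrossed_proj \<Gamma>)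
      (BP (\<sigma>', \<tau>')) (bicrossed_incl F) (bicrossed_proj \<Gamma>)"
  shows "\<exists>f. rescaling f (\<sigma>, \<tau>) (\<sigma>', \<tau>')"
proof -
  interpret c: bicrossed_datum F \<Gamma> "(\<triangleright>)" "(\<triangleleft>)" \<sigma> \<tau> by (rule c)
  interpret d: bicrossed_datum F \<Gamma> "(\<triangleright>)" "(\<triangleleft>)" \<sigma>' \<tau>' by (rule d)
  let ?B = "carrier \<Gamma> \<times> carrier F" and ?A = "BP (\<sigma>, \<tau>)" and ?A' = "BP (\<sigma>', \<tau>')"
  obtain \<phi> where hom: "hopf_hom ?A ?A' \<phi>"
    and bij: "bij_betw (lmap ?B ?B \<phi>) (vecs ?B) (vecs ?B)"
    and incl: "\<forall>v\<in>vecs (carrier \<Gamma>). lmap ?B ?B \<phi> (lmap (carrier \<Gamma>) ?B (bicrossed_incl F) v)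
        = lmap (carrier \<Gamma>) ?B (bicrossed_incl F) v"
    and proj: "\<forall>v\<in>vecs ?B. lmap ?B (carrier F) (bicrossed_proj \<Gamma>) (lmap ?B ?B \<phi> v)
        = lmap ?B (carrier F) (bicrossed_proj \<Gamma>) v"
    using eq unfolding equivalent_extensions_def by (auto simp: bicrossed_simps fun_hopf_def grp_hopf_def)
  note H = hopf_hom_coordsI[OF _ _ hom, unfolded hopf_hom_coords_def bicrossed_simps(1), OF finite_index finite_index]
  have incl': "\<phi> (s, \<one>\<^bsub>F\<^esub>) b = of_bool (b = (s, \<one>\<^bsub>F\<^esub>))" if s: "s \<in> carrier \<Gamma>" and b: "b \<in> ?B" for s b
  proof -
    have e: "lmap (carrier \<Gamma>) ?B (bicrossed_incl F) (bvec (carrier \<Gamma>) s) = (bvec ?B (s, \<one>\<^bsub>F\<^esub>) :: _ \<Rightarrow> 'k)"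
      unfolding lmap_incl[OF bvec_in_vecs] using s by (auto simp: bvec_def restrict_eq_iff)
    have "lmap ?B ?B \<phi> (bvec ?B (s, \<one>\<^bsub>F\<^esub>)) b = bvec ?B (s, \<one>\<^bsub>F\<^esub>) b"
      using incl[rule_format, of "bvec (carrier \<Gamma>) s"] unfolding e by simp
    then show ?thesis using s b finite_index by (simp add: lmap_bvec) (simp add: bvec_def)
  qed
  have proj': "\<phi> a (\<one>\<^bsub>\<Gamma>\<^esub>, z) = of_bool (a = (\<one>\<^bsub>\<Gamma>\<^esub>, z))" if a: "a \<in> ?B" and z: "z \<in> carrier F" for a z
  proof -
    have "lmap ?B (carrier F) (bicrossed_proj \<Gamma>) (lmap ?B ?B \<phi> (bvec ?B a)) z
      = lmap ?B (carrier F) (bicrossed_proj \<Gamma>) (bvec ?B a) z"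
      using proj by simp
    then show ?thesis using a z finite_index by (simp add: lmap_proj lmap_bvec) (auto simp: bvec_def)
  qed
  have left: "\<phi> (s, x) (t, y) = of_bool (s = t) * \<phi> (s, x) (t, y)"
    if *: "s \<in> carrier \<Gamma>" "x \<in> carrier F" "t \<in> carrier \<Gamma>" "y \<in> carrier F" for s x t y
  proof -
    have "\<phi> (s, x) (t, y) = (\<Sum>p\<in>?B. mlt ?A (s, \<one>\<^bsub>F\<^esub>) (s, x) p * \<phi> p (t, y))"
      using * by (simp add: sum_mlt c.\<sigma>_one_left)
    also have "\<dots> = (\<Sum>a\<in>?B. \<Sum>b\<in>?B. \<phi> (s, \<one>\<^bsub>F\<^esub>) a * \<phi> (s, x) b * mlt ?A' a b (t, y))"
      using H * by blast
    also have "\<dots> = (\<Sum>a\<in>?B. of_bool (a = (s, \<one>\<^bsub>F\<^esub>)) * (\<Sum>b\<in>?B. \<phi> (s, x) b * mlt ?A' a b (t, y)))"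
      using * by (intro sum.cong refl) (simp add: incl' sum_distrib_left mult.assoc)
    also have "\<dots> = (\<Sum>b\<in>?B. \<phi> (s, x) b * mlt ?A' (s, \<one>\<^bsub>F\<^esub>) b (t, y))"
      using * finite_index by (simp add: sum_of_bool_eq)
    also have "\<dots> = (\<Sum>b\<in>?B. of_bool (b = (s, y)) * (of_bool (s = t) * \<phi> (s, x) (t, y)))"
      using * by (intro sum.cong) (auto simp: bicrossed_simps d.\<sigma>_one_left)
    finally show ?thesis using * finite_index by (simp add: sum_of_bool_eq)
  qed
  have right: "\<phi> (s, x) (t, y) = of_bool (y = x) * \<phi> (s, x) (t, y)"
    if *: "s \<in> carrier \<Gamma>" "x \<in> carrier F" "t \<in> carrier \<Gamma>" "y \<in> carrier F" for s x t y
  proof -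
    have "\<phi> (s, x) (t, y) = (\<Sum>p\<in>?B. \<phi> (s, x) p * cml ?A' p (t, y) (\<one>\<^bsub>\<Gamma>\<^esub>, y))"
    proof -
      have "(\<Sum>p\<in>?B. \<phi> (s, x) p * cml ?A' p (t, y) (\<one>\<^bsub>\<Gamma>\<^esub>, y)) = (\<Sum>p\<in>?B. of_bool (p = (t, y)) * \<phi> (s, x) p)"
        using * by (intro sum.cong) (auto simp: bicrossed_simps d.\<tau>_one_right)
      then show ?thesis using * finite_index by (simp add: sum_of_bool_eq)
    qed
    also have "\<dots> = (\<Sum>j\<in>?B. \<Sum>l\<in>?B. cml ?A (s, x) j l * (\<phi> j (t, y) * \<phi> l (\<one>\<^bsub>\<Gamma>\<^esub>, y)))"
      using H * by simp
    also have "\<dots> = (\<Sum>u\<in>carrier \<Gamma>. of_bool (u = \<one>\<^bsub>\<Gamma>\<^esub>) * (of_bool (y = x) * \<phi> (s, x) (t, y)))"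
      unfolding sum_cml[OF *(1,2)] using * by (intro sum.cong refl) (auto simp: proj' c.\<tau>_one_right)
    finally show ?thesis using finite_\<Gamma> by (simp add: sum_of_bool_eq)
  qed
  define f where "f s x = \<phi> (s, x) (s, x)" for s x
  have \<phi>: "\<phi> a b = of_bool (a = b) * f (fst a) (snd a)" if "a \<in> ?B" "b \<in> ?B" for a b
  proof -
    obtain s x t y where ab: "a = (s, x)" "b = (t, y)" by (cases a; cases b)
    consider "s \<noteq> t" | "y \<noteq> x" | "a = b" using ab by auto
    then show ?thesis
    proof cases
      case 1
      then have "\<phi> a b = 0" unfolding ab using that ab by (subst left) auto
      then show ?thesis using 1 ab by simp
    next
      case 2
      then have "\<phi> a b = 0" unfolding ab using that ab by (subst right) auto
      then show ?thesis using 2 ab by simp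
    qed (simp add: f_def)
  qed
  have \<phi>1: "(\<Sum>a\<in>?B. g a * \<phi> a b) = g b * f (fst b) (snd b)" if "b \<in> ?B" for g b
  proof -
    have "(\<Sum>a\<in>?B. g a * \<phi> a b) = (\<Sum>a\<in>?B. of_bool (a = b) * (g a * f (fst a) (snd a)))"
      using that by (intro sum.cong refl) (simp add: \<phi>)
    then show ?thesis using that finite_index by (simp add: sum_of_bool_eq)
  qed
  have \<phi>2: "(\<Sum>b\<in>?B. \<phi> a b * g b) = f (fst a) (snd a) * g a" if "a \<in> ?B" for g a
  proof -
    have "(\<Sum>b\<in>?B. \<phi> a b * g b) = (\<Sum>b\<in>?B. of_bool (b = a) * (f (fst a) (snd a) * g b))"
      using that by (intro sum.cong refl) (auto simp: \<phi>)
    then show ?thesis using that finite_index by (simp add: sum_of_bool_eq)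
  qed
  have "rescaling f (\<sigma>, \<tau>) (\<sigma>', \<tau>')"
    unfolding rescaling_def fst_conv snd_conv
  proof (intro conjI ballI)
    fix s x assume *: "s \<in> carrier \<Gamma>" "x \<in> carrier F"
    show "f s x \<noteq> 0"
    proof
      assume "f s x = 0"
      then have "lmap ?B ?B \<phi> (bvec ?B (s, x)) = lmap ?B ?B \<phi> (vzero ?B)"
        using * finite_index by (auto simp: lmap_bvec \<phi>) (auto simp: lmap_def vzero_def \<phi> restrict_eq_iff)
      then have "bvec ?B (s, x) = (vzero ?B :: _ \<Rightarrow> 'k)"
        using bij by (auto simp: bij_betw_def vzero_def vecs_def bvec_def inj_on_def)
      then have "bvec ?B (s, x) (s, x) = (vzero ?B (s, x) :: 'k)" by simp
      then show False using * by (simp add: bvec_def vzero_def)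
    qed
  next
    fix s assume "s \<in> carrier \<Gamma>"
    then show "f s \<one>\<^bsub>F\<^esub> = 1" by (simp add: f_def incl')
  next
    fix x assume "x \<in> carrier F"
    then show "f \<one>\<^bsub>\<Gamma>\<^esub> x = 1" by (simp add: f_def proj')
  next
    fix s x y assume *: "s \<in> carrier \<Gamma>" "x \<in> carrier F" "y \<in> carrier F"
    let ?i = "(s, x)" and ?j = "(s \<triangleleft> x, y)" and ?l = "(s, x \<otimes>\<^bsub>F\<^esub> y)"
    have "(\<Sum>p\<in>?B. mlt ?A ?i ?j p * \<phi> p ?l) = (\<Sum>a\<in>?B. \<Sum>b\<in>?B. \<phi> ?i a * \<phi> ?j b * mlt ?A' a b ?l)"
      using H * by auto
    also have "\<dots> = (\<Sum>a\<in>?B. \<phi> ?i a * (\<Sum>b\<in>?B. \<phi> ?j b * mlt ?A' a b ?l))"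
      by (simp only: sum_distrib_left mult.assoc)
    finally show "\<sigma> s x y * f s (x \<otimes>\<^bsub>F\<^esub> y) = f s x * f (s \<triangleleft> x) y * \<sigma>' s x y"
      using * by (simp add: \<phi>1 \<phi>2) (simp add: bicrossed_simps)
  next
    fix x t u assume *: "x \<in> carrier F" "t \<in> carrier \<Gamma>" "u \<in> carrier \<Gamma>"
    let ?i = "(t \<otimes>\<^bsub>\<Gamma>\<^esub> u, x)" and ?q = "(t, u \<triangleright> x)" and ?r = "(u, x)"
    have "(\<Sum>j\<in>?B. \<Sum>l\<in>?B. cml ?A ?i j l * (\<phi> j ?q * \<phi> l ?r)) = (\<Sum>p\<in>?B. \<phi> ?i p * cml ?A' p ?q ?r)"
      using H * by auto
    moreover have "(\<Sum>j\<in>?B. \<Sum>l\<in>?B. cml ?A ?i j l * (\<phi> j ?q * \<phi> l ?r))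
      = (\<Sum>j\<in>?B. (\<Sum>l\<in>?B. cml ?A ?i j l * \<phi> l ?r) * \<phi> j ?q)"
      by (simp add: sum_distrib_left sum_distrib_right ac_simps)
    ultimately show "\<tau> x t u * (f t (u \<triangleright> x) * f u x) = f (t \<otimes>\<^bsub>\<Gamma>\<^esub> u) x * \<tau>' x t u"
      using * by (simp add: \<phi>1 \<phi>2) (simp add: bicrossed_simps ac_simps)
  qed
  then show ?thesis by (rule exI[where x = f])
qed

end

lemma mult_shuffle:
  fixes a :: "'a::comm_monoid_mult"
  shows "a * b * (x * y) = (a * x) * (b * y)"
  by (simp only: ac_simps)

context matched_pair
begin

lemma rescaling_one:
  "bicrossed_datum F \<Gamma> (\<triangleright>) (\<triangleleft>) \<sigma> \<tau> \<Longrightarrow> rescaling (\<lambda>_ _. 1) (\<sigma>, \<tau>) (\<sigma>, \<tau>)"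
  by (simp add: rescaling_def)

lemma rescaling_inverse:
  assumes "rescaling f c d"
  shows "rescaling (\<lambda>s x. inverse (f s x)) d c"
proof -
  have f: "\<And>s x. s \<in> carrier \<Gamma> \<Longrightarrow> x \<in> carrier F \<Longrightarrow> f s x \<noteq> 0"
    using assms by (simp add: rescaling_def)
  show ?thesis
    using assms unfolding rescaling_def
    by (simp add: field_simps f)
qed

lemma rescaling_trans:
  assumes "rescaling f c d" "rescaling g d e"
  shows "rescaling (\<lambda>s x. f s x * g s x) c e"
  unfolding rescaling_def
proof (intro conjI ballI)
  note A = assms[unfolded rescaling_def]
  fix s x y assume *: "s \<in> carrier \<Gamma>" "x \<in> carrier F" "y \<in> carrier F"
  have "fst c s x y * (f s (x \<otimes>\<^bsub>F\<^esub> y) * g s (x \<otimes>\<^bsub>F\<^esub> y)) = f s x * f (s \<triangleleft> x) y * (fst d s x y * g s (x \<otimes>\<^bsub>F\<^esub> y))"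
    using A(1) * by (simp flip: mult.assoc)
  also have "fst d s x y * g s (x \<otimes>\<^bsub>F\<^esub> y) = g s x * g (s \<triangleleft> x) y * fst e s x y"
    using A(2) * by simp
  finally show "fst c s x y * (f s (x \<otimes>\<^bsub>F\<^esub> y) * g s (x \<otimes>\<^bsub>F\<^esub> y)) = f s x * g s x * (f (s \<triangleleft> x) y * g (s \<triangleleft> x) y) * fst e s x y"
    by (simp only: ac_simps)
next
  note A = assms[unfolded rescaling_def]
  fix x t u assume *: "x \<in> carrier F" "t \<in> carrier \<Gamma>" "u \<in> carrier \<Gamma>"
  have "snd c x t u * (f t (u \<triangleright> x) * g t (u \<triangleright> x) * (f u x * g u x))
      = (snd c x t u * (f t (u \<triangleright> x) * f u x)) * (g t (u \<triangleright> x) * g u x)"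
    by (simp only: ac_simps)
  also have "\<dots> = f (t \<otimes>\<^bsub>\<Gamma>\<^esub> u) x * (snd d x t u * (g t (u \<triangleright> x) * g u x))"
    using A(1) * by (simp only: ac_simps)
  also have "snd d x t u * (g t (u \<triangleright> x) * g u x) = g (t \<otimes>\<^bsub>\<Gamma>\<^esub> u) x * snd e x t u"
    using A(2) * by simp
  finally show "snd c x t u * (f t (u \<triangleright> x) * g t (u \<triangleright> x) * (f u x * g u x))
      = f (t \<otimes>\<^bsub>\<Gamma>\<^esub> u) x * g (t \<otimes>\<^bsub>\<Gamma>\<^esub> u) x * snd e x t u"
    by (simp only: ac_simps)
qed (use assms in \<open>simp_all add: rescaling_def\<close>)

lemma rescaling_mult:
  assumes "rescaling f c d" "rescaling g c' d'"
  shows "rescaling (\<lambda>s x. f s x * g s x) (pair_mult c c') (pair_mult d d')"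
proof -
  obtain \<sigma>1 \<tau>1 \<sigma>2 \<tau>2 \<sigma>3 \<tau>3 \<sigma>4 \<tau>4 where c: "c = (\<sigma>1, \<tau>1)" "d = (\<sigma>2, \<tau>2)" "c' = (\<sigma>3, \<tau>3)" "d' = (\<sigma>4, \<tau>4)"
    by (cases c; cases d; cases c'; cases d')
  note A = assms[unfolded c rescaling_def fst_conv snd_conv]
  show ?thesis
    unfolding rescaling_def c pair_mult_def case_prod_conv fst_conv snd_conv
  proof (intro conjI ballI)
    fix s x y assume *: "s \<in> carrier \<Gamma>" "x \<in> carrier F" "y \<in> carrier F"
    have 1: "\<sigma>1 s x y * f s (x \<otimes>\<^bsub>F\<^esub> y) = f s x * f (s \<triangleleft> x) y * \<sigma>2 s x y"
      and 2: "\<sigma>3 s x y * g s (x \<otimes>\<^bsub>F\<^esub> y) = g s x * g (s \<triangleleft> x) y * \<sigma>4 s x y"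
      using A * by blast+
    show "\<sigma>1 s x y * \<sigma>3 s x y * (f s (x \<otimes>\<^bsub>F\<^esub> y) * g s (x \<otimes>\<^bsub>F\<^esub> y))
      = f s x * g s x * (f (s \<triangleleft> x) y * g (s \<triangleleft> x) y) * (\<sigma>2 s x y * \<sigma>4 s x y)"
      by (subst mult_shuffle, unfold 1 2) (simp only: ac_simps)
  next
    fix x t u assume *: "x \<in> carrier F" "t \<in> carrier \<Gamma>" "u \<in> carrier \<Gamma>"
    have 1: "\<tau>1 x t u * (f t (u \<triangleright> x) * f u x) = f (t \<otimes>\<^bsub>\<Gamma>\<^esub> u) x * \<tau>2 x t u"
      and 2: "\<tau>3 x t u * (g t (u \<triangleright> x) * g u x) = g (t \<otimes>\<^bsub>\<Gamma>\<^esub> u) x * \<tau>4 x t u"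
      using A * by blast+
    have "\<tau>1 x t u * \<tau>3 x t u * (f t (u \<triangleright> x) * g t (u \<triangleright> x) * (f u x * g u x))
      = (\<tau>1 x t u * (f t (u \<triangleright> x) * f u x)) * (\<tau>3 x t u * (g t (u \<triangleright> x) * g u x))"
      by (simp only: ac_simps)
    then show "\<tau>1 x t u * \<tau>3 x t u * (f t (u \<triangleright> x) * g t (u \<triangleright> x) * (f u x * g u x))
      = f (t \<otimes>\<^bsub>\<Gamma>\<^esub> u) x * g (t \<otimes>\<^bsub>\<Gamma>\<^esub> u) x * (\<tau>2 x t u * \<tau>4 x t u)"
      unfolding 1 2 by (simp only: ac_simps)
  qed (use A in simp_all)
qed

abbreviation "CP \<equiv> cocycle_pairs F \<Gamma> (\<triangleright>) (\<triangleleft>)"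

lemma CP_one: "(\<lambda>s x y. 1, \<lambda>x s t. 1) \<in> CP"
  unfolding cocycle_pairs_iff by unfold_locales simp_all

lemma CP_mult: "c \<in> CP \<Longrightarrow> d \<in> CP \<Longrightarrow> pair_mult c d \<in> CP"
proof (cases c; cases d)
  fix \<sigma> \<tau> \<sigma>' \<tau>' assume cd: "c \<in> CP" "d \<in> CP" "c = (\<sigma>, \<tau>)" "d = (\<sigma>', \<tau>')"
  interpret c: bicrossed_datum F \<Gamma> "(\<triangleright>)" "(\<triangleleft>)" \<sigma> \<tau> using cd by (simp flip: cocycle_pairs_iff)
  interpret d: bicrossed_datum F \<Gamma> "(\<triangleright>)" "(\<triangleleft>)" \<sigma>' \<tau>' using cd by (simp flip: cocycle_pairs_iff)
  have "bicrossed_datum F \<Gamma> (\<triangleright>) (\<triangleleft>) (\<lambda>s x y. \<sigma> s x y * \<sigma>' s x y) (\<lambda>x s t. \<tau> x s t * \<tau>' x s t)"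
  proof unfold_locales
    fix s x y z assume "s \<in> carrier \<Gamma>" "x \<in> carrier F" "y \<in> carrier F" "z \<in> carrier F"
    then show "\<sigma> (s \<triangleleft> x) y z * \<sigma>' (s \<triangleleft> x) y z * (\<sigma> s x (y \<otimes>\<^bsub>F\<^esub> z) * \<sigma>' s x (y \<otimes>\<^bsub>F\<^esub> z))
      = \<sigma> s x y * \<sigma>' s x y * (\<sigma> s (x \<otimes>\<^bsub>F\<^esub> y) z * \<sigma>' s (x \<otimes>\<^bsub>F\<^esub> y) z)"
      by (subst (1 2) mult_shuffle) (simp only: c.\<sigma>_cocycle d.\<sigma>_cocycle)
  next
    fix x s t u assume "x \<in> carrier F" "s \<in> carrier \<Gamma>" "t \<in> carrier \<Gamma>" "u \<in> carrier \<Gamma>"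
    then show "\<tau> (u \<triangleright> x) s t * \<tau>' (u \<triangleright> x) s t * (\<tau> x (s \<otimes>\<^bsub>\<Gamma>\<^esub> t) u * \<tau>' x (s \<otimes>\<^bsub>\<Gamma>\<^esub> t) u)
      = \<tau> x t u * \<tau>' x t u * (\<tau> x s (t \<otimes>\<^bsub>\<Gamma>\<^esub> u) * \<tau>' x s (t \<otimes>\<^bsub>\<Gamma>\<^esub> u))"
      by (subst (1 2) mult_shuffle) (simp only: c.\<tau>_cocycle d.\<tau>_cocycle)
  next
    fix t u x y assume *: "t \<in> carrier \<Gamma>" "u \<in> carrier \<Gamma>" "x \<in> carrier F" "y \<in> carrier F"
    have "\<sigma> (t \<otimes>\<^bsub>\<Gamma>\<^esub> u) x y * \<sigma>' (t \<otimes>\<^bsub>\<Gamma>\<^esub> u) x y * (\<tau> (x \<otimes>\<^bsub>F\<^esub> y) t u * \<tau>' (x \<otimes>\<^bsub>F\<^esub> y) t u)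
      = (\<sigma> (t \<otimes>\<^bsub>\<Gamma>\<^esub> u) x y * \<tau> (x \<otimes>\<^bsub>F\<^esub> y) t u) * (\<sigma>' (t \<otimes>\<^bsub>\<Gamma>\<^esub> u) x y * \<tau>' (x \<otimes>\<^bsub>F\<^esub> y) t u)"
      by (rule mult_shuffle)
    then show "\<sigma> (t \<otimes>\<^bsub>\<Gamma>\<^esub> u) x y * \<sigma>' (t \<otimes>\<^bsub>\<Gamma>\<^esub> u) x y * (\<tau> (x \<otimes>\<^bsub>F\<^esub> y) t u * \<tau>' (x \<otimes>\<^bsub>F\<^esub> y) t u)
      = \<tau> x t u * \<tau>' x t u * (\<tau> y (t \<triangleleft> (u \<triangleright> x)) (u \<triangleleft> x) * \<tau>' y (t \<triangleleft> (u \<triangleright> x)) (u \<triangleleft> x))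
        * (\<sigma> t (u \<triangleright> x) ((u \<triangleleft> x) \<triangleright> y) * \<sigma>' t (u \<triangleright> x) ((u \<triangleleft> x) \<triangleright> y)) * (\<sigma> u x y * \<sigma>' u x y)"
      unfolding c.compat[OF *] d.compat[OF *] by (simp only: ac_simps)
  qed (simp_all add: c.\<sigma>_nonzero d.\<sigma>_nonzero c.\<tau>_nonzero d.\<tau>_nonzero c.\<sigma>_one_left d.\<sigma>_one_left
      c.\<sigma>_one_right d.\<sigma>_one_right c.\<tau>_one_left d.\<tau>_one_left c.\<tau>_one_right d.\<tau>_one_right
      c.\<sigma>_unit d.\<sigma>_unit c.\<tau>_unit d.\<tau>_unit)
  then show ?thesis by (simp add: cd pair_mult_def cocycle_pairs_iff)
qed

lemma CP_inverse:
  assumes "(\<sigma>, \<tau>) \<in> CP"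
  shows "(\<lambda>s x y. inverse (\<sigma> s x y), \<lambda>x s t. inverse (\<tau> x s t)) \<in> CP"
proof -
  interpret bicrossed_datum F \<Gamma> "(\<triangleright>)" "(\<triangleleft>)" \<sigma> \<tau> using assms by (simp flip: cocycle_pairs_iff)
  show ?thesis
    unfolding cocycle_pairs_iff
  proof unfold_locales
    fix t u x y assume *: "t \<in> carrier \<Gamma>" "u \<in> carrier \<Gamma>" "x \<in> carrier F" "y \<in> carrier F"
    show "inverse (\<sigma> (t \<otimes>\<^bsub>\<Gamma>\<^esub> u) x y) * inverse (\<tau> (x \<otimes>\<^bsub>F\<^esub> y) t u)
      = inverse (\<tau> x t u) * inverse (\<tau> y (t \<triangleleft> (u \<triangleright> x)) (u \<triangleleft> x))
        * inverse (\<sigma> t (u \<triangleright> x) ((u \<triangleleft> x) \<triangleright> y)) * inverse (\<sigma> u x y)"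
      using compat[OF *] by (simp flip: inverse_mult_distrib)
  qed (simp_all add: \<sigma>_nonzero \<tau>_nonzero \<sigma>_one_left \<sigma>_one_right \<tau>_one_left \<tau>_one_right \<sigma>_unit \<tau>_unit
      \<sigma>_cocycle \<tau>_cocycle flip: inverse_mult_distrib)
qed

lemma opext_rel_iff:
  "(c, d) \<in> opext_rel F \<Gamma> (\<triangleright>) (\<triangleleft>) \<longleftrightarrow> c \<in> CP \<and> d \<in> CP \<and> (\<exists>f. rescaling f c d)"
proof (cases c; cases d)
  fix \<sigma> \<tau> \<sigma>' \<tau>' assume cd: "c = (\<sigma>, \<tau>)" "d = (\<sigma>', \<tau>')"
  show ?thesis
    unfolding cd opext_rel_def
    using equivalent_if_rescaling[of _ \<sigma> \<tau> \<sigma>' \<tau>'] rescaling_if_equivalent[of \<sigma> \<tau> \<sigma>' \<tau>']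
    by (auto simp: cocycle_pairs_iff)
qed

lemma equiv_opext_rel: "equiv CP (opext_rel F \<Gamma> (\<triangleright>) (\<triangleleft>))"
proof (rule equivI)
  show "opext_rel F \<Gamma> (\<triangleright>) (\<triangleleft>) \<subseteq> CP \<times> CP" by (auto simp: opext_rel_def)
  show "refl_on CP (opext_rel F \<Gamma> (\<triangleright>) (\<triangleleft>))"
  proof (rule refl_onI)
    fix c assume "c \<in> CP"
    then show "(c, c) \<in> opext_rel F \<Gamma> (\<triangleright>) (\<triangleleft>)"
      unfolding opext_rel_iff using rescaling_one cocycle_pairs_iff by (metis surj_pair)
  qed
  show "sym (opext_rel F \<Gamma> (\<triangleright>) (\<triangleleft>))"
    by (rule symI) (auto simp: opext_rel_iff dest: rescaling_inverse)
  show "trans (opext_rel F \<Gamma> (\<triangleright>) (\<triangleleft>))"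
    by (rule transI) (auto simp: opext_rel_iff dest: rescaling_trans)
qed

abbreviation "cls c \<equiv> opext_rel F \<Gamma> (\<triangleright>) (\<triangleleft>) `` {c}"

lemma cls_eq_iff: "c \<in> CP \<Longrightarrow> d \<in> CP \<Longrightarrow> cls c = cls d \<longleftrightarrow> (\<exists>f. rescaling f c d)"
  using eq_equiv_class_iff[OF equiv_opext_rel] opext_rel_iff by blast

lemma Opext_mult:
  assumes "c \<in> CP" "d \<in> CP"
  shows "cls c \<otimes>\<^bsub>Opext F \<Gamma> (\<triangleright>) (\<triangleleft>)\<^esub> cls d = cls (pair_mult c d)"
proof -
  let ?R = "opext_rel F \<Gamma> (\<triangleright>) (\<triangleleft>)"
  have "cls (pair_mult c' d') = cls (pair_mult c d)" if "c' \<in> cls c" "d' \<in> cls d" for c' d'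
  proof -
    have "(c, c') \<in> ?R" "(d, d') \<in> ?R" using that by auto
    then have "\<exists>f. rescaling f (pair_mult c d) (pair_mult c' d')" "c' \<in> CP" "d' \<in> CP"
      unfolding opext_rel_iff using rescaling_mult by blast+
    then show ?thesis using cls_eq_iff[of "pair_mult c d" "pair_mult c' d'"] CP_mult assms by metis
  qed
  moreover have "c \<in> cls c" "d \<in> cls d"
    by (rule equiv_class_self[OF equiv_opext_rel assms(1)], rule equiv_class_self[OF equiv_opext_rel assms(2)])
  ultimately have "?R `` {pair_mult c' d' | c' d'. c' \<in> cls c \<and> d' \<in> cls d} = cls (pair_mult c d)"
    by blast
  then show ?thesis by (simp add: Opext_def)
qed

lemma Opext_simps:
  "carrier (Opext F \<Gamma> (\<triangleright>) (\<triangleleft>)) = CP // opext_rel F \<Gamma> (\<triangleright>) (\<triangleleft>)"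
  "\<one>\<^bsub>Opext F \<Gamma> (\<triangleright>) (\<triangleleft>)\<^esub> = cls (\<lambda>s x y. 1, \<lambda>x s t. 1)"
  by (simp_all add: Opext_def)

text \<open>
  By \<open>opext_rel_iff\<close> the classes are the orbits of rescalings, which are compatible with pointwise products
  and inverses.
\<close>

lemma group_Opext: "group (Opext F \<Gamma> (\<triangleright>) (\<triangleleft>) ::
  (('g \<Rightarrow> 'f \<Rightarrow> 'f \<Rightarrow> 'k::field) \<times> ('f \<Rightarrow> 'g \<Rightarrow> 'g \<Rightarrow> 'k)) set monoid)"
proof (rule groupI)
  let ?O = "Opext F \<Gamma> (\<triangleright>) (\<triangleleft>) :: (('g \<Rightarrow> 'f \<Rightarrow> 'f \<Rightarrow> 'k::field) \<times> ('f \<Rightarrow> 'g \<Rightarrow> 'g \<Rightarrow> 'k)) set monoid"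
  let ?one = "(\<lambda>s x y. 1, \<lambda>x s t. 1) :: ('g \<Rightarrow> 'f \<Rightarrow> 'f \<Rightarrow> 'k::field) \<times> ('f \<Rightarrow> 'g \<Rightarrow> 'g \<Rightarrow> 'k)"
  have cE: "\<exists>c\<in>CP. C = cls c" if "C \<in> carrier ?O" for C
    using that by (auto simp: Opext_simps elim: quotientE)
  have cI: "cls c \<in> carrier ?O" if "c \<in> CP" for c
    using that by (auto simp: Opext_simps intro: quotientI)
  {
    fix C D assume "C \<in> carrier ?O" "D \<in> carrier ?O"
    then show "C \<otimes>\<^bsub>?O\<^esub> D \<in> carrier ?O"
      using cE cI CP_mult by (metis Opext_mult)
  }
  show "\<one>\<^bsub>?O\<^esub> \<in> carrier ?O" using cI[OF CP_one] by (simp add: Opext_simps(2))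
  {
    fix C D E assume "C \<in> carrier ?O" "D \<in> carrier ?O" "E \<in> carrier ?O"
    then obtain c d e where "c \<in> CP" "d \<in> CP" "e \<in> CP" "C = cls c" "D = cls d" "E = cls e"
      using cE by meson
    moreover have "pair_mult (pair_mult c d) e = pair_mult c (pair_mult d e)"
      by (cases c; cases d; cases e) (simp add: pair_mult_def mult.assoc)
    ultimately show "C \<otimes>\<^bsub>?O\<^esub> D \<otimes>\<^bsub>?O\<^esub> E = C \<otimes>\<^bsub>?O\<^esub> (D \<otimes>\<^bsub>?O\<^esub> E)"
      by (simp add: Opext_mult CP_mult)
  }
  {
    fix C assume "C \<in> carrier ?O"
    then obtain c where c: "c \<in> CP" "C = cls c" using cE by meson
    have "pair_mult ?one c = c" by (cases c) (simp add: pair_mult_def)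
    then show "\<one>\<^bsub>?O\<^esub> \<otimes>\<^bsub>?O\<^esub> C = C" using Opext_mult[OF CP_one c(1)] c(2) by (simp add: Opext_simps(2))
    obtain \<sigma> \<tau> where \<sigma>\<tau>: "c = (\<sigma>, \<tau>)" by (cases c)
    define d where "d = (\<lambda>s x y. inverse (\<sigma> s x y), \<lambda>x s t. inverse (\<tau> x s t))"
    have d: "d \<in> CP" using c CP_inverse by (simp add: d_def \<sigma>\<tau>)
    interpret bicrossed_datum F \<Gamma> "(\<triangleright>)" "(\<triangleleft>)" \<sigma> \<tau> using c \<sigma>\<tau> by (simp flip: cocycle_pairs_iff)
    have "rescaling (\<lambda>s x. 1) (pair_mult d c) ?one"
      by (simp add: rescaling_def d_def \<sigma>\<tau> pair_mult_def \<sigma>_nonzero \<tau>_nonzero)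
    then have "cls (pair_mult d c) = cls ?one" using cls_eq_iff[OF CP_mult[OF d c(1)] CP_one] by blast
    then have "cls d \<otimes>\<^bsub>?O\<^esub> C = \<one>\<^bsub>?O\<^esub>" using c d by (simp add: Opext_mult Opext_simps(2))
    then show "\<exists>D\<in>carrier ?O. D \<otimes>\<^bsub>?O\<^esub> C = \<one>\<^bsub>?O\<^esub>" using cI[OF d] by blast
  }
qed

lemma Opext_pow:
  assumes "(\<sigma>, \<tau>) \<in> CP"
  shows "(\<lambda>s x y. \<sigma> s x y ^ n, \<lambda>x s t. \<tau> x s t ^ n) \<in> CP"
    and "cls (\<sigma>, \<tau>) [^]\<^bsub>Opext F \<Gamma> (\<triangleright>) (\<triangleleft>)\<^esub> n = cls (\<lambda>s x y. \<sigma> s x y ^ n, \<lambda>x s t. \<tau> x s t ^ n)"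
proof (induction n)
  case 0
  interpret O: group "Opext F \<Gamma> (\<triangleright>) (\<triangleleft>)" by (rule group_Opext)
  {
    case 1 show ?case using CP_one by simp
  next
    case 2 show ?case by (simp add: Opext_simps(2))
  }
next
  case (Suc n)
  interpret O: group "Opext F \<Gamma> (\<triangleright>) (\<triangleleft>)" by (rule group_Opext)
  have e: "(\<lambda>s x y. \<sigma> s x y ^ Suc n, \<lambda>x s t. \<tau> x s t ^ Suc n)
    = pair_mult (\<lambda>s x y. \<sigma> s x y ^ n, \<lambda>x s t. \<tau> x s t ^ n) (\<sigma>, \<tau>)"
    by (simp add: pair_mult_def mult.commute)
  {
    case 1 show ?case unfolding e by (rule CP_mult[OF Suc.IH(1) assms])
  next
    case 2 show ?case unfolding e by (simp add: Suc.IH Opext_mult assms)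
  }
qed

end

context bicrossed_datum
begin

text \<open>
  The pair \<open>(\<sigma>\<^sup>e, \<tau>\<^sup>e)\<close> is equivalent to the trivial one, and by \<open>orb_exponent\<close> the end of the orbit
  only contributes values of the rescaling at units, which are 1.
\<close>

lemma orb_coeff_power_exponent:
  defines "m \<equiv> group_exponent (bowtie F \<Gamma> (\<triangleright>) (\<triangleleft>))"
    and "e \<equiv> group_exponent (Opext F \<Gamma> (\<triangleright>) (\<triangleleft>) :: (('g \<Rightarrow> 'f \<Rightarrow> 'f \<Rightarrow> 'k) \<times> ('f \<Rightarrow> 'g \<Rightarrow> 'g \<Rightarrow> 'k)) set monoid)"
  assumes "s \<in> carrier \<Gamma>" "x \<in> carrier F"
  shows "orb_coeff \<sigma> \<tau> m s x ^ e = 1"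
proof -
  interpret O: group "Opext F \<Gamma> (\<triangleright>) (\<triangleleft>) :: (('g \<Rightarrow> 'f \<Rightarrow> 'f \<Rightarrow> 'k) \<times> ('f \<Rightarrow> 'g \<Rightarrow> 'g \<Rightarrow> 'k)) set monoid"
    by (rule group_Opext)
  have c: "(\<sigma>, \<tau>) \<in> CP" unfolding cocycle_pairs_iff by unfold_locales
  have C: "cls (\<sigma>, \<tau>) \<in> carrier (Opext F \<Gamma> (\<triangleright>) (\<triangleleft>))"
    using c by (auto simp: Opext_simps intro: quotientI)
  have "O.ord (cls (\<sigma>, \<tau>)) dvd e"
    unfolding e_def group_exponent_def by (rule dvd_Lcm) (use C in blast)
  then have "cls (\<sigma>, \<tau>) [^]\<^bsub>Opext F \<Gamma> (\<triangleright>) (\<triangleleft>)\<^esub> e = \<one>\<^bsub>Opext F \<Gamma> (\<triangleright>) (\<triangleleft>)\<^esub>"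
    using O.pow_eq_id[OF C] by simp
  then have "cls (\<lambda>s x y. \<sigma> s x y ^ e, \<lambda>x s t. \<tau> x s t ^ e) = cls (\<lambda>s x y. 1, \<lambda>x s t. 1)"
    by (simp add: Opext_pow(2)[OF c] Opext_simps(2))
  then obtain f where f: "rescaling f (\<lambda>s x y. \<sigma> s x y ^ e, \<lambda>x s t. \<tau> x s t ^ e) (\<lambda>s x y. 1, \<lambda>x s t. 1)"
    using cls_eq_iff[OF Opext_pow(1)[OF c] CP_one] by blast
  have "orb_coeff (\<lambda>s x y. \<sigma> s x y ^ e) (\<lambda>x s t. \<tau> x s t ^ e) m s x * f s (orbF m s x) = f (orb\<Gamma> m s x) (orb_last m s x)"
    by (rule orb_coeff_coboundary) (use f assms(3,4) in \<open>simp_all add: rescaling_def\<close>)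
  then show ?thesis
    using f assms(3,4) unfolding orb_coeff_power m_def by (simp add: orb_exponent rescaling_def)
qed

end

section \<open>Abelian extensions are bicrossed products\<close>

lemma sum_move_in3:
  "(\<Sum>p\<in>A. \<Sum>i\<in>B. \<Sum>j\<in>C. f p i j) = (\<Sum>i\<in>B. \<Sum>j\<in>C. \<Sum>p\<in>A. f p i j)"
  by ((rule trans[OF sum.swap], rule sum.cong[OF refl])+, rule refl)

lemma sum_move_in4:
  "(\<Sum>p\<in>A. \<Sum>i\<in>B. \<Sum>j\<in>C. \<Sum>k\<in>D. f p i j k) = (\<Sum>i\<in>B. \<Sum>j\<in>C. \<Sum>k\<in>D. \<Sum>p\<in>A. f p i j k)"
  by ((rule trans[OF sum.swap], rule sum.cong[OF refl])+, rule refl)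

lemma sum_move_in5:
  "(\<Sum>p\<in>A. \<Sum>i\<in>B. \<Sum>j\<in>C. \<Sum>k\<in>D. \<Sum>l\<in>E. f p i j k l) = (\<Sum>i\<in>B. \<Sum>j\<in>C. \<Sum>k\<in>D. \<Sum>l\<in>E. \<Sum>p\<in>A. f p i j k l)"
  by ((rule trans[OF sum.swap], rule sum.cong[OF refl])+, rule refl)

context bialgebra
begin

text \<open>
  Vectors of \<open>A\<close> are extended by zero outside the basis, so that equality of vectors is equality of functions.
\<close>

definition mulv :: "('i \<Rightarrow> 'k) \<Rightarrow> ('i \<Rightarrow> 'k) \<Rightarrow> 'i \<Rightarrow> 'k" (infixl "\<star>" 70) where
  "a \<star> b = (\<lambda>l. if l \<in> basis A then \<Sum>i\<in>basis A. \<Sum>j\<in>basis A. a i * b j * mlt A i j l else 0)"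

definition onev :: "'i \<Rightarrow> 'k" where
  "onev = (\<lambda>i. if i \<in> basis A then unt A i else 0)"

definition supported :: "('i \<Rightarrow> 'k) \<Rightarrow> bool" where
  "supported a \<longleftrightarrow> (\<forall>i. i \<notin> basis A \<longrightarrow> a i = 0)"

definition eps :: "('i \<Rightarrow> 'k) \<Rightarrow> 'k" where
  "eps a = (\<Sum>i\<in>basis A. a i * cou A i)"

text \<open>
  The coproduct of \<open>a\<close>, as its coefficient at \<open>b\<^sub>p \<otimes> b\<^sub>q\<close>.
\<close>

definition com :: "('i \<Rightarrow> 'k) \<Rightarrow> 'i \<Rightarrow> 'i \<Rightarrow> 'k" where
  "com a p q = (\<Sum>i\<in>basis A. a i * cml A i p q)"

lemma supported_mulv [simp]: "supported (a \<star> b)" by (simp add: supported_def mulv_def)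
lemma supported_onev [simp]: "supported onev" by (simp add: supported_def onev_def)

lemma supported_eqI: "supported a \<Longrightarrow> supported b \<Longrightarrow> (\<And>i. i \<in> basis A \<Longrightarrow> a i = b i) \<Longrightarrow> a = b"
  by (rule ext) (metis supported_def)

lemma mulv_assoc: "a \<star> b \<star> c = a \<star> (b \<star> c)"
proof (rule supported_eqI)
  let ?I = "basis A"
  fix l assume l: "l \<in> ?I"
  have "(a \<star> b \<star> c) l = (\<Sum>p\<in>?I. \<Sum>k\<in>?I. \<Sum>i\<in>?I. \<Sum>j\<in>?I. a i * b j * c k * (mlt A i j p * mlt A p k l))"
    using l by (simp add: mulv_def sum_distrib_left sum_distrib_right ac_simps)
  also have "\<dots> = (\<Sum>k\<in>?I. \<Sum>i\<in>?I. \<Sum>j\<in>?I. \<Sum>p\<in>?I. a i * b j * c k * (mlt A i j p * mlt A p k l))"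
    by (rule sum_move_in4)
  also have "\<dots> = (\<Sum>k\<in>?I. \<Sum>i\<in>?I. \<Sum>j\<in>?I. a i * b j * c k * (\<Sum>p\<in>?I. mlt A j k p * mlt A i p l))"
    using l by (intro sum.cong refl) (simp add: assoc flip: sum_distrib_left)
  also have "\<dots> = (\<Sum>i\<in>?I. \<Sum>j\<in>?I. \<Sum>k\<in>?I. a i * b j * c k * (\<Sum>p\<in>?I. mlt A j k p * mlt A i p l))"
    by (rule sum_move_in3)
  also have "\<dots> = (\<Sum>i\<in>?I. \<Sum>j\<in>?I. \<Sum>k\<in>?I. \<Sum>p\<in>?I. a i * b j * c k * (mlt A j k p * mlt A i p l))"
    by (simp only: sum_distrib_left)
  also have "\<dots> = (\<Sum>i\<in>?I. \<Sum>p\<in>?I. \<Sum>j\<in>?I. \<Sum>k\<in>?I. a i * b j * c k * (mlt A j k p * mlt A i p l))"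
    by (rule sum.cong[OF refl], rule sum_move_in3[symmetric])
  also have "\<dots> = (a \<star> (b \<star> c)) l"
    using l by (simp add: mulv_def sum_distrib_left sum_distrib_right ac_simps)
  finally show "(a \<star> b \<star> c) l = (a \<star> (b \<star> c)) l" .
qed simp_all

lemma onev_mulv:
  assumes "supported a"
  shows "onev \<star> a = a"
proof (rule supported_eqI)
  fix l assume l: "l \<in> basis A"
  have "(onev \<star> a) l = (\<Sum>p\<in>basis A. \<Sum>j\<in>basis A. a j * (unt A p * mlt A p j l))"
    using l by (simp add: mulv_def onev_def ac_simps)
  also have "\<dots> = (\<Sum>j\<in>basis A. a j * of_bool (j = l))"
    using l by (subst sum.swap) (simp add: unit_left flip: sum_distrib_left)
  finally show "(onev \<star> a) l = a l" using l finite_basis by (simp add: sum_of_bool_eq)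
qed (use assms in simp_all)

lemma mulv_onev:
  assumes "supported a"
  shows "a \<star> onev = a"
proof (rule supported_eqI)
  fix l assume l: "l \<in> basis A"
  have "(a \<star> onev) l = (\<Sum>j\<in>basis A. \<Sum>p\<in>basis A. a j * (unt A p * mlt A j p l))"
    using l by (simp add: mulv_def onev_def ac_simps)
  also have "\<dots> = (\<Sum>j\<in>basis A. a j * of_bool (j = l))"
    using l by (simp add: unit_right flip: sum_distrib_left)
  finally show "(a \<star> onev) l = a l" using l finite_basis by (simp add: sum_of_bool_eq)
qed (use assms in simp_all)

lemma mulv_scale: "(\<lambda>i. c * a i) \<star> b = (\<lambda>i. c * (a \<star> b) i)" "a \<star> (\<lambda>i. c * b i) = (\<lambda>i. c * (a \<star> b) i)"
  by (auto simp: mulv_def sum_distrib_left ac_simps)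

lemma mulv_zero [simp]: "(\<lambda>_. 0) \<star> b = (\<lambda>_. 0)" "a \<star> (\<lambda>_. 0) = (\<lambda>_. 0)"
  by (auto simp: mulv_def)

lemma mulv_sum_right: "a \<star> (\<lambda>i. \<Sum>k\<in>K. v k i) = (\<lambda>i. \<Sum>k\<in>K. (a \<star> v k) i)"
proof (rule supported_eqI)
  fix l assume l: "l \<in> basis A"
  have "(a \<star> (\<lambda>i. \<Sum>k\<in>K. v k i)) l = (\<Sum>i\<in>basis A. \<Sum>j\<in>basis A. \<Sum>k\<in>K. a i * v k j * mlt A i j l)"
    using l by (simp add: mulv_def sum_distrib_left sum_distrib_right)
  also have "\<dots> = (\<Sum>k\<in>K. \<Sum>i\<in>basis A. \<Sum>j\<in>basis A. a i * v k j * mlt A i j l)"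
    by (rule sum_move_in3[symmetric])
  finally show "(a \<star> (\<lambda>i. \<Sum>k\<in>K. v k i)) l = (\<Sum>k\<in>K. (a \<star> v k) l)" using l by (simp add: mulv_def)
qed (simp_all add: supported_def mulv_def)

lemma mulv_sum_left: "(\<lambda>i. \<Sum>k\<in>K. v k i) \<star> a = (\<lambda>i. \<Sum>k\<in>K. (v k \<star> a) i)"
proof (rule supported_eqI)
  fix l assume l: "l \<in> basis A"
  have "((\<lambda>i. \<Sum>k\<in>K. v k i) \<star> a) l = (\<Sum>i\<in>basis A. \<Sum>j\<in>basis A. \<Sum>k\<in>K. v k i * a j * mlt A i j l)"
    using l by (simp add: mulv_def sum_distrib_left sum_distrib_right)
  also have "\<dots> = (\<Sum>k\<in>K. \<Sum>i\<in>basis A. \<Sum>j\<in>basis A. v k i * a j * mlt A i j l)"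
    by (rule sum_move_in3[symmetric])
  finally show "((\<lambda>i. \<Sum>k\<in>K. v k i) \<star> a) l = (\<Sum>k\<in>K. (v k \<star> a) l)" using l by (simp add: mulv_def)
qed (simp_all add: supported_def mulv_def)

lemma eps_mulv: "eps (a \<star> b) = eps a * eps b"
proof -
  let ?I = "basis A"
  have "eps (a \<star> b) = (\<Sum>l\<in>?I. \<Sum>i\<in>?I. \<Sum>j\<in>?I. a i * b j * (mlt A i j l * cou A l))"
    by (simp add: eps_def mulv_def sum_distrib_right mult.assoc)
  also have "\<dots> = (\<Sum>i\<in>?I. \<Sum>j\<in>?I. \<Sum>l\<in>?I. a i * b j * (mlt A i j l * cou A l))"
    by (rule sum_move_in3)
  also have "\<dots> = (\<Sum>i\<in>?I. \<Sum>j\<in>?I. (a i * cou A i) * (b j * cou A j))"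
    by (intro sum.cong refl) (simp only: sum_distrib_left[symmetric] counit_mult, simp only: ac_simps)
  finally show ?thesis by (simp add: eps_def sum_product)
qed

lemma com_mulv:
  assumes "p \<in> basis A" "q \<in> basis A"
  shows "com (a \<star> b) p q = (\<Sum>i\<in>basis A. \<Sum>j\<in>basis A. \<Sum>k\<in>basis A. \<Sum>l\<in>basis A.
    com a i j * com b k l * (mlt A i k p * mlt A j l q))"
proof -
  let ?I = "basis A"
  have "com (a \<star> b) p q = (\<Sum>n\<in>?I. \<Sum>r\<in>?I. \<Sum>s\<in>?I. a r * b s * (mlt A r s n * cml A n p q))"
    by (simp add: com_def mulv_def sum_distrib_right mult.assoc)
  also have "\<dots> = (\<Sum>r\<in>?I. \<Sum>s\<in>?I. \<Sum>n\<in>?I. a r * b s * (mlt A r s n * cml A n p q))"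
    by (rule sum_move_in3)
  also have "\<dots> = (\<Sum>r\<in>?I. \<Sum>s\<in>?I. a r * b s * (\<Sum>i\<in>?I. \<Sum>j\<in>?I. \<Sum>k\<in>?I. \<Sum>l\<in>?I.
      cml A r i j * cml A s k l * mlt A i k p * mlt A j l q))"
    using assms by (intro sum.cong refl) (simp add: comult_mult flip: sum_distrib_left)
  also have "\<dots> = (\<Sum>r\<in>?I. \<Sum>s\<in>?I. \<Sum>i\<in>?I. \<Sum>j\<in>?I. \<Sum>k\<in>?I. \<Sum>l\<in>?I.
      a r * cml A r i j * (b s * cml A s k l) * (mlt A i k p * mlt A j l q))"
    by (simp add: sum_distrib_left ac_simps)
  also have "\<dots> = (\<Sum>r\<in>?I. \<Sum>i\<in>?I. \<Sum>j\<in>?I. \<Sum>k\<in>?I. \<Sum>l\<in>?I. \<Sum>s\<in>?I.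
      a r * cml A r i j * (b s * cml A s k l) * (mlt A i k p * mlt A j l q))"
    by (rule sum.cong[OF refl], rule sum_move_in5)
  also have "\<dots> = (\<Sum>r\<in>?I. \<Sum>i\<in>?I. \<Sum>j\<in>?I. \<Sum>k\<in>?I. \<Sum>l\<in>?I. a r * cml A r i j * com b k l * (mlt A i k p * mlt A j l q))"
    by (simp add: com_def sum_distrib_left sum_distrib_right)
  also have "\<dots> = (\<Sum>i\<in>?I. \<Sum>j\<in>?I. \<Sum>k\<in>?I. \<Sum>l\<in>?I. \<Sum>r\<in>?I. a r * cml A r i j * com b k l * (mlt A i k p * mlt A j l q))"
    by (rule sum_move_in5)
  also have "\<dots> = (\<Sum>i\<in>?I. \<Sum>j\<in>?I. \<Sum>k\<in>?I. \<Sum>l\<in>?I. com a i j * com b k l * (mlt A i k p * mlt A j l q))"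
    by (simp add: com_def sum_distrib_right)
  finally show ?thesis .
qed

text \<open>
  The multiplicativity of the coproduct, for coproducts that are given as sums of pure tensors.
\<close>

lemma com_mulv_tensors:
  assumes "p \<in> basis A" "q \<in> basis A"
    and a: "\<And>i j. i \<in> basis A \<Longrightarrow> j \<in> basis A \<Longrightarrow> com a i j = (\<Sum>u\<in>U. \<alpha> u i * \<beta> u j)"
    and b: "\<And>i j. i \<in> basis A \<Longrightarrow> j \<in> basis A \<Longrightarrow> com b i j = (\<Sum>w\<in>W. \<gamma> w i * \<delta> w j)"
  shows "com (a \<star> b) p q = (\<Sum>u\<in>U. \<Sum>w\<in>W. (\<alpha> u \<star> \<gamma> w) p * (\<beta> u \<star> \<delta> w) q)"
proof -
  let ?I = "basis A"
  have "com (a \<star> b) p q = (\<Sum>i\<in>?I. \<Sum>j\<in>?I. \<Sum>k\<in>?I. \<Sum>l\<in>?I.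
    (\<Sum>u\<in>U. \<alpha> u i * \<beta> u j) * (\<Sum>w\<in>W. \<gamma> w k * \<delta> w l) * (mlt A i k p * mlt A j l q))"
    unfolding com_mulv[OF assms(1,2)] by (intro sum.cong refl) (simp add: a b)
  also have "\<dots> = (\<Sum>i\<in>?I. \<Sum>j\<in>?I. \<Sum>k\<in>?I. \<Sum>l\<in>?I. \<Sum>u\<in>U. \<Sum>w\<in>W.
    (\<alpha> u i * \<gamma> w k * mlt A i k p) * (\<beta> u j * \<delta> w l * mlt A j l q))"
    unfolding sum_product unfolding sum_distrib_right by (simp only: ac_simps)
  also have "\<dots> = (\<Sum>i\<in>?I. \<Sum>j\<in>?I. \<Sum>k\<in>?I. \<Sum>u\<in>U. \<Sum>w\<in>W. \<Sum>l\<in>?I.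
    (\<alpha> u i * \<gamma> w k * mlt A i k p) * (\<beta> u j * \<delta> w l * mlt A j l q))"
    by (rule sum.cong[OF refl], rule sum.cong[OF refl], rule sum.cong[OF refl], rule sum_move_in3)
  also have "\<dots> = (\<Sum>i\<in>?I. \<Sum>k\<in>?I. \<Sum>u\<in>U. \<Sum>w\<in>W. \<Sum>j\<in>?I. \<Sum>l\<in>?I.
    (\<alpha> u i * \<gamma> w k * mlt A i k p) * (\<beta> u j * \<delta> w l * mlt A j l q))"
    by (rule sum.cong[OF refl], rule sum_move_in4)
  also have "\<dots> = (\<Sum>i\<in>?I. \<Sum>u\<in>U. \<Sum>w\<in>W. \<Sum>k\<in>?I. \<Sum>j\<in>?I. \<Sum>l\<in>?I.
    (\<alpha> u i * \<gamma> w k * mlt A i k p) * (\<beta> u j * \<delta> w l * mlt A j l q))"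
    by (rule sum.cong[OF refl], rule sum_move_in3)
  also have "\<dots> = (\<Sum>u\<in>U. \<Sum>w\<in>W. \<Sum>i\<in>?I. \<Sum>k\<in>?I. \<Sum>j\<in>?I. \<Sum>l\<in>?I.
    (\<alpha> u i * \<gamma> w k * mlt A i k p) * (\<beta> u j * \<delta> w l * mlt A j l q))"
    by (rule sum_move_in3)
  also have "\<dots> = (\<Sum>u\<in>U. \<Sum>w\<in>W. (\<alpha> u \<star> \<gamma> w) p * (\<beta> u \<star> \<delta> w) q)"
    using assms(1,2) by (simp only: mulv_def if_True sum_distrib_right) (simp only: sum_distrib_left)
  finally show ?thesis .
qed

lemma com_coassoc:
  assumes "i \<in> basis A" "j \<in> basis A" "l \<in> basis A"
  shows "com (\<lambda>p. com a p l) i j = com (com a i) j l"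
proof -
  let ?I = "basis A"
  have "com (\<lambda>p. com a p l) i j = (\<Sum>p\<in>?I. \<Sum>n\<in>?I. a n * (cml A n p l * cml A p i j))"
    by (simp add: com_def sum_distrib_right mult.assoc)
  also have "\<dots> = (\<Sum>n\<in>?I. \<Sum>p\<in>?I. a n * (cml A n i p * cml A p j l))"
    using assms by (subst sum.swap) (simp add: coassoc flip: sum_distrib_left)
  also have "\<dots> = com (com a i) j l"
    by (subst sum.swap) (simp add: com_def sum_distrib_right mult.assoc)
  finally show ?thesis .
qed

lemma com_counit_right:
  assumes "p \<in> basis A"
  shows "(\<Sum>q\<in>basis A. com a p q * cou A q) = a p"
proof -
  have "(\<Sum>q\<in>basis A. com a p q * cou A q) = (\<Sum>q\<in>basis A. \<Sum>i\<in>basis A. a i * (cml A i p q * cou A q))"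
    by (simp add: com_def sum_distrib_right mult.assoc)
  also have "\<dots> = (\<Sum>i\<in>basis A. a i * of_bool (i = p))"
    using assms by (subst sum.swap) (simp add: counit_right flip: sum_distrib_left)
  finally show ?thesis using assms finite_basis by (simp add: sum_of_bool_eq)
qed

lemma com_counit_left:
  assumes "q \<in> basis A"
  shows "(\<Sum>p\<in>basis A. com a p q * cou A p) = a q"
proof -
  have "(\<Sum>p\<in>basis A. com a p q * cou A p) = (\<Sum>p\<in>basis A. \<Sum>i\<in>basis A. a i * (cml A i p q * cou A p))"
    by (simp add: com_def sum_distrib_right mult.assoc)
  also have "\<dots> = (\<Sum>i\<in>basis A. a i * of_bool (i = q))"
    using assms by (subst sum.swap) (simp add: counit_left flip: sum_distrib_left)
  finally show ?thesis using assms finite_basis by (simp add: sum_of_bool_eq)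
qed

lemma com_scale: "com (\<lambda>i. c * a i) p q = c * com a p q"
  by (simp add: com_def sum_distrib_left mult.assoc)

lemma com_sum: "com (\<lambda>i. \<Sum>k\<in>K. v k i) p q = (\<Sum>k\<in>K. com (v k) p q)"
  by (simp add: com_def sum_distrib_right sum.swap[of _ K])

end

text \<open>
  An extension of \<open>k F\<close> by \<open>k\<^sup>\<Gamma>\<close> in coordinates: \<open>e s\<close> is the image of the idempotent \<open>e\<^sub>s\<close> in \<open>A\<close>, and
  \<open>\<pi> i x\<close> is the coefficient of \<open>x\<close> in the image of the basis vector \<open>i\<close>. The last four assumptions
  express that the coinvariants are \<open>k\<^sup>\<Gamma>\<close> and that the extension affords the two actions.
\<close>

locale abelian_extension = matched_pair F \<Gamma> lact ract + hopf_algebra A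
  for F :: "('f, 'm) monoid_scheme" and \<Gamma> :: "('g, 'n) monoid_scheme"
    and lact :: "'g \<Rightarrow> 'f \<Rightarrow> 'f" (infixr "\<triangleright>" 75)
    and ract :: "'g \<Rightarrow> 'f \<Rightarrow> 'g" (infixl "\<triangleleft>" 75)
    and A :: "('i, 'k::field) bialg" +
  fixes e :: "'g \<Rightarrow> 'i \<Rightarrow> 'k" and \<pi> :: "'i \<Rightarrow> 'f \<Rightarrow> 'k"
  assumes supported_e: "s \<in> carrier \<Gamma> \<Longrightarrow> supported (e s)"
    and e_mult: "\<lbrakk>s \<in> carrier \<Gamma>; t \<in> carrier \<Gamma>\<rbrakk> \<Longrightarrow> e s \<star> e t = (if s = t then e s else (\<lambda>_. 0))"
    and e_sum: "(\<lambda>i. \<Sum>s\<in>carrier \<Gamma>. e s i) = onev"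
    and e_com: "\<lbrakk>s \<in> carrier \<Gamma>; p \<in> basis A; q \<in> basis A\<rbrakk>
      \<Longrightarrow> com (e s) p q = (\<Sum>u\<in>carrier \<Gamma>. e (s \<otimes>\<^bsub>\<Gamma>\<^esub> inv\<^bsub>\<Gamma>\<^esub> u) p * e u q)"
    and e_eps: "s \<in> carrier \<Gamma> \<Longrightarrow> eps (e s) = of_bool (s = \<one>\<^bsub>\<Gamma>\<^esub>)"
    and e_nonzero: "s \<in> carrier \<Gamma> \<Longrightarrow> e s \<noteq> (\<lambda>_. 0)"
    and \<pi>_mult: "\<lbrakk>i \<in> basis A; j \<in> basis A; z \<in> carrier F\<rbrakk>
      \<Longrightarrow> (\<Sum>p\<in>basis A. mlt A i j p * \<pi> p z) = (\<Sum>x\<in>carrier F. \<pi> i x * \<pi> j (inv\<^bsub>F\<^esub> x \<otimes>\<^bsub>F\<^esub> z))"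
    and \<pi>_com: "\<lbrakk>i \<in> basis A; x \<in> carrier F; y \<in> carrier F\<rbrakk>
      \<Longrightarrow> (\<Sum>j\<in>basis A. \<Sum>l\<in>basis A. cml A i j l * (\<pi> j x * \<pi> l y)) = of_bool (x = y) * \<pi> i x"
    and \<pi>_eps: "i \<in> basis A \<Longrightarrow> (\<Sum>x\<in>carrier F. \<pi> i x) = cou A i"
    and \<pi>_surj: "x \<in> carrier F \<Longrightarrow> \<exists>a. \<forall>y\<in>carrier F. (\<Sum>i\<in>basis A. a i * \<pi> i y) = of_bool (y = x)"
    and coinvariants: "\<lbrakk>supported a; \<And>p y. \<lbrakk>p \<in> basis A; y \<in> carrier F\<rbrakk> \<Longrightarrow>
        (\<Sum>q\<in>basis A. com a p q * \<pi> q y) = of_bool (y = \<one>\<^bsub>F\<^esub>) * a p\<rbrakk>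
      \<Longrightarrow> \<exists>f. a = (\<lambda>i. \<Sum>s\<in>carrier \<Gamma>. f s * e s i)"
    and e_coinvariant: "\<lbrakk>s \<in> carrier \<Gamma>; p \<in> basis A; y \<in> carrier F\<rbrakk>
      \<Longrightarrow> (\<Sum>q\<in>basis A. com (e s) p q * \<pi> q y) = of_bool (y = \<one>\<^bsub>F\<^esub>) * e s p"
    and e_commute: "\<lbrakk>s \<in> carrier \<Gamma>; x \<in> carrier F; supported a;
        \<And>p y. \<lbrakk>p \<in> basis A; y \<in> carrier F\<rbrakk> \<Longrightarrow> (\<Sum>q\<in>basis A. com a p q * \<pi> q y) = of_bool (y = x) * a p\<rbrakk>
      \<Longrightarrow> e s \<star> a = a \<star> e (s \<triangleleft> x)"
    and e_left_degree: "\<lbrakk>s \<in> carrier \<Gamma>; x \<in> carrier F; supported a;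
        \<And>p y. \<lbrakk>p \<in> basis A; y \<in> carrier F\<rbrakk> \<Longrightarrow> (\<Sum>q\<in>basis A. com a p q * \<pi> q y) = of_bool (y = x) * a p;
        q \<in> basis A; y \<in> carrier F\<rbrakk>
      \<Longrightarrow> (\<Sum>p\<in>basis A. com (e s \<star> a) p q * \<pi> p y) = of_bool (y = s \<triangleright> x) * (e s \<star> a) q"
begin

text \<open>
  The projection of \<open>A\<close> onto its part of degree \<open>y\<close> for the coaction of \<open>k F\<close>.
\<close>

definition gr :: "'f \<Rightarrow> ('i \<Rightarrow> 'k) \<Rightarrow> 'i \<Rightarrow> 'k" where
  "gr y a = (\<lambda>p. if p \<in> basis A then \<Sum>q\<in>basis A. com a p q * \<pi> q y else 0)"

definition homog :: "'f \<Rightarrow> ('i \<Rightarrow> 'k) \<Rightarrow> bool" where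
  "homog x a \<longleftrightarrow> supported a \<and> (\<forall>p\<in>basis A. \<forall>y\<in>carrier F. (\<Sum>q\<in>basis A. com a p q * \<pi> q y) = of_bool (y = x) * a p)"

lemma homogD:
  "homog x a \<Longrightarrow> p \<in> basis A \<Longrightarrow> y \<in> carrier F \<Longrightarrow> (\<Sum>q\<in>basis A. com a p q * \<pi> q y) = of_bool (y = x) * a p"
  by (simp add: homog_def)

lemma homog_gr: "homog x a \<Longrightarrow> y \<in> carrier F \<Longrightarrow> gr y a = (if y = x then a else (\<lambda>_. 0))"
  by (auto simp: gr_def homog_def supported_def)

lemma homog_commute: "s \<in> carrier \<Gamma> \<Longrightarrow> x \<in> carrier F \<Longrightarrow> homog x a \<Longrightarrow> e s \<star> a = a \<star> e (s \<triangleleft> x)"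
  by (rule e_commute) (auto simp: homog_def)

lemma homog_left:
  "s \<in> carrier \<Gamma> \<Longrightarrow> x \<in> carrier F \<Longrightarrow> homog x a \<Longrightarrow> q \<in> basis A \<Longrightarrow> y \<in> carrier F \<Longrightarrow>
    (\<Sum>p\<in>basis A. com (e s \<star> a) p q * \<pi> p y) = of_bool (y = s \<triangleright> x) * (e s \<star> a) q"
  by (rule e_left_degree) (auto simp: homog_def)

lemma homog_e: "s \<in> carrier \<Gamma> \<Longrightarrow> homog \<one>\<^bsub>F\<^esub> (e s)"
  by (simp add: homog_def supported_e e_coinvariant)

lemma homog_one: "homog \<one>\<^bsub>F\<^esub> a \<Longrightarrow> \<exists>f. a = (\<lambda>i. \<Sum>s\<in>carrier \<Gamma>. f s * e s i)"
  by (rule coinvariants) (auto simp: homog_def)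

lemma homog_scale: "homog x a \<Longrightarrow> homog x (\<lambda>i. c * a i)"
  by (simp add: homog_def supported_def com_scale mult.assoc mult.left_commute flip: sum_distrib_left)

lemma e_absorb_sum:
  assumes "s \<in> carrier \<Gamma>"
  shows "e s \<star> (\<lambda>i. \<Sum>t\<in>carrier \<Gamma>. f t * e t i) = (\<lambda>i. f s * e s i)"
proof -
  have "e s \<star> (\<lambda>i. \<Sum>t\<in>carrier \<Gamma>. f t * e t i) = (\<lambda>i. \<Sum>t\<in>carrier \<Gamma>. if s = t then f s * e s i else 0)"
    unfolding mulv_sum_right mulv_scale using assms by (intro ext sum.cong) (auto simp: e_mult)
  then show ?thesis using assms finite_\<Gamma> by simp
qed

lemma homog_one_e:
  assumes "homog \<one>\<^bsub>F\<^esub> a" "s \<in> carrier \<Gamma>"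
  shows "\<exists>c. e s \<star> a = (\<lambda>i. c * e s i)"
  using homog_one[OF assms(1)] e_absorb_sum[OF assms(2)] by metis

lemma homog_mulv:
  assumes a: "homog x a" and b: "homog y b" and xy: "x \<in> carrier F" "y \<in> carrier F"
  shows "homog (x \<otimes>\<^bsub>F\<^esub> y) (a \<star> b)"
  unfolding homog_def
proof (intro conjI ballI)
  let ?I = "basis A"
  fix p z assume p: "p \<in> ?I" and z: "z \<in> carrier F"
  have "(\<Sum>q\<in>?I. com (a \<star> b) p q * \<pi> q z) = (\<Sum>q\<in>?I. \<Sum>i\<in>?I. \<Sum>j\<in>?I. \<Sum>k\<in>?I. \<Sum>l\<in>?I.
      com a i j * com b k l * mlt A i k p * (mlt A j l q * \<pi> q z))"
    using p by (simp add: com_mulv sum_distrib_right mult.assoc)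
  also have "\<dots> = (\<Sum>i\<in>?I. \<Sum>j\<in>?I. \<Sum>k\<in>?I. \<Sum>l\<in>?I. \<Sum>q\<in>?I.
      com a i j * com b k l * mlt A i k p * (mlt A j l q * \<pi> q z))"
    by (rule sum_move_in5)
  also have "\<dots> = (\<Sum>i\<in>?I. \<Sum>j\<in>?I. \<Sum>k\<in>?I. \<Sum>l\<in>?I. \<Sum>w\<in>carrier F.
      com a i j * \<pi> j w * mlt A i k p * (com b k l * \<pi> l (inv\<^bsub>F\<^esub> w \<otimes>\<^bsub>F\<^esub> z)))"
    using z by (intro sum.cong refl)
      (simp only: sum_distrib_left[symmetric] \<pi>_mult, simp add: sum_distrib_left ac_simps)
  also have "\<dots> = (\<Sum>w\<in>carrier F. \<Sum>i\<in>?I. \<Sum>j\<in>?I. \<Sum>k\<in>?I. \<Sum>l\<in>?I.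
      com a i j * \<pi> j w * mlt A i k p * (com b k l * \<pi> l (inv\<^bsub>F\<^esub> w \<otimes>\<^bsub>F\<^esub> z)))"
    by (rule sum_move_in5[symmetric])
  also have "\<dots> = (\<Sum>w\<in>carrier F. \<Sum>i\<in>?I. \<Sum>j\<in>?I. \<Sum>k\<in>?I.
      com a i j * \<pi> j w * (mlt A i k p * (of_bool (inv\<^bsub>F\<^esub> w \<otimes>\<^bsub>F\<^esub> z = y) * b k)))"
    using z by (intro sum.cong refl) (simp add: homogD[OF b] mult.assoc flip: sum_distrib_left)
  also have "\<dots> = (\<Sum>w\<in>carrier F. \<Sum>i\<in>?I. \<Sum>k\<in>?I. \<Sum>j\<in>?I.
      com a i j * \<pi> j w * (mlt A i k p * (of_bool (inv\<^bsub>F\<^esub> w \<otimes>\<^bsub>F\<^esub> z = y) * b k)))"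
    by (rule sum.cong[OF refl], rule sum.cong[OF refl], rule sum.swap)
  also have "\<dots> = (\<Sum>w\<in>carrier F. \<Sum>i\<in>?I. \<Sum>k\<in>?I.
      of_bool (w = x) * a i * (mlt A i k p * (of_bool (inv\<^bsub>F\<^esub> w \<otimes>\<^bsub>F\<^esub> z = y) * b k)))"
    by (intro sum.cong refl) (simp add: homogD[OF a] flip: sum_distrib_right)
  also have "\<dots> = (\<Sum>w\<in>carrier F. of_bool (w = x) * (of_bool (inv\<^bsub>F\<^esub> w \<otimes>\<^bsub>F\<^esub> z = y) * (a \<star> b) p))"
    using p by (simp add: mulv_def sum_distrib_left ac_simps)
  also have "\<dots> = of_bool (inv\<^bsub>F\<^esub> x \<otimes>\<^bsub>F\<^esub> z = y) * (a \<star> b) p"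
    using xy finite_F by (simp add: sum_of_bool_eq)
  also have "inv\<^bsub>F\<^esub> x \<otimes>\<^bsub>F\<^esub> z = y \<longleftrightarrow> z = x \<otimes>\<^bsub>F\<^esub> y"
    using xy z by (metis F.inv_closed F.inv_solve_left F.m_closed)
  finally show "(\<Sum>q\<in>?I. com (a \<star> b) p q * \<pi> q z) = of_bool (z = x \<otimes>\<^bsub>F\<^esub> y) * (a \<star> b) p" .
qed simp

lemma homog_of_gr:
  assumes x: "x \<in> carrier F"
  shows "homog x (gr x a)"
  unfolding homog_def
proof (intro conjI ballI)
  let ?I = "basis A"
  fix p y assume p: "p \<in> ?I" and y: "y \<in> carrier F"
  have "(\<Sum>q\<in>?I. com (gr x a) p q * \<pi> q y) = (\<Sum>q\<in>?I. \<Sum>r\<in>?I. com (\<lambda>i. com a i r) p q * \<pi> r x * \<pi> q y)"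
  proof (intro sum.cong refl)
    fix q assume "q \<in> ?I"
    have "com (gr x a) p q = com (\<lambda>i. \<Sum>r\<in>?I. \<pi> r x * com a i r) p q"
      by (simp add: com_def gr_def mult.commute)
    also have "\<dots> = (\<Sum>r\<in>?I. com (\<lambda>i. com a i r) p q * \<pi> r x)"
      unfolding com_sum com_scale by (simp add: mult.commute)
    finally show "com (gr x a) p q * \<pi> q y = (\<Sum>r\<in>?I. com (\<lambda>i. com a i r) p q * \<pi> r x * \<pi> q y)"
      by (simp add: sum_distrib_right)
  qed
  also have "\<dots> = (\<Sum>q\<in>?I. \<Sum>r\<in>?I. \<Sum>n\<in>?I. com a p n * (cml A n q r * (\<pi> q y * \<pi> r x)))"
    using p by (intro sum.cong refl)
      (simp add: com_coassoc, simp add: com_def[of "com a p"] sum_distrib_right sum_distrib_left ac_simps)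
  also have "\<dots> = (\<Sum>n\<in>?I. \<Sum>q\<in>?I. \<Sum>r\<in>?I. com a p n * (cml A n q r * (\<pi> q y * \<pi> r x)))"
    by (rule sum_move_in3[symmetric])
  also have "\<dots> = (\<Sum>n\<in>?I. com a p n * (of_bool (y = x) * \<pi> n y))"
    using x y by (intro sum.cong refl) (simp add: \<pi>_com flip: sum_distrib_left)
  also have "\<dots> = of_bool (y = x) * gr x a p"
    using p by (auto simp: gr_def sum_distrib_left)
  finally show "(\<Sum>q\<in>?I. com (gr x a) p q * \<pi> q y) = of_bool (y = x) * gr x a p" .
qed (simp add: gr_def supported_def)

lemma sum_gr:
  assumes "supported a"
  shows "(\<lambda>i. \<Sum>x\<in>carrier F. gr x a i) = a"
proof (rule supported_eqI)
  fix p assume p: "p \<in> basis A"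
  have "(\<Sum>x\<in>carrier F. gr x a p) = (\<Sum>q\<in>basis A. \<Sum>x\<in>carrier F. com a p q * \<pi> q x)"
    using p by (subst sum.swap) (simp add: gr_def)
  also have "\<dots> = (\<Sum>q\<in>basis A. com a p q * cou A q)"
    by (simp add: \<pi>_eps flip: sum_distrib_left)
  finally show "(\<Sum>x\<in>carrier F. gr x a p) = a p" using com_counit_right[OF p] by simp
qed (use assms in \<open>simp_all add: supported_def gr_def\<close>)

lemma gr_sum: "gr y (\<lambda>i. \<Sum>k\<in>K. v k i) = (\<lambda>i. \<Sum>k\<in>K. gr y (v k) i)"
proof (rule ext)
  fix p
  show "gr y (\<lambda>i. \<Sum>k\<in>K. v k i) p = (\<Sum>k\<in>K. gr y (v k) p)"
    unfolding gr_def com_sum sum_distrib_right by (simp add: sum.swap[of _ "basis A" K])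
qed

text \<open>
  By coassociativity the right legs of the coproduct of a homogeneous element have the same degree.
\<close>

lemma homog_slice:
  assumes a: "homog x a" and i: "i \<in> basis A"
  shows "homog x (\<lambda>p. if p \<in> basis A then com a i p else 0)"
  unfolding homog_def
proof (intro conjI ballI)
  let ?I = "basis A"
  let ?d = "\<lambda>p. if p \<in> ?I then com a i p else 0"
  fix p y assume p: "p \<in> ?I" and y: "y \<in> carrier F"
  have "(\<Sum>q\<in>?I. com ?d p q * \<pi> q y) = (\<Sum>q\<in>?I. com (com a i) p q * \<pi> q y)"
    by (simp add: com_def)
  also have "\<dots> = (\<Sum>q\<in>?I. com (\<lambda>n. com a n q * \<pi> q y) i p)"
    using p i by (intro sum.cong refl) (simp flip: com_coassoc add: com_scale[of "\<pi> _ y", simplified mult.commute[of "\<pi> _ y"]])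
  also have "\<dots> = com (\<lambda>n. \<Sum>q\<in>?I. com a n q * \<pi> q y) i p"
    by (rule com_sum[symmetric])
  also have "\<dots> = com (\<lambda>n. of_bool (y = x) * a n) i p"
    unfolding com_def[of "\<lambda>n. \<Sum>q\<in>?I. com a n q * \<pi> q y"] com_def[of "\<lambda>n. of_bool (y = x) * a n"]
    by (intro sum.cong refl) (simp add: homogD[OF a _ y])
  finally show "(\<Sum>q\<in>?I. com ?d p q * \<pi> q y) = of_bool (y = x) * ?d p"
    using p by (simp add: com_scale)
qed (simp add: supported_def)

lemma eps_gr:
  assumes "x \<in> carrier F"
  shows "eps (gr x a) = (\<Sum>i\<in>basis A. a i * \<pi> i x)"
proof -
  let ?I = "basis A"
  have "eps (gr x a) = (\<Sum>p\<in>?I. \<Sum>q\<in>?I. com a p q * cou A p * \<pi> q x)"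
    by (simp add: eps_def gr_def sum_distrib_left sum_distrib_right ac_simps)
  also have "\<dots> = (\<Sum>q\<in>?I. (\<Sum>p\<in>?I. com a p q * cou A p) * \<pi> q x)"
    by (subst sum.swap) (simp add: sum_distrib_right)
  finally show ?thesis by (simp add: com_counit_left)
qed

text \<open>
  Take \<open>b\<close> of degree \<open>x\<close> with counit 1, which exists because the projection to \<open>k F\<close> is surjective. In the
  antipode axiom \<open>1 = \<Sum> S(b\<^sub>1) b\<^sub>2\<close> the factors \<open>b\<^sub>2\<close> have degree \<open>x\<close>. Since 1 has trivial degree, the factors
  \<open>S(b\<^sub>1)\<close> can be replaced by their parts of degree \<open>inverse x\<close>.
\<close>

lemma one_decomposition:
  assumes x: "x \<in> carrier F"
  shows "\<exists>g d. (\<forall>j\<in>basis A. homog (inv\<^bsub>F\<^esub> x) (g j) \<and> homog x (d j)) \<and> onev = (\<lambda>l. \<Sum>j\<in>basis A. (g j \<star> d j) l)"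
proof -
  let ?I = "basis A"
  obtain b0 where b0: "\<forall>y\<in>carrier F. (\<Sum>i\<in>?I. b0 i * \<pi> i y) = of_bool (y = x)" using \<pi>_surj[OF x] by blast
  define b where "b = gr x b0"
  have b: "homog x b" "eps b = 1" using homog_of_gr[OF x] eps_gr[OF x] b0 x by (auto simp: b_def)
  obtain S where S: "\<forall>i\<in>?I. \<forall>n\<in>?I. (\<Sum>j\<in>?I. \<Sum>l\<in>?I. \<Sum>p\<in>?I. cml A i j l * S j p * mlt A p l n) = cou A i * unt A n"
    using antipode by blast
  define d where "d j = (\<lambda>p. if p \<in> ?I then com b j p else 0)" for j
  define g0 where "g0 j = (\<lambda>p. if p \<in> ?I then S j p else 0)" for j
  have d: "homog x (d j)" if "j \<in> ?I" for j using homog_slice[OF b(1) that] by (simp add: d_def)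
  have one: "onev = (\<lambda>l. \<Sum>j\<in>?I. (g0 j \<star> d j) l)"
  proof (rule supported_eqI)
    fix n assume n: "n \<in> ?I"
    have "(\<Sum>j\<in>?I. (g0 j \<star> d j) n) = (\<Sum>j\<in>?I. \<Sum>p\<in>?I. \<Sum>l\<in>?I. \<Sum>i\<in>?I. b i * (cml A i j l * S j p * mlt A p l n))"
      using n by (simp add: mulv_def g0_def d_def com_def sum_distrib_left sum_distrib_right ac_simps)
    also have "\<dots> = (\<Sum>i\<in>?I. \<Sum>j\<in>?I. \<Sum>p\<in>?I. \<Sum>l\<in>?I. b i * (cml A i j l * S j p * mlt A p l n))"
      by (rule sum_move_in4[symmetric])
    also have "\<dots> = (\<Sum>i\<in>?I. \<Sum>j\<in>?I. \<Sum>l\<in>?I. \<Sum>p\<in>?I. b i * (cml A i j l * S j p * mlt A p l n))"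
      by (rule sum.cong[OF refl], rule sum.cong[OF refl], rule sum.swap)
    also have "\<dots> = (\<Sum>i\<in>?I. b i * (cou A i * unt A n))"
      using S n by (intro sum.cong refl) (simp flip: sum_distrib_left)
    also have "\<dots> = eps b * unt A n" by (simp add: eps_def sum_distrib_right mult.assoc)
    finally show "onev n = (\<Sum>j\<in>?I. (g0 j \<star> d j) n)" using b n by (simp add: onev_def)
  qed (simp_all add: supported_def mulv_def onev_def)
  have unit: "homog \<one>\<^bsub>F\<^esub> onev"
    unfolding e_sum[symmetric] homog_def com_sum
    using supported_e by (auto simp: supported_def sum_distrib_right sum.swap[of _ "carrier \<Gamma>" ?I] e_coinvariant)
  have g0: "supported (g0 j)" for j by (simp add: g0_def supported_def)
  have "onev = gr \<one>\<^bsub>F\<^esub> onev" using homog_gr[OF unit] by simp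
  also have "\<dots> = (\<lambda>l. \<Sum>j\<in>?I. gr \<one>\<^bsub>F\<^esub> (g0 j \<star> d j) l)" by (subst one) (rule gr_sum)
  also have "\<dots> = (\<lambda>l. \<Sum>j\<in>?I. (gr (inv\<^bsub>F\<^esub> x) (g0 j) \<star> d j) l)"
  proof (intro ext sum.cong refl)
    fix l j assume j: "j \<in> ?I"
    have "gr \<one>\<^bsub>F\<^esub> (g0 j \<star> d j) = gr \<one>\<^bsub>F\<^esub> ((\<lambda>i. \<Sum>y\<in>carrier F. gr y (g0 j) i) \<star> d j)"
      using sum_gr[OF g0] by simp
    also have "\<dots> = (\<lambda>l. \<Sum>y\<in>carrier F. gr \<one>\<^bsub>F\<^esub> (gr y (g0 j) \<star> d j) l)"
      unfolding mulv_sum_left gr_sum ..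
    also have "\<dots> = (\<lambda>l. \<Sum>y\<in>carrier F. if y = inv\<^bsub>F\<^esub> x then (gr y (g0 j) \<star> d j) l else 0)"
    proof (intro ext sum.cong refl)
      fix l y assume y: "y \<in> carrier F"
      have "homog (y \<otimes>\<^bsub>F\<^esub> x) (gr y (g0 j) \<star> d j)"
        by (rule homog_mulv[OF homog_of_gr[OF y] d[OF j] y x])
      moreover have "\<one>\<^bsub>F\<^esub> = y \<otimes>\<^bsub>F\<^esub> x \<longleftrightarrow> y = inv\<^bsub>F\<^esub> x"
        using x y by (metis F.inv_equality F.l_inv)
      ultimately show "gr \<one>\<^bsub>F\<^esub> (gr y (g0 j) \<star> d j) l = (if y = inv\<^bsub>F\<^esub> x then (gr y (g0 j) \<star> d j) l else 0)"
        using homog_gr by auto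
    qed
    finally show "gr \<one>\<^bsub>F\<^esub> (g0 j \<star> d j) l = (gr (inv\<^bsub>F\<^esub> x) (g0 j) \<star> d j) l"
      using x finite_F by simp
  qed
  finally have "onev = (\<lambda>l. \<Sum>j\<in>?I. (gr (inv\<^bsub>F\<^esub> x) (g0 j) \<star> d j) l)" .
  then show ?thesis
    using d homog_of_gr[of "inv\<^bsub>F\<^esub> x"] x by (intro exI[of _ "\<lambda>j. gr (inv\<^bsub>F\<^esub> x) (g0 j)"] exI[of _ d]) auto
qed

text \<open>
  The decomposition of 1 yields \<open>g\<close> of degree \<open>x\<close> and \<open>d\<close> of the inverse degree with \<open>e\<^sub>s g d \<noteq> 0\<close>. This product is
  a coinvariant, hence a multiple of \<open>e\<^sub>s\<close>. So \<open>e\<^sub>s g\<close> has an inverse up to \<open>e\<^sub>s\<close>, and multiplication by the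
  inverse identifies \<open>e\<^sub>s A\<^sub>x\<close> with the line \<open>e\<^sub>s A\<^sub>1\<close>.
\<close>

lemma component_generator:
  assumes s: "s \<in> carrier \<Gamma>" and x: "x \<in> carrier F"
  shows "\<exists>a b. homog x a \<and> e s \<star> a = a \<and> homog (inv\<^bsub>F\<^esub> x) b \<and> a \<star> b = e s \<and> b \<star> a = e (s \<triangleleft> x)
    \<and> (\<forall>c. homog x c \<longrightarrow> e s \<star> c = c \<longrightarrow> (\<exists>\<zeta>. c = (\<lambda>i. \<zeta> * a i)))"
proof -
  let ?I = "basis A" and ?t = "s \<triangleleft> x"
  have t: "?t \<in> carrier \<Gamma>" and xi: "inv\<^bsub>F\<^esub> x \<in> carrier F" using s x by auto
  obtain g d where gd: "\<forall>j\<in>?I. homog x (g j) \<and> homog (inv\<^bsub>F\<^esub> x) (d j)"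
    and one: "onev = (\<lambda>l. \<Sum>j\<in>?I. (g j \<star> d j) l)"
    using one_decomposition[OF xi] x by auto
  have gd1: "homog \<one>\<^bsub>F\<^esub> (g j \<star> d j)" if "j \<in> ?I" for j
    using homog_mulv[of x "g j" "inv\<^bsub>F\<^esub> x" "d j"] gd that x by simp
  have es: "e s = (\<lambda>l. \<Sum>j\<in>?I. (e s \<star> (g j \<star> d j)) l)"
    using mulv_onev[OF supported_e[OF s]] unfolding one mulv_sum_right by simp
  have "\<exists>j\<in>?I. e s \<star> (g j \<star> d j) \<noteq> (\<lambda>_. 0)"
  proof (rule ccontr)
    assume "\<not> ?thesis"
    then have "e s = (\<lambda>_. 0)" by (subst es) simp
    then show False using e_nonzero[OF s] by simp
  qed
  then obtain j where j: "j \<in> ?I" "e s \<star> (g j \<star> d j) \<noteq> (\<lambda>_. 0)" by blast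
  obtain c where c: "e s \<star> (g j \<star> d j) = (\<lambda>i. c * e s i)" using homog_one_e[OF gd1[OF j(1)] s] by blast
  have "c \<noteq> 0" using j(2) unfolding c by auto
  define a where "a = e s \<star> g j"
  define b0 where "b0 = (\<lambda>i. inverse c * d j i)"
  define b where "b = e ?t \<star> b0"
  have a: "homog x a" using homog_mulv[OF homog_e[OF s] _ F.one_closed x] gd j x by (simp add: a_def)
  have b0: "homog (inv\<^bsub>F\<^esub> x) b0" using gd j by (simp add: b0_def homog_scale)
  have b: "homog (inv\<^bsub>F\<^esub> x) b" using homog_mulv[OF homog_e[OF t] b0 F.one_closed xi] xi by (simp add: b_def)
  have esa: "e s \<star> a = a" using s by (simp add: a_def e_mult flip: mulv_assoc)
  have aet: "a \<star> e ?t = a" using homog_commute[OF s x a] esa by simp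
  have "a \<star> b = a \<star> b0" using aet by (simp add: b_def flip: mulv_assoc)
  also have "\<dots> = (\<lambda>i. inverse c * (e s \<star> (g j \<star> d j)) i)"
    by (simp add: a_def b0_def mulv_scale mulv_assoc)
  also have "\<dots> = e s" using \<open>c \<noteq> 0\<close> by (simp add: c flip: mult.assoc)
  finally have ab: "a \<star> b = e s" .
  have etb: "e ?t \<star> b = b" using t by (simp add: b_def e_mult flip: mulv_assoc)
  have ba1: "homog \<one>\<^bsub>F\<^esub> (b \<star> a)" using homog_mulv[OF b a xi x] x by simp
  obtain \<mu> where \<mu>: "b \<star> a = (\<lambda>i. \<mu> * e ?t i)"
    using homog_one_e[OF ba1 t] etb by (simp flip: mulv_assoc) blast
  have "a = (a \<star> b) \<star> a" using ab esa by simp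
  also have "\<dots> = (\<lambda>i. \<mu> * a i)" by (simp add: mulv_assoc \<mu> mulv_scale aet)
  finally have a\<mu>: "a = (\<lambda>i. \<mu> * a i)" .
  have "a \<noteq> (\<lambda>_. 0)" using ab e_nonzero[OF s] by auto
  then obtain i where "a i \<noteq> 0" by auto
  then have "\<mu> = 1" using fun_cong[OF a\<mu>, of i] by simp
  then have ba: "b \<star> a = e ?t" using \<mu> by simp
  have "\<exists>\<zeta>. c = (\<lambda>i. \<zeta> * a i)" if hc: "homog x c" "e s \<star> c = c" for c
  proof -
    have "homog \<one>\<^bsub>F\<^esub> (c \<star> b)" using homog_mulv[OF hc(1) b x xi] x by simp
    then obtain \<zeta> where "e s \<star> (c \<star> b) = (\<lambda>i. \<zeta> * e s i)" using homog_one_e[OF _ s] by blast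
    then have cb: "c \<star> b = (\<lambda>i. \<zeta> * e s i)" using hc(2) by (simp flip: mulv_assoc)
    have "c = c \<star> e ?t" using homog_commute[OF s x hc(1)] hc(2) by simp
    also have "\<dots> = (c \<star> b) \<star> a" by (simp add: ba mulv_assoc)
    also have "\<dots> = (\<lambda>i. \<zeta> * a i)" by (simp add: cb mulv_scale esa)
    finally show ?thesis by blast
  qed
  then show ?thesis using a b ab ba esa by blast
qed

text \<open>
  The generators are normalized so that the cocycles built from them are normalized.
\<close>

lemma generators_exist:
  "\<exists>a. \<forall>s\<in>carrier \<Gamma>. \<forall>x\<in>carrier F. homog x (a s x) \<and> e s \<star> a s x = a s x
    \<and> (\<exists>b. a s x \<star> b = e s \<and> b \<star> a s x = e (s \<triangleleft> x))
    \<and> (\<forall>c. homog x c \<longrightarrow> e s \<star> c = c \<longrightarrow> (\<exists>\<zeta>. c = (\<lambda>i. \<zeta> * a s x i)))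
    \<and> (x = \<one>\<^bsub>F\<^esub> \<longrightarrow> a s x = e s) \<and> (s = \<one>\<^bsub>\<Gamma>\<^esub> \<longrightarrow> eps (a s x) = 1)"
    (is "\<exists>a. \<forall>s\<in>_. \<forall>x\<in>_. ?Q s x (a s x)")
proof -
  have "\<exists>a. ?Q s x a" if s: "s \<in> carrier \<Gamma>" and x: "x \<in> carrier F" for s x
  proof (cases "x = \<one>\<^bsub>F\<^esub>")
    case True
    have "\<exists>\<zeta>. c = (\<lambda>i. \<zeta> * e s i)" if "homog x c" "e s \<star> c = c" for c
      using homog_one_e[of c s] that s True by auto
    then have "?Q s x (e s)" using s True by (auto simp: homog_e e_mult e_eps intro!: exI[of _ "e s"])
    then show ?thesis by blast
  next
    case False
    obtain a b where ab: "homog x a" "e s \<star> a = a" "a \<star> b = e s" "b \<star> a = e (s \<triangleleft> x)"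
      "\<forall>c. homog x c \<longrightarrow> e s \<star> c = c \<longrightarrow> (\<exists>\<zeta>. c = (\<lambda>i. \<zeta> * a i))"
      using component_generator[OF s x] by blast
    \<comment> \<open>Only generators with \<open>s = 1\<close> have a nonzero counit.\<close>
    define k where "k = (if s = \<one>\<^bsub>\<Gamma>\<^esub> then inverse (eps a) else 1)"
    have "eps a * eps b = of_bool (s = \<one>\<^bsub>\<Gamma>\<^esub>)" using ab(3) e_eps[OF s] by (metis eps_mulv)
    then have nz: "s = \<one>\<^bsub>\<Gamma>\<^esub> \<Longrightarrow> eps a \<noteq> 0" by auto
    then have k: "k \<noteq> 0" "s = \<one>\<^bsub>\<Gamma>\<^esub> \<Longrightarrow> k * eps a = 1" by (auto simp: k_def)
    have 1: "(\<lambda>i. k * a i) \<star> (\<lambda>i. inverse k * b i) = e s"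
      "(\<lambda>i. inverse k * b i) \<star> (\<lambda>i. k * a i) = e (s \<triangleleft> x)"
      using k(1) by (simp_all add: mulv_scale ab flip: mult.assoc)
    have 2: "\<exists>\<zeta>. c = (\<lambda>i. \<zeta> * (k * a i))" if c: "homog x c" "e s \<star> c = c" for c
    proof -
      obtain \<zeta> where "c = (\<lambda>i. \<zeta> * a i)" using ab(5) c by blast
      then have "c = (\<lambda>i. (\<zeta> * inverse k) * (k * a i))" using k(1) by (simp add: mult.assoc fun_eq_iff)
      then show ?thesis by blast
    qed
    have 3: "eps (\<lambda>i. k * a i) = k * eps a" by (simp add: eps_def sum_distrib_left mult.assoc)
    have 4: "e s \<star> (\<lambda>i. k * a i) = (\<lambda>i. k * a i)" by (simp add: mulv_scale ab(2))
    have "?Q s x (\<lambda>i. k * a i)"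
    proof (intro conjI allI impI)
      show "\<exists>b. (\<lambda>i. k * a i) \<star> b = e s \<and> b \<star> (\<lambda>i. k * a i) = e (s \<triangleleft> x)" using 1 by blast
    qed (use 2 3 4 k False homog_scale[OF ab(1)] in auto)
    then show ?thesis by blast
  qed
  then have "\<forall>p\<in>carrier \<Gamma> \<times> carrier F. \<exists>a. ?Q (fst p) (snd p) a" by auto
  from bchoice[OF this] obtain h where h: "\<forall>p\<in>carrier \<Gamma> \<times> carrier F. ?Q (fst p) (snd p) (h p)" by blast
  show ?thesis
  proof (rule exI[of _ "\<lambda>s x. h (s, x)"], intro ballI)
    fix s x assume "s \<in> carrier \<Gamma>" "x \<in> carrier F"
    then have "(s, x) \<in> carrier \<Gamma> \<times> carrier F" by simp
    from h[THEN bspec, OF this] show "?Q s x (h (s, x))" unfolding fst_conv snd_conv .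
  qed
qed

end

locale extension_basis = abelian_extension F \<Gamma> lact ract A e \<pi>
  for F :: "('f, 'm) monoid_scheme" and \<Gamma> :: "('g, 'n) monoid_scheme"
    and lact :: "'g \<Rightarrow> 'f \<Rightarrow> 'f" (infixr "\<triangleright>" 75)
    and ract :: "'g \<Rightarrow> 'f \<Rightarrow> 'g" (infixl "\<triangleleft>" 75)
    and A :: "('i, 'k::field) bialg" and e and \<pi> +
  fixes a :: "'g \<Rightarrow> 'f \<Rightarrow> 'i \<Rightarrow> 'k"
  assumes a_homog: "\<lbrakk>s \<in> carrier \<Gamma>; x \<in> carrier F\<rbrakk> \<Longrightarrow> homog x (a s x)"
    and a_left: "\<lbrakk>s \<in> carrier \<Gamma>; x \<in> carrier F\<rbrakk> \<Longrightarrow> e s \<star> a s x = a s x"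
    and a_invertible: "\<lbrakk>s \<in> carrier \<Gamma>; x \<in> carrier F\<rbrakk> \<Longrightarrow> \<exists>b. a s x \<star> b = e s \<and> b \<star> a s x = e (s \<triangleleft> x)"
    and a_span: "\<lbrakk>s \<in> carrier \<Gamma>; x \<in> carrier F; homog x c; e s \<star> c = c\<rbrakk> \<Longrightarrow> \<exists>\<zeta>. c = (\<lambda>i. \<zeta> * a s x i)"
    and a_one: "s \<in> carrier \<Gamma> \<Longrightarrow> a s \<one>\<^bsub>F\<^esub> = e s"
    and a_eps: "x \<in> carrier F \<Longrightarrow> eps (a \<one>\<^bsub>\<Gamma>\<^esub> x) = 1"
begin

lemma a_supported: "s \<in> carrier \<Gamma> \<Longrightarrow> x \<in> carrier F \<Longrightarrow> supported (a s x)"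
  using a_homog by (simp add: homog_def)

lemma a_nonzero: "s \<in> carrier \<Gamma> \<Longrightarrow> x \<in> carrier F \<Longrightarrow> a s x \<noteq> (\<lambda>_. 0)"
  using a_invertible[of s x] e_nonzero[of s] by auto

lemma a_cancel:
  assumes "s \<in> carrier \<Gamma>" "x \<in> carrier F" "\<And>i. i \<in> basis A \<Longrightarrow> c * a s x i = d * a s x i"
  shows "c = d"
proof -
  obtain i where i: "a s x i \<noteq> 0" using a_nonzero[OF assms(1,2)] by auto
  then have "i \<in> basis A" using a_supported[OF assms(1,2)] by (auto simp: supported_def)
  from assms(3)[OF this] i show ?thesis by simp
qed

lemma a_right: "s \<in> carrier \<Gamma> \<Longrightarrow> x \<in> carrier F \<Longrightarrow> a s x \<star> e (s \<triangleleft> x) = a s x"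
  using homog_commute[OF _ _ a_homog] a_left by simp

definition unit_vec :: "'i \<Rightarrow> 'i \<Rightarrow> 'k" where
  "unit_vec i = (\<lambda>j. of_bool (j = i))"

text \<open>
  The functional dual to \<open>a s x\<close>: the part \<open>e\<^sub>s (b\<^sub>i)\<^sub>x\<close> of the basis vector is a multiple of \<open>a s x\<close>.
  \<open>K\<close> is its linear extension.
\<close>

definition kap :: "'g \<Rightarrow> 'f \<Rightarrow> 'i \<Rightarrow> 'k" where
  "kap s x i = (SOME \<zeta>. e s \<star> gr x (unit_vec i) = (\<lambda>l. \<zeta> * a s x l))"

definition K :: "'g \<Rightarrow> 'f \<Rightarrow> ('i \<Rightarrow> 'k) \<Rightarrow> 'k" where
  "K s x v = (\<Sum>i\<in>basis A. kap s x i * v i)"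

lemma com_unit_vec: "i \<in> basis A \<Longrightarrow> com (unit_vec i) p q = cml A i p q"
  using finite_basis by (simp add: com_def unit_vec_def sum_of_bool_eq)

lemma kap: "s \<in> carrier \<Gamma> \<Longrightarrow> x \<in> carrier F \<Longrightarrow> e s \<star> gr x (unit_vec i) = (\<lambda>l. kap s x i * a s x l)"
proof -
  assume s: "s \<in> carrier \<Gamma>" and x: "x \<in> carrier F"
  have "homog x (e s \<star> gr x (unit_vec i))"
    using homog_mulv[OF homog_e[OF s] homog_of_gr[OF x] F.one_closed x] x by simp
  moreover have "e s \<star> (e s \<star> gr x (unit_vec i)) = e s \<star> gr x (unit_vec i)"
    using s by (simp add: e_mult flip: mulv_assoc)
  ultimately have "\<exists>\<zeta>. e s \<star> gr x (unit_vec i) = (\<lambda>l. \<zeta> * a s x l)" using a_span[OF s x] by blast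
  then show ?thesis unfolding kap_def by (rule someI_ex)
qed

lemma K_eq:
  assumes s: "s \<in> carrier \<Gamma>" and x: "x \<in> carrier F"
  shows "e s \<star> gr x v = (\<lambda>l. K s x v * a s x l)"
proof -
  have "gr x v = (\<lambda>p. \<Sum>i\<in>basis A. v i * gr x (unit_vec i) p)"
  proof (rule ext)
    fix p
    have "com v p q = (\<Sum>i\<in>basis A. v i * com (unit_vec i) p q)" for q
      by (simp add: com_def[of v] com_unit_vec)
    then have "(\<Sum>q\<in>basis A. com v p q * \<pi> q x) = (\<Sum>i\<in>basis A. v i * (\<Sum>q\<in>basis A. com (unit_vec i) p q * \<pi> q x))"
      by (simp add: sum_distrib_left sum_distrib_right mult.assoc) (rule sum.swap)
    then show "gr x v p = (\<Sum>i\<in>basis A. v i * gr x (unit_vec i) p)" by (simp add: gr_def)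
  qed
  then show ?thesis
    using kap[OF s x] by (simp add: mulv_sum_right mulv_scale K_def sum_distrib_right mult.assoc mult.left_commute)
qed

lemma K_homog:
  assumes "s \<in> carrier \<Gamma>" "x \<in> carrier F" "y \<in> carrier F" "homog y v" "y \<noteq> x"
  shows "K s x v = 0"
proof (rule a_cancel[OF assms(1,2)])
  fix i
  have "e s \<star> gr x v = (\<lambda>_. 0)" using homog_gr[OF assms(4,2)] assms(5) by auto
  then show "K s x v * a s x i = 0 * a s x i" using K_eq[OF assms(1,2)] by (metis mult_zero_left)
qed

lemma K_a:
  assumes "s \<in> carrier \<Gamma>" "x \<in> carrier F" "t \<in> carrier \<Gamma>" "y \<in> carrier F"
  shows "K s x (a t y) = of_bool (s = t \<and> x = y)"
proof (cases "x = y")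
  case True
  have "e s \<star> a t y = (if s = t then a t y else (\<lambda>_. 0))"
  proof -
    have "e s \<star> a t y = (e s \<star> e t) \<star> a t y" using a_left[of t y] assms by (simp add: mulv_assoc)
    then show ?thesis using assms by (simp add: e_mult a_left)
  qed
  then have *: "(\<lambda>l. K s x (a t y) * a s x l) = (if s = t then a t y else (\<lambda>_. 0))"
    using K_eq[OF assms(1,2), of "a t y"] homog_gr[OF a_homog] assms True by simp
  show ?thesis
    by (rule a_cancel[OF assms(1,2)]) (use fun_cong[OF *] True in \<open>auto split: if_splits\<close>)
qed (use K_homog[OF assms(1,2,4) a_homog[OF assms(3,4)]] in auto)

lemma expand:
  assumes "supported v"
  shows "v = (\<lambda>l. \<Sum>s\<in>carrier \<Gamma>. \<Sum>x\<in>carrier F. K s x v * a s x l)"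
proof -
  have "v = onev \<star> (\<lambda>i. \<Sum>x\<in>carrier F. gr x v i)"
    using sum_gr[OF assms] onev_mulv[OF assms] by simp
  also have "\<dots> = (\<lambda>l. \<Sum>s\<in>carrier \<Gamma>. (\<lambda>i. \<Sum>x\<in>carrier F. (e s \<star> gr x v) i) l)"
    unfolding e_sum[symmetric] mulv_sum_left mulv_sum_right ..
  finally show ?thesis by (simp add: K_eq)
qed

lemma K_unit_vec: "i \<in> basis A \<Longrightarrow> K s x (unit_vec i) = kap s x i"
  using finite_basis by (simp add: K_def unit_vec_def sum_of_bool_eq)

lemma completeness:
  assumes "i \<in> basis A"
  shows "(\<Sum>s\<in>carrier \<Gamma>. \<Sum>x\<in>carrier F. kap s x i * a s x j) = of_bool (j = i)"
proof -
  have "supported (unit_vec i)" using assms by (auto simp: supported_def unit_vec_def)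
  from fun_cong[OF expand[OF this], of j]
  have "unit_vec i j = (\<Sum>s\<in>carrier \<Gamma>. \<Sum>x\<in>carrier F. kap s x i * a s x j)"
    using assms by (simp add: K_unit_vec)
  then show ?thesis unfolding unit_vec_def by (rule sym)
qed

definition \<sigma> :: "'g \<Rightarrow> 'f \<Rightarrow> 'f \<Rightarrow> 'k" where
  "\<sigma> s x y = K s (x \<otimes>\<^bsub>F\<^esub> y) (a s x \<star> a (s \<triangleleft> x) y)"

lemma a_mult:
  assumes "s \<in> carrier \<Gamma>" "x \<in> carrier F" "t \<in> carrier \<Gamma>" "y \<in> carrier F"
  shows "a s x \<star> a t y = (if s \<triangleleft> x = t then (\<lambda>i. \<sigma> s x y * a s (x \<otimes>\<^bsub>F\<^esub> y) i) else (\<lambda>_. 0))"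
proof -
  have "a s x \<star> a t y = a s x \<star> (e (s \<triangleleft> x) \<star> e t) \<star> a t y"
    using assms by (simp add: a_right a_left mulv_assoc) (simp add: a_right a_left flip: mulv_assoc)
  moreover have "a s x \<star> a t y = (\<lambda>i. \<sigma> s x y * a s (x \<otimes>\<^bsub>F\<^esub> y) i)" if t: "s \<triangleleft> x = t"
  proof -
    have xy: "x \<otimes>\<^bsub>F\<^esub> y \<in> carrier F" using assms by simp
    have "homog (x \<otimes>\<^bsub>F\<^esub> y) (a s x \<star> a t y)" using assms by (intro homog_mulv a_homog)
    then have "gr (x \<otimes>\<^bsub>F\<^esub> y) (a s x \<star> a t y) = a s x \<star> a t y" using homog_gr xy by auto
    moreover have "e s \<star> (a s x \<star> a t y) = a s x \<star> a t y" using assms by (simp add: a_left flip: mulv_assoc)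
    ultimately show ?thesis using K_eq[OF assms(1) xy, of "a s x \<star> a t y"] t by (simp add: \<sigma>_def)
  qed
  ultimately show ?thesis using assms by (auto simp: e_mult)
qed

lemma \<sigma>_nonzero:
  assumes "s \<in> carrier \<Gamma>" "x \<in> carrier F" "y \<in> carrier F"
  shows "\<sigma> s x y \<noteq> 0"
proof
  assume "\<sigma> s x y = 0"
  then have 0: "a s x \<star> a (s \<triangleleft> x) y = (\<lambda>_. 0)" using a_mult[of s x "s \<triangleleft> x" y] assms by simp
  obtain b where "b \<star> a s x = e (s \<triangleleft> x)" using a_invertible assms by blast
  then have "a (s \<triangleleft> x) y = b \<star> (a s x \<star> a (s \<triangleleft> x) y)" using assms by (simp add: a_left flip: mulv_assoc)
  then show False using 0 a_nonzero[of "s \<triangleleft> x" y] assms by simp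
qed

text \<open>
  The functional \<open>kap t y \<otimes> kap u z\<close> applied to the coproduct. On the basis it vanishes unless three constraints on
  the indices hold: \<open>W_zero_right\<close>, \<open>W_zero_product\<close>, \<open>W_zero_left\<close>.
\<close>

definition W :: "'g \<Rightarrow> 'f \<Rightarrow> 'g \<Rightarrow> 'f \<Rightarrow> ('i \<Rightarrow> 'k) \<Rightarrow> 'k" where
  "W t y u z v = (\<Sum>j\<in>basis A. \<Sum>l\<in>basis A. com v j l * kap t y j * kap u z l)"

text \<open>
  The right leg of the coproduct of a homogeneous element keeps the degree.
\<close>

lemma W_zero_right:
  assumes "s \<in> carrier \<Gamma>" "x \<in> carrier F" "u \<in> carrier \<Gamma>" "z \<in> carrier F" "x \<noteq> z"
  shows "W t y u z (a s x) = 0"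
proof -
  have "(\<Sum>l\<in>basis A. com (a s x) j l * kap t y j * kap u z l) = 0" if j: "j \<in> basis A" for j
  proof -
    have "(\<Sum>l\<in>basis A. com (a s x) j l * kap t y j * kap u z l)
        = kap t y j * K u z (\<lambda>p. if p \<in> basis A then com (a s x) j p else 0)"
      by (simp add: K_def sum_distrib_left ac_simps)
    then show ?thesis using K_homog[OF assms(3,4,2) homog_slice[OF a_homog[OF assms(1,2)] j] assms(5)] by simp
  qed
  then show ?thesis by (simp add: W_def)
qed

lemma K_e:
  assumes "t \<in> carrier \<Gamma>" "y \<in> carrier F" "r \<in> carrier \<Gamma>" "r \<noteq> t"
  shows "K t y (e r \<star> v) = 0"
proof -
  define v' where "v' = (\<lambda>i. if i \<in> basis A then v i else 0)"
  have v': "supported v'" "e r \<star> v = e r \<star> v'" by (auto simp: v'_def supported_def mulv_def)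
  have "e r \<star> v = (\<lambda>i. \<Sum>x\<in>carrier F. (e r \<star> gr x v') i)"
    using v'(2) sum_gr[OF v'(1)] by (metis mulv_sum_right)
  then have "gr y (e r \<star> v) = (\<lambda>i. \<Sum>x\<in>carrier F. gr y (e r \<star> gr x v') i)"
    by (simp only: gr_sum)
  also have "\<dots> = (\<lambda>i. \<Sum>x\<in>carrier F. if x = y then (e r \<star> gr x v') i else 0)"
  proof (intro ext sum.cong refl)
    fix i x assume x: "x \<in> carrier F"
    have "homog x (e r \<star> gr x v')"
      using homog_mulv[OF homog_e[OF assms(3)] homog_of_gr[OF x] F.one_closed x] x by simp
    then show "gr y (e r \<star> gr x v') i = (if x = y then (e r \<star> gr x v') i else 0)"
      using homog_gr assms(2) by auto
  qed
  also have "\<dots> = e r \<star> gr y v'" using assms(2) finite_F by simp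
  finally have "e t \<star> gr y (e r \<star> v) = (e t \<star> e r) \<star> gr y v'" by (simp add: mulv_assoc)
  then have 0: "(\<lambda>l. K t y (e r \<star> v) * a t y l) = (\<lambda>_. 0)"
    using assms by (simp add: K_eq e_mult)
  show ?thesis by (rule a_cancel[OF assms(1,2)]) (use fun_cong[OF 0] in auto)
qed

text \<open>
  Since \<open>a s x = e\<^sub>s a s x\<close>, the coproduct is a sum over \<open>w\<close> of elements of
  \<open>e\<^bsub>s inverse w\<^esub> A \<otimes> e\<^sub>w A\<close>.
\<close>

lemma W_zero_product:
  assumes s: "s \<in> carrier \<Gamma>" "x \<in> carrier F" and t: "t \<in> carrier \<Gamma>" "y \<in> carrier F"
    and u: "u \<in> carrier \<Gamma>" "z \<in> carrier F" and ne: "s \<noteq> t \<otimes>\<^bsub>\<Gamma>\<^esub> u"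
  shows "W t y u z (a s x) = 0"
proof -
  let ?I = "basis A" and ?q = "\<lambda>w. s \<otimes>\<^bsub>\<Gamma>\<^esub> inv\<^bsub>\<Gamma>\<^esub> w"
  have b: "com (a s x) i j = (\<Sum>k\<in>?I. unit_vec k i * com (a s x) k j)" if "i \<in> ?I" for i j
    using that finite_basis by (simp add: unit_vec_def sum_of_bool_eq)
  have c: "com (a s x) p q = (\<Sum>w\<in>carrier \<Gamma>. \<Sum>k\<in>?I. (e (?q w) \<star> unit_vec k) p * (e w \<star> com (a s x) k) q)"
    if "p \<in> ?I" "q \<in> ?I" for p q
  proof -
    have "com (a s x) p q = com (e s \<star> a s x) p q" using a_left[OF s] by simp
    also have "\<dots> = (\<Sum>w\<in>carrier \<Gamma>. \<Sum>k\<in>?I. (e (?q w) \<star> unit_vec k) p * (e w \<star> com (a s x) k) q)"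
      by (rule com_mulv_tensors[OF that]) (use e_com s b in auto)
    finally show ?thesis .
  qed
  have "W t y u z (a s x) = (\<Sum>j\<in>?I. \<Sum>l\<in>?I. \<Sum>w\<in>carrier \<Gamma>. \<Sum>k\<in>?I.
      (kap t y j * (e (?q w) \<star> unit_vec k) j) * (kap u z l * (e w \<star> com (a s x) k) l))"
    unfolding W_def by (intro sum.cong refl) (simp add: c sum_distrib_right sum_distrib_left ac_simps)
  also have "\<dots> = (\<Sum>j\<in>?I. \<Sum>w\<in>carrier \<Gamma>. \<Sum>k\<in>?I. \<Sum>l\<in>?I.
      (kap t y j * (e (?q w) \<star> unit_vec k) j) * (kap u z l * (e w \<star> com (a s x) k) l))"
    by (rule sum.cong[OF refl], rule sum_move_in3)
  also have "\<dots> = (\<Sum>w\<in>carrier \<Gamma>. \<Sum>k\<in>?I. \<Sum>j\<in>?I. \<Sum>l\<in>?I.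
      (kap t y j * (e (?q w) \<star> unit_vec k) j) * (kap u z l * (e w \<star> com (a s x) k) l))"
    by (rule sum_move_in3)
  also have "\<dots> = (\<Sum>w\<in>carrier \<Gamma>. \<Sum>k\<in>?I. K t y (e (?q w) \<star> unit_vec k) * K u z (e w \<star> com (a s x) k))"
    by (simp add: K_def sum_product)
  also have "\<dots> = (\<Sum>w\<in>carrier \<Gamma>. \<Sum>k\<in>?I. 0)"
  proof (intro sum.cong refl)
    fix w k assume w: "w \<in> carrier \<Gamma>"
    have "?q w \<noteq> t \<or> w \<noteq> u" using ne s t u by (auto simp: \<Gamma>.m_assoc)
    then show "K t y (e (?q w) \<star> unit_vec k) * K u z (e w \<star> com (a s x) k) = 0"
      using K_e[OF t, of "?q w"] K_e[OF u, of w] w s by auto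
  qed
  finally show ?thesis by simp
qed

text \<open>
  The part \<open>e\<^sub>u A\<^sub>z\<close> has left degree \<open>u \<triangleright> z\<close>, since the extension affords the action. Coassociativity
  identifies this with the right degree of the left leg.
\<close>

lemma W_zero_left:
  assumes s: "s \<in> carrier \<Gamma>" "x \<in> carrier F" and t: "t \<in> carrier \<Gamma>" "y \<in> carrier F"
    and u: "u \<in> carrier \<Gamma>" "z \<in> carrier F" and ne: "y \<noteq> u \<triangleright> z"
  shows "W t y u z (a s x) = 0"
proof -
  let ?I = "basis A"
  have Kgr: "K t y v = K t y (gr y v)" for v
  proof (rule a_cancel[OF t])
    fix i
    have "gr y (gr y v) = gr y v" using homog_gr[OF homog_of_gr[OF t(2)] t(2)] by simp
    then show "K t y v * a t y i = K t y (gr y v) * a t y i" using K_eq[OF t] by metis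
  qed
  define Z where "Z c = (\<Sum>l\<in>?I. (\<Sum>q\<in>?I. com c q l * \<pi> q y) * kap u z l)" for c
  have Z0: "Z c = 0" if c: "supported c" for c
  proof -
    have "Z (a r w) = of_bool (y = r \<triangleright> w) * K u z (a r w)" if "r \<in> carrier \<Gamma>" "w \<in> carrier F" for r w
      using homog_left[OF that a_homog[OF that] _ t(2)] a_left[OF that]
      by (simp add: Z_def K_def sum_distrib_left ac_simps)
    then have Za: "Z (a r w) = 0" if "r \<in> carrier \<Gamma>" "w \<in> carrier F" for r w
      using that ne u by (auto simp: K_a)
    have "Z c = Z (\<lambda>l. \<Sum>r\<in>carrier \<Gamma>. \<Sum>w\<in>carrier F. K r w c * a r w l)"
      using expand[OF c] by simp
    also have "\<dots> = (\<Sum>l\<in>?I. \<Sum>q\<in>?I. \<Sum>r\<in>carrier \<Gamma>. \<Sum>w\<in>carrier F. K r w c * (com (a r w) q l * \<pi> q y * kap u z l))"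
      by (simp add: Z_def com_sum com_scale sum_distrib_right mult.assoc)
    also have "\<dots> = (\<Sum>l\<in>?I. \<Sum>r\<in>carrier \<Gamma>. \<Sum>w\<in>carrier F. \<Sum>q\<in>?I. K r w c * (com (a r w) q l * \<pi> q y * kap u z l))"
      by (rule sum.cong[OF refl], rule sum_move_in3)
    also have "\<dots> = (\<Sum>r\<in>carrier \<Gamma>. \<Sum>w\<in>carrier F. \<Sum>l\<in>?I. \<Sum>q\<in>?I. K r w c * (com (a r w) q l * \<pi> q y * kap u z l))"
      by (rule sum_move_in3)
    also have "\<dots> = (\<Sum>r\<in>carrier \<Gamma>. \<Sum>w\<in>carrier F. K r w c * Z (a r w))"
      by (simp add: Z_def sum_distrib_left sum_distrib_right)
    finally show ?thesis by (simp add: Za)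
  qed
  have "W t y u z (a s x) = (\<Sum>l\<in>?I. K t y (\<lambda>j. com (a s x) j l) * kap u z l)"
    unfolding W_def by (subst sum.swap) (simp add: K_def sum_distrib_left sum_distrib_right ac_simps)
  also have "\<dots> = (\<Sum>l\<in>?I. \<Sum>j\<in>?I. kap t y j * (\<Sum>q\<in>?I. com (com (a s x) j) q l * \<pi> q y) * kap u z l)"
  proof (rule sum.cong[OF refl])
    fix l assume l: "l \<in> ?I"
    have "K t y (\<lambda>j. com (a s x) j l) = (\<Sum>j\<in>?I. kap t y j * (\<Sum>q\<in>?I. com (com (a s x) j) q l * \<pi> q y))"
      by (subst Kgr) (simp add: K_def gr_def com_coassoc l)
    then show "K t y (\<lambda>j. com (a s x) j l) * kap u z l
      = (\<Sum>j\<in>?I. kap t y j * (\<Sum>q\<in>?I. com (com (a s x) j) q l * \<pi> q y) * kap u z l)"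
      by (simp add: sum_distrib_right)
  qed
  also have "\<dots> = (\<Sum>j\<in>?I. kap t y j * Z (com (a s x) j))"
    by (subst sum.swap) (simp add: Z_def sum_distrib_left sum_distrib_right mult.assoc)
  also have "\<dots> = (\<Sum>j\<in>?I. kap t y j * Z (\<lambda>p. if p \<in> ?I then com (a s x) j p else 0))"
    by (intro sum.cong refl) (simp add: Z_def com_def)
  also have "\<dots> = 0" by (simp add: Z0 supported_def)
  finally show ?thesis .
qed

definition \<tau> :: "'f \<Rightarrow> 'g \<Rightarrow> 'g \<Rightarrow> 'k" where
  "\<tau> x t u = W t (u \<triangleright> x) u x (a (t \<otimes>\<^bsub>\<Gamma>\<^esub> u) x)"

lemma W_a:
  assumes s: "s \<in> carrier \<Gamma>" "x \<in> carrier F" and t: "t \<in> carrier \<Gamma>" "y \<in> carrier F"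
    and u: "u \<in> carrier \<Gamma>" "z \<in> carrier F"
  shows "W t y u z (a s x) = of_bool (s = t \<otimes>\<^bsub>\<Gamma>\<^esub> u \<and> y = u \<triangleright> z \<and> x = z) * \<tau> z t u"
  using W_zero_right[OF s u] W_zero_product[OF s t u] W_zero_left[OF s t u]
  by (cases "s = t \<otimes>\<^bsub>\<Gamma>\<^esub> u \<and> y = u \<triangleright> z \<and> x = z") (auto simp: \<tau>_def)

lemma com_a:
  assumes s: "s \<in> carrier \<Gamma>" "x \<in> carrier F" and pq: "p \<in> basis A" "q \<in> basis A"
  shows "com (a s x) p q = (\<Sum>u\<in>carrier \<Gamma>. \<tau> x (s \<otimes>\<^bsub>\<Gamma>\<^esub> inv\<^bsub>\<Gamma>\<^esub> u) u * (a (s \<otimes>\<^bsub>\<Gamma>\<^esub> inv\<^bsub>\<Gamma>\<^esub> u) (u \<triangleright> x) p * a u x q))"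
proof -
  let ?I = "basis A" and ?q = "\<lambda>u. s \<otimes>\<^bsub>\<Gamma>\<^esub> inv\<^bsub>\<Gamma>\<^esub> u"
  have "com (a s x) p q = (\<Sum>j\<in>?I. \<Sum>l\<in>?I. com (a s x) j l * of_bool (p = j) * of_bool (q = l))"
    by (simp only: sum_of_bool_eq[OF finite_basis] pq if_True)
  also have "\<dots> = (\<Sum>j\<in>?I. \<Sum>l\<in>?I. com (a s x) j l
      * (\<Sum>t\<in>carrier \<Gamma>. \<Sum>y\<in>carrier F. kap t y j * a t y p) * (\<Sum>u\<in>carrier \<Gamma>. \<Sum>z\<in>carrier F. kap u z l * a u z q))"
    by (intro sum.cong refl) (simp add: completeness)
  also have "\<dots> = (\<Sum>j\<in>?I. \<Sum>l\<in>?I. \<Sum>t\<in>carrier \<Gamma>. \<Sum>y\<in>carrier F. \<Sum>u\<in>carrier \<Gamma>. \<Sum>z\<in>carrier F.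
      (com (a s x) j l * kap t y j * kap u z l) * (a t y p * a u z q))"
    by (simp add: sum_distrib_left sum_distrib_right ac_simps)
  also have "\<dots> = (\<Sum>j\<in>?I. \<Sum>t\<in>carrier \<Gamma>. \<Sum>y\<in>carrier F. \<Sum>u\<in>carrier \<Gamma>. \<Sum>z\<in>carrier F. \<Sum>l\<in>?I.
      (com (a s x) j l * kap t y j * kap u z l) * (a t y p * a u z q))"
    by (rule sum.cong[OF refl], rule sum_move_in5)
  also have "\<dots> = (\<Sum>t\<in>carrier \<Gamma>. \<Sum>y\<in>carrier F. \<Sum>u\<in>carrier \<Gamma>. \<Sum>z\<in>carrier F. \<Sum>j\<in>?I. \<Sum>l\<in>?I.
      (com (a s x) j l * kap t y j * kap u z l) * (a t y p * a u z q))"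
    by (rule sum_move_in5)
  also have "\<dots> = (\<Sum>t\<in>carrier \<Gamma>. \<Sum>y\<in>carrier F. \<Sum>u\<in>carrier \<Gamma>. \<Sum>z\<in>carrier F. W t y u z (a s x) * (a t y p * a u z q))"
    by (simp add: W_def sum_distrib_right)
  also have "\<dots> = (\<Sum>t\<in>carrier \<Gamma>. \<Sum>y\<in>carrier F. \<Sum>u\<in>carrier \<Gamma>. \<Sum>z\<in>carrier F.
      of_bool (z = x) * (of_bool (t = ?q u) * (of_bool (y = u \<triangleright> x) * (\<tau> x t u * (a t y p * a u x q)))))"
  proof (intro sum.cong refl)
    fix t y u z assume *: "t \<in> carrier \<Gamma>" "y \<in> carrier F" "u \<in> carrier \<Gamma>" "z \<in> carrier F"
    have "s = t \<otimes>\<^bsub>\<Gamma>\<^esub> u \<longleftrightarrow> t = ?q u" using * s by (auto simp: \<Gamma>.m_assoc)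
    then show "W t y u z (a s x) * (a t y p * a u z q)
      = of_bool (z = x) * (of_bool (t = ?q u) * (of_bool (y = u \<triangleright> x) * (\<tau> x t u * (a t y p * a u x q))))"
      using * s by (auto simp: W_a)
  qed
  also have "\<dots> = (\<Sum>t\<in>carrier \<Gamma>. \<Sum>y\<in>carrier F. \<Sum>u\<in>carrier \<Gamma>.
      of_bool (t = ?q u) * (of_bool (y = u \<triangleright> x) * (\<tau> x t u * (a t y p * a u x q))))"
    by (simp only: sum_of_bool_eq(1)[OF finite_F] s if_True)
  also have "\<dots> = (\<Sum>u\<in>carrier \<Gamma>. \<Sum>t\<in>carrier \<Gamma>. \<Sum>y\<in>carrier F.
      of_bool (t = ?q u) * (of_bool (y = u \<triangleright> x) * (\<tau> x t u * (a t y p * a u x q))))"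
    by (rule sum_move_in3[symmetric])
  also have "\<dots> = (\<Sum>u\<in>carrier \<Gamma>. \<tau> x (?q u) u * (a (?q u) (u \<triangleright> x) p * a u x q))"
    using s finite_F finite_\<Gamma> by (intro sum.cong refl) (simp add: sum_of_bool_eq flip: sum_distrib_left)
  finally show ?thesis .
qed

lemma independence:
  assumes "x \<in> carrier F" "u \<in> carrier \<Gamma>"
    and eq: "\<And>l. l \<in> basis A \<Longrightarrow> (\<Sum>u\<in>carrier \<Gamma>. c u * a u x l) = (\<Sum>u\<in>carrier \<Gamma>. d u * a u x l)"
  shows "c u = d u"
proof -
  have "K u x (\<lambda>l. \<Sum>w\<in>carrier \<Gamma>. c w * a w x l) = c u" for c
  proof -
    have "K u x (\<lambda>l. \<Sum>w\<in>carrier \<Gamma>. c w * a w x l) = (\<Sum>w\<in>carrier \<Gamma>. c w * K u x (a w x))"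
      unfolding K_def sum_distrib_left by (subst sum.swap) (simp add: ac_simps)
    also have "\<dots> = (\<Sum>w\<in>carrier \<Gamma>. of_bool (w = u) * c w)"
      using assms by (intro sum.cong refl) (auto simp: K_a)
    finally show ?thesis using assms finite_\<Gamma> by (simp add: sum_of_bool_eq)
  qed
  moreover have "K u x (\<lambda>l. \<Sum>w\<in>carrier \<Gamma>. c w * a w x l) = K u x (\<lambda>l. \<Sum>w\<in>carrier \<Gamma>. d w * a w x l)"
    unfolding K_def by (intro sum.cong refl) (simp add: eq)
  ultimately show ?thesis by simp
qed

lemma com_cong: "(\<And>p. p \<in> basis A \<Longrightarrow> v p = w p) \<Longrightarrow> com v i j = com w i j"
  by (simp add: com_def)

lemma eps_a:
  assumes "s \<in> carrier \<Gamma>" "x \<in> carrier F"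
  shows "eps (a s x) = of_bool (s = \<one>\<^bsub>\<Gamma>\<^esub>)"
proof -
  have "eps (a s x) = eps (e s) * eps (a s x)" using a_left[OF assms] by (metis eps_mulv)
  then show ?thesis using assms by (auto simp: e_eps a_eps)
qed

lemma counit_kap:
  assumes "i \<in> basis A"
  shows "cou A i = (\<Sum>x\<in>carrier F. kap \<one>\<^bsub>\<Gamma>\<^esub> x i)"
proof -
  have "cou A i = (\<Sum>j\<in>basis A. of_bool (j = i) * cou A j)"
    by (simp only: sum_of_bool_eq(1)[OF finite_basis] assms if_True)
  also have "\<dots> = (\<Sum>j\<in>basis A. \<Sum>s\<in>carrier \<Gamma>. \<Sum>x\<in>carrier F. kap s x i * (a s x j * cou A j))"
    by (simp add: sum_distrib_right mult.assoc flip: completeness[OF assms])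
  also have "\<dots> = (\<Sum>s\<in>carrier \<Gamma>. \<Sum>x\<in>carrier F. kap s x i * eps (a s x))"
    by (subst sum_move_in3) (simp add: eps_def sum_distrib_left)
  also have "\<dots> = (\<Sum>s\<in>carrier \<Gamma>. of_bool (s = \<one>\<^bsub>\<Gamma>\<^esub>) * (\<Sum>x\<in>carrier F. kap s x i))"
    unfolding sum_distrib_left by (intro sum.cong refl) (simp add: eps_a)
  also have "\<dots> = (\<Sum>x\<in>carrier F. kap \<one>\<^bsub>\<Gamma>\<^esub> x i)"
    by (simp only: sum_of_bool_eq(1)[OF finite_\<Gamma>] \<Gamma>.one_closed if_True)
  finally show ?thesis .
qed

lemma unit_a: "i \<in> basis A \<Longrightarrow> unt A i = (\<Sum>s\<in>carrier \<Gamma>. a s \<one>\<^bsub>F\<^esub> i)"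
  using fun_cong[OF e_sum, of i] by (simp add: a_one onev_def)

text \<open>
  All identities come from the Hopf algebra axioms of \<open>A\<close> by comparing coefficients in the basis \<open>a\<close>: the cocycle
  identity of \<open>\<sigma>\<close> from associativity, that of \<open>\<tau>\<close> from coassociativity, and \<open>compat\<close> from the
  multiplicativity of the coproduct. That \<open>\<tau>\<close> does not vanish follows from \<open>compat\<close> with \<open>y\<close> the inverse of \<open>x\<close>.
\<close>

lemma bicrossed_datum_of_basis: "bicrossed_datum F \<Gamma> (\<triangleright>) (\<triangleleft>) \<sigma> \<tau>"
proof -
  let ?I = "basis A" and ?q = "\<lambda>s u. s \<otimes>\<^bsub>\<Gamma>\<^esub> inv\<^bsub>\<Gamma>\<^esub> u"
  have \<sigma>1: "\<sigma> s x \<one>\<^bsub>F\<^esub> = 1" "\<sigma> s \<one>\<^bsub>F\<^esub> x = 1" if "s \<in> carrier \<Gamma>" "x \<in> carrier F" for s x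
    using that by (simp_all add: \<sigma>_def a_one a_right a_left K_a)
  have \<sigma>c: "\<sigma> (s \<triangleleft> x) y z * \<sigma> s x (y \<otimes>\<^bsub>F\<^esub> z) = \<sigma> s x y * \<sigma> s (x \<otimes>\<^bsub>F\<^esub> y) z"
    if *: "s \<in> carrier \<Gamma>" "x \<in> carrier F" "y \<in> carrier F" "z \<in> carrier F" for s x y z
  proof (rule a_cancel[of s "x \<otimes>\<^bsub>F\<^esub> y \<otimes>\<^bsub>F\<^esub> z"])
    fix i
    have "a s x \<star> (a (s \<triangleleft> x) y \<star> a (s \<triangleleft> x \<triangleleft> y) z) = (\<lambda>i. (\<sigma> (s \<triangleleft> x) y z * \<sigma> s x (y \<otimes>\<^bsub>F\<^esub> z)) * a s (x \<otimes>\<^bsub>F\<^esub> y \<otimes>\<^bsub>F\<^esub> z) i)"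
      using * by (simp add: a_mult mulv_scale F.m_assoc mult.assoc)
    moreover have "a s x \<star> a (s \<triangleleft> x) y \<star> a (s \<triangleleft> x \<triangleleft> y) z = (\<lambda>i. (\<sigma> s x y * \<sigma> s (x \<otimes>\<^bsub>F\<^esub> y) z) * a s (x \<otimes>\<^bsub>F\<^esub> y \<otimes>\<^bsub>F\<^esub> z) i)"
      using * by (simp add: a_mult mulv_scale ract_mult mult.assoc)
    ultimately show "\<sigma> (s \<triangleleft> x) y z * \<sigma> s x (y \<otimes>\<^bsub>F\<^esub> z) * a s (x \<otimes>\<^bsub>F\<^esub> y \<otimes>\<^bsub>F\<^esub> z) i
      = \<sigma> s x y * \<sigma> s (x \<otimes>\<^bsub>F\<^esub> y) z * a s (x \<otimes>\<^bsub>F\<^esub> y \<otimes>\<^bsub>F\<^esub> z) i"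
      unfolding mulv_assoc by metis
  qed (use * in auto)
  have \<sigma>u: "\<sigma> \<one>\<^bsub>\<Gamma>\<^esub> x y = 1" if "x \<in> carrier F" "y \<in> carrier F" for x y
  proof -
    have "eps (a \<one>\<^bsub>\<Gamma>\<^esub> x \<star> a \<one>\<^bsub>\<Gamma>\<^esub> y) = 1" using that by (simp add: eps_mulv a_eps)
    moreover have "eps (\<lambda>i. c * a \<one>\<^bsub>\<Gamma>\<^esub> (x \<otimes>\<^bsub>F\<^esub> y) i) = c * eps (a \<one>\<^bsub>\<Gamma>\<^esub> (x \<otimes>\<^bsub>F\<^esub> y))" for c
      by (simp add: eps_def sum_distrib_left mult.assoc)
    ultimately show ?thesis using that by (simp add: a_mult a_eps)
  qed
  have \<tau>u: "\<tau> \<one>\<^bsub>F\<^esub> t v = 1" if "t \<in> carrier \<Gamma>" "v \<in> carrier \<Gamma>" for t v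
  proof (rule a_cancel[OF that(1) F.one_closed])
    fix p assume p: "p \<in> ?I"
    define s where "s = t \<otimes>\<^bsub>\<Gamma>\<^esub> v"
    have s: "s \<in> carrier \<Gamma>" and sv: "?q s v = t" using that by (auto simp: s_def \<Gamma>.m_assoc)
    have "\<tau> \<one>\<^bsub>F\<^esub> (?q s v) v * a (?q s v) \<one>\<^bsub>F\<^esub> p = a (?q s v) \<one>\<^bsub>F\<^esub> p"
    proof (rule independence[OF F.one_closed that(2), where
          c = "\<lambda>u. \<tau> \<one>\<^bsub>F\<^esub> (?q s u) u * a (?q s u) \<one>\<^bsub>F\<^esub> p" and d = "\<lambda>u. a (?q s u) \<one>\<^bsub>F\<^esub> p"])
      fix l assume l: "l \<in> ?I"
      show "(\<Sum>u\<in>carrier \<Gamma>. \<tau> \<one>\<^bsub>F\<^esub> (?q s u) u * a (?q s u) \<one>\<^bsub>F\<^esub> p * a u \<one>\<^bsub>F\<^esub> l)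
        = (\<Sum>u\<in>carrier \<Gamma>. a (?q s u) \<one>\<^bsub>F\<^esub> p * a u \<one>\<^bsub>F\<^esub> l)"
        using com_a[OF s F.one_closed p l] e_com[OF s p l] s by (simp add: a_one mult.assoc)
    qed
    then show "\<tau> \<one>\<^bsub>F\<^esub> t v * a t \<one>\<^bsub>F\<^esub> p = 1 * a t \<one>\<^bsub>F\<^esub> p" by (simp add: sv)
  qed
  have \<tau>r: "\<tau> x s \<one>\<^bsub>\<Gamma>\<^esub> = 1" if "x \<in> carrier F" "s \<in> carrier \<Gamma>" for x s
  proof (rule a_cancel[OF that(2,1)])
    fix p assume p: "p \<in> ?I"
    have "a s x p = (\<Sum>q\<in>?I. com (a s x) p q * cou A q)" by (rule com_counit_right[OF p, symmetric])
    also have "\<dots> = (\<Sum>q\<in>?I. \<Sum>u\<in>carrier \<Gamma>. \<tau> x (?q s u) u * a (?q s u) (u \<triangleright> x) p * (a u x q * cou A q))"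
      using that p by (intro sum.cong refl) (simp add: com_a sum_distrib_right mult.assoc)
    also have "\<dots> = (\<Sum>u\<in>carrier \<Gamma>. \<tau> x (?q s u) u * a (?q s u) (u \<triangleright> x) p * eps (a u x))"
      by (subst sum.swap) (simp add: eps_def sum_distrib_left)
    also have "\<dots> = (\<Sum>u\<in>carrier \<Gamma>. of_bool (u = \<one>\<^bsub>\<Gamma>\<^esub>) * (\<tau> x (?q s u) u * a (?q s u) (u \<triangleright> x) p))"
      using that by (intro sum.cong refl) (simp add: eps_a)
    also have "\<dots> = \<tau> x (?q s \<one>\<^bsub>\<Gamma>\<^esub>) \<one>\<^bsub>\<Gamma>\<^esub> * a (?q s \<one>\<^bsub>\<Gamma>\<^esub>) (\<one>\<^bsub>\<Gamma>\<^esub> \<triangleright> x) p"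
      by (simp only: sum_of_bool_eq(1)[OF finite_\<Gamma>] \<Gamma>.one_closed if_True)
    finally show "\<tau> x s \<one>\<^bsub>\<Gamma>\<^esub> * a s x p = 1 * a s x p" using that by simp
  qed
  have \<tau>l: "\<tau> x \<one>\<^bsub>\<Gamma>\<^esub> s = 1" if "x \<in> carrier F" "s \<in> carrier \<Gamma>" for x s
  proof (rule a_cancel[OF that(2,1)])
    fix q assume q: "q \<in> ?I"
    have "a s x q = (\<Sum>p\<in>?I. com (a s x) p q * cou A p)" by (rule com_counit_left[OF q, symmetric])
    also have "\<dots> = (\<Sum>p\<in>?I. \<Sum>u\<in>carrier \<Gamma>. \<tau> x (?q s u) u * a u x q * (a (?q s u) (u \<triangleright> x) p * cou A p))"
      using that q by (intro sum.cong refl) (simp add: com_a sum_distrib_left ac_simps)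
    also have "\<dots> = (\<Sum>u\<in>carrier \<Gamma>. \<tau> x (?q s u) u * a u x q * eps (a (?q s u) (u \<triangleright> x)))"
      by (subst sum.swap) (simp add: eps_def sum_distrib_left)
    also have "\<dots> = (\<Sum>u\<in>carrier \<Gamma>. of_bool (u = s) * (\<tau> x (?q s u) u * a u x q))"
    proof (intro sum.cong refl)
      fix u assume u: "u \<in> carrier \<Gamma>"
      have "?q s u = \<one>\<^bsub>\<Gamma>\<^esub> \<longleftrightarrow> u = s" using u that \<Gamma>.inv_equality by fastforce
      then show "\<tau> x (?q s u) u * a u x q * eps (a (?q s u) (u \<triangleright> x)) = of_bool (u = s) * (\<tau> x (?q s u) u * a u x q)"
        using u that by (simp add: eps_a)
    qed
    also have "\<dots> = \<tau> x (?q s s) s * a s x q"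
      by (simp only: sum_of_bool_eq(1)[OF finite_\<Gamma>] that if_True)
    finally show "\<tau> x \<one>\<^bsub>\<Gamma>\<^esub> s * a s x q = 1 * a s x q" using that by simp
  qed
  have \<tau>c: "\<tau> (v \<triangleright> x) r t * \<tau> x (r \<otimes>\<^bsub>\<Gamma>\<^esub> t) v = \<tau> x t v * \<tau> x r (t \<otimes>\<^bsub>\<Gamma>\<^esub> v)"
    if *: "x \<in> carrier F" "r \<in> carrier \<Gamma>" "t \<in> carrier \<Gamma>" "v \<in> carrier \<Gamma>" for x r t v
  proof -
    define s where "s = r \<otimes>\<^bsub>\<Gamma>\<^esub> t \<otimes>\<^bsub>\<Gamma>\<^esub> v"
    have s: "s \<in> carrier \<Gamma>" and sv: "?q s v = r \<otimes>\<^bsub>\<Gamma>\<^esub> t" and rt: "?q (r \<otimes>\<^bsub>\<Gamma>\<^esub> t) t = r"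
      and stv: "?q s (t \<otimes>\<^bsub>\<Gamma>\<^esub> v) = r"
      using * by (auto simp: s_def \<Gamma>.m_assoc \<Gamma>.inv_mult_group) (simp flip: \<Gamma>.m_assoc)
    have eq1: "\<tau> x (?q s v) v * com (a (?q s v) (v \<triangleright> x)) i j
        = (\<Sum>w\<in>carrier \<Gamma>. \<tau> x (?q s (w \<otimes>\<^bsub>\<Gamma>\<^esub> v)) (w \<otimes>\<^bsub>\<Gamma>\<^esub> v) * a (?q s (w \<otimes>\<^bsub>\<Gamma>\<^esub> v)) ((w \<otimes>\<^bsub>\<Gamma>\<^esub> v) \<triangleright> x) i * \<tau> x w v * a w (v \<triangleright> x) j)"
      if i: "i \<in> ?I" and j: "j \<in> ?I" for i j
    proof (rule independence[OF *(1,4), where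
          c = "\<lambda>u. \<tau> x (?q s u) u * com (a (?q s u) (u \<triangleright> x)) i j" and
          d = "\<lambda>u. \<Sum>w\<in>carrier \<Gamma>. \<tau> x (?q s (w \<otimes>\<^bsub>\<Gamma>\<^esub> u)) (w \<otimes>\<^bsub>\<Gamma>\<^esub> u) * a (?q s (w \<otimes>\<^bsub>\<Gamma>\<^esub> u)) ((w \<otimes>\<^bsub>\<Gamma>\<^esub> u) \<triangleright> x) i * \<tau> x w u * a w (u \<triangleright> x) j"])
      fix l assume l: "l \<in> ?I"
      have "com (\<lambda>p. com (a s x) p l) i j = com (\<lambda>p. \<Sum>u\<in>carrier \<Gamma>. (\<tau> x (?q s u) u * a u x l) * a (?q s u) (u \<triangleright> x) p) i j"
        using s * l by (intro com_cong) (simp add: com_a ac_simps)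
      also have "\<dots> = (\<Sum>u\<in>carrier \<Gamma>. \<tau> x (?q s u) u * com (a (?q s u) (u \<triangleright> x)) i j * a u x l)"
        unfolding com_sum com_scale by (simp add: ac_simps)
      finally have L: "com (\<lambda>p. com (a s x) p l) i j = (\<Sum>u\<in>carrier \<Gamma>. \<tau> x (?q s u) u * com (a (?q s u) (u \<triangleright> x)) i j * a u x l)" .
      have "com (com (a s x) i) j l = com (\<lambda>p. \<Sum>r\<in>carrier \<Gamma>. (\<tau> x (?q s r) r * a (?q s r) (r \<triangleright> x) i) * a r x p) j l"
        using s * i by (intro com_cong) (simp add: com_a mult.assoc)
      also have "\<dots> = (\<Sum>r\<in>carrier \<Gamma>. \<tau> x (?q s r) r * a (?q s r) (r \<triangleright> x) i * (\<Sum>u\<in>carrier \<Gamma>. \<tau> x (?q r u) u * (a (?q r u) (u \<triangleright> x) j * a u x l)))"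
        unfolding com_sum com_scale using * j l by (intro sum.cong refl) (simp add: com_a)
      also have "\<dots> = (\<Sum>u\<in>carrier \<Gamma>. \<Sum>r\<in>carrier \<Gamma>. \<tau> x (?q s r) r * a (?q s r) (r \<triangleright> x) i * \<tau> x (?q r u) u * a (?q r u) (u \<triangleright> x) j * a u x l)"
        unfolding sum_distrib_left by (subst sum.swap) (simp add: mult.assoc)
      also have "\<dots> = (\<Sum>u\<in>carrier \<Gamma>. \<Sum>w\<in>carrier \<Gamma>. \<tau> x (?q s (w \<otimes>\<^bsub>\<Gamma>\<^esub> u)) (w \<otimes>\<^bsub>\<Gamma>\<^esub> u) * a (?q s (w \<otimes>\<^bsub>\<Gamma>\<^esub> u)) ((w \<otimes>\<^bsub>\<Gamma>\<^esub> u) \<triangleright> x) i * \<tau> x w u * a w (u \<triangleright> x) j * a u x l)"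
      proof (rule sum.cong[OF refl])
        fix u assume u: "u \<in> carrier \<Gamma>"
        show "(\<Sum>r\<in>carrier \<Gamma>. \<tau> x (?q s r) r * a (?q s r) (r \<triangleright> x) i * \<tau> x (?q r u) u * a (?q r u) (u \<triangleright> x) j * a u x l)
          = (\<Sum>w\<in>carrier \<Gamma>. \<tau> x (?q s (w \<otimes>\<^bsub>\<Gamma>\<^esub> u)) (w \<otimes>\<^bsub>\<Gamma>\<^esub> u) * a (?q s (w \<otimes>\<^bsub>\<Gamma>\<^esub> u)) ((w \<otimes>\<^bsub>\<Gamma>\<^esub> u) \<triangleright> x) i * \<tau> x w u * a w (u \<triangleright> x) j * a u x l)"
          using u by (intro sum.reindex_bij_witness[where i = "\<lambda>w. w \<otimes>\<^bsub>\<Gamma>\<^esub> u" and j = "\<lambda>r. ?q r u"]) (auto simp: \<Gamma>.m_assoc)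
      qed
      finally show "(\<Sum>u\<in>carrier \<Gamma>. \<tau> x (?q s u) u * com (a (?q s u) (u \<triangleright> x)) i j * a u x l)
        = (\<Sum>u\<in>carrier \<Gamma>. (\<Sum>w\<in>carrier \<Gamma>. \<tau> x (?q s (w \<otimes>\<^bsub>\<Gamma>\<^esub> u)) (w \<otimes>\<^bsub>\<Gamma>\<^esub> u) * a (?q s (w \<otimes>\<^bsub>\<Gamma>\<^esub> u)) ((w \<otimes>\<^bsub>\<Gamma>\<^esub> u) \<triangleright> x) i * \<tau> x w u * a w (u \<triangleright> x) j) * a u x l)"
        using com_coassoc[OF i j l, of "a s x"] unfolding L by (simp add: sum_distrib_right)
    qed
    have "\<tau> x (r \<otimes>\<^bsub>\<Gamma>\<^esub> t) v * \<tau> (v \<triangleright> x) r t = \<tau> x r (t \<otimes>\<^bsub>\<Gamma>\<^esub> v) * \<tau> x t v"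
    proof (rule a_cancel[of r "t \<triangleright> v \<triangleright> x"])
      fix i assume i: "i \<in> ?I"
      have "\<tau> x (?q s v) v * \<tau> (v \<triangleright> x) (?q (?q s v) t) t * a (?q (?q s v) t) (t \<triangleright> (v \<triangleright> x)) i
        = \<tau> x (?q s (t \<otimes>\<^bsub>\<Gamma>\<^esub> v)) (t \<otimes>\<^bsub>\<Gamma>\<^esub> v) * a (?q s (t \<otimes>\<^bsub>\<Gamma>\<^esub> v)) ((t \<otimes>\<^bsub>\<Gamma>\<^esub> v) \<triangleright> x) i * \<tau> x t v"
      proof (rule independence[of "v \<triangleright> x" t, where
            c = "\<lambda>w. \<tau> x (?q s v) v * \<tau> (v \<triangleright> x) (?q (?q s v) w) w * a (?q (?q s v) w) (w \<triangleright> (v \<triangleright> x)) i" and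
            d = "\<lambda>w. \<tau> x (?q s (w \<otimes>\<^bsub>\<Gamma>\<^esub> v)) (w \<otimes>\<^bsub>\<Gamma>\<^esub> v) * a (?q s (w \<otimes>\<^bsub>\<Gamma>\<^esub> v)) ((w \<otimes>\<^bsub>\<Gamma>\<^esub> v) \<triangleright> x) i * \<tau> x w v"])
        fix j assume j: "j \<in> ?I"
        have "com (a (?q s v) (v \<triangleright> x)) i j = (\<Sum>w\<in>carrier \<Gamma>. \<tau> (v \<triangleright> x) (?q (?q s v) w) w * (a (?q (?q s v) w) (w \<triangleright> (v \<triangleright> x)) i * a w (v \<triangleright> x) j))"
          using s * i j by (intro com_a) auto
        then show "(\<Sum>w\<in>carrier \<Gamma>. \<tau> x (?q s v) v * \<tau> (v \<triangleright> x) (?q (?q s v) w) w * a (?q (?q s v) w) (w \<triangleright> (v \<triangleright> x)) i * a w (v \<triangleright> x) j)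
          = (\<Sum>w\<in>carrier \<Gamma>. \<tau> x (?q s (w \<otimes>\<^bsub>\<Gamma>\<^esub> v)) (w \<otimes>\<^bsub>\<Gamma>\<^esub> v) * a (?q s (w \<otimes>\<^bsub>\<Gamma>\<^esub> v)) ((w \<otimes>\<^bsub>\<Gamma>\<^esub> v) \<triangleright> x) i * \<tau> x w v * a w (v \<triangleright> x) j)"
          using eq1[OF i j] by (simp add: sum_distrib_left mult.assoc)
      qed (use * in auto)
      then show "\<tau> x (r \<otimes>\<^bsub>\<Gamma>\<^esub> t) v * \<tau> (v \<triangleright> x) r t * a r (t \<triangleright> v \<triangleright> x) i = \<tau> x r (t \<otimes>\<^bsub>\<Gamma>\<^esub> v) * \<tau> x t v * a r (t \<triangleright> v \<triangleright> x) i"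
        using * by (simp add: sv rt stv lact_mult)
    qed (use * in auto)
    then show ?thesis by (simp only: mult.commute)
  qed
  have comp: "\<sigma> (t \<otimes>\<^bsub>\<Gamma>\<^esub> v) x y * \<tau> (x \<otimes>\<^bsub>F\<^esub> y) t v
      = \<tau> x t v * \<tau> y (t \<triangleleft> (v \<triangleright> x)) (v \<triangleleft> x) * \<sigma> t (v \<triangleright> x) ((v \<triangleleft> x) \<triangleright> y) * \<sigma> v x y"
    if *: "t \<in> carrier \<Gamma>" "v \<in> carrier \<Gamma>" "x \<in> carrier F" "y \<in> carrier F" for t v x y
  proof (rule a_cancel[of t "v \<triangleright> (x \<otimes>\<^bsub>F\<^esub> y)"])
    fix p assume p: "p \<in> ?I"
    define s where "s = t \<otimes>\<^bsub>\<Gamma>\<^esub> v"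
    let ?s' = "s \<triangleleft> x"
    have s: "s \<in> carrier \<Gamma>" and sv: "?q s v = t" using * by (auto simp: s_def \<Gamma>.m_assoc)
    define \<alpha> where "\<alpha> u = (\<lambda>i. \<tau> x (?q s u) u * a (?q s u) (u \<triangleright> x) i)" for u
    define \<gamma> where "\<gamma> w = (\<lambda>i. \<tau> y (?q ?s' w) w * a (?q ?s' w) (w \<triangleright> y) i)" for w
    have "\<sigma> s x y * \<tau> (x \<otimes>\<^bsub>F\<^esub> y) (?q s v) v * a (?q s v) (v \<triangleright> (x \<otimes>\<^bsub>F\<^esub> y)) p = (\<alpha> v \<star> \<gamma> (v \<triangleleft> x)) p * \<sigma> v x y"
    proof (rule independence[of "x \<otimes>\<^bsub>F\<^esub> y" v, where
          c = "\<lambda>v. \<sigma> s x y * \<tau> (x \<otimes>\<^bsub>F\<^esub> y) (?q s v) v * a (?q s v) (v \<triangleright> (x \<otimes>\<^bsub>F\<^esub> y)) p" and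
          d = "\<lambda>v. (\<alpha> v \<star> \<gamma> (v \<triangleleft> x)) p * \<sigma> v x y"])
      fix q assume q: "q \<in> ?I"
      have "com (a s x \<star> a ?s' y) p q = \<sigma> s x y * com (a s (x \<otimes>\<^bsub>F\<^esub> y)) p q"
        using s * by (simp add: a_mult com_scale)
      also have "\<dots> = (\<Sum>v\<in>carrier \<Gamma>. \<sigma> s x y * \<tau> (x \<otimes>\<^bsub>F\<^esub> y) (?q s v) v * a (?q s v) (v \<triangleright> (x \<otimes>\<^bsub>F\<^esub> y)) p * a v (x \<otimes>\<^bsub>F\<^esub> y) q)"
        using s * p q by (simp add: com_a sum_distrib_left mult.assoc)
      finally have L: "com (a s x \<star> a ?s' y) p q
        = (\<Sum>v\<in>carrier \<Gamma>. \<sigma> s x y * \<tau> (x \<otimes>\<^bsub>F\<^esub> y) (?q s v) v * a (?q s v) (v \<triangleright> (x \<otimes>\<^bsub>F\<^esub> y)) p * a v (x \<otimes>\<^bsub>F\<^esub> y) q)" .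
      have "com (a s x \<star> a ?s' y) p q = (\<Sum>u\<in>carrier \<Gamma>. \<Sum>w\<in>carrier \<Gamma>. (\<alpha> u \<star> \<gamma> w) p * (a u x \<star> a w y) q)"
        by (rule com_mulv_tensors[OF p q]) (use s * in \<open>simp_all add: com_a \<alpha>_def \<gamma>_def mult.assoc\<close>)
      also have "\<dots> = (\<Sum>u\<in>carrier \<Gamma>. \<Sum>w\<in>carrier \<Gamma>. of_bool (w = u \<triangleleft> x) * ((\<alpha> u \<star> \<gamma> w) p * (\<sigma> u x y * a u (x \<otimes>\<^bsub>F\<^esub> y) q)))"
        using * by (intro sum.cong refl) (auto simp: a_mult)
      also have "\<dots> = (\<Sum>u\<in>carrier \<Gamma>. (\<alpha> u \<star> \<gamma> (u \<triangleleft> x)) p * \<sigma> u x y * a u (x \<otimes>\<^bsub>F\<^esub> y) q)"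
        using * by (intro sum.cong refl) (simp only: sum_of_bool_eq(1)[OF finite_\<Gamma>] ract_closed if_True mult.assoc)
      finally show "(\<Sum>v\<in>carrier \<Gamma>. \<sigma> s x y * \<tau> (x \<otimes>\<^bsub>F\<^esub> y) (?q s v) v * a (?q s v) (v \<triangleright> (x \<otimes>\<^bsub>F\<^esub> y)) p * a v (x \<otimes>\<^bsub>F\<^esub> y) q)
        = (\<Sum>v\<in>carrier \<Gamma>. (\<alpha> v \<star> \<gamma> (v \<triangleleft> x)) p * \<sigma> v x y * a v (x \<otimes>\<^bsub>F\<^esub> y) q)"
        unfolding L .
    qed (use * in auto)
    moreover have "(\<alpha> v \<star> \<gamma> (v \<triangleleft> x)) p = \<tau> x t v * \<tau> y (t \<triangleleft> (v \<triangleright> x)) (v \<triangleleft> x) * \<sigma> t (v \<triangleright> x) ((v \<triangleleft> x) \<triangleright> y) * a t (v \<triangleright> (x \<otimes>\<^bsub>F\<^esub> y)) p"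
    proof -
      have q': "?q ?s' (v \<triangleleft> x) = t \<triangleleft> (v \<triangleright> x)" using ract_matched[of t v x] * by (simp add: s_def \<Gamma>.m_assoc)
      show ?thesis
        unfolding \<alpha>_def \<gamma>_def sv q' mulv_scale using * lact_matched[of v x y] by (simp add: a_mult ac_simps)
    qed
    ultimately show "\<sigma> (t \<otimes>\<^bsub>\<Gamma>\<^esub> v) x y * \<tau> (x \<otimes>\<^bsub>F\<^esub> y) t v * a t (v \<triangleright> (x \<otimes>\<^bsub>F\<^esub> y)) p
      = \<tau> x t v * \<tau> y (t \<triangleleft> (v \<triangleright> x)) (v \<triangleleft> x) * \<sigma> t (v \<triangleright> x) ((v \<triangleleft> x) \<triangleright> y) * \<sigma> v x y * a t (v \<triangleright> (x \<otimes>\<^bsub>F\<^esub> y)) p"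
      unfolding sv by (simp add: s_def ac_simps)
  qed (use * in auto)
  have \<tau>n: "\<tau> x t v \<noteq> 0" if *: "x \<in> carrier F" "t \<in> carrier \<Gamma>" "v \<in> carrier \<Gamma>" for x t v
  proof
    assume "\<tau> x t v = 0"
    then have "\<sigma> (t \<otimes>\<^bsub>\<Gamma>\<^esub> v) x (inv\<^bsub>F\<^esub> x) * \<tau> \<one>\<^bsub>F\<^esub> t v = 0" using comp[of t v x "inv\<^bsub>F\<^esub> x"] * by simp
    then show False using \<sigma>_nonzero[of "t \<otimes>\<^bsub>\<Gamma>\<^esub> v" x "inv\<^bsub>F\<^esub> x"] \<tau>u * by simp
  qed
  show ?thesis
    by unfold_locales (use \<sigma>_nonzero \<sigma>1 \<sigma>c \<tau>n \<tau>r \<tau>l \<tau>c \<sigma>u \<tau>u comp in auto)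
qed

end

section \<open>Modules over an abelian extension in bicrossed coordinates\<close>

context extension_basis
begin

lemma unit_vec_expand:
  assumes "i \<in> basis A"
  shows "unit_vec i = (\<lambda>l. \<Sum>s\<in>carrier \<Gamma>. \<Sum>x\<in>carrier F. kap s x i * a s x l)"
proof -
  have "supported (unit_vec i)" using assms by (auto simp: supported_def unit_vec_def)
  from expand[OF this] show ?thesis by (simp only: K_unit_vec[OF assms])
qed

lemma comult_kap:
  assumes t: "t \<in> carrier \<Gamma>" "y \<in> carrier F" and u: "u \<in> carrier \<Gamma>" "z \<in> carrier F" and i: "i \<in> basis A"
  shows "(\<Sum>j\<in>basis A. \<Sum>l\<in>basis A. cml A i j l * kap t y j * kap u z l)
    = of_bool (y = u \<triangleright> z) * \<tau> z t u * kap (t \<otimes>\<^bsub>\<Gamma>\<^esub> u) z i"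
proof -
  let ?I = "basis A"
  have "(\<Sum>j\<in>?I. \<Sum>l\<in>?I. cml A i j l * kap t y j * kap u z l) = W t y u z (unit_vec i)"
    using i by (simp add: W_def com_unit_vec)
  also have "\<dots> = W t y u z (\<lambda>l. \<Sum>s\<in>carrier \<Gamma>. \<Sum>x\<in>carrier F. kap s x i * a s x l)"
    by (simp only: unit_vec_expand[OF i])
  also have "\<dots> = (\<Sum>j\<in>?I. \<Sum>l\<in>?I. \<Sum>s\<in>carrier \<Gamma>. \<Sum>x\<in>carrier F. kap s x i * (com (a s x) j l * kap t y j * kap u z l))"
    by (simp add: W_def com_sum com_scale sum_distrib_right mult.assoc)
  also have "\<dots> = (\<Sum>j\<in>?I. \<Sum>s\<in>carrier \<Gamma>. \<Sum>x\<in>carrier F. \<Sum>l\<in>?I. kap s x i * (com (a s x) j l * kap t y j * kap u z l))"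
    by (rule sum.cong[OF refl], rule sum_move_in3)
  also have "\<dots> = (\<Sum>s\<in>carrier \<Gamma>. \<Sum>x\<in>carrier F. \<Sum>j\<in>?I. \<Sum>l\<in>?I. kap s x i * (com (a s x) j l * kap t y j * kap u z l))"
    by (rule sum_move_in3)
  also have "\<dots> = (\<Sum>s\<in>carrier \<Gamma>. \<Sum>x\<in>carrier F. kap s x i * W t y u z (a s x))"
    by (simp add: W_def sum_distrib_left)
  also have "\<dots> = (\<Sum>s\<in>carrier \<Gamma>. \<Sum>x\<in>carrier F.
      of_bool (x = z) * (of_bool (s = t \<otimes>\<^bsub>\<Gamma>\<^esub> u) * (of_bool (y = u \<triangleright> z) * \<tau> z t u * kap s x i)))"
    using t u by (intro sum.cong refl) (simp add: W_a ac_simps)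
  also have "\<dots> = (\<Sum>s\<in>carrier \<Gamma>. of_bool (s = t \<otimes>\<^bsub>\<Gamma>\<^esub> u) * (of_bool (y = u \<triangleright> z) * \<tau> z t u * kap s z i))"
    by (simp only: sum_of_bool_eq(1)[OF finite_F] u if_True)
  also have "\<dots> = of_bool (y = u \<triangleright> z) * \<tau> z t u * kap (t \<otimes>\<^bsub>\<Gamma>\<^esub> u) z i"
    by (simp only: sum_of_bool_eq(1)[OF finite_\<Gamma>] \<Gamma>.m_closed t u if_True)
  finally show ?thesis .
qed

text \<open>
  The functional \<open>K v w\<close> of a product with one factor from the basis \<open>a\<close>; expanding the other factor in this basis
  leaves one term.
\<close>

lemma kap_mult_left:
  assumes v: "v \<in> carrier \<Gamma>" "w \<in> carrier F" and u: "u \<in> carrier \<Gamma>" "x \<in> carrier F" and j: "j \<in> basis A"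
    and y: "y \<in> carrier F" "y \<otimes>\<^bsub>F\<^esub> x = w"
  shows "K v w (unit_vec j \<star> a u x) = of_bool (v \<triangleleft> y = u) * \<sigma> v y x * kap v y j"
proof -
  have lin: "K v w (\<lambda>l. \<Sum>k\<in>B. c k l) = (\<Sum>k\<in>B. K v w (c k))" for B and c :: "'z \<Rightarrow> 'i \<Rightarrow> 'k"
    unfolding K_def sum_distrib_left by (rule sum.swap)
  have scal: "K v w (\<lambda>l. r * c l) = r * K v w c" for r c
    by (simp add: K_def sum_distrib_left mult.left_commute)
  have yx: "x' \<otimes>\<^bsub>F\<^esub> x = w \<longleftrightarrow> x' = y" if "x' \<in> carrier F" for x'
    using that y u F.right_cancel by auto
  note unit_vec_expand[OF j]
  then have "K v w (unit_vec j \<star> a u x) = (\<Sum>s\<in>carrier \<Gamma>. \<Sum>x'\<in>carrier F. kap s x' j * K v w (a s x' \<star> a u x))"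
    by (simp add: mulv_sum_left mulv_scale lin scal)
  also have "\<dots> = (\<Sum>s\<in>carrier \<Gamma>. \<Sum>x'\<in>carrier F.
      of_bool (x' = y) * (of_bool (s = v) * (of_bool (s \<triangleleft> x' = u) * \<sigma> s x' x * kap s x' j)))"
  proof (intro sum.cong refl)
    fix s x' assume "s \<in> carrier \<Gamma>" "x' \<in> carrier F"
    then show "kap s x' j * K v w (a s x' \<star> a u x)
      = of_bool (x' = y) * (of_bool (s = v) * (of_bool (s \<triangleleft> x' = u) * \<sigma> s x' x * kap s x' j))"
      using v u yx by (auto simp: a_mult scal K_a K_def[of _ _ "\<lambda>_. 0"])
  qed
  also have "\<dots> = (\<Sum>s\<in>carrier \<Gamma>. of_bool (s = v) * (of_bool (s \<triangleleft> y = u) * \<sigma> s y x * kap s y j))"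
    by (simp only: sum_of_bool_eq(1)[OF finite_F] y(1) if_True)
  also have "\<dots> = of_bool (v \<triangleleft> y = u) * \<sigma> v y x * kap v y j"
    by (simp only: sum_of_bool_eq(1)[OF finite_\<Gamma>] v(1) if_True)
  finally show ?thesis .
qed

lemma kap_mult_right:
  assumes v: "v \<in> carrier \<Gamma>" "w \<in> carrier F" and r: "r \<in> carrier \<Gamma>" "x \<in> carrier F" and j: "j \<in> basis A"
    and z: "z \<in> carrier F" "x \<otimes>\<^bsub>F\<^esub> z = w"
  shows "K v w (a r x \<star> unit_vec j) = of_bool (r = v) * \<sigma> v x z * kap (v \<triangleleft> x) z j"
proof -
  have lin: "K v w (\<lambda>l. \<Sum>k\<in>B. c k l) = (\<Sum>k\<in>B. K v w (c k))" for B and c :: "'z \<Rightarrow> 'i \<Rightarrow> 'k"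
    unfolding K_def sum_distrib_left by (rule sum.swap)
  have scal: "K v w (\<lambda>l. r * c l) = r * K v w c" for r c
    by (simp add: K_def sum_distrib_left mult.left_commute)
  have yx: "x \<otimes>\<^bsub>F\<^esub> x' = w \<longleftrightarrow> x' = z" if "x' \<in> carrier F" for x'
    using that z r F.Units_l_cancel[of x x' z] by (auto simp: F.Units_eq)
  note unit_vec_expand[OF j]
  then have "K v w (a r x \<star> unit_vec j) = (\<Sum>s\<in>carrier \<Gamma>. \<Sum>x'\<in>carrier F. kap s x' j * K v w (a r x \<star> a s x'))"
    by (simp add: mulv_sum_right mulv_scale lin scal)
  also have "\<dots> = (\<Sum>s\<in>carrier \<Gamma>. \<Sum>x'\<in>carrier F.
      of_bool (x' = z) * (of_bool (s = r \<triangleleft> x) * (of_bool (r = v) * \<sigma> r x x' * kap s x' j)))"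
  proof (intro sum.cong refl)
    fix s x' assume "s \<in> carrier \<Gamma>" "x' \<in> carrier F"
    then show "kap s x' j * K v w (a r x \<star> a s x')
      = of_bool (x' = z) * (of_bool (s = r \<triangleleft> x) * (of_bool (r = v) * \<sigma> r x x' * kap s x' j))"
      using v r yx by (auto simp: a_mult scal K_a K_def[of _ _ "\<lambda>_. 0"])
  qed
  also have "\<dots> = (\<Sum>s\<in>carrier \<Gamma>. of_bool (s = r \<triangleleft> x) * (of_bool (r = v) * \<sigma> r x z * kap s z j))"
    by (simp only: sum_of_bool_eq(1)[OF finite_F] z(1) if_True)
  also have "\<dots> = of_bool (r = v) * \<sigma> v x z * kap (v \<triangleleft> x) z j"
    using r by (simp only: sum_of_bool_eq(1)[OF finite_\<Gamma>] ract_closed if_True) auto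
  finally show ?thesis .
qed

lemma K_unit_mult:
  assumes "j \<in> basis A"
  shows "(\<Sum>n\<in>basis A. \<Sum>q\<in>basis A. kap v w n * (c q * mlt A j q n)) = K v w (unit_vec j \<star> c)"
    and "(\<Sum>n\<in>basis A. \<Sum>p\<in>basis A. kap v w n * (c p * mlt A p j n)) = K v w (c \<star> unit_vec j)"
proof -
  have "(unit_vec j \<star> c) n = (\<Sum>q\<in>basis A. c q * mlt A j q n)" if "n \<in> basis A" for n
  proof -
    have "(unit_vec j \<star> c) n = (\<Sum>i\<in>basis A. \<Sum>q\<in>basis A. of_bool (i = j) * (c q * mlt A i q n))"
      using that by (simp add: mulv_def unit_vec_def mult.assoc)
    also have "\<dots> = (\<Sum>i\<in>basis A. of_bool (i = j) * (\<Sum>q\<in>basis A. c q * mlt A i q n))"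
      by (simp add: sum_distrib_left)
    finally show ?thesis by (simp only: sum_of_bool_eq(1)[OF finite_basis] assms if_True)
  qed
  then show "(\<Sum>n\<in>basis A. \<Sum>q\<in>basis A. kap v w n * (c q * mlt A j q n)) = K v w (unit_vec j \<star> c)"
    by (simp add: K_def sum_distrib_left)
  have "(c \<star> unit_vec j) n = (\<Sum>p\<in>basis A. c p * mlt A p j n)" if "n \<in> basis A" for n
  proof -
    have "(c \<star> unit_vec j) n = (\<Sum>p\<in>basis A. \<Sum>i\<in>basis A. of_bool (i = j) * (c p * mlt A p i n))"
      using that by (simp add: mulv_def unit_vec_def ac_simps)
    also have "\<dots> = (\<Sum>p\<in>basis A. c p * mlt A p j n)"
      by (simp only: sum_of_bool_eq(1)[OF finite_basis] assms if_True)
    finally show ?thesis .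
  qed
  then show "(\<Sum>n\<in>basis A. \<Sum>p\<in>basis A. kap v w n * (c p * mlt A p j n)) = K v w (c \<star> unit_vec j)"
    by (simp add: K_def sum_distrib_left)
qed

end

locale extension_modules = extension_basis F \<Gamma> lact ract A e \<pi> a + scalar_algebra scale
  for F :: "('f, 'm) monoid_scheme" and \<Gamma> :: "('g, 'n) monoid_scheme"
    and lact :: "'g \<Rightarrow> 'f \<Rightarrow> 'f" (infixr "\<triangleright>" 75)
    and ract :: "'g \<Rightarrow> 'f \<Rightarrow> 'g" (infixl "\<triangleleft>" 75)
    and A :: "('i, 'k::field) bialg" and e and \<pi> and a
    and scale :: "'k \<Rightarrow> 'e::ring_1 \<Rightarrow> 'e" (infixr "\<cdot>" 75)
begin

sublocale M: bicrossed_modules F \<Gamma> "(\<triangleright>)" "(\<triangleleft>)" \<sigma> \<tau> "(\<cdot>)"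
  using bicrossed_datum_of_basis scalar_algebra_axioms by (simp add: bicrossed_modules_def)

definition lin :: "('i \<Rightarrow> 'k) \<Rightarrow> ('i \<Rightarrow> 'e) \<Rightarrow> 'e" where
  "lin v X = (\<Sum>i\<in>basis A. v i \<cdot> X i)"

definition bil :: "('i \<Rightarrow> 'i \<Rightarrow> 'k) \<Rightarrow> ('i \<Rightarrow> 'e) \<Rightarrow> ('i \<Rightarrow> 'e) \<Rightarrow> 'e" where
  "bil m X Y = (\<Sum>j\<in>basis A. \<Sum>p\<in>basis A. m j p \<cdot> (X j * Y p))"

text \<open>
  Yetter-Drinfeld modules in the given basis of \<open>A\<close>: \<open>R i\<close> is the action of the basis vector \<open>i\<close>, and
  \<open>T i\<close> is the operator with \<open>c\<^sub>X = \<Sum>\<^sub>i b\<^sub>i|\<^sub>X \<otimes> T i\<close> for a half-braiding \<open>c\<close>. The last condition is the coefficient at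
  \<open>n\<close> of \<open>\<Sum> b\<^sub>j h\<^sub>2 \<otimes> T j R h\<^sub>1 = \<Sum> h\<^sub>1 b\<^sub>j \<otimes> R h\<^sub>2 T j\<close> for the basis vector \<open>h = b\<^sub>i\<close>.
\<close>

definition yd_rep :: "('i \<Rightarrow> 'e) \<Rightarrow> ('i \<Rightarrow> 'e) \<Rightarrow> bool" where
  "yd_rep R T \<longleftrightarrow>
    (\<forall>i\<in>basis A. \<forall>j\<in>basis A. R i * R j = lin (mlt A i j) R) \<and> lin (unt A) R = 1 \<and>
    (\<forall>p\<in>basis A. \<forall>q\<in>basis A. T q * T p = lin (\<lambda>i. cml A i p q) T) \<and> lin (cou A) T = 1 \<and>
    (\<forall>i\<in>basis A. \<forall>n\<in>basis A.
      bil (\<lambda>j p. \<Sum>q\<in>basis A. cml A i p q * mlt A j q n) T R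
        = bil (\<lambda>q j. \<Sum>p\<in>basis A. cml A i p q * mlt A p j n) R T)"

definition rep_coords :: "('i \<Rightarrow> 'e) \<Rightarrow> 'g \<Rightarrow> 'f \<Rightarrow> 'e" where
  "rep_coords R s x = lin (a s x) R"

definition corep_coords :: "('i \<Rightarrow> 'e) \<Rightarrow> 'g \<Rightarrow> 'f \<Rightarrow> 'e" where
  "corep_coords T s x = lin (kap s x) T"

lemma lin_cong: "(\<And>i. i \<in> basis A \<Longrightarrow> v i = w i) \<Longrightarrow> lin v X = lin w X"
  by (simp add: lin_def)

lemma bil_cong: "(\<And>i j. i \<in> basis A \<Longrightarrow> j \<in> basis A \<Longrightarrow> v i j = w i j) \<Longrightarrow> bil v X Y = bil w X Y"
  by (simp add: bil_def)

lemma lin_scale: "lin (\<lambda>i. c * v i) X = c \<cdot> lin v X"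
  by (simp add: lin_def scale_sum_right)

lemma bil_scale: "bil (\<lambda>i j. c * m i j) X Y = c \<cdot> bil m X Y"
  by (simp add: bil_def scale_sum_right)

lemma lin_sum: "lin (\<lambda>i. \<Sum>k\<in>B. v k i) X = (\<Sum>k\<in>B. lin (v k) X)"
  unfolding lin_def scale_sum_left by (rule sum.swap)

lemma bil_sum: "bil (\<lambda>i j. \<Sum>k\<in>B. m k i j) X Y = (\<Sum>k\<in>B. bil (m k) X Y)"
  unfolding bil_def scale_sum_left by (rule sum_move_in3[symmetric])

lemma lin_zero: "lin (\<lambda>_. 0) X = 0"
  by (simp add: lin_def)

lemma lin_mult: "lin v X * lin w Y = bil (\<lambda>i j. v i * w j) X Y"
  by (simp add: lin_def bil_def sum_product mult.commute)

lemma alg_rep_coords: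
  assumes "yd_rep R T"
  shows "M.alg_rep (rep_coords R)"
  unfolding M.alg_rep_def
proof (intro conjI ballI)
  fix s x t y assume *: "s \<in> carrier \<Gamma>" "x \<in> carrier F" "t \<in> carrier \<Gamma>" "y \<in> carrier F"
  let ?I = "basis A"
  have "rep_coords R s x * rep_coords R t y = (\<Sum>i\<in>?I. \<Sum>j\<in>?I. lin (\<lambda>l. (a s x i * a t y j) * mlt A i j l) R)"
    using assms by (simp add: rep_coords_def lin_mult bil_def yd_rep_def lin_scale)
  also have "\<dots> = lin (a s x \<star> a t y) R"
    unfolding lin_sum[symmetric] by (rule lin_cong) (simp add: mulv_def)
  finally show "rep_coords R s x * rep_coords R t y
      = (if s \<triangleleft> x = t then \<sigma> s x y \<cdot> rep_coords R s (x \<otimes>\<^bsub>F\<^esub> y) else 0)"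
    using * by (auto simp: a_mult rep_coords_def lin_scale lin_zero)
next
  have "(\<Sum>s\<in>carrier \<Gamma>. rep_coords R s \<one>\<^bsub>F\<^esub>) = lin (unt A) R"
    unfolding rep_coords_def lin_sum[symmetric] by (rule lin_cong) (simp add: unit_a)
  then show "(\<Sum>s\<in>carrier \<Gamma>. rep_coords R s \<one>\<^bsub>F\<^esub>) = 1" using assms by (simp add: yd_rep_def)
qed

lemma coalg_rep_coords:
  assumes "yd_rep R T"
  shows "M.coalg_rep (corep_coords T)"
  unfolding M.coalg_rep_def
proof (intro conjI ballI)
  fix u x t y assume *: "u \<in> carrier \<Gamma>" "x \<in> carrier F" "t \<in> carrier \<Gamma>" "y \<in> carrier F"
  let ?I = "basis A"
  have "corep_coords T u x * corep_coords T t y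
      = (\<Sum>q\<in>?I. \<Sum>p\<in>?I. lin (\<lambda>i. (kap u x q * kap t y p) * cml A i p q) T)"
    using assms by (simp add: corep_coords_def lin_mult bil_def yd_rep_def lin_scale)
  also have "\<dots> = (\<Sum>p\<in>?I. \<Sum>q\<in>?I. lin (\<lambda>i. (kap u x q * kap t y p) * cml A i p q) T)"
    by (rule sum.swap)
  also have "\<dots> = lin (\<lambda>i. \<Sum>p\<in>?I. \<Sum>q\<in>?I. cml A i p q * kap t y p * kap u x q) T"
    unfolding lin_sum[symmetric] by (rule lin_cong) (simp add: ac_simps)
  also have "\<dots> = lin (\<lambda>i. (of_bool (y = u \<triangleright> x) * \<tau> x t u) * kap (t \<otimes>\<^bsub>\<Gamma>\<^esub> u) x i) T"
    using * by (intro lin_cong) (simp add: comult_kap)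
  finally show "corep_coords T u x * corep_coords T t y
      = (if y = u \<triangleright> x then \<tau> x t u \<cdot> corep_coords T (t \<otimes>\<^bsub>\<Gamma>\<^esub> u) x else 0)"
    by (auto simp: corep_coords_def lin_scale lin_zero)
next
  have "(\<Sum>x\<in>carrier F. corep_coords T \<one>\<^bsub>\<Gamma>\<^esub> x) = lin (cou A) T"
    unfolding corep_coords_def lin_sum[symmetric] by (rule lin_cong) (simp add: counit_kap)
  then show "(\<Sum>x\<in>carrier F. corep_coords T \<one>\<^bsub>\<Gamma>\<^esub> x) = 1" using assms by (simp add: yd_rep_def)
qed

text \<open>
  The Yetter-Drinfeld conditions for \<open>i\<close> and \<open>n\<close> are combined with the coefficients \<open>a s x i\<close> and
  \<open>kap v w n\<close>, where \<open>s = t \<otimes> u\<close> and \<open>w = y \<otimes> x\<close>. On each side the coproduct and product rules of the basis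
  \<open>a\<close> then leave a single term.
\<close>

lemma yd_coords:
  assumes R: "yd_rep R T"
  shows "M.yd (rep_coords R) (corep_coords T)"
  unfolding M.yd_def
proof (intro conjI ballI impI)
  show "M.alg_rep (rep_coords R)" "M.coalg_rep (corep_coords T)"
    using R by (rule alg_rep_coords, rule coalg_rep_coords)
  fix v t u r x y z
  assume *: "v \<in> carrier \<Gamma>" "t \<in> carrier \<Gamma>" "u \<in> carrier \<Gamma>" "r \<in> carrier \<Gamma>"
      "x \<in> carrier F" "y \<in> carrier F" "z \<in> carrier F"
    and u: "u = v \<triangleleft> y" and s: "v \<otimes>\<^bsub>\<Gamma>\<^esub> r = t \<otimes>\<^bsub>\<Gamma>\<^esub> u" and w: "(r \<triangleright> x) \<otimes>\<^bsub>F\<^esub> z = y \<otimes>\<^bsub>F\<^esub> x"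
  let ?I = "basis A" and ?s = "t \<otimes>\<^bsub>\<Gamma>\<^esub> u" and ?w = "y \<otimes>\<^bsub>F\<^esub> x"
  let ?q = "\<lambda>u. ?s \<otimes>\<^bsub>\<Gamma>\<^esub> inv\<^bsub>\<Gamma>\<^esub> u"
  have cs: "?s \<in> carrier \<Gamma>" and cw: "?w \<in> carrier F" using * by auto
  have qu: "?q u = t" using * by (simp add: \<Gamma>.m_assoc)
  have qr: "?q u' = v \<longleftrightarrow> u' = r" if "u' \<in> carrier \<Gamma>" for u'
  proof
    assume "?q u' = v"
    then have "v \<otimes>\<^bsub>\<Gamma>\<^esub> u' = ?s" using that * by (auto simp: \<Gamma>.m_assoc)
    then show "u' = r" using s that * \<Gamma>.Units_l_cancel \<Gamma>.Units_eq by metis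
  next
    assume "u' = r"
    then show "?q u' = v" using * by (simp add: \<Gamma>.m_assoc flip: s)
  qed
  have L: "(\<Sum>i\<in>?I. \<Sum>n\<in>?I. (a ?s x i * kap v ?w n) * (\<Sum>q\<in>?I. cml A i p q * mlt A j q n))
      = (\<tau> x t u * \<sigma> v y x) * (kap v y j * a t (u \<triangleright> x) p)" if j: "j \<in> ?I" and p: "p \<in> ?I" for j p
  proof -
    have "(\<Sum>i\<in>?I. \<Sum>n\<in>?I. (a ?s x i * kap v ?w n) * (\<Sum>q\<in>?I. cml A i p q * mlt A j q n))
        = (\<Sum>i\<in>?I. \<Sum>n\<in>?I. \<Sum>q\<in>?I. kap v ?w n * (a ?s x i * cml A i p q * mlt A j q n))"
      by (simp add: sum_distrib_left ac_simps)
    also have "\<dots> = (\<Sum>n\<in>?I. \<Sum>q\<in>?I. \<Sum>i\<in>?I. kap v ?w n * (a ?s x i * cml A i p q * mlt A j q n))"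
      by (rule sum_move_in3)
    also have "\<dots> = (\<Sum>n\<in>?I. \<Sum>q\<in>?I. kap v ?w n * (com (a ?s x) p q * mlt A j q n))"
      by (simp add: com_def sum_distrib_left sum_distrib_right mult.assoc)
    also have "\<dots> = (\<Sum>n\<in>?I. \<Sum>q\<in>?I. \<Sum>u'\<in>carrier \<Gamma>. (\<tau> x (?q u') u' * a (?q u') (u' \<triangleright> x) p) * (kap v ?w n * (a u' x q * mlt A j q n)))"
      using cs * p by (intro sum.cong refl) (simp add: com_a sum_distrib_left sum_distrib_right ac_simps)
    also have "\<dots> = (\<Sum>u'\<in>carrier \<Gamma>. \<Sum>n\<in>?I. \<Sum>q\<in>?I. (\<tau> x (?q u') u' * a (?q u') (u' \<triangleright> x) p) * (kap v ?w n * (a u' x q * mlt A j q n)))"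
      by (rule sum_move_in3[symmetric])
    also have "\<dots> = (\<Sum>u'\<in>carrier \<Gamma>. (\<tau> x (?q u') u' * a (?q u') (u' \<triangleright> x) p) * K v ?w (unit_vec j \<star> a u' x))"
      by (simp only: K_unit_mult[OF j, symmetric] sum_distrib_left)
    also have "\<dots> = (\<Sum>u'\<in>carrier \<Gamma>. of_bool (u' = u) * ((\<tau> x (?q u') u' * a (?q u') (u' \<triangleright> x) p) * (\<sigma> v y x * kap v y j)))"
      using * j u by (intro sum.cong refl) (auto simp: kap_mult_left[OF _ cw _ _ j _ refl])
    also have "\<dots> = (\<tau> x t u * \<sigma> v y x) * (kap v y j * a t (u \<triangleright> x) p)"
      by (simp only: sum_of_bool_eq(1)[OF finite_\<Gamma>] *(3) if_True qu) (simp add: ac_simps)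
    finally show ?thesis .
  qed
  have Rr: "(\<Sum>i\<in>?I. \<Sum>n\<in>?I. (a ?s x i * kap v ?w n) * (\<Sum>p\<in>?I. cml A i p q * mlt A p j n))
      = (\<tau> x v r * \<sigma> v (r \<triangleright> x) z) * (a r x q * kap (v \<triangleleft> (r \<triangleright> x)) z j)" if q: "q \<in> ?I" and j: "j \<in> ?I" for q j
  proof -
    have "(\<Sum>i\<in>?I. \<Sum>n\<in>?I. (a ?s x i * kap v ?w n) * (\<Sum>p\<in>?I. cml A i p q * mlt A p j n))
        = (\<Sum>i\<in>?I. \<Sum>n\<in>?I. \<Sum>p\<in>?I. kap v ?w n * (a ?s x i * cml A i p q * mlt A p j n))"
      by (simp add: sum_distrib_left ac_simps)
    also have "\<dots> = (\<Sum>n\<in>?I. \<Sum>p\<in>?I. \<Sum>i\<in>?I. kap v ?w n * (a ?s x i * cml A i p q * mlt A p j n))"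
      by (rule sum_move_in3)
    also have "\<dots> = (\<Sum>n\<in>?I. \<Sum>p\<in>?I. kap v ?w n * (com (a ?s x) p q * mlt A p j n))"
      by (simp add: com_def sum_distrib_left sum_distrib_right mult.assoc)
    also have "\<dots> = (\<Sum>n\<in>?I. \<Sum>p\<in>?I. \<Sum>u'\<in>carrier \<Gamma>. (\<tau> x (?q u') u' * a u' x q) * (kap v ?w n * (a (?q u') (u' \<triangleright> x) p * mlt A p j n)))"
      using cs * q by (intro sum.cong refl) (simp add: com_a sum_distrib_left sum_distrib_right ac_simps)
    also have "\<dots> = (\<Sum>u'\<in>carrier \<Gamma>. \<Sum>n\<in>?I. \<Sum>p\<in>?I. (\<tau> x (?q u') u' * a u' x q) * (kap v ?w n * (a (?q u') (u' \<triangleright> x) p * mlt A p j n)))"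
      by (rule sum_move_in3[symmetric])
    also have "\<dots> = (\<Sum>u'\<in>carrier \<Gamma>. (\<tau> x (?q u') u' * a u' x q) * K v ?w (a (?q u') (u' \<triangleright> x) \<star> unit_vec j))"
      by (simp only: K_unit_mult[OF j, symmetric] sum_distrib_left)
    also have "\<dots> = (\<Sum>u'\<in>carrier \<Gamma>. of_bool (u' = r) * ((\<tau> x (?q u') u' * a u' x q) * (\<sigma> v (u' \<triangleright> x) z * kap (v \<triangleleft> (u' \<triangleright> x)) z j)))"
    proof (intro sum.cong refl)
      fix u' assume u': "u' \<in> carrier \<Gamma>"
      define z' where "z' = inv\<^bsub>F\<^esub> (u' \<triangleright> x) \<otimes>\<^bsub>F\<^esub> ?w"
      have z': "z' \<in> carrier F" "(u' \<triangleright> x) \<otimes>\<^bsub>F\<^esub> z' = ?w" using u' * by (auto simp: z'_def simp flip: F.m_assoc)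
      have "z' = z" if "u' = r" using that z' w * by (metis F.Units_l_cancel F.Units_eq lact_closed)
      then show "(\<tau> x (?q u') u' * a u' x q) * K v ?w (a (?q u') (u' \<triangleright> x) \<star> unit_vec j)
        = of_bool (u' = r) * ((\<tau> x (?q u') u' * a u' x q) * (\<sigma> v (u' \<triangleright> x) z * kap (v \<triangleleft> (u' \<triangleright> x)) z j))"
        using kap_mult_right[OF *(1) cw _ _ j z', of "?q u'"] qr[OF u'] u' * cs by (cases "u' = r") auto
    qed
    also have "\<dots> = (\<tau> x v r * \<sigma> v (r \<triangleright> x) z) * (a r x q * kap (v \<triangleleft> (r \<triangleright> x)) z j)"
      using qr[OF *(4)] by (simp only: sum_of_bool_eq(1)[OF finite_\<Gamma>] *(4) if_True) (simp add: ac_simps)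
    finally show ?thesis .
  qed
  have "(\<Sum>i\<in>?I. \<Sum>n\<in>?I. (a ?s x i * kap v ?w n) \<cdot> bil (\<lambda>j p. \<Sum>q\<in>?I. cml A i p q * mlt A j q n) T R)
      = (\<Sum>i\<in>?I. \<Sum>n\<in>?I. (a ?s x i * kap v ?w n) \<cdot> bil (\<lambda>q j. \<Sum>p\<in>?I. cml A i p q * mlt A p j n) R T)"
    using R by (simp add: yd_rep_def)
  then have "bil (\<lambda>j p. \<Sum>i\<in>?I. \<Sum>n\<in>?I. (a ?s x i * kap v ?w n) * (\<Sum>q\<in>?I. cml A i p q * mlt A j q n)) T R
      = bil (\<lambda>q j. \<Sum>i\<in>?I. \<Sum>n\<in>?I. (a ?s x i * kap v ?w n) * (\<Sum>p\<in>?I. cml A i p q * mlt A p j n)) R T"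
    by (simp only: bil_sum bil_scale)
  then have "bil (\<lambda>j p. (\<tau> x t u * \<sigma> v y x) * (kap v y j * a t (u \<triangleright> x) p)) T R
      = bil (\<lambda>q j. (\<tau> x v r * \<sigma> v (r \<triangleright> x) z) * (a r x q * kap (v \<triangleleft> (r \<triangleright> x)) z j)) R T"
    by (simp add: L Rr cong: bil_cong)
  then show "(\<tau> x t u * \<sigma> v y x) \<cdot> (corep_coords T v y * rep_coords R t (u \<triangleright> x))
      = (\<tau> x v r * \<sigma> v (r \<triangleright> x) z) \<cdot> (rep_coords R r x * corep_coords T (v \<triangleleft> (r \<triangleright> x)) z)"
    by (simp only: bil_scale rep_coords_def corep_coords_def lin_mult)
qed

text \<open>
  The element \<open>\<Sum>\<^sub>i R\<^sub>i T\<^sub>i\<close> does not depend on the choice of the pair of dual bases.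
\<close>

lemma twist_coords: "M.twist (rep_coords R) (corep_coords T) = (\<Sum>i\<in>basis A. R i * T i)"
proof -
  have "M.twist (rep_coords R) (corep_coords T)
      = (\<Sum>s\<in>carrier \<Gamma>. \<Sum>x\<in>carrier F. bil (\<lambda>j i. kap s x i * a s x j) R T)"
    by (simp add: M.twist_def rep_coords_def corep_coords_def lin_mult sum.cartesian_product mult.commute)
  also have "\<dots> = bil (\<lambda>j i. of_bool (j = i)) R T"
    unfolding bil_sum[symmetric] by (rule bil_cong) (simp add: completeness)
  also have "\<dots> = (\<Sum>j\<in>basis A. \<Sum>i\<in>basis A. if i = j then R j * T i else 0)"
    unfolding bil_def by (intro sum.cong refl) auto
  finally show ?thesis using finite_basis by simp
qed

lemma lin_commute:
  assumes "\<And>i j. i \<in> basis A \<Longrightarrow> j \<in> basis A \<Longrightarrow> X i * Y j = Y j * X i"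
  shows "lin v X * lin w Y = lin w Y * lin v X"
proof -
  have "lin v X * lin w Y = (\<Sum>j\<in>basis A. \<Sum>i\<in>basis A. (v i * w j) \<cdot> (X i * Y j))"
    unfolding lin_mult bil_def by (rule sum.swap)
  then show ?thesis using assms by (simp add: lin_mult bil_def mult.commute)
qed

lemma double_braiding_exponent:
  assumes "yd_rep R T" "yd_rep R' T'"
    and "\<And>i j. i \<in> basis A \<Longrightarrow> j \<in> basis A \<Longrightarrow> R i * R' j = R' j * R i"
    and "\<And>i j. i \<in> basis A \<Longrightarrow> j \<in> basis A \<Longrightarrow> R i * T' j = T' j * R i"
    and "\<And>i j. i \<in> basis A \<Longrightarrow> j \<in> basis A \<Longrightarrow> T i * R' j = R' j * T i"
    and "\<And>i j. i \<in> basis A \<Longrightarrow> j \<in> basis A \<Longrightarrow> T i * T' j = T' j * T i"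
  shows "((\<Sum>i\<in>basis A. R i * T' i) * (\<Sum>i\<in>basis A. R' i * T i))
    ^ (group_exponent (Opext F \<Gamma> (\<triangleright>) (\<triangleleft>) :: (('g \<Rightarrow> 'f \<Rightarrow> 'f \<Rightarrow> 'k) \<times> ('f \<Rightarrow> 'g \<Rightarrow> 'g \<Rightarrow> 'k)) set monoid)
      * group_exponent (bowtie F \<Gamma> (\<triangleright>) (\<triangleleft>))) = 1"
  unfolding twist_coords[symmetric]
  by (rule M.double_braiding_exponent[OF yd_coords[OF assms(1)] yd_coords[OF assms(2)]])
    (auto simp: M.commuting_def rep_coords_def corep_coords_def assms intro!: lin_commute M.orb_coeff_power_exponent)

end

section \<open>Exact sequences in coordinates\<close>

context bialgebra
begin

lemma right_degree_iff:
  assumes F: "x \<in> carrier F"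
  shows "restrict a (basis A) \<in> right_degree A (grp_hopf F) \<pi> (bvec (carrier F) x) \<longleftrightarrow>
    (\<forall>p\<in>basis A. \<forall>y\<in>carrier F. (\<Sum>q\<in>basis A. com a p q * \<pi> q y) = of_bool (y = x) * a p)"
proof -
  let ?I = "basis A" and ?a = "restrict a (basis A)"
  have "lmap (?I \<times> ?I) (?I \<times> carrier F) (ltensor lid \<pi>) (vcomult A ?a) (p, y) = (\<Sum>q\<in>?I. com a p q * \<pi> q y)"
    if "p \<in> ?I" "y \<in> carrier F" for p y
  proof -
    have "lmap (?I \<times> ?I) (?I \<times> carrier F) (ltensor lid \<pi>) (vcomult A ?a) (p, y)
        = (\<Sum>i\<in>?I. \<Sum>q\<in>?I. of_bool (i = p) * (com a i q * \<pi> q y))"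
      using that by (simp add: lmap_def vcomult_def ltensor_def lid_def com_def sum.cartesian_product case_prod_unfold mult.left_commute)
    also have "\<dots> = (\<Sum>q\<in>?I. \<Sum>i\<in>?I. of_bool (i = p) * (com a i q * \<pi> q y))" by (rule sum.swap)
    finally show ?thesis by (simp only: sum_of_bool_eq(1)[OF finite_basis] that if_True)
  qed
  moreover have "vtensor ?I (carrier F) ?a (bvec (carrier F) x) (p, y) = of_bool (y = x) * a p"
    if "p \<in> ?I" "y \<in> carrier F" for p y
    using that by (simp add: vtensor_def bvec_def)
  moreover have "?a \<in> right_degree A (grp_hopf F) \<pi> (bvec (carrier F) x) \<longleftrightarrow>
      (\<forall>p\<in>?I. \<forall>y\<in>carrier F. lmap (?I \<times> ?I) (?I \<times> carrier F) (ltensor lid \<pi>) (vcomult A ?a) (p, y)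
        = vtensor ?I (carrier F) ?a (bvec (carrier F) x) (p, y))"
    unfolding right_degree_def grp_hopf_def lmap_def vtensor_def by (simp add: restrict_eq_iff vecs_def)
  ultimately show ?thesis by simp
qed

lemma left_degree_iff:
  assumes F: "x \<in> carrier F"
  shows "restrict a (basis A) \<in> left_degree A (grp_hopf F) \<pi> (bvec (carrier F) x) \<longleftrightarrow>
    (\<forall>q\<in>basis A. \<forall>y\<in>carrier F. (\<Sum>p\<in>basis A. com a p q * \<pi> p y) = of_bool (y = x) * a q)"
proof -
  let ?I = "basis A" and ?a = "restrict a (basis A)"
  have "lmap (?I \<times> ?I) (carrier F \<times> ?I) (ltensor \<pi> lid) (vcomult A ?a) (y, q) = (\<Sum>p\<in>?I. com a p q * \<pi> p y)"
    if "q \<in> ?I" "y \<in> carrier F" for q y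
  proof -
    have "lmap (?I \<times> ?I) (carrier F \<times> ?I) (ltensor \<pi> lid) (vcomult A ?a) (y, q)
        = (\<Sum>p\<in>?I. \<Sum>i\<in>?I. of_bool (i = q) * (com a p i * \<pi> p y))"
      using that by (simp add: lmap_def vcomult_def ltensor_def lid_def com_def sum.cartesian_product case_prod_unfold ac_simps)
    then show ?thesis by (simp only: sum_of_bool_eq(1)[OF finite_basis] that if_True)
  qed
  moreover have "vtensor (carrier F) ?I (bvec (carrier F) x) ?a (y, q) = of_bool (y = x) * a q"
    if "q \<in> ?I" "y \<in> carrier F" for q y
    using that by (simp add: vtensor_def bvec_def)
  moreover have "?a \<in> left_degree A (grp_hopf F) \<pi> (bvec (carrier F) x) \<longleftrightarrow>
      (\<forall>q\<in>?I. \<forall>y\<in>carrier F. lmap (?I \<times> ?I) (carrier F \<times> ?I) (ltensor \<pi> lid) (vcomult A ?a) (y, q)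
        = vtensor (carrier F) ?I (bvec (carrier F) x) ?a (y, q))"
    unfolding left_degree_def grp_hopf_def lmap_def vtensor_def by (auto simp add: restrict_eq_iff vecs_def)
  ultimately show ?thesis by simp
qed

lemma vmult_restrict: "vmult A (restrict v (basis A)) (restrict w (basis A)) = restrict (v \<star> w) (basis A)"
  by (simp add: vmult_def mulv_def restrict_def fun_eq_iff)

lemma restrict_supported_eq:
  assumes "supported v" "supported w" "restrict v (basis A) = restrict w (basis A)"
  shows "v = w"
  using assms by (auto simp: restrict_eq_iff intro: supported_eqI)

end

text \<open>
  The conditions on \<open>\<iota>\<close> and \<open>\<pi>\<close> are evaluated on basis vectors. The image of \<open>\<iota>\<close> consists of the vectors of
  trivial right degree, which gives both the coinvariants and the degree of \<open>e\<^sub>s\<close>.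
\<close>

lemma abelian_extension_of_exact_sequence:
  fixes F :: "('f, 'm) monoid_scheme" and \<Gamma> :: "('g, 'n) monoid_scheme"
    and A :: "('i, 'k::field) bialg"
  assumes mp: "matched_pair F \<Gamma> lact ract" and ha: "hopf_algebra A"
    and ex: "exact_sequence (fun_hopf \<Gamma>) A (grp_hopf F) \<iota> \<pi>"
    and aff: "affords_actions F \<Gamma> lact ract A \<iota> \<pi>"
  shows "abelian_extension F \<Gamma> lact ract A (\<lambda>s i. if i \<in> basis A then \<iota> s i else 0) \<pi>"
proof -
  interpret matched_pair F \<Gamma> lact ract by (rule mp)
  interpret hopf_algebra A by (rule ha)
  let ?I = "basis A" and ?F = "carrier F" and ?G = "carrier \<Gamma>"
  define e where "e = (\<lambda>s i. if i \<in> ?I then \<iota> s i else 0)"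
  have h\<iota>: "hopf_hom (fun_hopf \<Gamma>) A \<iota>" and h\<pi>: "hopf_hom A (grp_hopf F) \<pi>"
    using ex by (auto simp: exact_sequence_def)
  have inj: "inj_on (lmap ?G ?I \<iota>) (vecs ?G)" and surj: "lmap ?I ?F \<pi> ` vecs ?I = vecs ?F"
    and coinv: "lmap ?G ?I \<iota> ` vecs ?G = right_degree A (grp_hopf F) \<pi> (bvec ?F \<one>\<^bsub>F\<^esub>)"
    using ex by (auto simp: exact_sequence_def fun_hopf_def grp_hopf_def vunit_def bvec_def)
  note c\<iota> = hopf_hom_coordsI[OF _ _ h\<iota>, unfolded hopf_hom_coords_def fun_hopf_def bialg.select_convs, OF finite_\<Gamma> finite_basis]
  note c\<pi> = hopf_hom_coordsI[OF _ _ h\<pi>, unfolded hopf_hom_coords_def grp_hopf_def bialg.select_convs, OF finite_basis finite_F]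
  note \<iota>_mult = c\<iota>[THEN conjunct1, rule_format]
  note \<iota>_unit = c\<iota>[THEN conjunct2, THEN conjunct1, rule_format]
  note \<iota>_com = c\<iota>[THEN conjunct2, THEN conjunct2, THEN conjunct1, rule_format]
  note \<iota>_eps = c\<iota>[THEN conjunct2, THEN conjunct2, THEN conjunct2, rule_format]
  note \<pi>_mult = c\<pi>[THEN conjunct1, rule_format]
  note \<pi>_com = c\<pi>[THEN conjunct2, THEN conjunct2, THEN conjunct1, rule_format]
  note \<pi>_eps = c\<pi>[THEN conjunct2, THEN conjunct2, THEN conjunct2, rule_format]
  have re: "lmap ?G ?I \<iota> (bvec ?G s) = restrict (e s) ?I" if "s \<in> ?G" for s
    using that finite_\<Gamma> by (simp add: lmap_bvec e_def restrict_def fun_eq_iff)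
  have se: "supported (e s)" for s by (simp add: supported_def e_def)
  show ?thesis
    unfolding e_def[symmetric]
  proof unfold_locales
    fix s assume s: "s \<in> ?G"
    show "supported (e s)" by (rule se)
    show "eps (e s) = of_bool (s = \<one>\<^bsub>\<Gamma>\<^esub>)" using \<iota>_eps[OF s] by (simp add: eps_def e_def)
    show "e s \<noteq> (\<lambda>_. 0)"
    proof
      assume 0: "e s = (\<lambda>_. 0)"
      have "lmap ?G ?I \<iota> (\<lambda>_\<in>?G. 0) = lmap ?G ?I \<iota> (bvec ?G s)"
        using re[OF s] 0 by (simp add: lmap_def)
      then have "(\<lambda>_\<in>?G. 0) = (bvec ?G s :: 'g \<Rightarrow> 'k)"
        by (rule inj_onD[OF inj]) (auto simp: vecs_def bvec_def)
      from fun_cong[OF this, of s] show False using s by (simp add: bvec_def)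
    qed
    fix p y assume "p \<in> ?I" "y \<in> ?F"
    moreover have "restrict (e s) ?I \<in> right_degree A (grp_hopf F) \<pi> (bvec ?F \<one>\<^bsub>F\<^esub>)"
      using coinv re[OF s] by (metis bvec_in_vecs imageI)
    ultimately show "(\<Sum>q\<in>?I. com (e s) p q * \<pi> q y) = of_bool (y = \<one>\<^bsub>F\<^esub>) * e s p"
      by (simp add: right_degree_iff)
  next
    fix s t assume st: "s \<in> ?G" "t \<in> ?G"
    show "e s \<star> e t = (if s = t then e s else (\<lambda>_. 0))"
    proof (rule supported_eqI)
      fix l assume l: "l \<in> ?I"
      have "(e s \<star> e t) l = (\<Sum>p\<in>?G. of_bool (s = t \<and> p = s) * \<iota> p l)"
        using l by (simp add: mulv_def e_def \<iota>_mult[OF st l])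
      also have "\<dots> = (\<Sum>p\<in>?G. of_bool (p = s) * (of_bool (s = t) * \<iota> p l))"
        by (intro sum.cong refl) auto
      also have "\<dots> = of_bool (s = t) * \<iota> s l" by (simp only: sum_of_bool_eq(1)[OF finite_\<Gamma>] st if_True)
      finally show "(e s \<star> e t) l = (if s = t then e s else (\<lambda>_. 0)) l" using l by (simp add: e_def)
    qed (simp, simp add: supported_def e_def)
  next
        show "(\<lambda>i. \<Sum>s\<in>?G. e s i) = onev" using \<iota>_unit by (auto simp: e_def onev_def)
  next
    fix s p q assume s: "s \<in> ?G" and pq: "p \<in> ?I" "q \<in> ?I"
    have "com (e s) p q = (\<Sum>t\<in>?G. \<Sum>u\<in>?G. of_bool (t \<otimes>\<^bsub>\<Gamma>\<^esub> u = s) * (\<iota> t p * \<iota> u q))"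
      using \<iota>_com[OF s pq] by (simp add: com_def e_def)
    also have "\<dots> = (\<Sum>u\<in>?G. \<Sum>t\<in>?G. of_bool (t = s \<otimes>\<^bsub>\<Gamma>\<^esub> inv\<^bsub>\<Gamma>\<^esub> u) * (\<iota> t p * \<iota> u q))"
    proof (subst sum.swap, intro sum.cong refl)
      fix u t assume "u \<in> ?G" "t \<in> ?G"
      then have "t \<otimes>\<^bsub>\<Gamma>\<^esub> u = s \<longleftrightarrow> t = s \<otimes>\<^bsub>\<Gamma>\<^esub> inv\<^bsub>\<Gamma>\<^esub> u" using s by (auto simp: \<Gamma>.m_assoc)
      then show "of_bool (t \<otimes>\<^bsub>\<Gamma>\<^esub> u = s) * (\<iota> t p * \<iota> u q) = of_bool (t = s \<otimes>\<^bsub>\<Gamma>\<^esub> inv\<^bsub>\<Gamma>\<^esub> u) * (\<iota> t p * \<iota> u q)"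
        by simp
    qed
    also have "\<dots> = (\<Sum>u\<in>?G. e (s \<otimes>\<^bsub>\<Gamma>\<^esub> inv\<^bsub>\<Gamma>\<^esub> u) p * e u q)"
      using s pq finite_\<Gamma> by (intro sum.cong refl) (simp add: sum_of_bool_eq e_def)
    finally show "com (e s) p q = (\<Sum>u\<in>?G. e (s \<otimes>\<^bsub>\<Gamma>\<^esub> inv\<^bsub>\<Gamma>\<^esub> u) p * e u q)" .
  next
    fix i j z assume ij: "i \<in> ?I" "j \<in> ?I" and z: "z \<in> ?F"
    have "(\<Sum>p\<in>?I. mlt A i j p * \<pi> p z) = (\<Sum>x\<in>?F. \<Sum>y\<in>?F. of_bool (z = x \<otimes>\<^bsub>F\<^esub> y) * (\<pi> i x * \<pi> j y))"
      unfolding \<pi>_mult[OF ij z] by (simp add: mult.commute)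
    also have "\<dots> = (\<Sum>x\<in>?F. \<Sum>y\<in>?F. of_bool (y = inv\<^bsub>F\<^esub> x \<otimes>\<^bsub>F\<^esub> z) * (\<pi> i x * \<pi> j y))"
    proof (intro sum.cong refl)
      fix x y assume "x \<in> ?F" "y \<in> ?F"
      then have "z = x \<otimes>\<^bsub>F\<^esub> y \<longleftrightarrow> y = inv\<^bsub>F\<^esub> x \<otimes>\<^bsub>F\<^esub> z" using z by (auto simp flip: F.m_assoc)
      then show "of_bool (z = x \<otimes>\<^bsub>F\<^esub> y) * (\<pi> i x * \<pi> j y) = of_bool (y = inv\<^bsub>F\<^esub> x \<otimes>\<^bsub>F\<^esub> z) * (\<pi> i x * \<pi> j y)"
        by simp
    qed
    finally show "(\<Sum>p\<in>?I. mlt A i j p * \<pi> p z) = (\<Sum>x\<in>?F. \<pi> i x * \<pi> j (inv\<^bsub>F\<^esub> x \<otimes>\<^bsub>F\<^esub> z))"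
      using z finite_F by (simp add: sum_of_bool_eq)
  next
    fix i x y assume i: "i \<in> ?I" and xy: "x \<in> ?F" "y \<in> ?F"
    have "(\<Sum>j\<in>?I. \<Sum>l\<in>?I. cml A i j l * (\<pi> j x * \<pi> l y)) = (\<Sum>p\<in>?F. \<pi> i p * of_bool (x = p \<and> y = p))"
      by (rule \<pi>_com[OF i xy])
    also have "\<dots> = (\<Sum>p\<in>?F. of_bool (p = x) * (of_bool (x = y) * \<pi> i p))"
      by (intro sum.cong refl) auto
    also have "\<dots> = of_bool (x = y) * \<pi> i x" by (simp only: sum_of_bool_eq(1)[OF finite_F] xy if_True)
    finally show "(\<Sum>j\<in>?I. \<Sum>l\<in>?I. cml A i j l * (\<pi> j x * \<pi> l y)) = of_bool (x = y) * \<pi> i x" .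
  next
    fix i assume "i \<in> ?I"
    from \<pi>_eps[OF this] show "(\<Sum>x\<in>?F. \<pi> i x) = cou A i" by simp
  next
    fix x assume "x \<in> ?F"
    have "(bvec ?F x :: 'f \<Rightarrow> 'k) \<in> lmap ?I ?F \<pi> ` vecs ?I" unfolding surj by simp
    then obtain v where v: "lmap ?I ?F \<pi> v = bvec ?F x" by force
    have "(\<Sum>i\<in>?I. v i * \<pi> i y) = of_bool (y = x)" if "y \<in> ?F" for y
      using that fun_cong[OF v, of y] by (simp add: lmap_def bvec_def)
    then show "\<exists>a. \<forall>y\<in>?F. (\<Sum>i\<in>?I. a i * \<pi> i y) = of_bool (y = x)" by blast
  next
    fix a assume a: "supported a"
      and d: "\<And>p y. p \<in> ?I \<Longrightarrow> y \<in> ?F \<Longrightarrow> (\<Sum>q\<in>?I. com a p q * \<pi> q y) = of_bool (y = \<one>\<^bsub>F\<^esub>) * a p"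
    have "restrict a ?I \<in> lmap ?G ?I \<iota> ` vecs ?G" unfolding coinv using d by (simp add: right_degree_iff)
    then obtain f where f: "restrict a ?I = lmap ?G ?I \<iota> f" by blast
    have "a = (\<lambda>i. \<Sum>s\<in>?G. f s * e s i)"
    proof (rule supported_eqI[OF a])
      fix i assume "i \<in> ?I"
      then show "a i = (\<Sum>s\<in>?G. f s * e s i)" using fun_cong[OF f, of i] by (simp add: lmap_def e_def)
    qed (simp add: supported_def e_def)
    then show "\<exists>f. a = (\<lambda>i. \<Sum>s\<in>?G. f s * e s i)" by blast
  next
    fix s x a
    assume s: "s \<in> ?G" "x \<in> ?F" and a: "supported a"
      and d: "\<And>p y. p \<in> ?I \<Longrightarrow> y \<in> ?F \<Longrightarrow> (\<Sum>q\<in>?I. com a p q * \<pi> q y) = of_bool (y = x) * a p"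
    have r: "restrict a ?I \<in> right_degree A (grp_hopf F) \<pi> (bvec ?F x)" using d s by (simp add: right_degree_iff)
    have *: "vmult A (restrict (e s) ?I) (restrict a ?I) = vmult A (restrict a ?I) (restrict (e (ract s x)) ?I)"
      "vmult A (restrict (e s) ?I) (restrict a ?I) \<in> left_degree A (grp_hopf F) \<pi> (bvec ?F (lact s x))"
      using aff[unfolded affords_actions_def Let_def, rule_format, OF s(2) r s(1)]
      unfolding re[OF s(1)] re[OF ract_closed[OF s]] by blast+
    show "e s \<star> a = a \<star> e (ract s x)"
      by (rule restrict_supported_eq[OF supported_mulv supported_mulv *(1)[unfolded vmult_restrict]])
    fix q y assume "q \<in> ?I" "y \<in> ?F"
    then show "(\<Sum>p\<in>?I. com (e s \<star> a) p q * \<pi> p y) = of_bool (y = lact s x) * (e s \<star> a) q"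
      using *(2) s unfolding vmult_restrict by (simp add: left_degree_iff)
  qed
qed

section \<open>Matrices as elements of one ring\<close>

text \<open>
  The matrices of a given size do not form a type, but the results above need a type of class \<open>ring_1\<close>. The
  endomorphisms of the space of sequences contain the matrices of every positive size: cut a sequence into blocks
  of length \<open>n\<close> and apply an \<open>n \<times> n\<close> matrix to each block. Unlike an embedding as a corner this
  preserves the unit.
\<close>

definition seq_linear :: "((nat \<Rightarrow> 'k::field) \<Rightarrow> nat \<Rightarrow> 'k) \<Rightarrow> bool" where
  "seq_linear f \<longleftrightarrow> (\<forall>c u v. f (\<lambda>i. c * u i + v i) = (\<lambda>i. c * f u i + f v i))"

typedef (overloaded) 'k endo = "{f :: (nat \<Rightarrow> 'k::field) \<Rightarrow> nat \<Rightarrow> 'k. seq_linear f}"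
  morphisms app Endo
  by (rule exI[of _ "\<lambda>u. u"]) (simp add: seq_linear_def)

lemma app_linear: "app f (\<lambda>i. c * u i + v i) = (\<lambda>i. c * app f u i + app f v i)"
  using app[of f] by (simp add: seq_linear_def)

lemma app_add: "app f (\<lambda>i. u i + v i) = (\<lambda>i. app f u i + app f v i)"
  using app_linear[of f 1 u v] by simp

lemma endo_eqI: "(\<And>u i. app f u i = app g u i) \<Longrightarrow> f = g"
  by (metis app_inject ext)

lemma app_Endo: "seq_linear f \<Longrightarrow> app (Endo f) = f"
  by (simp add: Endo_inverse)

instantiation endo :: (field) ring_1
begin

definition "0 = Endo (\<lambda>u i. 0)"
definition "1 = Endo (\<lambda>u. u)"
definition "f + g = Endo (\<lambda>u i. app f u i + app g u i)"
definition "f - g = Endo (\<lambda>u i. app f u i - app g u i)"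
definition "- f = Endo (\<lambda>u i. - app f u i)"
definition "f * g = Endo (\<lambda>u. app f (app g u))"

lemma app_endo [simp]:
  "app 0 u i = (0 :: 'a::field)" "app 1 u i = u i"
  "app (f + g) u i = app f u i + app g u i" "app (f - g) u i = app f u i - app g u i"
  "app (- f) u i = - app f u i" "app (f * g) u i = app f (app g u) i"
proof -
  show "app 0 u i = (0 :: 'a)" unfolding zero_endo_def by (subst app_Endo) (simp_all add: seq_linear_def)
  show "app 1 u i = u i" unfolding one_endo_def by (subst app_Endo) (simp_all add: seq_linear_def)
  show "app (f + g) u i = app f u i + app g u i" unfolding plus_endo_def
    by (subst app_Endo; simp add: seq_linear_def app_linear; simp add: algebra_simps)
  show "app (f - g) u i = app f u i - app g u i" unfolding minus_endo_def
    by (subst app_Endo; simp add: seq_linear_def app_linear; simp add: algebra_simps)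
  show "app (- f) u i = - app f u i" unfolding uminus_endo_def
    by (subst app_Endo; simp add: seq_linear_def app_linear; simp add: algebra_simps)
  show "app (f * g) u i = app f (app g u) i" unfolding times_endo_def
    by (subst app_Endo) (simp_all add: seq_linear_def app_linear)
qed

instance
proof
  fix f g h :: "'a endo"
  show "f * g * h = f * (g * h)" "f + g + h = f + (g + h)" "f + g = g + f" "0 + f = f" "- f + f = 0"
    "f - g = f + - g" "1 * f = f" "f * 1 = f" "(f + g) * h = f * h + g * h"
    by (rule endo_eqI, simp add: app_endo[abs_def])+
  show "f * (g + h) = f * g + f * h"
  proof (rule endo_eqI)
    fix u i
    have "app (g + h) u = (\<lambda>i. app g u i + app h u i)" by (rule ext) simp
    then show "app (f * (g + h)) u i = app (f * g + f * h) u i" by (simp add: app_add)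
  qed
  have "app (0 :: 'a endo) (\<lambda>_. 1) 0 \<noteq> app (1 :: 'a endo) (\<lambda>_. 1) 0" by simp
  then show "(0 :: 'a endo) \<noteq> 1" by metis
qed

end

definition endo_scale :: "'k::field \<Rightarrow> 'k endo \<Rightarrow> 'k endo" where
  "endo_scale c f = Endo (\<lambda>u i. c * app f u i)"

lemma app_endo_scale [simp]: "app (endo_scale c f) u i = c * app f u i"
  unfolding endo_scale_def by (subst app_Endo; simp add: seq_linear_def app_linear; simp add: algebra_simps)

lemma app_sum [simp]: "app (\<Sum>k\<in>B. f k) u i = (\<Sum>k\<in>B. app (f k) u i)"
  by (induction B rule: infinite_finite_induct) simp_all

interpretation endo: scalar_algebra endo_scale
proof
  fix a b :: 'a and f g :: "'a endo"
  show "endo_scale (a + b) f = endo_scale a f + endo_scale b f" "endo_scale a (f + g) = endo_scale a f + endo_scale a g"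
    "endo_scale a (endo_scale b f) = endo_scale (a * b) f" "endo_scale 1 f = f" "endo_scale a f * g = endo_scale a (f * g)"
    by (rule endo_eqI, simp add: algebra_simps)+
  show "f * endo_scale a g = endo_scale a (f * g)"
  proof (rule endo_eqI)
    fix u i
    have "app (endo_scale a g) u = (\<lambda>i. a * app g u i + 0)" by (rule ext) simp
    then have "app f (app (endo_scale a g) u) i = a * app f (app g u) i + app f (\<lambda>i. 0) i"
      by (simp only: app_linear)
    moreover have "app f (\<lambda>i. 0) = (\<lambda>_. 0)" using app_linear[of f "-1" "\<lambda>_. 0" "\<lambda>_. 0"] by simp
    ultimately show "app (f * endo_scale a g) u i = app (endo_scale a (f * g)) u i" by simp
  qed
qed

text \<open>
  Position \<open>i\<close> of a sequence is position \<open>i mod n\<close> of block \<open>i div n\<close>.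
\<close>

definition endo_of_mat :: "'k::field mat \<Rightarrow> 'k endo" where
  "endo_of_mat M = (let n = dim_row M in
    Endo (\<lambda>u i. \<Sum>k<n. M $$ (i mod n, k) * u (k + n * (i div n))))"

lemma app_endo_of_mat:
  assumes "M \<in> carrier_mat n n"
  shows "app (endo_of_mat M) u i = (\<Sum>k<n. M $$ (i mod n, k) * u (k + n * (i div n)))"
  using assms unfolding endo_of_mat_def Let_def
  by (subst app_Endo) (auto simp: seq_linear_def sum_distrib_left sum.distrib algebra_simps)

lemma mult_mat_index:
  assumes "M \<in> carrier_mat l m" "N \<in> carrier_mat m n" "i < l" "j < n"
  shows "(M * N) $$ (i, j) = (\<Sum>k<m. M $$ (i, k) * N $$ (k, j))"
  using assms by (simp add: scalar_prod_def lessThan_atLeast0)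

lemma endo_of_mat_mult:
  assumes "M \<in> carrier_mat n n" "N \<in> carrier_mat n n" "n > 0"
  shows "endo_of_mat (M * N) = endo_of_mat M * endo_of_mat N"
proof (rule endo_eqI)
  fix u i
  have "app (endo_of_mat (M * N)) u i = (\<Sum>k<n. \<Sum>l<n. M $$ (i mod n, l) * (N $$ (l, k) * u (k + n * (i div n))))"
    using assms by (simp add: app_endo_of_mat[of _ n] mult_mat_index[of _ n n _ n] sum_distrib_right mult.assoc del: index_mult_mat(1))
  also have "\<dots> = (\<Sum>l<n. \<Sum>k<n. M $$ (i mod n, l) * (N $$ (l, k) * u (k + n * (i div n))))"
    by (rule sum.swap)
  also have "\<dots> = app (endo_of_mat M * endo_of_mat N) u i"
    using assms by (simp add: app_endo_of_mat[of _ n] sum_distrib_left)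
  finally show "app (endo_of_mat (M * N)) u i = app (endo_of_mat M * endo_of_mat N) u i" .
qed

lemma endo_of_mat_one:
  assumes "n > 0"
  shows "endo_of_mat (1\<^sub>m n) = 1"
proof (rule endo_eqI)
  fix u i
  have "app (endo_of_mat (1\<^sub>m n)) u i = (\<Sum>k<n. if k = i mod n then u (k + n * (i div n)) else 0)"
    by (subst app_endo_of_mat[of _ n]) (use assms in \<open>auto simp del: sum.delta sum.delta' intro!: sum.cong\<close>)
  also have "\<dots> = u i" using assms by simp
  finally show "app (endo_of_mat (1\<^sub>m n)) u i = app 1 u i" by simp
qed

lemma endo_of_mat_inj:
  assumes "M \<in> carrier_mat n n" "N \<in> carrier_mat n n" "endo_of_mat M = endo_of_mat N"
  shows "M = N"
proof (rule eq_matI)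
  fix i j assume "i < dim_row N" "j < dim_col N"
  then have ij: "i < n" "j < n" using assms by auto
  have "app (endo_of_mat M) (\<lambda>k. if k = j then 1 else 0) i = M $$ (i, j)" if "M \<in> carrier_mat n n" for M :: "'a mat"
    using ij by (simp add: app_endo_of_mat[OF that] if_distrib cong: if_cong)
  from this[OF assms(1)] this[OF assms(2)] assms(3) show "M $$ (i, j) = N $$ (i, j)" by simp
qed (use assms in auto)

lemma endo_of_mat_sum:
  assumes "n > 0"
  shows "endo_of_mat (mat_sum n B c M) = (\<Sum>k\<in>B. endo_scale (c k) (endo_of_mat (mat n n (\<lambda>ij. M k $$ ij))))"
proof (rule endo_eqI)
  fix u i
  have "app (endo_of_mat (mat_sum n B c M)) u i = (\<Sum>l<n. \<Sum>k\<in>B. c k * (M k $$ (i mod n, l) * u (l + n * (i div n))))"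
    using assms by (subst app_endo_of_mat[of _ n]) (auto simp: mat_sum_def sum_distrib_right mult.assoc)
  also have "\<dots> = (\<Sum>k\<in>B. \<Sum>l<n. c k * (M k $$ (i mod n, l) * u (l + n * (i div n))))" by (rule sum.swap)
  also have "\<dots> = app (\<Sum>k\<in>B. endo_scale (c k) (endo_of_mat (mat n n (\<lambda>ij. M k $$ ij)))) u i"
    using assms by (simp add: app_endo_of_mat[of _ n] sum_distrib_left)
  finally show "app (endo_of_mat (mat_sum n B c M)) u i
    = app (\<Sum>k\<in>B. endo_scale (c k) (endo_of_mat (mat n n (\<lambda>ij. M k $$ ij)))) u i" .
qed

lemma mat_self: "M \<in> carrier_mat n m \<Longrightarrow> mat n m (\<lambda>ij. M $$ ij) = M"
  by (intro eq_matI) auto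

section \<open>Kronecker products\<close>

text \<open>
  The indices of a Kronecker product are written as \<open>i * n + j\<close> with \<open>j < n\<close>, so that its entries and the sums over
  its indices split.
\<close>

lemma sum_lessThan_mult: "(\<Sum>k<m * n. f k) = (\<Sum>i<m. \<Sum>j<n. f (i * n + j))" for f :: "nat \<Rightarrow> 'a::comm_monoid_add"
proof -
  have "(\<Sum>k<m * n. f k) = (\<Sum>i<m. sum f {i * n..<i * n + n})" by (rule sum.nat_group[symmetric])
  also have "\<dots> = (\<Sum>i<m. \<Sum>j<n. f (i * n + j))"
  proof (rule sum.cong[OF refl])
    fix i
    show "sum f {i * n..<i * n + n} = (\<Sum>j<n. f (i * n + j))"
      using sum.shift_bounds_nat_ivl[of f 0 "i * n" n] by (simp add: lessThan_atLeast0 add.commute)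
  qed
  finally show ?thesis .
qed

lemma pair_index_less: "i < m \<Longrightarrow> j < n \<Longrightarrow> i * n + j < m * (n::nat)"
  using mult_le_mono1[of "Suc i" m n] by simp

lemma kron_carrier: "M \<in> carrier_mat a b \<Longrightarrow> N \<in> carrier_mat c d \<Longrightarrow> kron M N \<in> carrier_mat (a * c) (b * d)"
  by (auto simp: kron_def)

lemma kron_index:
  assumes "M \<in> carrier_mat a b" "N \<in> carrier_mat c d" "i < a" "p < c" "j < b" "q < d"
  shows "kron M N $$ (i * c + p, j * d + q) = M $$ (i, j) * N $$ (p, q)"
  using assms pair_index_less[of i a p c] pair_index_less[of j b q d] by (simp add: kron_def)

lemma pair_index_cases:
  assumes "r < m * (n::nat)"
  obtains i j where "i < m" "j < n" "r = i * n + j"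
proof
  have "n > 0" using assms by (cases n) auto
  then show "r div n < m" "r mod n < n" "r = r div n * n + r mod n"
    using assms by (simp_all add: less_mult_imp_div_less)
qed

lemma pair_eq_matI:
  assumes "M \<in> carrier_mat (a * b) (c * d)" "N \<in> carrier_mat (a * b) (c * d)"
    and "\<And>i p j q. i < a \<Longrightarrow> p < b \<Longrightarrow> j < c \<Longrightarrow> q < d \<Longrightarrow> M $$ (i * b + p, j * d + q) = N $$ (i * b + p, j * d + q)"
  shows "M = N"
proof (rule eq_matI)
  fix r s assume "r < dim_row N" "s < dim_col N"
  then have "r < a * b" "s < c * d" using assms by auto
  then obtain i p j q where "i < a" "p < b" "r = i * b + p" "j < c" "q < d" "s = j * d + q"
    by (metis pair_index_cases)
  then show "M $$ (r, s) = N $$ (r, s)" using assms(3) by simp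
qed (use assms in auto)

lemma kron_mult:
  assumes "M \<in> carrier_mat a a" "M' \<in> carrier_mat a a" "N \<in> carrier_mat b b" "N' \<in> carrier_mat b b"
  shows "kron M N * kron M' N' = kron (M * M') (N * N')"
proof (rule pair_eq_matI[of _ a b a b])
  fix i p j q assume *: "i < a" "p < b" "j < a" "q < b"
  have "(kron M N * kron M' N') $$ (i * b + p, j * b + q)
      = (\<Sum>k<a. \<Sum>l<b. kron M N $$ (i * b + p, k * b + l) * kron M' N' $$ (k * b + l, j * b + q))"
    using assms kron_carrier * pair_index_less by (subst mult_mat_index[of _ "a * b" "a * b" _ "a * b"]) (auto simp: sum_lessThan_mult)
  also have "\<dots> = (\<Sum>k<a. \<Sum>l<b. (M $$ (i, k) * M' $$ (k, j)) * (N $$ (p, l) * N' $$ (l, q)))"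
    using * by (intro sum.cong refl) (simp add: kron_index[OF assms(1,3)] kron_index[OF assms(2,4)])
  also have "\<dots> = (M * M') $$ (i, j) * (N * N') $$ (p, q)"
    using * by (simp add: mult_mat_index[OF assms(1,2)] mult_mat_index[OF assms(3,4)] sum_product)
  also have "\<dots> = kron (M * M') (N * N') $$ (i * b + p, j * b + q)"
    using * assms by (intro kron_index[symmetric]) auto
  finally show "(kron M N * kron M' N') $$ (i * b + p, j * b + q) = kron (M * M') (N * N') $$ (i * b + p, j * b + q)" .
qed (use assms in \<open>auto intro!: kron_carrier mult_carrier_mat\<close>)

lemma kron_one: "kron (1\<^sub>m a) (1\<^sub>m b) = 1\<^sub>m (a * b)"
proof (rule pair_eq_matI[of _ a b a b])
  fix i p j q assume *: "i < a" "p < b" "j < a" "q < b"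
  have "i * b + p = j * b + q \<longleftrightarrow> i = j \<and> p = q"
    using * by (metis div_mult_self3 div_less add_0_right mod_mult_self3 mod_less less_nat_zero_code)
  then show "kron (1\<^sub>m a) (1\<^sub>m b) $$ (i * b + p, j * b + q) = 1\<^sub>m (a * b) $$ (i * b + p, j * b + q)"
    using * pair_index_less by (subst kron_index[of _ a a _ b b]) auto
qed (auto intro: kron_carrier)

lemma kron_sum:
  "kron (mat_sum a B c M) (1\<^sub>m b) = mat_sum (a * b) B c (\<lambda>k. kron (mat a a (\<lambda>ij. M k $$ ij)) (1\<^sub>m b))"
    (is "?L = ?R")
  "kron (1\<^sub>m b) (mat_sum a B c M) = mat_sum (b * a) B c (\<lambda>k. kron (1\<^sub>m b) (mat a a (\<lambda>ij. M k $$ ij)))"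
    (is "?L' = ?R'")
proof -
  have *: "mat_sum a B c M \<in> carrier_mat a a" "mat a a (\<lambda>ij. M k $$ ij) \<in> carrier_mat a a" for k
    by (simp_all add: mat_sum_def)
  show "?L = ?R"
  proof (rule pair_eq_matI[of _ a b a b])
    fix i p j q assume ij: "i < a" "p < b" "j < a" "q < b"
    show "?L $$ (i * b + p, j * b + q) = ?R $$ (i * b + p, j * b + q)"
      unfolding kron_index[OF *(1) one_carrier_mat ij] using ij pair_index_less
      by (simp add: mat_sum_def kron_index[OF *(2) one_carrier_mat])
  qed (auto intro: kron_carrier * simp: mat_sum_def)
  show "?L' = ?R'"
  proof (rule pair_eq_matI[of _ b a b a])
    fix i p j q assume ij: "i < b" "p < a" "j < b" "q < a"
    show "?L' $$ (i * a + p, j * a + q) = ?R' $$ (i * a + p, j * a + q)"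
      unfolding kron_index[OF one_carrier_mat *(1) ij] using ij pair_index_less
      by (simp add: mat_sum_def kron_index[OF one_carrier_mat *(2)])
  qed (auto intro: kron_carrier * simp: mat_sum_def)
qed

section \<open>Half-braidings\<close>

lemma mult_kron_one_left:
  assumes "M \<in> carrier_mat l (a * b)" "N \<in> carrier_mat b c" "i < l" "j < a" "q < c"
  shows "(M * kron (1\<^sub>m a) N) $$ (i, j * c + q) = (\<Sum>p<b. M $$ (i, j * b + p) * N $$ (p, q))"
proof -
  have "(M * kron (1\<^sub>m a) N) $$ (i, j * c + q)
      = (\<Sum>k<a. \<Sum>p<b. M $$ (i, k * b + p) * kron (1\<^sub>m a) N $$ (k * b + p, j * c + q))"
    using assms pair_index_less kron_carrier[OF one_carrier_mat assms(2)]
    by (subst mult_mat_index[of _ l "a * b" _ "a * c"]) (auto simp: sum_lessThan_mult)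
  also have "\<dots> = (\<Sum>k<a. of_bool (k = j) * (\<Sum>p<b. M $$ (i, k * b + p) * N $$ (p, q)))"
    unfolding sum_distrib_left using assms
    by (intro sum.cong refl) (simp add: kron_index[OF one_carrier_mat assms(2)])
  finally show ?thesis by (simp only: sum_of_bool_eq(1)[OF finite_lessThan] lessThan_iff assms if_True)
qed

lemma kron_one_right_mult:
  assumes "M \<in> carrier_mat a b" "N \<in> carrier_mat (b * d) l" "i < a" "p < d" "j < l"
  shows "(kron M (1\<^sub>m d) * N) $$ (i * d + p, j) = (\<Sum>k<b. M $$ (i, k) * N $$ (k * d + p, j))"
proof -
  have "(kron M (1\<^sub>m d) * N) $$ (i * d + p, j)
      = (\<Sum>k<b. \<Sum>q<d. kron M (1\<^sub>m d) $$ (i * d + p, k * d + q) * N $$ (k * d + q, j))"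
    using assms pair_index_less kron_carrier[OF assms(1) one_carrier_mat]
    by (subst mult_mat_index[of _ "a * d" "b * d" _ l]) (auto simp: sum_lessThan_mult)
  also have "\<dots> = (\<Sum>k<b. \<Sum>q<d. of_bool (q = p) * (M $$ (i, k) * N $$ (k * d + q, j)))"
    using assms by (intro sum.cong refl) (simp add: kron_index[OF assms(1) one_carrier_mat])
  finally show ?thesis by (simp only: sum_of_bool_eq(1)[OF finite_lessThan] lessThan_iff assms if_True)
qed

lemma kron_one_left_mult:
  assumes "M \<in> carrier_mat b c" "N \<in> carrier_mat (a * c) l" "i < a" "p < b" "j < l"
  shows "(kron (1\<^sub>m a) M * N) $$ (i * b + p, j) = (\<Sum>k<c. M $$ (p, k) * N $$ (i * c + k, j))"
proof -
  have "(kron (1\<^sub>m a) M * N) $$ (i * b + p, j)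
      = (\<Sum>q<a. \<Sum>k<c. kron (1\<^sub>m a) M $$ (i * b + p, q * c + k) * N $$ (q * c + k, j))"
    using assms pair_index_less kron_carrier[OF one_carrier_mat assms(1)]
    by (subst mult_mat_index[of _ "a * b" "a * c" _ l]) (auto simp: sum_lessThan_mult)
  also have "\<dots> = (\<Sum>q<a. of_bool (q = i) * (\<Sum>k<c. M $$ (p, k) * N $$ (q * c + k, j)))"
    unfolding sum_distrib_left using assms
    by (intro sum.cong refl) (simp add: kron_index[OF one_carrier_mat assms(1)])
  finally show ?thesis by (simp only: sum_of_bool_eq(1)[OF finite_lessThan] lessThan_iff assms if_True)
qed

lemma Rep_simps:
  "Obj (Rep A) = rep_objects A" "Comp (Rep A) = (*)" "TensM (Rep A) = kron"
  "Ident (Rep A) (d, \<rho>) = 1\<^sub>m d"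
  "Hom (Rep A) (d, \<rho>) (d', \<rho>') = {T \<in> carrier_mat d' d. \<forall>i\<in>basis A. T * \<rho> i = \<rho>' i * T}"
  "TensO (Rep A) (d, \<rho>) (d', \<rho>') = (d * d',
    \<lambda>i\<in>basis A. mat_sum (d * d') (basis A \<times> basis A) (\<lambda>(p, q). cml A i p q) (\<lambda>(p, q). kron (\<rho> p) (\<rho>' q)))"
  "UnitO (Rep A) = (1, \<lambda>i\<in>basis A. mat 1 1 (\<lambda>_. cou A i))"
  by (simp_all add: Rep_def)

lemma rep_objectsD:
  assumes "(d, \<rho>) \<in> rep_objects A"
  shows "i \<in> basis A \<Longrightarrow> \<rho> i \<in> carrier_mat d d"
    and "i \<in> basis A \<Longrightarrow> j \<in> basis A \<Longrightarrow> \<rho> i * \<rho> j = mat_sum d (basis A) (mlt A i j) \<rho>"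
    and "mat_sum d (basis A) (unt A) \<rho> = 1\<^sub>m d"
  using assms by (auto simp: rep_objects_def)

lemma mat_sum_carrier [simp]: "mat_sum d B c M \<in> carrier_mat d d"
  by (simp add: mat_sum_def)

lemma mat_sum_index: "i < d \<Longrightarrow> j < d \<Longrightarrow> mat_sum d B c M $$ (i, j) = (\<Sum>k\<in>B. c k * M k $$ (i, j))"
  by (simp add: mat_sum_def)

context bialgebra
begin

text \<open>
  A numbering of the basis, by which the regular module becomes one of the spaces \<open>k\<^sup>n\<close>.
\<close>

definition idx :: "nat \<Rightarrow> 'i" where
  "idx = (SOME h. bij_betw h {..<card (basis A)} (basis A))"

lemma idx_bij: "bij_betw idx {..<card (basis A)} (basis A)"
proof -
  have "\<exists>h. bij_betw h {..<card (basis A)} (basis A)"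
    using ex_bij_betw_nat_finite[OF finite_basis] by (simp add: lessThan_atLeast0)
  then show ?thesis unfolding idx_def by (rule someI_ex)
qed

lemma idx_in [simp]: "m < card (basis A) \<Longrightarrow> idx m \<in> basis A"
  using idx_bij by (auto simp: bij_betw_def)

lemma idx_eq: "m < card (basis A) \<Longrightarrow> l < card (basis A) \<Longrightarrow> idx m = idx l \<longleftrightarrow> m = l"
  using idx_bij by (auto simp: bij_betw_def inj_on_def)

lemma idx_surj: "i \<in> basis A \<Longrightarrow> \<exists>m<card (basis A). i = idx m"
  using idx_bij by (auto simp: bij_betw_def)

lemma sum_idx: "(\<Sum>m<card (basis A). f (idx m)) = sum f (basis A)" for f :: "'i \<Rightarrow> 'z::comm_monoid_add"
  by (rule sum.reindex_bij_betw[OF idx_bij])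

definition reg :: "'i \<Rightarrow> 'k mat" where
  "reg i = mat (card (basis A)) (card (basis A)) (\<lambda>(r, c). mlt A i (idx c) (idx r))"

lemma reg_carrier [simp]: "reg i \<in> carrier_mat (card (basis A)) (card (basis A))"
  by (simp add: reg_def)

lemma reg_index [simp]: "r < card (basis A) \<Longrightarrow> c < card (basis A) \<Longrightarrow> reg i $$ (r, c) = mlt A i (idx c) (idx r)"
  by (simp add: reg_def)

text \<open>
  Applying the action of \<open>b\<^sub>i\<close> on the regular module to the vector 1 gives \<open>b\<^sub>i\<close>.
\<close>

lemma reg_unit:
  assumes "i \<in> basis A" "r < card (basis A)"
  shows "(\<Sum>k<card (basis A). reg i $$ (r, k) * unt A (idx k)) = of_bool (i = idx r)"
proof -
  have "(\<Sum>k<card (basis A). reg i $$ (r, k) * unt A (idx k)) = (\<Sum>k<card (basis A). unt A (idx k) * mlt A i (idx k) (idx r))"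
    using assms by (simp add: mult.commute)
  also have "\<dots> = (\<Sum>j\<in>basis A. unt A j * mlt A i j (idx r))" by (rule sum_idx)
  finally show ?thesis using unit_right[OF assms(1), of "idx r"] assms(2) by simp
qed

lemma reg_object: "(card (basis A), restrict reg (basis A)) \<in> rep_objects A"
proof -
  let ?n = "card (basis A)"
  have "reg i * reg j = mat_sum ?n (basis A) (mlt A i j) (restrict reg (basis A))"
    if ij: "i \<in> basis A" "j \<in> basis A" for i j
  proof (rule eq_matI)
    fix r c assume "r < dim_row (mat_sum ?n (basis A) (mlt A i j) (restrict reg (basis A)))"
      "c < dim_col (mat_sum ?n (basis A) (mlt A i j) (restrict reg (basis A)))"
    then have rc: "r < ?n" "c < ?n" by (auto simp: mat_sum_def)
    have "(reg i * reg j) $$ (r, c) = (\<Sum>k<?n. mlt A j (idx c) (idx k) * mlt A i (idx k) (idx r))"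
      using rc by (subst mult_mat_index[OF reg_carrier reg_carrier]) (auto simp: mult.commute)
    also have "\<dots> = (\<Sum>l\<in>basis A. mlt A j (idx c) l * mlt A i l (idx r))" by (rule sum_idx)
    also have "\<dots> = (\<Sum>l\<in>basis A. mlt A i j l * mlt A l (idx c) (idx r))" using assoc[of i j "idx c" "idx r"] ij rc by simp
    finally show "(reg i * reg j) $$ (r, c) = mat_sum ?n (basis A) (mlt A i j) (restrict reg (basis A)) $$ (r, c)"
      using rc by (simp add: mat_sum_index)
  qed (auto simp: mat_sum_def reg_def)
  moreover have "mat_sum ?n (basis A) (unt A) (restrict reg (basis A)) = 1\<^sub>m ?n"
  proof (rule eq_matI)
    fix r c assume "r < dim_row (1\<^sub>m ?n :: 'k mat)" "c < dim_col (1\<^sub>m ?n :: 'k mat)"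
    then have rc: "r < ?n" "c < ?n" by auto
    then show "mat_sum ?n (basis A) (unt A) (restrict reg (basis A)) $$ (r, c) = 1\<^sub>m ?n $$ (r, c)"
      using unit_left[of "idx c" "idx r"] by (auto simp: mat_sum_index idx_eq)
  qed (auto simp: mat_sum_def)
  ultimately show ?thesis by (auto simp: rep_objects_def)
qed

lemma unit_object: "UnitO (Rep A) \<in> rep_objects A"
proof -
  have "mat 1 1 (\<lambda>_. cou A i) * mat 1 1 (\<lambda>_. cou A j) = mat_sum 1 (basis A) (mlt A i j) (\<lambda>i\<in>basis A. mat 1 1 (\<lambda>_. cou A i))"
    if "i \<in> basis A" "j \<in> basis A" for i j
    using counit_mult[OF that] by (intro eq_matI) (auto simp: mat_sum_def scalar_prod_def)
  moreover have "mat_sum 1 (basis A) (unt A) (\<lambda>i\<in>basis A. mat 1 1 (\<lambda>_. cou A i)) = 1\<^sub>m 1"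
    using counit_unit by (intro eq_matI) (auto simp: mat_sum_def)
  ultimately show ?thesis by (auto simp: rep_objects_def Rep_simps)
qed

lemma tensor_object:
  assumes "X \<in> rep_objects A" "Y \<in> rep_objects A"
  shows "TensO (Rep A) X Y \<in> rep_objects A"
proof -
  let ?I = "basis A"
  obtain d \<rho> d' \<rho>' where XY: "X = (d, \<rho>)" "Y = (d', \<rho>')" by (metis surj_pair)
  note X = rep_objectsD[OF assms(1)[unfolded XY(1)]] and Y = rep_objectsD[OF assms(2)[unfolded XY(2)]]
  define D where "D i = mat_sum (d * d') (?I \<times> ?I) (\<lambda>(p, q). cml A i p q) (\<lambda>(p, q). kron (\<rho> p) (\<rho>' q))" for i
  have Di: "D i $$ (x * d' + y, z * d' + w) = (\<Sum>p\<in>?I. \<Sum>q\<in>?I. cml A i p q * (\<rho> p $$ (x, z) * \<rho>' q $$ (y, w)))"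
    if "x < d" "z < d" "y < d'" "w < d'" for i x y z w
    using that pair_index_less X(1) Y(1)
    unfolding D_def sum.cartesian_product
    by (subst mat_sum_index) (auto intro!: sum.cong simp: kron_index[of _ d d _ d' d'])
  have Dc: "D i \<in> carrier_mat (d * d') (d * d')" for i by (simp add: D_def)
  have "D i * D j = mat_sum (d * d') ?I (mlt A i j) D" if ij: "i \<in> ?I" "j \<in> ?I" for i j
  proof (rule pair_eq_matI[of _ d d' d d'])
    fix x y z w assume *: "x < d" "y < d'" "z < d" "w < d'"
    have \<rho>: "(\<Sum>u<d. \<rho> p $$ (x, u) * \<rho> r $$ (u, z)) = (\<Sum>g\<in>?I. mlt A p r g * \<rho> g $$ (x, z))" if "p \<in> ?I" "r \<in> ?I" for p r
      using X(2)[OF that] mult_mat_index[OF X(1)[OF that(1)] X(1)[OF that(2)] *(1,3)] * by (simp add: mat_sum_index)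
    have \<rho>': "(\<Sum>v<d'. \<rho>' p $$ (y, v) * \<rho>' r $$ (v, w)) = (\<Sum>g\<in>?I. mlt A p r g * \<rho>' g $$ (y, w))" if "p \<in> ?I" "r \<in> ?I" for p r
      using Y(2)[OF that] mult_mat_index[OF Y(1)[OF that(1)] Y(1)[OF that(2)] *(2,4)] * by (simp add: mat_sum_index)
    have "(D i * D j) $$ (x * d' + y, z * d' + w)
        = (\<Sum>u<d. \<Sum>v<d'. D i $$ (x * d' + y, u * d' + v) * D j $$ (u * d' + v, z * d' + w))"
      using * pair_index_less by (subst mult_mat_index[OF Dc Dc]) (auto simp: sum_lessThan_mult)
    also have "\<dots> = (\<Sum>u<d. \<Sum>v<d'. \<Sum>p\<in>?I. \<Sum>q\<in>?I. \<Sum>r\<in>?I. \<Sum>s\<in>?I. (cml A i p q * cml A j r s) *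
        ((\<rho> p $$ (x, u) * \<rho> r $$ (u, z)) * (\<rho>' q $$ (y, v) * \<rho>' s $$ (v, w))))"
      using * by (intro sum.cong refl) (simp only: Di lessThan_iff sum_distrib_right, simp add: sum_distrib_left ac_simps)
    also have "\<dots> = (\<Sum>u<d. \<Sum>p\<in>?I. \<Sum>q\<in>?I. \<Sum>r\<in>?I. \<Sum>s\<in>?I. \<Sum>v<d'. (cml A i p q * cml A j r s) *
        ((\<rho> p $$ (x, u) * \<rho> r $$ (u, z)) * (\<rho>' q $$ (y, v) * \<rho>' s $$ (v, w))))"
      by (rule sum.cong[OF refl], rule sum_move_in5)
    also have "\<dots> = (\<Sum>p\<in>?I. \<Sum>q\<in>?I. \<Sum>r\<in>?I. \<Sum>s\<in>?I. \<Sum>u<d. \<Sum>v<d'. (cml A i p q * cml A j r s) *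
        ((\<rho> p $$ (x, u) * \<rho> r $$ (u, z)) * (\<rho>' q $$ (y, v) * \<rho>' s $$ (v, w))))"
      by (rule sum_move_in5)
    also have "\<dots> = (\<Sum>p\<in>?I. \<Sum>q\<in>?I. \<Sum>r\<in>?I. \<Sum>s\<in>?I. \<Sum>g\<in>?I. \<Sum>h\<in>?I. (cml A i p q * cml A j r s * mlt A p r g * mlt A q s h) *
        (\<rho> g $$ (x, z) * \<rho>' h $$ (y, w)))"
    proof (intro sum.cong refl)
      fix p q r s assume "p \<in> ?I" "q \<in> ?I" "r \<in> ?I" "s \<in> ?I"
      then have "(\<Sum>u<d. \<Sum>v<d'. (\<rho> p $$ (x, u) * \<rho> r $$ (u, z)) * (\<rho>' q $$ (y, v) * \<rho>' s $$ (v, w)))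
          = (\<Sum>g\<in>?I. \<Sum>h\<in>?I. (mlt A p r g * \<rho> g $$ (x, z)) * (mlt A q s h * \<rho>' h $$ (y, w)))"
        by (simp only: \<rho> \<rho>' flip: sum_product)
      from arg_cong[OF this, of "(*) (cml A i p q * cml A j r s)"]
      show "(\<Sum>u<d. \<Sum>v<d'. (cml A i p q * cml A j r s) * ((\<rho> p $$ (x, u) * \<rho> r $$ (u, z)) * (\<rho>' q $$ (y, v) * \<rho>' s $$ (v, w))))
          = (\<Sum>g\<in>?I. \<Sum>h\<in>?I. (cml A i p q * cml A j r s * mlt A p r g * mlt A q s h) * (\<rho> g $$ (x, z) * \<rho>' h $$ (y, w)))"
        unfolding sum_distrib_left by (simp only: ac_simps)
    qed
    also have "\<dots> = (\<Sum>p\<in>?I. \<Sum>q\<in>?I. \<Sum>g\<in>?I. \<Sum>h\<in>?I. \<Sum>r\<in>?I. \<Sum>s\<in>?I. (cml A i p q * cml A j r s * mlt A p r g * mlt A q s h) *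
        (\<rho> g $$ (x, z) * \<rho>' h $$ (y, w)))"
      by (rule sum.cong[OF refl], rule sum.cong[OF refl], rule trans[OF sum.cong[OF refl sum_move_in3] sum_move_in3])
    also have "\<dots> = (\<Sum>g\<in>?I. \<Sum>h\<in>?I. \<Sum>p\<in>?I. \<Sum>q\<in>?I. \<Sum>r\<in>?I. \<Sum>s\<in>?I. (cml A i p q * cml A j r s * mlt A p r g * mlt A q s h) *
        (\<rho> g $$ (x, z) * \<rho>' h $$ (y, w)))"
      by (rule trans[OF sum.cong[OF refl sum_move_in3] sum_move_in3])
    also have "\<dots> = (\<Sum>g\<in>?I. \<Sum>h\<in>?I. (\<Sum>l\<in>?I. mlt A i j l * cml A l g h) * (\<rho> g $$ (x, z) * \<rho>' h $$ (y, w)))"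
      using ij by (intro sum.cong refl) (simp only: comult_mult sum_distrib_right)
    also have "\<dots> = (\<Sum>l\<in>?I. \<Sum>g\<in>?I. \<Sum>h\<in>?I. mlt A i j l * (cml A l g h * (\<rho> g $$ (x, z) * \<rho>' h $$ (y, w))))"
      unfolding sum_distrib_right mult.assoc by (rule sum_move_in3[symmetric])
    also have "\<dots> = mat_sum (d * d') ?I (mlt A i j) D $$ (x * d' + y, z * d' + w)"
      using * pair_index_less by (simp add: mat_sum_index Di sum_distrib_left)
    finally show "(D i * D j) $$ (x * d' + y, z * d' + w) = mat_sum (d * d') ?I (mlt A i j) D $$ (x * d' + y, z * d' + w)" .
  qed (use Dc in \<open>auto intro: mult_carrier_mat\<close>)
  moreover have "mat_sum (d * d') ?I (unt A) D = 1\<^sub>m (d * d')"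
    unfolding kron_one[symmetric]
  proof (rule pair_eq_matI[of _ d d' d d'])
    fix x y z w assume *: "x < d" "y < d'" "z < d" "w < d'"
    have "mat_sum (d * d') ?I (unt A) D $$ (x * d' + y, z * d' + w)
        = (\<Sum>i\<in>?I. \<Sum>p\<in>?I. \<Sum>q\<in>?I. (unt A i * cml A i p q) * (\<rho> p $$ (x, z) * \<rho>' q $$ (y, w)))"
      using * pair_index_less by (simp add: mat_sum_index Di sum_distrib_left mult.assoc)
    also have "\<dots> = (\<Sum>p\<in>?I. \<Sum>q\<in>?I. \<Sum>i\<in>?I. (unt A i * cml A i p q) * (\<rho> p $$ (x, z) * \<rho>' q $$ (y, w)))"
      by (rule sum_move_in3)
    also have "\<dots> = (\<Sum>p\<in>?I. \<Sum>q\<in>?I. (unt A p * \<rho> p $$ (x, z)) * (unt A q * \<rho>' q $$ (y, w)))"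
    proof (intro sum.cong refl)
      fix p q assume "p \<in> ?I" "q \<in> ?I"
      from comult_unit[OF this] show "(\<Sum>i\<in>?I. (unt A i * cml A i p q) * (\<rho> p $$ (x, z) * \<rho>' q $$ (y, w)))
          = (unt A p * \<rho> p $$ (x, z)) * (unt A q * \<rho>' q $$ (y, w))"
        by (simp flip: sum_distrib_right)
    qed
    also have "\<dots> = mat_sum d ?I (unt A) \<rho> $$ (x, z) * mat_sum d' ?I (unt A) \<rho>' $$ (y, w)"
      using * by (simp add: mat_sum_index sum_product)
    finally show "mat_sum (d * d') ?I (unt A) D $$ (x * d' + y, z * d' + w) = kron (1\<^sub>m d) (1\<^sub>m d') $$ (x * d' + y, z * d' + w)"
      using * by (simp only: X(3) Y(3) kron_index[of _ d d _ d' d'] one_carrier_mat)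
  qed (auto intro: kron_carrier)
  moreover have "mat_sum (d * d') ?I f (restrict D ?I) = mat_sum (d * d') ?I f D" for f by (simp add: mat_sum_def cong: sum.cong)
  ultimately show ?thesis
    using Dc unfolding XY Rep_simps by (auto simp: rep_objects_def simp flip: D_def)
qed

text \<open>
  The conditions of \<open>yd_rep\<close> on \<open>T\<close>, for matrices.
\<close>

definition center_data :: "nat \<Rightarrow> ('i \<Rightarrow> 'k mat) \<Rightarrow> ('i \<Rightarrow> 'k mat) \<Rightarrow> bool" where
  "center_data d \<rho> T \<longleftrightarrow> (\<forall>i. T i \<in> carrier_mat d d) \<and>
    (\<forall>p\<in>basis A. \<forall>q\<in>basis A. T q * T p = mat_sum d (basis A) (\<lambda>i. cml A i p q) T) \<and>
    mat_sum d (basis A) (cou A) T = 1\<^sub>m d \<and>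
    (\<forall>i\<in>basis A. \<forall>r\<in>basis A.
      mat_sum d (basis A \<times> basis A) (\<lambda>(j, p). \<Sum>q\<in>basis A. cml A i p q * mlt A j q r) (\<lambda>(j, p). T j * \<rho> p)
      = mat_sum d (basis A \<times> basis A) (\<lambda>(q, j). \<Sum>p\<in>basis A. cml A i p q * mlt A p j r) (\<lambda>(q, j). \<rho> q * T j))"

lemma half_braiding_hom:
  assumes "half_braiding (Rep A) Z c" "X \<in> rep_objects A"
  shows "c X \<in> Hom (Rep A) (TensO (Rep A) Z X) (TensO (Rep A) X Z)"
  using assms unfolding half_braiding_def iso_in_def Rep_simps(1) by blast

lemma half_braiding_natural:
  assumes "half_braiding (Rep A) (d, \<rho>) c" "X \<in> rep_objects A" "Y \<in> rep_objects A" "f \<in> Hom (Rep A) X Y"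
  shows "c Y * kron (1\<^sub>m d) f = kron f (1\<^sub>m d) * c X"
  using assms unfolding half_braiding_def Rep_simps by blast

lemma half_braiding_tensor:
  assumes "half_braiding (Rep A) Z c" "(d, \<rho>) \<in> rep_objects A" "(d', \<rho>') \<in> rep_objects A"
  shows "c (TensO (Rep A) (d, \<rho>) (d', \<rho>')) = kron (1\<^sub>m d) (c (d', \<rho>')) * kron (c (d, \<rho>)) (1\<^sub>m d')"
  using assms unfolding half_braiding_def Rep_simps(1-4) by (metis Rep_simps(4))

lemma half_braiding_unit:
  "half_braiding (Rep A) (d, \<rho>) c \<Longrightarrow> c (UnitO (Rep A)) = 1\<^sub>m d"
  unfolding half_braiding_def Rep_simps(4) by blast

text \<open>
  For a vector \<open>v\<close> of a module \<open>X\<close> there is a module map from the regular module to \<open>X\<close> that sends 1 to \<open>v\<close>.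
  Naturality for this map computes \<open>c\<^sub>X\<close> on \<open>z \<otimes> v\<close> from \<open>c\<close> on \<open>z \<otimes> 1\<close>, and the latter defines the matrices
  \<open>T\<close>. Row \<open>r * d + x\<close> is the basis vector \<open>r\<close> of \<open>X\<close> tensor the basis vector \<open>x\<close> of \<open>Z\<close>, while in columns
  \<open>Z\<close> comes first.
\<close>

lemma half_braiding_formula:
  assumes hb: "half_braiding (Rep A) (d, \<rho>) c" and Z: "(d, \<rho>) \<in> rep_objects A"
  defines "T \<equiv> \<lambda>i. mat d d (\<lambda>(x, y). \<Sum>m<card (basis A).
      c (card (basis A), restrict reg (basis A)) $$ (the_inv_into {..<card (basis A)} idx i * d + x, y * card (basis A) + m)
        * unt A (idx m))"
  assumes X: "(d', \<rho>') \<in> rep_objects A" and rk: "r < d'" "k < d'" and xy: "x < d" "y < d"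
  shows "c (d', \<rho>') $$ (r * d + x, y * d' + k) = (\<Sum>i\<in>basis A. \<rho>' i $$ (r, k) * T i $$ (x, y))"
proof -
  let ?I = "basis A" and ?n = "card (basis A)"
  let ?R = "(?n, restrict reg ?I)" and ?X = "(d', \<rho>')"
  note \<rho>' = rep_objectsD[OF X]
  \<comment> \<open>The module map that sends 1 to the \<open>k\<close>-th basis vector of \<open>X\<close>.\<close>
  define F where "F = mat d' ?n (\<lambda>(r, m). \<rho>' (idx m) $$ (r, k))"
  have F: "F \<in> carrier_mat d' ?n" by (simp add: F_def)
  have carr: "c ?X \<in> carrier_mat (d' * d) (d * d')" "c ?R \<in> carrier_mat (?n * d) (d * ?n)"
    using half_braiding_hom[OF hb X] half_braiding_hom[OF hb reg_object] by (auto simp: Rep_simps)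
  have "F \<in> Hom (Rep A) ?R ?X"
  proof -
    have "F * reg i = \<rho>' i * F" if i: "i \<in> ?I" for i
    proof (rule eq_matI)
      fix r m assume "r < dim_row (\<rho>' i * F)" "m < dim_col (\<rho>' i * F)"
      then have rm: "r < d'" "m < ?n" using \<rho>'(1)[OF i] F by auto
      have "(F * reg i) $$ (r, m) = (\<Sum>l<?n. mlt A i (idx m) (idx l) * \<rho>' (idx l) $$ (r, k))"
        using rm by (subst mult_mat_index[OF F reg_carrier]) (auto simp: F_def mult.commute)
      also have "\<dots> = mat_sum d' ?I (mlt A i (idx m)) \<rho>' $$ (r, k)" using rm rk by (simp add: mat_sum_index flip: sum_idx)
      also have "\<dots> = (\<rho>' i * \<rho>' (idx m)) $$ (r, k)" using \<rho>'(2)[OF i] rm by simp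
      also have "\<dots> = (\<Sum>l<d'. \<rho>' i $$ (r, l) * \<rho>' (idx m) $$ (l, k))"
        using rm rk by (subst mult_mat_index[OF \<rho>'(1)[OF i] \<rho>'(1)]) auto
      also have "\<dots> = (\<rho>' i * F) $$ (r, m)"
        using rm by (subst mult_mat_index[OF \<rho>'(1)[OF i] F]) (auto simp: F_def)
      finally show "(F * reg i) $$ (r, m) = (\<rho>' i * F) $$ (r, m)" .
    qed (use \<rho>'(1)[OF i] F in \<open>auto simp: reg_def\<close>)
    then show ?thesis using F by (simp add: Rep_simps)
  qed
  then have nat: "c ?X * kron (1\<^sub>m d) F = kron F (1\<^sub>m d) * c ?R"
    using half_braiding_natural[OF hb reg_object X] by simp
  have i1: "r * d + x < d' * d" using rk xy pair_index_less by blast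
  have "c ?X $$ (r * d + x, y * d' + k) = (\<Sum>q<d'. of_bool (q = k) * c ?X $$ (r * d + x, y * d' + q))"
    by (simp only: sum_of_bool_eq(1)[OF finite_lessThan] lessThan_iff rk if_True)
  also have "\<dots> = (\<Sum>q<d'. c ?X $$ (r * d + x, y * d' + q) * (\<Sum>m<?n. F $$ (q, m) * unt A (idx m)))"
  proof (intro sum.cong refl)
    fix q assume q: "q \<in> {..<d'}"
    have "(\<Sum>m<?n. F $$ (q, m) * unt A (idx m)) = (\<Sum>m<?n. unt A (idx m) * \<rho>' (idx m) $$ (q, k))"
      using q by (simp add: F_def mult.commute)
    also have "\<dots> = mat_sum d' ?I (unt A) \<rho>' $$ (q, k)" using q rk by (simp add: mat_sum_index flip: sum_idx)
    also have "\<dots> = of_bool (q = k)" using q rk by (simp add: \<rho>'(3))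
    finally show "of_bool (q = k) * c ?X $$ (r * d + x, y * d' + q)
      = c ?X $$ (r * d + x, y * d' + q) * (\<Sum>m<?n. F $$ (q, m) * unt A (idx m))" by simp
  qed
  also have "\<dots> = (\<Sum>m<?n. (\<Sum>q<d'. c ?X $$ (r * d + x, y * d' + q) * F $$ (q, m)) * unt A (idx m))"
    unfolding sum_distrib_left sum_distrib_right by (subst sum.swap) (simp add: mult.assoc)
  also have "\<dots> = (\<Sum>m<?n. (\<Sum>l<?n. F $$ (r, l) * c ?R $$ (l * d + x, y * ?n + m)) * unt A (idx m))"
  proof (intro sum.cong refl)
    fix m assume m: "m \<in> {..<?n}"
    have "(\<Sum>q<d'. c ?X $$ (r * d + x, y * d' + q) * F $$ (q, m)) = (c ?X * kron (1\<^sub>m d) F) $$ (r * d + x, y * ?n + m)"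
      using m xy i1 by (subst mult_kron_one_left[OF carr(1) F]) auto
    also have "\<dots> = (\<Sum>l<?n. F $$ (r, l) * c ?R $$ (l * d + x, y * ?n + m))"
      unfolding nat using m xy rk pair_index_less by (subst kron_one_right_mult[OF F carr(2)]) auto
    finally show "(\<Sum>q<d'. c ?X $$ (r * d + x, y * d' + q) * F $$ (q, m)) * unt A (idx m)
      = (\<Sum>l<?n. F $$ (r, l) * c ?R $$ (l * d + x, y * ?n + m)) * unt A (idx m)" by simp
  qed
  also have "\<dots> = (\<Sum>l<?n. F $$ (r, l) * (\<Sum>m<?n. c ?R $$ (l * d + x, y * ?n + m) * unt A (idx m)))"
    unfolding sum_distrib_left sum_distrib_right by (subst sum.swap) (simp add: mult.assoc)
  also have "\<dots> = (\<Sum>l<?n. \<rho>' (idx l) $$ (r, k) * T (idx l) $$ (x, y))"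
    using rk xy idx_bij by (intro sum.cong refl) (simp add: F_def T_def the_inv_into_f_f bij_betw_imp_inj_on)
  also have "\<dots> = (\<Sum>i\<in>?I. \<rho>' i $$ (r, k) * T i $$ (x, y))" by (rule sum_idx)
  finally show ?thesis .
qed

text \<open>
  The axioms of a half-braiding at tensor products, at the unit object and as a module map are written for the
  regular module \<open>k\<^sup>n\<close>. There the formula for \<open>c\<close> can be inverted by applying both sides to the vector 1, which isolates the
  matrices \<open>T\<close>: each axiom then becomes one of the conditions in \<open>center_data\<close>.
\<close>

lemma half_braiding_data:
  assumes hb: "half_braiding (Rep A) (d, \<rho>) c" and Z: "(d, \<rho>) \<in> rep_objects A"
  shows "\<exists>T. center_data d \<rho> T \<and>
    (\<forall>d' \<rho>' r k x y. (d', \<rho>') \<in> rep_objects A \<longrightarrow> r < d' \<longrightarrow> k < d' \<longrightarrow> x < d \<longrightarrow> y < d \<longrightarrow>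
      c (d', \<rho>') $$ (r * d + x, y * d' + k) = (\<Sum>i\<in>basis A. \<rho>' i $$ (r, k) * T i $$ (x, y)))"
proof -
  let ?I = "basis A" and ?n = "card (basis A)"
  let ?R = "(?n, restrict reg ?I)" and ?C = "c (?n, restrict reg ?I)"
  define T where "T = (\<lambda>i. mat d d (\<lambda>(x, y). \<Sum>m<?n.
      ?C $$ (the_inv_into {..<?n} idx i * d + x, y * ?n + m) * unt A (idx m)))"
  have Tc: "T i \<in> carrier_mat d d" for i by (simp add: T_def)
  have form: "c (d', \<rho>') $$ (r * d + x, y * d' + k) = (\<Sum>i\<in>?I. \<rho>' i $$ (r, k) * T i $$ (x, y))"
    if "(d', \<rho>') \<in> rep_objects A" "r < d'" "k < d'" "x < d" "y < d" for d' \<rho>' r k x y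
    unfolding T_def by (rule half_braiding_formula[OF hb Z that])
  note \<rho> = rep_objectsD[OF Z]
  have Cc: "?C \<in> carrier_mat (?n * d) (d * ?n)"
    using half_braiding_hom[OF hb reg_object] by (auto simp: Rep_simps)
  have Cf: "?C $$ (r * d + x, y * ?n + k) = (\<Sum>i\<in>?I. reg i $$ (r, k) * T i $$ (x, y))"
    if "r < ?n" "k < ?n" "x < d" "y < d" for r k x y
    using form[OF reg_object that] by simp
  \<comment> \<open>The value of \<open>c\<close> at the unit vector recovers \<open>T\<close>.\<close>
  have Cu: "(\<Sum>k<?n. ?C $$ (r * d + x, y * ?n + k) * unt A (idx k)) = T (idx r) $$ (x, y)"
    if "r < ?n" "x < d" "y < d" for r x y
  proof -
    have "(\<Sum>k<?n. ?C $$ (r * d + x, y * ?n + k) * unt A (idx k))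
        = (\<Sum>k<?n. \<Sum>i\<in>?I. (reg i $$ (r, k) * unt A (idx k)) * T i $$ (x, y))"
      using that by (intro sum.cong refl) (simp only: Cf lessThan_iff, simp only: sum_distrib_right, simp only: ac_simps)
    also have "\<dots> = (\<Sum>i\<in>?I. (\<Sum>k<?n. reg i $$ (r, k) * unt A (idx k)) * T i $$ (x, y))"
      unfolding sum_distrib_right by (rule sum.swap)
    also have "\<dots> = (\<Sum>i\<in>?I. of_bool (i = idx r) * T i $$ (x, y))"
      using that by (intro sum.cong refl) (simp only: reg_unit)
    finally show ?thesis using that by (simp only: sum_of_bool_eq(1)[OF finite_basis] idx_in if_True)
  qed
  have com: "T q * T p = mat_sum d ?I (\<lambda>i. cml A i p q) T" if pq: "p \<in> ?I" "q \<in> ?I" for p q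
  proof (rule eq_matI)
    fix a b assume "a < dim_row (mat_sum d ?I (\<lambda>i. cml A i p q) T)" "b < dim_col (mat_sum d ?I (\<lambda>i. cml A i p q) T)"
    then have ab: "a < d" "b < d" by (auto simp: mat_sum_def)
    obtain x y where xy: "x < ?n" "y < ?n" "p = idx x" "q = idx y" using idx_surj pq by metis
    define D where "D i = mat_sum (?n * ?n) (?I \<times> ?I) (\<lambda>(p, q). cml A i p q) (\<lambda>(p, q). kron (restrict reg ?I p) (restrict reg ?I q))" for i
    have RR: "TensO (Rep A) ?R ?R = (?n * ?n, restrict D ?I)" by (simp only: Rep_simps D_def[abs_def])
    have RRo: "(?n * ?n, restrict D ?I) \<in> rep_objects A"
      using tensor_object[OF reg_object reg_object] unfolding RR .
    have Di: "D i $$ (x * ?n + y, k * ?n + l) = (\<Sum>u\<in>?I. \<Sum>v\<in>?I. cml A i u v * (reg u $$ (x, k) * reg v $$ (y, l)))"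
      if "k < ?n" "l < ?n" for i k l
      unfolding D_def sum.cartesian_product using xy that pair_index_less
      by (subst mat_sum_index) (auto intro!: sum.cong simp: kron_index[OF reg_carrier reg_carrier] simp del: reg_index)
    have eq: "(\<Sum>i\<in>?I. D i $$ (x * ?n + y, k * ?n + l) * T i $$ (a, b))
        = (\<Sum>m<d. ?C $$ (y * d + a, m * ?n + l) * ?C $$ (x * d + m, b * ?n + k))" if kl: "k < ?n" "l < ?n" for k l
    proof -
      have "(\<Sum>i\<in>?I. D i $$ (x * ?n + y, k * ?n + l) * T i $$ (a, b))
          = c (?n * ?n, restrict D ?I) $$ ((x * ?n + y) * d + a, b * (?n * ?n) + (k * ?n + l))"
        using form[OF RRo pair_index_less pair_index_less ab, of x y k l] xy kl by simp
      also have "\<dots> = (kron (1\<^sub>m ?n) ?C * kron ?C (1\<^sub>m ?n)) $$ (x * (?n * d) + (y * d + a), (b * ?n + k) * ?n + l)"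
        unfolding half_braiding_tensor[OF hb reg_object reg_object, unfolded RR] by (simp add: algebra_simps)
      also have "\<dots> = (\<Sum>m<d. \<Sum>l'<?n. ?C $$ (y * d + a, m * ?n + l') * kron ?C (1\<^sub>m ?n) $$ (x * (d * ?n) + (m * ?n + l'), (b * ?n + k) * ?n + l))"
      proof (subst kron_one_left_mult[OF Cc])
        show "kron ?C (1\<^sub>m ?n) \<in> carrier_mat (?n * (d * ?n)) (d * ?n * ?n)"
          using kron_carrier[OF Cc one_carrier_mat, of ?n] by (simp add: mult.assoc)
      qed (use xy ab kl pair_index_less in \<open>auto simp: sum_lessThan_mult\<close>)
      also have "\<dots> = (\<Sum>m<d. \<Sum>l'<?n. of_bool (l' = l) * (?C $$ (y * d + a, m * ?n + l') * ?C $$ (x * d + m, b * ?n + k)))"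
      proof (intro sum.cong refl)
        fix m l' assume ml: "m \<in> {..<d}" "l' \<in> {..<?n}"
        have e: "x * (d * ?n) + (m * ?n + l') = (x * d + m) * ?n + l'" by (simp add: algebra_simps)
        have i: "x * d + m < ?n * d" "l' < ?n" "b * ?n + k < d * ?n" using ml kl ab xy pair_index_less by auto
        show "?C $$ (y * d + a, m * ?n + l') * kron ?C (1\<^sub>m ?n) $$ (x * (d * ?n) + (m * ?n + l'), (b * ?n + k) * ?n + l)
          = of_bool (l' = l) * (?C $$ (y * d + a, m * ?n + l') * ?C $$ (x * d + m, b * ?n + k))"
          unfolding e kron_index[OF Cc one_carrier_mat i kl(2)] using ml kl by simp
      qed
      finally show ?thesis using kl by (simp only: sum_of_bool_eq(1)[OF finite_lessThan] lessThan_iff if_True)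
    qed
    have "(T q * T p) $$ (a, b) = (\<Sum>m<d. T q $$ (a, m) * T p $$ (m, b))"
      using ab by (intro mult_mat_index[OF Tc Tc])
    also have "\<dots> = (\<Sum>m<d. (\<Sum>l<?n. ?C $$ (y * d + a, m * ?n + l) * unt A (idx l)) * (\<Sum>k<?n. ?C $$ (x * d + m, b * ?n + k) * unt A (idx k)))"
      using xy ab by (intro sum.cong refl) (simp only: Cu lessThan_iff)
    also have "\<dots> = (\<Sum>m<d. \<Sum>l<?n. \<Sum>k<?n. (unt A (idx l) * unt A (idx k)) * (?C $$ (y * d + a, m * ?n + l) * ?C $$ (x * d + m, b * ?n + k)))"
      unfolding sum_product by (simp only: ac_simps)
    also have "\<dots> = (\<Sum>l<?n. \<Sum>k<?n. (unt A (idx l) * unt A (idx k)) * (\<Sum>m<d. ?C $$ (y * d + a, m * ?n + l) * ?C $$ (x * d + m, b * ?n + k)))"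
      unfolding sum_distrib_left by (rule sum_move_in3)
    also have "\<dots> = (\<Sum>l<?n. \<Sum>k<?n. \<Sum>i\<in>?I. \<Sum>u\<in>?I. \<Sum>v\<in>?I. (cml A i u v * T i $$ (a, b)) * ((reg u $$ (x, k) * unt A (idx k)) * (reg v $$ (y, l) * unt A (idx l))))"
      by (intro sum.cong refl) (simp only: eq[symmetric] lessThan_iff, simp only: Di lessThan_iff, simp only: sum_distrib_left sum_distrib_right ac_simps)
    also have "\<dots> = (\<Sum>i\<in>?I. \<Sum>u\<in>?I. \<Sum>v\<in>?I. \<Sum>l<?n. \<Sum>k<?n. (cml A i u v * T i $$ (a, b)) * ((reg u $$ (x, k) * unt A (idx k)) * (reg v $$ (y, l) * unt A (idx l))))"
      by (rule trans[OF sum.cong[OF refl sum_move_in4] sum_move_in4])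
    also have "\<dots> = (\<Sum>i\<in>?I. \<Sum>u\<in>?I. \<Sum>v\<in>?I. (cml A i u v * T i $$ (a, b)) * ((\<Sum>l<?n. reg v $$ (y, l) * unt A (idx l)) * (\<Sum>k<?n. reg u $$ (x, k) * unt A (idx k))))"
      unfolding sum_product by (simp only: sum_distrib_left ac_simps)
    also have "\<dots> = (\<Sum>i\<in>?I. \<Sum>u\<in>?I. \<Sum>v\<in>?I. of_bool (v = q) * (of_bool (u = p) * (cml A i u v * T i $$ (a, b))))"
      using xy by (intro sum.cong refl) (simp add: reg_unit del: reg_index)
    also have "\<dots> = (\<Sum>i\<in>?I. cml A i p q * T i $$ (a, b))"
      by (simp only: sum_of_bool_eq(1)[OF finite_basis] pq if_True)
    finally show "(T q * T p) $$ (a, b) = mat_sum d ?I (\<lambda>i. cml A i p q) T $$ (a, b)"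
      using ab by (simp add: mat_sum_index)
  qed (use Tc in \<open>auto simp: mat_sum_def\<close>)
  have cou: "mat_sum d ?I (cou A) T = 1\<^sub>m d"
  proof (rule eq_matI)
    fix a b assume "a < dim_row (1\<^sub>m d :: 'k mat)" "b < dim_col (1\<^sub>m d :: 'k mat)"
    then have ab: "a < d" "b < d" by auto
    show "mat_sum d ?I (cou A) T $$ (a, b) = 1\<^sub>m d $$ (a, b)"
      using form[OF unit_object[unfolded Rep_simps] _ _ ab, of 0 0] half_braiding_unit[OF hb] ab
      by (simp add: mat_sum_index Rep_simps)
  qed (auto simp: mat_sum_def)
  have yd: "mat_sum d (?I \<times> ?I) (\<lambda>(j, p). \<Sum>q\<in>?I. cml A i p q * mlt A j q w) (\<lambda>(j, p). T j * \<rho> p)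
      = mat_sum d (?I \<times> ?I) (\<lambda>(q, j). \<Sum>p\<in>?I. cml A i p q * mlt A p j w) (\<lambda>(q, j). \<rho> q * T j)"
    (is "?Y = ?Y'") if iw: "i \<in> ?I" "w \<in> ?I" for i w
  proof (rule eq_matI)
    fix a b assume "a < dim_row ?Y'" "b < dim_col ?Y'"
    then have ab: "a < d" "b < d" by (auto simp: mat_sum_def)
    obtain r where r: "r < ?n" "w = idx r" using idx_surj iw by metis
    define L where "L = mat_sum (d * ?n) (?I \<times> ?I) (\<lambda>(p, q). cml A i p q) (\<lambda>(p, q). kron (\<rho> p) (restrict reg ?I q))"
    define M where "M = mat_sum (?n * d) (?I \<times> ?I) (\<lambda>(p, q). cml A i p q) (\<lambda>(p, q). kron (restrict reg ?I p) (\<rho> q))"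
    have LM: "L \<in> carrier_mat (d * ?n) (d * ?n)" "M \<in> carrier_mat (?n * d) (?n * d)" by (simp_all add: L_def M_def)
    have eq: "?C * L = M * ?C"
    proof -
      have "L = snd (TensO (Rep A) (d, \<rho>) ?R) i" "M = snd (TensO (Rep A) ?R (d, \<rho>)) i"
        using iw by (simp_all add: Rep_simps L_def M_def)
      then show ?thesis using half_braiding_hom[OF hb reg_object] iw by (auto simp: Rep_simps)
    qed
    have Li: "L $$ (y * ?n + k', b * ?n + k) = (\<Sum>p\<in>?I. \<Sum>q\<in>?I. cml A i p q * (\<rho> p $$ (y, b) * reg q $$ (k', k)))"
      if "y < d" "k' < ?n" "k < ?n" for y k' k
      unfolding L_def sum.cartesian_product using ab that pair_index_less
      by (subst mat_sum_index) (auto intro!: sum.cong simp: kron_index[OF \<rho>(1) reg_carrier] simp del: reg_index)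
    have Mi: "M $$ (r * d + a, k * d + y) = (\<Sum>p\<in>?I. \<Sum>q\<in>?I. cml A i p q * (reg p $$ (r, k) * \<rho> q $$ (a, y)))"
      if "y < d" "k < ?n" for y k
      unfolding M_def sum.cartesian_product using ab r that pair_index_less
      by (subst mat_sum_index) (auto intro!: sum.cong simp: kron_index[OF reg_carrier \<rho>(1)] simp del: reg_index)
    have "(\<Sum>k<?n. (?C * L) $$ (r * d + a, b * ?n + k) * unt A (idx k)) = ?Y $$ (a, b)"
    proof -
      have "(\<Sum>k<?n. (?C * L) $$ (r * d + a, b * ?n + k) * unt A (idx k))
          = (\<Sum>k<?n. (\<Sum>y<d. \<Sum>k'<?n. ?C $$ (r * d + a, y * ?n + k') * L $$ (y * ?n + k', b * ?n + k)) * unt A (idx k))"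
        using ab r pair_index_less by (intro sum.cong refl, subst mult_mat_index[OF Cc LM(1)]) (auto simp: sum_lessThan_mult)
      also have "\<dots> = (\<Sum>k<?n. \<Sum>y<d. \<Sum>k'<?n. \<Sum>p\<in>?I. \<Sum>q\<in>?I. (?C $$ (r * d + a, y * ?n + k') * (cml A i p q * \<rho> p $$ (y, b))) * (reg q $$ (k', k) * unt A (idx k)))"
        unfolding sum_distrib_right
        by (intro sum.cong refl) (simp only: Li lessThan_iff, simp only: sum_distrib_left sum_distrib_right, simp only: ac_simps)
      also have "\<dots> = (\<Sum>y<d. \<Sum>k'<?n. \<Sum>p\<in>?I. \<Sum>q\<in>?I. \<Sum>k<?n. (?C $$ (r * d + a, y * ?n + k') * (cml A i p q * \<rho> p $$ (y, b))) * (reg q $$ (k', k) * unt A (idx k)))"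
        by (rule sum_move_in5)
      also have "\<dots> = (\<Sum>y<d. \<Sum>k'<?n. \<Sum>p\<in>?I. \<Sum>q\<in>?I. of_bool (q = idx k') * (?C $$ (r * d + a, y * ?n + k') * (cml A i p q * \<rho> p $$ (y, b))))"
        unfolding sum_distrib_left[symmetric] by (intro sum.cong refl) (simp only: reg_unit lessThan_iff, simp only: mult.commute)
      also have "\<dots> = (\<Sum>y<d. \<Sum>k'<?n. \<Sum>p\<in>?I. ?C $$ (r * d + a, y * ?n + k') * (cml A i p (idx k') * \<rho> p $$ (y, b)))"
        by (intro sum.cong refl) (simp only: sum_of_bool_eq(1)[OF finite_basis] idx_in lessThan_iff if_True)
      also have "\<dots> = (\<Sum>y<d. \<Sum>k'<?n. \<Sum>p\<in>?I. \<Sum>j\<in>?I. (cml A i p (idx k') * mlt A j (idx k') w) * (T j $$ (a, y) * \<rho> p $$ (y, b)))"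
      proof (intro sum.cong refl)
        fix y k' p assume "y \<in> {..<d}" "k' \<in> {..<?n}"
        then have "?C $$ (r * d + a, y * ?n + k') = (\<Sum>j\<in>?I. mlt A j (idx k') w * T j $$ (a, y))"
          using Cf[of r k' a y] r ab by simp
        then show "?C $$ (r * d + a, y * ?n + k') * (cml A i p (idx k') * \<rho> p $$ (y, b))
          = (\<Sum>j\<in>?I. (cml A i p (idx k') * mlt A j (idx k') w) * (T j $$ (a, y) * \<rho> p $$ (y, b)))"
          by (simp add: sum_distrib_right sum_distrib_left ac_simps)
      qed
      also have "\<dots> = (\<Sum>y<d. \<Sum>q\<in>?I. \<Sum>p\<in>?I. \<Sum>j\<in>?I. (cml A i p q * mlt A j q w) * (T j $$ (a, y) * \<rho> p $$ (y, b)))"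
        by (intro sum.cong refl) (rule sum_idx)
      also have "\<dots> = (\<Sum>q\<in>?I. \<Sum>p\<in>?I. \<Sum>j\<in>?I. \<Sum>y<d. (cml A i p q * mlt A j q w) * (T j $$ (a, y) * \<rho> p $$ (y, b)))"
        by (rule sum_move_in4)
      also have "\<dots> = (\<Sum>q\<in>?I. \<Sum>j\<in>?I. \<Sum>p\<in>?I. \<Sum>y<d. (cml A i p q * mlt A j q w) * (T j $$ (a, y) * \<rho> p $$ (y, b)))"
        by (rule sum.cong[OF refl], rule sum.swap)
      also have "\<dots> = (\<Sum>j\<in>?I. \<Sum>p\<in>?I. \<Sum>q\<in>?I. \<Sum>y<d. (cml A i p q * mlt A j q w) * (T j $$ (a, y) * \<rho> p $$ (y, b)))"
        by (rule sum_move_in3)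
      also have "\<dots> = (\<Sum>j\<in>?I. \<Sum>p\<in>?I. (\<Sum>q\<in>?I. cml A i p q * mlt A j q w) * (T j * \<rho> p) $$ (a, b))"
        using ab by (intro sum.cong refl) (simp only: mult_mat_index[OF Tc \<rho>(1)] sum_product)
      also have "\<dots> = ?Y $$ (a, b)" using ab by (simp add: mat_sum_index sum.cartesian_product case_prod_unfold del: index_mult_mat)
      finally show ?thesis .
    qed
    moreover have "(\<Sum>k<?n. (M * ?C) $$ (r * d + a, b * ?n + k) * unt A (idx k)) = ?Y' $$ (a, b)"
    proof -
      have "(\<Sum>k<?n. (M * ?C) $$ (r * d + a, b * ?n + k) * unt A (idx k))
          = (\<Sum>k<?n. (\<Sum>k'<?n. \<Sum>y<d. M $$ (r * d + a, k' * d + y) * ?C $$ (k' * d + y, b * ?n + k)) * unt A (idx k))"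
        using ab r pair_index_less by (intro sum.cong refl, subst mult_mat_index[OF LM(2) Cc]) (auto simp: sum_lessThan_mult)
      also have "\<dots> = (\<Sum>k<?n. \<Sum>k'<?n. \<Sum>y<d. M $$ (r * d + a, k' * d + y) * (?C $$ (k' * d + y, b * ?n + k) * unt A (idx k)))"
        by (simp only: sum_distrib_right mult.assoc)
      also have "\<dots> = (\<Sum>k'<?n. \<Sum>y<d. M $$ (r * d + a, k' * d + y) * (\<Sum>k<?n. ?C $$ (k' * d + y, b * ?n + k) * unt A (idx k)))"
        unfolding sum_distrib_left by (rule sum_move_in3)
      also have "\<dots> = (\<Sum>k'<?n. \<Sum>y<d. \<Sum>p\<in>?I. \<Sum>q\<in>?I. (cml A i p q * mlt A p (idx k') w) * (\<rho> q $$ (a, y) * T (idx k') $$ (y, b)))"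
        using ab r by (intro sum.cong refl) (simp only: Cu Mi lessThan_iff, simp add: sum_distrib_left sum_distrib_right ac_simps)
      also have "\<dots> = (\<Sum>j\<in>?I. \<Sum>y<d. \<Sum>p\<in>?I. \<Sum>q\<in>?I. (cml A i p q * mlt A p j w) * (\<rho> q $$ (a, y) * T j $$ (y, b)))"
        by (rule sum_idx)
      also have "\<dots> = (\<Sum>j\<in>?I. \<Sum>p\<in>?I. \<Sum>q\<in>?I. \<Sum>y<d. (cml A i p q * mlt A p j w) * (\<rho> q $$ (a, y) * T j $$ (y, b)))"
        by (rule sum.cong[OF refl], rule sum_move_in3)
      also have "\<dots> = (\<Sum>p\<in>?I. \<Sum>q\<in>?I. \<Sum>j\<in>?I. \<Sum>y<d. (cml A i p q * mlt A p j w) * (\<rho> q $$ (a, y) * T j $$ (y, b)))"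
        by (rule sum_move_in3)
      also have "\<dots> = (\<Sum>q\<in>?I. \<Sum>j\<in>?I. \<Sum>p\<in>?I. \<Sum>y<d. (cml A i p q * mlt A p j w) * (\<rho> q $$ (a, y) * T j $$ (y, b)))"
        by (rule sum_move_in3)
      also have "\<dots> = (\<Sum>q\<in>?I. \<Sum>j\<in>?I. (\<Sum>p\<in>?I. cml A i p q * mlt A p j w) * (\<rho> q * T j) $$ (a, b))"
        using ab by (intro sum.cong refl) (simp only: mult_mat_index[OF \<rho>(1) Tc] sum_product)
      also have "\<dots> = ?Y' $$ (a, b)" using ab by (simp add: mat_sum_index sum.cartesian_product case_prod_unfold del: index_mult_mat)
      finally show ?thesis .
    qed
    ultimately show "?Y $$ (a, b) = ?Y' $$ (a, b)" unfolding eq by simp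
  qed (auto simp: mat_sum_def)
  have "center_data d \<rho> T" unfolding center_data_def using Tc com cou yd by blast
  then show ?thesis using form by blast
qed

end

section \<open>The exponent of an abelian extension\<close>

lemma mult_power_funpow:
  assumes "M \<in> carrier_mat n n" "n > 0"
  shows "((*) M ^^ N) (1\<^sub>m n) \<in> carrier_mat n n"
    and "endo_of_mat (((*) M ^^ N) (1\<^sub>m n)) = endo_of_mat M ^ N"
proof -
  have "((*) M ^^ N) (1\<^sub>m n) \<in> carrier_mat n n \<and> endo_of_mat (((*) M ^^ N) (1\<^sub>m n)) = endo_of_mat M ^ N"
    by (induction N) (use assms in \<open>auto simp: endo_of_mat_one endo_of_mat_mult intro: mult_carrier_mat\<close>)
  then show "((*) M ^^ N) (1\<^sub>m n) \<in> carrier_mat n n" "endo_of_mat (((*) M ^^ N) (1\<^sub>m n)) = endo_of_mat M ^ N"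
    by auto
qed

text \<open>
  The exponents \<open>N\<close> with \<open>M\<^sup>N = 1\<close> are closed under remainders, so the least exponent that works for all pairs of
  objects divides every other one.
\<close>

lemma funpow_mult_mod:
  assumes "M \<in> carrier_mat n n" "((*) M ^^ q) (1\<^sub>m n) = 1\<^sub>m n" "((*) M ^^ N) (1\<^sub>m n) = 1\<^sub>m n"
  shows "((*) M ^^ (N mod q)) (1\<^sub>m n) = 1\<^sub>m n"
proof -
  have "((*) M ^^ (q * k)) (1\<^sub>m n) = 1\<^sub>m n" for k
    by (induction k) (simp_all add: assms funpow_add add.commute)
  note this[of "N div q"]
  then have "((*) M ^^ (N mod q + q * (N div q))) (1\<^sub>m n) = ((*) M ^^ (N mod q)) (1\<^sub>m n)"
    by (simp only: funpow_add o_apply)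
  then show ?thesis using assms(3) by simp
qed

context extension_basis
begin

interpretation E: extension_modules F \<Gamma> "(\<triangleright>)" "(\<triangleleft>)" A e \<pi> a endo_scale
  by unfold_locales

text \<open>
  The map \<open>h\<close> will be one of the two embeddings \<open>M \<mapsto> M \<otimes> 1\<close> and \<open>M \<mapsto> 1 \<otimes> M\<close> of matrices into the
  endomorphisms of a tensor product.
\<close>

lemma yd_rep_of_mats:
  assumes Z: "(d, \<rho>) \<in> rep_objects A" and T: "center_data d \<rho> T"
    and h_mult: "\<And>M N. M \<in> carrier_mat d d \<Longrightarrow> N \<in> carrier_mat d d \<Longrightarrow> h (M * N) = h M * h N"
    and h_one: "h (1\<^sub>m d) = 1"
    and h_sum: "\<And>(B :: 'i set) c M. \<forall>k\<in>B. M k \<in> carrier_mat d d \<Longrightarrow> h (mat_sum d B c M) = (\<Sum>k\<in>B. endo_scale (c k) (h (M k)))"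
    and h_sum_pairs: "\<And>(B :: ('i \<times> 'i) set) c M. \<forall>k\<in>B. M k \<in> carrier_mat d d \<Longrightarrow> h (mat_sum d B c M) = (\<Sum>k\<in>B. endo_scale (c k) (h (M k)))"
  shows "E.yd_rep (\<lambda>i. h (\<rho> i)) (\<lambda>i. h (T i))"
  unfolding E.yd_rep_def
proof (intro conjI ballI)
  let ?I = "basis A"
  note \<rho> = rep_objectsD[OF Z]
  have Tc: "T i \<in> carrier_mat d d" for i using T by (simp add: center_data_def)
  have lin: "E.lin c (\<lambda>i. h (M i)) = h (mat_sum d ?I c M)" if "\<forall>k\<in>?I. M k \<in> carrier_mat d d" for c M
    using h_sum[OF that] by (simp add: E.lin_def)
  have bil: "E.bil m (\<lambda>i. h (M i)) (\<lambda>i. h (N i)) = h (mat_sum d (?I \<times> ?I) (\<lambda>(i, j). m i j) (\<lambda>(i, j). M i * N j))"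
    if "\<forall>k\<in>?I. M k \<in> carrier_mat d d" "\<forall>k\<in>?I. N k \<in> carrier_mat d d" for m M N
  proof -
    have "\<forall>k\<in>?I \<times> ?I. (case k of (i, j) \<Rightarrow> M i * N j) \<in> carrier_mat d d" using that by auto
    from h_sum_pairs[OF this] show ?thesis
      using that by (auto simp: E.bil_def sum.cartesian_product h_mult case_prod_unfold mem_Times_iff intro!: sum.cong)
  qed
  have c: "\<forall>k\<in>?I. \<rho> k \<in> carrier_mat d d" "\<forall>k\<in>?I. T k \<in> carrier_mat d d" using \<rho>(1) Tc by auto
  show "E.lin (unt A) (\<lambda>i. h (\<rho> i)) = 1" by (simp add: lin[OF c(1)] \<rho>(3) h_one)
  show "E.lin (cou A) (\<lambda>i. h (T i)) = 1" using T by (simp add: lin[OF c(2)] h_one center_data_def)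
  fix i j assume ij: "i \<in> ?I" "j \<in> ?I"
  show "h (\<rho> i) * h (\<rho> j) = E.lin (mlt A i j) (\<lambda>i. h (\<rho> i))"
    using \<rho>(2)[OF ij] h_mult[of "\<rho> i" "\<rho> j"] c ij by (simp add: lin[OF c(1)])
  show "h (T j) * h (T i) = E.lin (\<lambda>k. cml A k i j) (\<lambda>i. h (T i))"
    using T h_mult[of "T j" "T i"] Tc ij by (simp add: lin[OF c(2)] center_data_def)
  show "E.bil (\<lambda>k p. \<Sum>q\<in>?I. cml A i p q * mlt A k q j) (\<lambda>i. h (T i)) (\<lambda>i. h (\<rho> i))
      = E.bil (\<lambda>q k. \<Sum>p\<in>?I. cml A i p q * mlt A p k j) (\<lambda>i. h (\<rho> i)) (\<lambda>i. h (T i))"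
    using T ij unfolding bil[OF c] bil[OF c(2,1)] center_data_def by simp
qed

text \<open>
  Written with the matrices \<open>T\<close> and \<open>T'\<close> of the two half-braidings, the double braiding is the product of
  \<open>P = \<Sum>\<^sub>i R\<^sub>i \<otimes> T'\<^sub>i\<close> and \<open>Q = \<Sum>\<^sub>i T\<^sub>i \<otimes> R'\<^sub>i\<close>. The first module acts through the left tensor factor and the second one
  through the right factor, so their actions commute.
\<close>

lemma center_braiding_exponent:
  fixes U V :: "(nat \<times> ('i \<Rightarrow> 'k mat)) \<times> (nat \<times> ('i \<Rightarrow> 'k mat) \<Rightarrow> 'k mat)"
  defines "N \<equiv> group_exponent (Opext F \<Gamma> (\<triangleright>) (\<triangleleft>) :: (('g \<Rightarrow> 'f \<Rightarrow> 'f \<Rightarrow> 'k) \<times> ('f \<Rightarrow> 'g \<Rightarrow> 'g \<Rightarrow> 'k)) set monoid)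
      * group_exponent (bowtie F \<Gamma> (\<triangleright>) (\<triangleleft>))"
  assumes U: "U \<in> center_objects (Rep A)" and V: "V \<in> center_objects (Rep A)"
    and n: "n = fst (fst U) * fst (fst V)"
  shows "center_braiding V U * center_braiding U V \<in> carrier_mat n n"
    and "((*) (center_braiding V U * center_braiding U V) ^^ N) (1\<^sub>m n) = 1\<^sub>m n"
proof -
  let ?I = "basis A"
  obtain d \<rho> c where Ue: "U = ((d, \<rho>), c)" by (metis surj_pair)
  obtain d' \<rho>' c' where Ve: "V = ((d', \<rho>'), c')" by (metis surj_pair)
  have Z: "(d, \<rho>) \<in> rep_objects A" "half_braiding (Rep A) (d, \<rho>) c"
    and Z': "(d', \<rho>') \<in> rep_objects A" "half_braiding (Rep A) (d', \<rho>') c'"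
    using U V by (auto simp: center_objects_def Ue Ve Rep_simps)
  let ?M = "c' (d, \<rho>) * c (d', \<rho>')"
  have cc: "c' (d, \<rho>) \<in> carrier_mat (d * d') (d' * d)" "c (d', \<rho>') \<in> carrier_mat (d' * d) (d * d')"
    using half_braiding_hom[OF Z(2) Z'(1)] half_braiding_hom[OF Z'(2) Z(1)] by (auto simp: Rep_simps)
  then have Mc: "?M \<in> carrier_mat (d * d') (d * d')" by auto
  have eqs: "center_braiding V U * center_braiding U V = ?M" "n = d * d'"
    by (simp_all add: center_braiding_def Ue Ve n)
  show "center_braiding V U * center_braiding U V \<in> carrier_mat n n" using Mc unfolding eqs .
  have "((*) ?M ^^ N) (1\<^sub>m (d * d')) = 1\<^sub>m (d * d')"
  \<comment> \<open>Only matrices of positive size embed into the ring of endomorphisms.\<close>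
  proof (cases "d * d' = 0")
    case True
    have "((*) ?M ^^ k) (1\<^sub>m (d * d')) \<in> carrier_mat (d * d') (d * d')" for k
      by (induction k) (use Mc in \<open>auto intro: mult_carrier_mat\<close>)
    from this[of N] show ?thesis unfolding True by (intro eq_matI) auto
  next
    case False
    then have pos: "d * d' > 0" by simp
    obtain T where T: "center_data d \<rho> T" and Tf: "\<And>d' \<rho>' r k x y. \<lbrakk>(d', \<rho>') \<in> rep_objects A; r < d'; k < d'; x < d; y < d\<rbrakk> \<Longrightarrow>
        c (d', \<rho>') $$ (r * d + x, y * d' + k) = (\<Sum>i\<in>?I. \<rho>' i $$ (r, k) * T i $$ (x, y))"
      using half_braiding_data[OF Z(2,1)] by blast
    obtain T' where T': "center_data d' \<rho>' T'" and Tf': "\<And>d \<rho> r k x y. \<lbrakk>(d, \<rho>) \<in> rep_objects A; r < d; k < d; x < d'; y < d'\<rbrakk> \<Longrightarrow>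
        c' (d, \<rho>) $$ (r * d' + x, y * d + k) = (\<Sum>i\<in>?I. \<rho> i $$ (r, k) * T' i $$ (x, y))"
      using half_braiding_data[OF Z'(2,1)] by blast
    note \<rho> = rep_objectsD[OF Z(1)] and \<rho>' = rep_objectsD[OF Z'(1)]
    have Tc: "T i \<in> carrier_mat d d" "T' i \<in> carrier_mat d' d'" for i
      using T T' by (auto simp: center_data_def)
    define l where "l M = endo_of_mat (kron M (1\<^sub>m d'))" for M :: "'k mat"
    define r where "r M = endo_of_mat (kron (1\<^sub>m d) M)" for M :: "'k mat"
    have lr: "l M * r M' = endo_of_mat (kron M M')" "r M' * l M = endo_of_mat (kron M M')"
      if "M \<in> carrier_mat d d" "M' \<in> carrier_mat d' d'" for M M'
      using that pos unfolding l_def r_def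
      by (simp_all add: kron_carrier kron_mult[of _ d _ _ d'] flip: endo_of_mat_mult[where n = "d * d'"])
    have l: "l (M * M') = l M * l M'" if "M \<in> carrier_mat d d" "M' \<in> carrier_mat d d" for M M'
      using that pos unfolding l_def
      by (simp add: kron_carrier kron_mult[of _ d _ _ d'] flip: endo_of_mat_mult[where n = "d * d'"])
    have r: "r (M * M') = r M * r M'" if "M \<in> carrier_mat d' d'" "M' \<in> carrier_mat d' d'" for M M'
      using that pos unfolding r_def
      by (simp add: kron_carrier kron_mult[of _ d _ _ d'] flip: endo_of_mat_mult[where n = "d * d'"])
    have one: "l (1\<^sub>m d) = 1" "r (1\<^sub>m d') = 1" using pos by (simp_all add: l_def r_def kron_one endo_of_mat_one)
    have ls: "l (mat_sum d B f M) = (\<Sum>k\<in>B. endo_scale (f k) (l (M k)))" if "\<forall>k\<in>B. M k \<in> carrier_mat d d" for B :: "'z set" and f M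
      unfolding l_def kron_sum endo_of_mat_sum[OF pos] using that
      by (intro sum.cong refl) (simp add: mat_self[of _ d d] mat_self[of _ "d * d'" "d * d'"] kron_carrier)
    have rs: "r (mat_sum d' B f M) = (\<Sum>k\<in>B. endo_scale (f k) (r (M k)))" if "\<forall>k\<in>B. M k \<in> carrier_mat d' d'" for B :: "'z set" and f M
      unfolding r_def kron_sum endo_of_mat_sum[OF pos] using that
      by (intro sum.cong refl) (simp add: mat_self[of _ d' d'] mat_self[of _ "d * d'" "d * d'"] kron_carrier)
    have yd: "E.yd_rep (\<lambda>i. l (\<rho> i)) (\<lambda>i. l (T i))" by (rule yd_rep_of_mats[OF Z(1) T l one(1) ls ls])
    have yd': "E.yd_rep (\<lambda>i. r (\<rho>' i)) (\<lambda>i. r (T' i))" by (rule yd_rep_of_mats[OF Z'(1) T' r one(2) rs rs])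
    define P Q where "P = mat_sum (d * d') ?I (\<lambda>_. 1) (\<lambda>i. kron (\<rho> i) (T' i))"
      and "Q = mat_sum (d * d') ?I (\<lambda>_. 1) (\<lambda>i. kron (T i) (\<rho>' i))"
    have PQ: "P \<in> carrier_mat (d * d') (d * d')" "Q \<in> carrier_mat (d * d') (d * d')" by (simp_all add: P_def Q_def)
    have "?M = P * Q"
    proof (rule pair_eq_matI[of _ d d' d d'])
      fix x y z w assume *: "x < d" "y < d'" "z < d" "w < d'"
      have "?M $$ (x * d' + y, z * d' + w) = (\<Sum>u<d'. \<Sum>v<d. c' (d, \<rho>) $$ (x * d' + y, u * d + v) * c (d', \<rho>') $$ (u * d + v, z * d' + w))"
        using * pair_index_less by (subst mult_mat_index[OF cc]) (auto simp: sum_lessThan_mult)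
      also have "\<dots> = (\<Sum>u<d'. \<Sum>v<d. (\<Sum>i\<in>?I. \<rho> i $$ (x, v) * T' i $$ (y, u)) * (\<Sum>i\<in>?I. T i $$ (v, z) * \<rho>' i $$ (u, w)))"
        using * by (intro sum.cong refl) (simp only: Tf[OF Z'(1)] Tf'[OF Z(1)] lessThan_iff, simp only: mult.commute)
      also have "\<dots> = (\<Sum>v<d. \<Sum>u<d'. P $$ (x * d' + y, v * d' + u) * Q $$ (v * d' + u, z * d' + w))"
      proof (subst sum.swap, intro sum.cong refl)
        fix u v assume "u \<in> {..<d'}" "v \<in> {..<d}"
        then show "(\<Sum>i\<in>?I. \<rho> i $$ (x, v) * T' i $$ (y, u)) * (\<Sum>i\<in>?I. T i $$ (v, z) * \<rho>' i $$ (u, w))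
          = P $$ (x * d' + y, v * d' + u) * Q $$ (v * d' + u, z * d' + w)"
          using * pair_index_less by (simp add: P_def Q_def mat_sum_index kron_index[OF \<rho>(1) Tc(2)] kron_index[OF Tc(1) \<rho>'(1)])
      qed
      also have "\<dots> = (P * Q) $$ (x * d' + y, z * d' + w)"
        using * pair_index_less by (subst mult_mat_index[OF PQ]) (auto simp: sum_lessThan_mult)
      finally show "?M $$ (x * d' + y, z * d' + w) = (P * Q) $$ (x * d' + y, z * d' + w)" .
    qed (use Mc PQ in auto)
    moreover have "endo_of_mat P = (\<Sum>i\<in>?I. l (\<rho> i) * r (T' i))"
      unfolding P_def endo_of_mat_sum[OF pos] using \<rho>(1) Tc
      by (intro sum.cong refl) (simp add: lr mat_self[of _ "d * d'" "d * d'"] kron_carrier)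
    moreover have "endo_of_mat Q = (\<Sum>i\<in>?I. r (\<rho>' i) * l (T i))"
      unfolding Q_def endo_of_mat_sum[OF pos] using \<rho>'(1) Tc
      by (intro sum.cong refl) (simp add: lr mat_self[of _ "d * d'" "d * d'"] kron_carrier)
    moreover have "((\<Sum>i\<in>?I. l (\<rho> i) * r (T' i)) * (\<Sum>i\<in>?I. r (\<rho>' i) * l (T i))) ^ N = 1"
      unfolding N_def using \<rho>(1) \<rho>'(1) Tc by (intro E.double_braiding_exponent[OF yd yd']) (simp_all add: lr)
    ultimately have "endo_of_mat ?M ^ N = 1" using PQ pos by (simp add: endo_of_mat_mult)
    then show ?thesis
      using mult_power_funpow[OF Mc pos, of N] endo_of_mat_one[OF pos] by (intro endo_of_mat_inj) auto
  qed
  then show "((*) (center_braiding V U * center_braiding U V) ^^ N) (1\<^sub>m n) = 1\<^sub>m n" unfolding eqs .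
qed

end

theorem corollary5p24:
  fixes F :: "('f, 'm) monoid_scheme"
    and \<Gamma> :: "('g, 'n) monoid_scheme"
    and lact :: "'g \<Rightarrow> 'f \<Rightarrow> 'f"
    and ract :: "'g \<Rightarrow> 'f \<Rightarrow> 'g"
    and A :: "('i, 'k :: {alg_closed_field, field_char_0}) bialg"
    and \<iota> :: "'g \<Rightarrow> 'i \<Rightarrow> 'k"
    and \<pi> :: "'i \<Rightarrow> 'f \<Rightarrow> 'k"
  assumes "matched_pair F \<Gamma> lact ract"
    and "hopf_algebra A"
    and "exact_sequence (fun_hopf \<Gamma>) A (grp_hopf F) \<iota> \<pi>"
    and "affords_actions F \<Gamma> lact ract A \<iota> \<pi>"
  shows "hopf_exponent A dvd
    group_exponent (Opext F \<Gamma> lact ract ::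
      (('g \<Rightarrow> 'f \<Rightarrow> 'f \<Rightarrow> 'k) \<times> ('f \<Rightarrow> 'g \<Rightarrow> 'g \<Rightarrow> 'k)) set monoid)
    * group_exponent (bowtie F \<Gamma> lact ract)"
proof -
  interpret abelian_extension F \<Gamma> lact ract A "\<lambda>s i. if i \<in> basis A then \<iota> s i else 0" \<pi>
    by (rule abelian_extension_of_exact_sequence[OF assms])
  let ?e = "\<lambda>s i. if i \<in> basis A then \<iota> s i else 0"
  obtain a where a: "\<forall>s\<in>carrier \<Gamma>. \<forall>x\<in>carrier F. homog x (a s x) \<and> ?e s \<star> a s x = a s x
    \<and> (\<exists>b. a s x \<star> b = ?e s \<and> b \<star> a s x = ?e (ract s x))
    \<and> (\<forall>c. homog x c \<longrightarrow> ?e s \<star> c = c \<longrightarrow> (\<exists>\<zeta>. c = (\<lambda>i. \<zeta> * a s x i)))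
    \<and> (x = \<one>\<^bsub>F\<^esub> \<longrightarrow> a s x = ?e s) \<and> (s = \<one>\<^bsub>\<Gamma>\<^esub> \<longrightarrow> eps (a s x) = 1)"
    using generators_exist by blast
  interpret extension_basis F \<Gamma> lact ract A ?e \<pi> a
    by unfold_locales (use a in blast)+
  define N where "N = group_exponent (Opext F \<Gamma> lact ract :: (('g \<Rightarrow> 'f \<Rightarrow> 'f \<Rightarrow> 'k) \<times> ('f \<Rightarrow> 'g \<Rightarrow> 'g \<Rightarrow> 'k)) set monoid)
    * group_exponent (bowtie F \<Gamma> lact ract)"
  define good where "good q \<longleftrightarrow> 1 \<le> q \<and> (\<forall>U\<in>center_objects (Rep A). \<forall>V\<in>center_objects (Rep A).
    ((*) (center_braiding V U * center_braiding U V) ^^ q) (1\<^sub>m (fst (fst U) * fst (fst V))) = 1\<^sub>m (fst (fst U) * fst (fst V)))" for q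
  have id: "Ident (Rep A) (TensO (Rep A) (fst U) (fst V)) = 1\<^sub>m (fst (fst U) * fst (fst V))"
    for U V :: "(nat \<times> ('i \<Rightarrow> 'k mat)) \<times> (nat \<times> ('i \<Rightarrow> 'k mat) \<Rightarrow> 'k mat)"
    by (cases "fst U"; cases "fst V") (simp add: Rep_simps)
  have exponent: "hopf_exponent A = (LEAST q. good q)"
    unfolding hopf_exponent_def cat_exponent_def good_def id Rep_simps(2) ..
  have "(LEAST q. good q) dvd N"
  proof (cases "N = 0")
    case False
    let ?q = "LEAST q. good q"
    have "good N" using False center_braiding_exponent(2)[folded N_def] by (auto simp: good_def)
    then have q: "good ?q" by (rule LeastI)
    have "\<not> good (N mod ?q)" using q not_less_Least[of "N mod ?q" good] by (auto simp: good_def)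
    moreover have "((*) (center_braiding V U * center_braiding U V) ^^ (N mod ?q)) (1\<^sub>m (fst (fst U) * fst (fst V)))
        = 1\<^sub>m (fst (fst U) * fst (fst V))"
      if "U \<in> center_objects (Rep A)" "V \<in> center_objects (Rep A)" for U V
      using center_braiding_exponent(1)[OF that refl] q \<open>good N\<close> that by (intro funpow_mult_mod) (auto simp: good_def)
    ultimately have "N mod ?q = 0" by (auto simp: good_def)
    then show ?thesis by auto
  qed simp
  then show ?thesis unfolding exponent N_def .
qed

end
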